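(* Consider real-analytic graphed surfaces $S=\{u=F(x,y)\}\subset\mathbb{R}^3$ with $F_{xx}\ne0\equiv F_{xx}F_{yy}-F_{xy}^2$, within the branch $\mathsf S\ne0$, $\mathsf W\neq0$ (expressions in the context). Then: (1) There is a single differential invariant of order $5$ under $\mathsf{SA}_3(\mathbb{R})$ which is differentially independent of $\mathsf W$, namely $\mathsf M$: $\mathsf M$ is a differential invariant of order $5$ which is not locally a function of $\mathsf W$ and its invariant derivatives, and every differential invariant of order at most $5$ is locally a function of $\mathsf W$ and $\mathsf M$. (2) Every surface germ $(S,p)$ is $\mathsf{SA}_3(\mathbb{R})$-equivalent to a germ at the origin of the form $$u=\frac{x^2}{2}+\frac{x^2y}{2}+F_{3,1}\frac{x^3y}{6}+\frac{x^2y^2}{2}+F_{5,0}\frac{x^5}{120}+6F_{3,1}\frac{x^3y^2}{12}+\frac{x^2y^3}{2}+\sum_{j+k\ge6}F_{j,k}\,x^jy^k,$$ where $F_{3,1}$ is the value of $\mathsf W$ at the origin and $F_{5,0}$ is the value of $\mathsf M$ at the origin. (3) Any other surface $\{v=G(s,t)\}$ within the same branch, similarly put into the form $$v=\frac{s^2}{2}+\frac{s^2t}{2}+G_{3,1}\frac{s^3t}{6}+\frac{s^2t^2}{2}+G_{5,0}\frac{s^5}{120}+6G_{3,1}\frac{s^3t^2}{12}+\frac{s^2t^3}{2}+\sum_{l+m\ge6}G_{l,m}\,s^lt^m,$$ is $\mathsf{SA}_3(\mathbb{R})$-equivalent (origin to origin) to the surface $\{u=F(x,y)\}$ in the form (2)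 if and only if $$G_{3,1}=F_{3,1},\qquad G_{5,0}=F_{5,0},\qquad G_{l,0}=F_{l,0}\ (l\ge6),\qquad G_{l,1}=F_{l,1}\ (l\ge5).$$
   Context: $\mathsf{SA}_3(\mathbb{R})=\mathsf{SL}_3(\mathbb{R})\ltimes\mathbb{R}^3$ acts on $\mathbb{R}^3\ni(x,y,u)$ by affine transformations with linear part of determinant $1$. Surfaces are local and real-analytic; germs $(S,p)$, $(S',p')$ are equivalent if some $g\in\mathsf{SA}_3(\mathbb{R})$ has $g(p)=p'$ and maps a neighbourhood of $p$ in $S$ onto a neighbourhood of $p'$ in $S'$. "$\ne0$" means nowhere zero. Real cube roots are used in fractional powers. Put $A=F_{xx}F_{xxy}-F_{xy}F_{xxx}$, $B=F_{xx}F_{xxxy}-F_{xy}F_{xxxx}$, $C=F_{xx}F_{xxxxy}-F_{xy}F_{xxxxx}$. Then $$\mathsf S=\frac{A}{F_{xx}^2},\qquad \mathsf W=\frac{F_{xx}B-2F_{xxx}A}{F_{xx}^2A^{2/3}},$$ $$\mathsf M=\Phi_{50}+\frac{10}{3}\,\mathsf W\,\Phi_{41}-\frac54\,\frac{\Phi_{41}^2}{\mathsf W},$$ $$\Phi_{41}=\frac{8F_{xxx}^2A-4F_{xx}F_{xxx}B+F_{xx}^2C-3F_{xx}F_{xxxx}A}{F_{xx}^4A^{1/3}},$$ $$\Phi_{50}=\frac{20F_{xx}^2F_{xxx}B^2-40F_{xxx}^3A^2-15F_{xx}^2F_{xxxx}AB+30F_{xx}F_{xxx}F_{xxxx}A^2+9F_{xx}^2F_{xxxxx}A^2-15F_{xx}^2F_{xxx}AC}{9F_{xx}^6A}.$$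 Since $F_{yy}=F_{xy}^2/F_{xx}$, all derivatives of $F$ are rational in $\{F_{x^j}\},\{F_{x^jy}\}$, which are the independent jet coordinates. A differential invariant of order at most $n$ is a (locally defined, analytic) function of $x,y$ and these derivatives up to order $n$ which takes equal values at corresponding points whenever an element of $\mathsf{SA}_3(\mathbb{R})$ (close to the identity) maps one surface of the branch to another. Invariant derivatives are obtained by applying successively, in any order, the invariant differentiation operators $\mathcal D_1,\mathcal D_2$, defined as follows: for $p\in S$ let $g_p\in\mathsf{SA}_3(\mathbb{R})$ be the unique element with $g_p(p)=0$ putting $S$ in the normal form of (2); the first two components $(s,t)$ of $g_p$ are local coordinates on $S$ near $p$, and $\mathcal D_1|_p=\partial_s|_p$, $\mathcal D_2|_p=\partial_t|_p$ act on invariants viewed as functions on $S$. *)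

theory Defs
  imports "HOL-Analysis.Analysis"
begin

section \<open>Real-analytic functions\<close>

definition analytic2_at :: "(real \<times> real \<Rightarrow> real) \<Rightarrow> real \<times> real \<Rightarrow> bool" where
  "analytic2_at f p \<longleftrightarrow>
     (\<exists>c :: nat \<Rightarrow> nat \<Rightarrow> real. \<exists>r > 0. \<forall>h k. \<bar>h\<bar> < r \<and> \<bar>k\<bar> < r \<longrightarrow>
        ((\<lambda>(i, j). c i j * h ^ i * k ^ j) has_sum f (fst p + h, snd p + k)) UNIV)"

text \<open>Analyticity of a function of the finitely many variables indexed by \<open>I\<close>.  Since the
  series only involves the coordinates in \<open>I\<close>, uniqueness of sums forces \<open>f\<close> to ignore
  all other coordinates near \<open>z\<close>.\<close>

definition analytic_vars_at :: "'i set \<Rightarrow> (('i \<Rightarrow> real) \<Rightarrow> real) \<Rightarrow> ('i \<Rightarrow> real) \<Rightarrow> bool" where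
  "analytic_vars_at I f z \<longleftrightarrow>
     (\<exists>c :: ('i \<Rightarrow> nat) \<Rightarrow> real. \<exists>r > 0. \<forall>w. (\<forall>i\<in>I. \<bar>w i - z i\<bar> < r) \<longrightarrow>
        ((\<lambda>\<alpha>. c \<alpha> * (\<Prod>i\<in>I. (w i - z i) ^ \<alpha> i)) has_sum f w) (I \<rightarrow>\<^sub>E UNIV))"

section \<open>Jets of parabolic surfaces\<close>

definition partial_x :: "(real \<times> real \<Rightarrow> real) \<Rightarrow> real \<times> real \<Rightarrow> real" where
  "partial_x F = (\<lambda>(x, y). deriv (\<lambda>t. F (t, y)) x)"

definition partial_y :: "(real \<times> real \<Rightarrow> real) \<Rightarrow> real \<times> real \<Rightarrow> real" where
  "partial_y F = (\<lambda>(x, y). deriv (\<lambda>t. F (x, t)) y)"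

definition partial :: "nat \<Rightarrow> nat \<Rightarrow> (real \<times> real \<Rightarrow> real) \<Rightarrow> real \<times> real \<Rightarrow> real" where
  "partial j k F = (partial_x ^^ j) ((partial_y ^^ k) F)"

text \<open>The independent jet coordinates: the base point \<open>(x, y)\<close>, the derivatives
  \<open>F\<^bsub>x^j\<^esub>\<close> (written \<open>Fx j\<close>) and \<open>F\<^bsub>x^j y\<^esub>\<close> (written \<open>Fxy j\<close>, of order \<open>j + 1\<close>).
  A \<open>jet\<close> carries all orders; statements about jets of order \<open>n\<close> only look at the
  coordinates in \<open>jet_coords n\<close>.\<close>

datatype jet_coord = X | Y | Fx nat | Fxy nat

type_synonym jet = "jet_coord \<Rightarrow> real"

definition jet_coords :: "nat \<Rightarrow> jet_coord set" where
  "jet_coords n = {X, Y} \<union> {Fx j |j. j \<le> n} \<union> {Fxy j |j. j + 1 \<le> n}"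

fun jet_of :: "(real \<times> real \<Rightarrow> real) \<Rightarrow> real \<times> real \<Rightarrow> jet" where
  "jet_of F p X = fst p"
| "jet_of F p Y = snd p"
| "jet_of F p (Fx j) = partial j 0 F p"
| "jet_of F p (Fxy j) = partial j 1 F p"

text \<open>\<open>U\<close> is (the preimage in the space of all jets of) an open set of jets of order \<open>n\<close>.\<close>

definition jet_open :: "nat \<Rightarrow> jet set \<Rightarrow> bool" where
  "jet_open n U \<longleftrightarrow>
     (\<forall>z\<in>U. \<exists>e > 0. \<forall>z'. (\<forall>i\<in>jet_coords n. \<bar>z' i - z i\<bar> < e) \<longrightarrow> z' \<in> U)"

section \<open>The functions \<open>S\<close>, \<open>W\<close> and \<open>M\<close>\<close>

definition A_jet :: "jet \<Rightarrow> real" where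
  "A_jet z = z (Fx 2) * z (Fxy 2) - z (Fxy 1) * z (Fx 3)"

definition B_jet :: "jet \<Rightarrow> real" where
  "B_jet z = z (Fx 2) * z (Fxy 3) - z (Fxy 1) * z (Fx 4)"

definition C_jet :: "jet \<Rightarrow> real" where
  "C_jet z = z (Fx 2) * z (Fxy 4) - z (Fxy 1) * z (Fx 5)"

definition S_inv :: "jet \<Rightarrow> real" where
  "S_inv z = A_jet z / z (Fx 2) ^ 2"

text \<open>\<open>root 3\<close> is the real cube root, also for negative arguments.\<close>

definition W_inv :: "jet \<Rightarrow> real" where
  "W_inv z = (z (Fx 2) * B_jet z - 2 * z (Fx 3) * A_jet z)
     / (z (Fx 2) ^ 2 * root 3 (A_jet z) ^ 2)"

definition Phi41 :: "jet \<Rightarrow> real" where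
  "Phi41 z =
     (8 * z (Fx 3) ^ 2 * A_jet z - 4 * z (Fx 2) * z (Fx 3) * B_jet z
      + z (Fx 2) ^ 2 * C_jet z - 3 * z (Fx 2) * z (Fx 4) * A_jet z)
     / (z (Fx 2) ^ 4 * root 3 (A_jet z))"

definition Phi50 :: "jet \<Rightarrow> real" where
  "Phi50 z =
     (20 * z (Fx 2) ^ 2 * z (Fx 3) * B_jet z ^ 2
      - 40 * z (Fx 3) ^ 3 * A_jet z ^ 2
      - 15 * z (Fx 2) ^ 2 * z (Fx 4) * A_jet z * B_jet z
      + 30 * z (Fx 2) * z (Fx 3) * z (Fx 4) * A_jet z ^ 2
      + 9 * z (Fx 2) ^ 2 * z (Fx 5) * A_jet z ^ 2
      - 15 * z (Fx 2) ^ 2 * z (Fx 3) * A_jet z * C_jet z)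
     / (9 * z (Fx 2) ^ 6 * A_jet z)"

definition M_inv :: "jet \<Rightarrow> real" where
  "M_inv z = Phi50 z + 10 / 3 * W_inv z * Phi41 z - 5 / 4 * (Phi41 z ^ 2 / W_inv z)"

definition branch_jets :: "jet set" where
  "branch_jets = {z. z (Fx 2) \<noteq> 0 \<and> S_inv z \<noteq> 0 \<and> W_inv z \<noteq> 0}"

definition branch_surface :: "(real \<times> real) set \<Rightarrow> (real \<times> real \<Rightarrow> real) \<Rightarrow> bool" where
  "branch_surface D F \<longleftrightarrow> open D \<and>
     (\<forall>p\<in>D. analytic2_at F p \<and>
        partial 2 0 F p * partial 0 2 F p - partial 1 1 F p ^ 2 = 0 \<and>
        jet_of F p \<in> branch_jets)"

section \<open>The group and its action on surface germs\<close>

definition SA3 :: "((real ^ 3 ^ 3) \<times> (real ^ 3)) set" where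
  "SA3 = {(A, b). det A = 1}"

definition act :: "(real ^ 3 ^ 3) \<times> (real ^ 3) \<Rightarrow> real ^ 3 \<Rightarrow> real ^ 3" where
  "act g v = fst g *v v + snd g"

definition point :: "(real \<times> real \<Rightarrow> real) \<Rightarrow> real \<times> real \<Rightarrow> real ^ 3" where
  "point F p = vector [fst p, snd p, F p]"

definition surface :: "(real \<times> real) set \<Rightarrow> (real \<times> real \<Rightarrow> real) \<Rightarrow> (real ^ 3) set" where
  "surface D F = point F ` D"

definition maps_germ ::
  "(real ^ 3 ^ 3) \<times> (real ^ 3) \<Rightarrow> (real ^ 3) set \<Rightarrow> real ^ 3 \<Rightarrow> (real ^ 3) set \<Rightarrow> real ^ 3 \<Rightarrow> bool"
  where
  "maps_germ g S p S' p' \<longleftrightarrow> act g p = p' \<and>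
     (\<exists>V V'. open V \<and> p \<in> V \<and> open V' \<and> p' \<in> V' \<and> act g ` (S \<inter> V) = S' \<inter> V')"

definition equivalent_germs ::
  "(real ^ 3) set \<Rightarrow> real ^ 3 \<Rightarrow> (real ^ 3) set \<Rightarrow> real ^ 3 \<Rightarrow> bool" where
  "equivalent_germs S p S' p' \<longleftrightarrow> (\<exists>g\<in>SA3. maps_germ g S p S' p')"

section \<open>The normal form\<close>

text \<open>\<open>a\<close> and \<open>b\<close> are the parameters \<open>F\<^bsub>3,1\<^esub>\<close> and \<open>F\<^bsub>5,0\<^esub>\<close>.  For \<open>j + k \<ge> 6\<close> the
  number \<open>c j k\<close> is the plain coefficient of \<open>x^j y^k\<close>, without factorials.\<close>

definition normal_form ::
  "real \<Rightarrow> real \<Rightarrow> (nat \<Rightarrow> nat \<Rightarrow> real) \<Rightarrow> (real \<times> real \<Rightarrow> real) \<Rightarrow> bool" where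
  "normal_form a b c F \<longleftrightarrow>
     (\<exists>r > 0. \<forall>x y. \<bar>x\<bar> < r \<and> \<bar>y\<bar> < r \<longrightarrow>
        ((\<lambda>(j, k). c j k * x ^ j * y ^ k) has_sum
           (F (x, y) - (x^2 / 2 + x^2 * y / 2 + a * (x^3 * y / 6) + x^2 * y^2 / 2
              + b * (x^5 / 120) + 6 * a * (x^3 * y^2 / 12) + x^2 * y^3 / 2)))
          {(j, k). j + k \<ge> 6})"

section \<open>Differential invariants\<close>

text \<open>How close to the identity \<open>g\<close> has to be may depend on the surface and on the point:
  invariants are local in the sense of local transformation group actions.\<close>

definition diff_invariant :: "nat \<Rightarrow> jet set \<Rightarrow> (jet \<Rightarrow> real) \<Rightarrow> bool" where
  "diff_invariant n U I \<longleftrightarrow>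
     jet_open n U \<and> U \<subseteq> branch_jets \<and> (\<forall>z\<in>U. analytic_vars_at (jet_coords n) I z) \<and>
     (\<forall>D F p. branch_surface D F \<and> p \<in> D \<and> jet_of F p \<in> U \<longrightarrow>
        (\<exists>e > 0. \<forall>g D' F' p'.
           g \<in> SA3 \<and> dist g (mat 1, 0) < e \<and> branch_surface D' F' \<and>
           act g ` surface D F = surface D' F' \<and>
           p' \<in> D' \<and> act g (point F p) = point F' p' \<and> jet_of F' p' \<in> U \<longrightarrow>
           I (jet_of F' p') = I (jet_of F p)))"

text \<open>Order exactly \<open>n\<close>: on no open set is \<open>I\<close> a function of the jet of order \<open>n - 1\<close>.\<close>

definition diff_invariant_of_order :: "nat \<Rightarrow> jet set \<Rightarrow> (jet \<Rightarrow> real) \<Rightarrow> bool" where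
  "diff_invariant_of_order n U I \<longleftrightarrow> diff_invariant n U I \<and>
     (\<forall>V. jet_open n V \<and> V \<noteq> {} \<and> V \<subseteq> U \<longrightarrow>
        (\<exists>z\<in>V. \<exists>z'\<in>V. (\<forall>i\<in>jet_coords (n - 1). z i = z' i) \<and> I z \<noteq> I z'))"

definition normalizing_map ::
  "(real \<times> real) set \<Rightarrow> (real \<times> real \<Rightarrow> real) \<Rightarrow> real \<times> real \<Rightarrow> (real ^ 3 ^ 3) \<times> (real ^ 3)" where
  "normalizing_map D F p =
     (THE g. g \<in> SA3 \<and>
        (\<exists>E G a b c. branch_surface E G \<and> (0, 0) \<in> E \<and> normal_form a b c G \<and>
           maps_germ g (surface D F) (point F p) (surface E G) 0))"

definition chart ::
  "(real \<times> real) set \<Rightarrow> (real \<times> real \<Rightarrow> real) \<Rightarrow> real \<times> real \<Rightarrow> real \<times> real \<Rightarrow> real \<times> real" where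
  "chart D F p q =
     (act (normalizing_map D F p) (point F q) $ 1, act (normalizing_map D F p) (point F q) $ 2)"

text \<open>Functions on the surface are written as functions of \<open>(x, y)\<close>; \<open>h\<close> below is the
  expression of \<open>f\<close> in the local coordinates \<open>(s, t)\<close>, in which \<open>p\<close> is the origin.\<close>

datatype direction = Dir1 | Dir2

fun inv_diff :: "direction \<Rightarrow> (real \<times> real) set \<Rightarrow> (real \<times> real \<Rightarrow> real)
    \<Rightarrow> (real \<times> real \<Rightarrow> real) \<Rightarrow> real \<times> real \<Rightarrow> real" where
  "inv_diff Dir1 D F f p =
     (THE d. \<exists>h. (\<forall>\<^sub>F q in nhds p. f q = h (chart D F p q)) \<and>
        ((\<lambda>s. h (s, 0)) has_real_derivative d) (at 0))"
| "inv_diff Dir2 D F f p =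
     (THE d. \<exists>h. (\<forall>\<^sub>F q in nhds p. f q = h (chart D F p q)) \<and>
        ((\<lambda>t. h (0, t)) has_real_derivative d) (at 0))"

definition inv_derivative :: "direction list \<Rightarrow> (jet \<Rightarrow> real)
    \<Rightarrow> (real \<times> real) set \<Rightarrow> (real \<times> real \<Rightarrow> real) \<Rightarrow> real \<times> real \<Rightarrow> real" where
  "inv_derivative w I D F = foldr (\<lambda>i. inv_diff i D F) w (\<lambda>q. I (jet_of F q))"

text \<open>On some nonempty open set of jets (of some order) the values of \<open>I\<close> are determined by those
  of \<open>J\<close> (the empty word) and of all invariant derivatives of \<open>J\<close>.\<close>

definition locally_function_of_derivatives :: "(jet \<Rightarrow> real) \<Rightarrow> (jet \<Rightarrow> real) \<Rightarrow> bool" where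
  "locally_function_of_derivatives I J \<longleftrightarrow>
     (\<exists>n V. \<exists>\<phi> :: (direction list \<Rightarrow> real) \<Rightarrow> real.
        jet_open n V \<and> V \<noteq> {} \<and> V \<subseteq> branch_jets \<and>
        (\<forall>D F p. branch_surface D F \<and> p \<in> D \<and> jet_of F p \<in> V \<longrightarrow>
           I (jet_of F p) = \<phi> (\<lambda>w. inv_derivative w J D F p)))"

definition locally_function_of_two ::
  "nat \<Rightarrow> jet set \<Rightarrow> (jet \<Rightarrow> real) \<Rightarrow> (jet \<Rightarrow> real) \<Rightarrow> (jet \<Rightarrow> real) \<Rightarrow> bool" where
  "locally_function_of_two n U I J K \<longleftrightarrow>
     (\<forall>z\<in>U. \<exists>V \<phi>. z \<in> V \<and> V \<subseteq> U \<and> jet_open n V \<and> analytic2_at \<phi> (J z, K z) \<and>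
        (\<forall>z'\<in>V. I z' = \<phi> (J z', K z')))"

end

theory Submission
  imports Defs "HOL-Library.Landau_Symbols" "HOL-Computational_Algebra.Formal_Power_Series" "HOL-Computational_Algebra.Polynomial"
begin

text \<open>A frame adapted to the rulings brings a parabolic germ of the branch to second order
  \<open>x\<^sup>2/2\<close> with \<open>F\<^sub>2\<^sub>1 = 1\<close>, and two such germs can only be related by a shear with three parameters
  \<open>r, s, w\<close>.  The shear fixes \<open>W\<close> and replaces \<open>\<Phi>\<^sub>4\<^sub>1\<close> by \<open>\<Phi>\<^sub>4\<^sub>1 + 2 W r\<close>, so for \<open>W \<noteq> 0\<close> exactly one
  shear annihilates \<open>F\<^sub>3\<^sub>0\<close>, \<open>F\<^sub>4\<^sub>0\<close> and \<open>F\<^sub>4\<^sub>1\<close>.  Hence the normal form exists, the normalising map is unique,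
  and the two coefficients left in order at most 5 are the invariants \<open>W\<close> and \<open>M\<close>.  The equation
  \<open>F\<^sub>x\<^sub>x F\<^sub>y\<^sub>y = F\<^sub>x\<^sub>y\<^sup>2\<close> computes all Taylor coefficients from those of \<open>x\<^sup>j\<close> and \<open>x\<^sup>j y\<close>, which gives (3).

  Reading off the normal form, \<open>D\<^sub>1 W = - 2/3 W\<^sup>2\<close> and \<open>D\<^sub>2 W = 2 W\<close>: the derived invariants of \<open>W\<close>
  are functions of \<open>W\<close>, whereas \<open>M\<close> genuinely involves \<open>F\<^sub>x\<^sub>x\<^sub>x\<^sub>x\<^sub>x\<close>.  Conversely, two nearby 5-jets with equal \<open>W\<close>
  and \<open>M\<close> are carried into each other by a group element near the identity, so an invariant of order 5 is
  locally constant on the common level sets of \<open>W\<close> and \<open>M\<close>, and these are locally connected.\<close>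

section \<open>Power series with a weighted summation norm\<close>

text \<open>Images of graphs and ruled surfaces with a prescribed jet both come from an implicit
  equation, so the analytic implicit function theorem is proved for absolutely convergent power
  series. Identities between germs in two variables are tested on lines through the origin: there
  they become identities of series in one variable whose coefficients up to order 5 are polynomials
  in the slope.

  The scale of the adapted frame is forced: once the quadratic part is \<open>x^2/2\<close>, only
  one scale \<open>\<alpha>\<close> is left, and the normalisation of the coefficient of
  \<open>x^2 y\<close> asks for \<open>\<alpha>^3 = A_jet z / z (Fx 2)^3\<close>. The real cube root
  solves this without a choice of sign.

  Two obstacles shape the last part. A differential invariant is only tested on group elements that
  carry a whole surface onto a whole graph, so a surface has to be cut down to a box on which every
  element near the identity does so. And invariants are functions of jets while invariance speaks of
  surfaces, so each jet of the branch must be realized by an actual parabolic surface.\<close>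

definition multi_index :: "'i set \<Rightarrow> ('i \<Rightarrow> nat) set" where
  "multi_index I = (I \<rightarrow>\<^sub>E UNIV)"

definition monom_at :: "'i set \<Rightarrow> ('i \<Rightarrow> real) \<Rightarrow> ('i \<Rightarrow> nat) \<Rightarrow> real" where
  "monom_at I w \<alpha> = (\<Prod>i\<in>I. w i ^ \<alpha> i)"

text \<open>\<open>K\<close> bounds the l1 norm of the coefficients weighted by powers of
  \<open>r\<close>. This norm is submultiplicative and dominates the sup norm on the closed
  polydisc; sums, products and substitutions keep explicit bounds, and absolutely convergent sums of
  such functions stay in the class.\<close>

definition ps :: "'i set \<Rightarrow> real \<Rightarrow> real \<Rightarrow> (('i \<Rightarrow> real) \<Rightarrow> real) \<Rightarrow> bool" where
  "ps I r K f \<longleftrightarrow> (\<exists>c :: ('i \<Rightarrow> nat) \<Rightarrow> real.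
     (\<lambda>\<alpha>. \<bar>c \<alpha>\<bar> * r ^ sum \<alpha> I) summable_on multi_index I \<and>
     infsum (\<lambda>\<alpha>. \<bar>c \<alpha>\<bar> * r ^ sum \<alpha> I) (multi_index I) \<le> K \<and>
     (\<forall>w. (\<forall>i\<in>I. \<bar>w i\<bar> \<le> r) \<longrightarrow> f w = infsum (\<lambda>\<alpha>. c \<alpha> * monom_at I w \<alpha>) (multi_index I)))"

lemma summable_abs_le:
  fixes f g :: "'a \<Rightarrow> real"
  assumes "g summable_on A" "\<And>x. x \<in> A \<Longrightarrow> \<bar>f x\<bar> \<le> g x"
  shows "f summable_on A"
proof -
  have "(\<lambda>x. norm (f x)) summable_on A"
    by (rule summable_on_comparison_test[OF assms(1)]) (use assms(2) in auto)
  then show ?thesis using summable_on_iff_abs_summable_on_real by blast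
qed

lemma abs_infsum_le:
  fixes f g :: "'a \<Rightarrow> real"
  assumes "g summable_on A" "\<And>x. x \<in> A \<Longrightarrow> \<bar>f x\<bar> \<le> g x"
  shows "\<bar>infsum f A\<bar> \<le> infsum g A"
  using norm_infsum_le[where f = f and g = g and X = A and S = "infsum f A" and T = "infsum g A"] summable_abs_le[OF assms] assms
  by auto

lemma monom_at_le:
  assumes "\<forall>i\<in>I. \<bar>w i\<bar> \<le> r"
  shows "\<bar>monom_at I w \<alpha>\<bar> \<le> r ^ sum \<alpha> I"
proof -
  have "\<bar>monom_at I w \<alpha>\<bar> = (\<Prod>i\<in>I. \<bar>w i\<bar> ^ \<alpha> i)"
    by (simp add: monom_at_def abs_prod power_abs)
  also have "\<dots> \<le> (\<Prod>i\<in>I. r ^ \<alpha> i)"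
    by (rule prod_mono) (use assms in \<open>auto intro!: power_mono\<close>)
  finally show ?thesis by (simp add: power_sum)
qed

text \<open>The operations below yield series of monomials over an arbitrary index set
  \<open>J\<close>, with repeated exponents. Splitting \<open>J\<close> into the fibres
  \<open>B\<close> of \<open>d\<close> and summing each fibre first is legitimate by absolute
  summability, and the triangle inequality on a fibre shows that collecting terms does not increase
  the norm.\<close>

lemma ps_collect:
  fixes a :: "'j \<Rightarrow> real" and d :: "'j \<Rightarrow> 'i \<Rightarrow> nat"
  assumes d: "\<And>j. j \<in> J \<Longrightarrow> d j \<in> multi_index I"
    and r: "r > 0"
    and S: "(\<lambda>j. \<bar>a j\<bar> * r ^ sum (d j) I) summable_on J"
    and K: "infsum (\<lambda>j. \<bar>a j\<bar> * r ^ sum (d j) I) J \<le> K"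
    and f: "\<And>w. \<forall>i\<in>I. \<bar>w i\<bar> \<le> r \<Longrightarrow> f w = infsum (\<lambda>j. a j * monom_at I w (d j)) J"
  shows "ps I r K f"
proof -
  define B where "B \<gamma> = {j\<in>J. d j = \<gamma>}" for \<gamma>
  define c where "c \<gamma> = infsum a (B \<gamma>)" for \<gamma>
  have bij: "bij_betw snd (Sigma (multi_index I) B) J"
    by (rule bij_betwI[of _ _ _ "\<lambda>j. (d j, j)"]) (auto simp: B_def d)
  have sm: "(\<lambda>p. g (snd p)) summable_on Sigma (multi_index I) B \<longleftrightarrow> g summable_on J" for g :: "'j \<Rightarrow> real"
    by (rule summable_on_reindex_bij_betw[OF bij])
  have im: "infsum (\<lambda>p. g (snd p)) (Sigma (multi_index I) B) = infsum g J" for g :: "'j \<Rightarrow> real"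
    by (rule infsum_reindex_bij_betw[OF bij])
  have S': "(\<lambda>j. \<bar>a j\<bar> * r ^ sum \<gamma> I) summable_on B \<gamma>" for \<gamma>
  proof -
    have "(\<lambda>j. \<bar>a j\<bar> * r ^ sum (d j) I) summable_on B \<gamma>"
      by (rule summable_on_subset_banach[OF S]) (auto simp: B_def)
    moreover have "(\<lambda>j. \<bar>a j\<bar> * r ^ sum (d j) I) summable_on B \<gamma> \<longleftrightarrow> (\<lambda>j. \<bar>a j\<bar> * r ^ sum \<gamma> I) summable_on B \<gamma>"
      by (rule summable_on_cong) (auto simp: B_def)
    ultimately show ?thesis by simp
  qed
  have Sa: "(\<lambda>j. \<bar>a j\<bar>) summable_on B \<gamma>" for \<gamma>
    using S'[of \<gamma>] r summable_on_cmult_left'[of "r ^ sum \<gamma> I" "\<lambda>j. \<bar>a j\<bar>" "B \<gamma>"] by simp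
  let ?h = "\<lambda>j. \<bar>a j\<bar> * r ^ sum (d j) I"
  have Sh: "(\<lambda>p. ?h (snd p)) summable_on Sigma (multi_index I) B" using S sm[of ?h] by simp
  have o1: "(\<lambda>\<gamma>. infsum (\<lambda>j. ?h j) (B \<gamma>)) summable_on multi_index I"
    using summable_on_Sigma_banach[of "\<lambda>\<gamma> j. ?h j" "multi_index I" B] Sh by (simp add: case_prod_unfold)
  have o2: "infsum (\<lambda>\<gamma>. infsum ?h (B \<gamma>)) (multi_index I) = infsum ?h J"
    using infsum_Sigma_banach[OF Sh] im[of ?h] by simp
  have cle: "\<bar>c \<gamma>\<bar> * r ^ sum \<gamma> I \<le> infsum ?h (B \<gamma>)" for \<gamma>
  proof -
    have "\<bar>c \<gamma>\<bar> \<le> infsum (\<lambda>j. \<bar>a j\<bar>) (B \<gamma>)"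
      unfolding c_def by (rule abs_infsum_le[OF Sa]) simp
    then have "\<bar>c \<gamma>\<bar> * r ^ sum \<gamma> I \<le> infsum (\<lambda>j. \<bar>a j\<bar>) (B \<gamma>) * r ^ sum \<gamma> I"
      using r by (intro mult_right_mono) auto
    also have "\<dots> = infsum (\<lambda>j. \<bar>a j\<bar> * r ^ sum \<gamma> I) (B \<gamma>)"
      by (simp add: infsum_cmult_left')
    also have "\<dots> = infsum ?h (B \<gamma>)" by (rule infsum_cong) (auto simp: B_def)
    finally show ?thesis .
  qed
  have S1: "(\<lambda>\<gamma>. \<bar>c \<gamma>\<bar> * r ^ sum \<gamma> I) summable_on multi_index I"
    by (rule summable_abs_le[OF o1]) (use cle r in \<open>auto simp: abs_mult\<close>)
  have "infsum (\<lambda>\<gamma>. \<bar>c \<gamma>\<bar> * r ^ sum \<gamma> I) (multi_index I) \<le> infsum (\<lambda>\<gamma>. infsum ?h (B \<gamma>)) (multi_index I)"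
    by (rule infsum_mono[OF S1 o1]) (use cle in auto)
  then have S2: "infsum (\<lambda>\<gamma>. \<bar>c \<gamma>\<bar> * r ^ sum \<gamma> I) (multi_index I) \<le> K" using o2 K by simp
  have "f w = infsum (\<lambda>\<alpha>. c \<alpha> * monom_at I w \<alpha>) (multi_index I)" if w: "\<forall>i\<in>I. \<bar>w i\<bar> \<le> r" for w
  proof -
    let ?g = "\<lambda>j. a j * monom_at I w (d j)"
    have "?g summable_on J"
      by (rule summable_abs_le[OF S]) (auto simp: abs_mult intro!: mult_left_mono monom_at_le[OF w])
    then have "(\<lambda>p. ?g (snd p)) summable_on Sigma (multi_index I) B" using sm[of ?g] by simp
    from infsum_Sigma_banach[OF this] im[of ?g]
    have "infsum ?g J = infsum (\<lambda>\<gamma>. infsum ?g (B \<gamma>)) (multi_index I)" by simp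
    also have "\<dots> = infsum (\<lambda>\<gamma>. c \<gamma> * monom_at I w \<gamma>) (multi_index I)"
    proof (rule infsum_cong)
      fix \<gamma>
      have "infsum ?g (B \<gamma>) = infsum (\<lambda>j. a j * monom_at I w \<gamma>) (B \<gamma>)"
        by (rule infsum_cong) (auto simp: B_def)
      also have "\<dots> = c \<gamma> * monom_at I w \<gamma>" by (simp add: c_def infsum_cmult_left')
      finally show "infsum ?g (B \<gamma>) = c \<gamma> * monom_at I w \<gamma>" .
    qed
    finally show ?thesis using f[OF w] by simp
  qed
  then show ?thesis unfolding ps_def using S1 S2 by blast
qed

section \<open>Algebra operations on bounded power series\<close>

lemma ps_monom:
  assumes "r > 0" "\<alpha> \<in> multi_index I"
  shows "ps I r (\<bar>k\<bar> * r ^ sum \<alpha> I) (\<lambda>w. k * monom_at I w \<alpha>)"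
  by (rule ps_collect[where J = "{()}" and a = "\<lambda>_. k" and d = "\<lambda>_. \<alpha>"]) (use assms in auto)

lemma ps_const: "r > 0 \<Longrightarrow> ps I r \<bar>k\<bar> (\<lambda>w. k)"
  using ps_monom[of r "\<lambda>i\<in>I. 0" I k] by (simp add: multi_index_def monom_at_def)

lemma ps_var:
  assumes "r > 0" "finite I" "i \<in> I"
  shows "ps I r r (\<lambda>w. w i)"
proof -
  have 1: "(\<Sum>j\<in>I. if j = i then 1 else (0::nat)) = 1" using assms by simp
  have 2: "(\<Prod>j\<in>I. w j ^ (if j = i then 1 else 0)) = w i" for w :: "'a \<Rightarrow> real"
  proof -
    have "(\<Prod>j\<in>I. w j ^ (if j = i then 1 else 0)) = (\<Prod>j\<in>I. if j = i then w j else 1)"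
      by (rule prod.cong) auto
    then show ?thesis using assms by simp
  qed
  define d where "d = (\<lambda>j\<in>I. if j = i then 1 else (0::nat))"
  have d: "d \<in> multi_index I" by (simp add: d_def multi_index_def)
  have "sum d I = (\<Sum>j\<in>I. if j = i then 1 else (0::nat))" by (rule sum.cong) (auto simp: d_def)
  then have sd: "sum d I = 1" using 1 by (rule trans)
  have md: "monom_at I w d = w i" for w
    by (rule trans[OF _ 2[of w]], unfold monom_at_def, rule prod.cong) (auto simp: d_def)
  show ?thesis using ps_monom[OF assms(1) d, of 1] unfolding sd md abs_one power_one_right mult_1 .
qed

lemma ps_mono: "ps I r K f \<Longrightarrow> K \<le> L \<Longrightarrow> ps I r L f"
  unfolding ps_def by (meson order_trans)

lemma ps_cong:
  assumes "ps I r K f" "\<And>w. \<forall>i\<in>I. \<bar>w i\<bar> \<le> r \<Longrightarrow> f w = g w"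
  shows "ps I r K g"
proof -
  from assms(1) obtain c where c: "(\<lambda>\<alpha>. \<bar>c \<alpha>\<bar> * r ^ sum \<alpha> I) summable_on multi_index I"
     "infsum (\<lambda>\<alpha>. \<bar>c \<alpha>\<bar> * r ^ sum \<alpha> I) (multi_index I) \<le> K"
     "\<And>w. (\<forall>i\<in>I. \<bar>w i\<bar> \<le> r) \<Longrightarrow> f w = infsum (\<lambda>\<alpha>. c \<alpha> * monom_at I w \<alpha>) (multi_index I)"
    unfolding ps_def by blast
  show ?thesis unfolding ps_def
    by (rule exI[of _ c]) (simp add: c(1,2) c(3)[symmetric] assms(2))
qed

lemma ps_shrink:
  assumes f: "ps I r K f" and s: "0 < s" "s \<le> r"
  shows "ps I s K f"
proof -
  from f obtain c where c: "(\<lambda>\<alpha>. \<bar>c \<alpha>\<bar> * r ^ sum \<alpha> I) summable_on multi_index I"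
     "infsum (\<lambda>\<alpha>. \<bar>c \<alpha>\<bar> * r ^ sum \<alpha> I) (multi_index I) \<le> K"
     "\<And>w. (\<forall>i\<in>I. \<bar>w i\<bar> \<le> r) \<Longrightarrow> f w = infsum (\<lambda>\<alpha>. c \<alpha> * monom_at I w \<alpha>) (multi_index I)"
    unfolding ps_def by blast
  have le: "\<bar>c \<alpha>\<bar> * s ^ sum \<alpha> I \<le> \<bar>c \<alpha>\<bar> * r ^ sum \<alpha> I" for \<alpha>
    using s by (intro mult_left_mono power_mono) auto
  have S: "(\<lambda>\<alpha>. \<bar>c \<alpha>\<bar> * s ^ sum \<alpha> I) summable_on multi_index I"
    by (rule summable_abs_le[OF c(1)]) (use le s in \<open>auto simp: abs_mult\<close>)
  have "infsum (\<lambda>\<alpha>. \<bar>c \<alpha>\<bar> * s ^ sum \<alpha> I) (multi_index I) \<le> K"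
    using infsum_mono[OF S c(1)] le c(2) by force
  moreover have "\<forall>w. (\<forall>i\<in>I. \<bar>w i\<bar> \<le> s) \<longrightarrow> f w = infsum (\<lambda>\<alpha>. c \<alpha> * monom_at I w \<alpha>) (multi_index I)"
    using c(3) s(2) by (meson order_trans)
  ultimately show ?thesis unfolding ps_def using S by blast
qed

lemma ps_bound:
  assumes "ps I r K f" "\<forall>i\<in>I. \<bar>w i\<bar> \<le> r"
  shows "\<bar>f w\<bar> \<le> K"
proof -
  from assms obtain c where c: "(\<lambda>\<alpha>. \<bar>c \<alpha>\<bar> * r ^ sum \<alpha> I) summable_on multi_index I"
     "infsum (\<lambda>\<alpha>. \<bar>c \<alpha>\<bar> * r ^ sum \<alpha> I) (multi_index I) \<le> K"
     "f w = infsum (\<lambda>\<alpha>. c \<alpha> * monom_at I w \<alpha>) (multi_index I)"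
    unfolding ps_def by blast
  have "\<bar>f w\<bar> \<le> infsum (\<lambda>\<alpha>. \<bar>c \<alpha>\<bar> * r ^ sum \<alpha> I) (multi_index I)"
    unfolding c(3) by (rule abs_infsum_le[OF c(1)])
      (auto simp: abs_mult intro!: mult_left_mono monom_at_le[OF assms(2)])
  then show ?thesis using c by simp
qed

lemma ps_nonneg:
  assumes "ps I r K f" "r > 0" shows "K \<ge> 0"
  using ps_bound[OF assms(1), of "\<lambda>_. 0"] assms(2) by auto

text \<open>Completeness of the class: the coefficient families are flattened to one family over
  \<open>N \<times> multi_index I\<close>, which is absolutely summable because the bounds
  \<open>K n\<close> are summable; equal exponents are then collected.\<close>

lemma ps_infsum:
  fixes f :: "'n \<Rightarrow> ('i \<Rightarrow> real) \<Rightarrow> real"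
  assumes r: "r > 0" and f: "\<And>n. n \<in> N \<Longrightarrow> ps I r (K n) (f n)"
    and K: "K summable_on N" "infsum K N \<le> L"
    and F: "\<And>w. \<forall>i\<in>I. \<bar>w i\<bar> \<le> r \<Longrightarrow> F w = infsum (\<lambda>n. f n w) N"
  shows "ps I r L F"
proof -
  let ?M = "multi_index I"
  have "\<forall>n\<in>N. \<exists>c. (\<lambda>\<alpha>. \<bar>c \<alpha>\<bar> * r ^ sum \<alpha> I) summable_on ?M \<and>
     infsum (\<lambda>\<alpha>. \<bar>c \<alpha>\<bar> * r ^ sum \<alpha> I) ?M \<le> K n \<and>
     (\<forall>w. (\<forall>i\<in>I. \<bar>w i\<bar> \<le> r) \<longrightarrow> f n w = infsum (\<lambda>\<alpha>. c \<alpha> * monom_at I w \<alpha>) ?M)"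
    using f unfolding ps_def by blast
  then obtain c where "\<forall>n\<in>N. (\<lambda>\<alpha>. \<bar>c n \<alpha>\<bar> * r ^ sum \<alpha> I) summable_on ?M \<and>
     infsum (\<lambda>\<alpha>. \<bar>c n \<alpha>\<bar> * r ^ sum \<alpha> I) ?M \<le> K n \<and>
     (\<forall>w. (\<forall>i\<in>I. \<bar>w i\<bar> \<le> r) \<longrightarrow> f n w = infsum (\<lambda>\<alpha>. c n \<alpha> * monom_at I w \<alpha>) ?M)"
    by (rule bchoice[THEN exE])
  then have c: "\<And>n. n\<in>N \<Longrightarrow> (\<lambda>\<alpha>. \<bar>c n \<alpha>\<bar> * r ^ sum \<alpha> I) summable_on ?M"
     "\<And>n. n\<in>N \<Longrightarrow> infsum (\<lambda>\<alpha>. \<bar>c n \<alpha>\<bar> * r ^ sum \<alpha> I) ?M \<le> K n"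
     "\<And>n w. n\<in>N \<Longrightarrow> \<forall>i\<in>I. \<bar>w i\<bar> \<le> r \<Longrightarrow> f n w = infsum (\<lambda>\<alpha>. c n \<alpha> * monom_at I w \<alpha>) ?M"
    by blast+
  let ?h = "\<lambda>(n, \<alpha>). \<bar>c n \<alpha>\<bar> * r ^ sum \<alpha> I"
  have i0: "0 \<le> infsum (\<lambda>\<alpha>. \<bar>c n \<alpha>\<bar> * r ^ sum \<alpha> I) ?M" for n
    by (rule infsum_nonneg) (use r in auto)
  have inner: "(\<lambda>n. infsum (\<lambda>\<alpha>. \<bar>c n \<alpha>\<bar> * r ^ sum \<alpha> I) ?M) summable_on N"
    by (rule summable_abs_le[OF K(1)]) (use c(2) i0 in auto)
  have S: "?h summable_on (N \<times> ?M)"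
    by (rule summable_on_SigmaI[where g = "\<lambda>n. infsum (\<lambda>\<alpha>. \<bar>c n \<alpha>\<bar> * r ^ sum \<alpha> I) ?M"])
      (use c(1) inner r in auto)
  have I: "infsum ?h (N \<times> ?M) = infsum (\<lambda>n. infsum (\<lambda>\<alpha>. \<bar>c n \<alpha>\<bar> * r ^ sum \<alpha> I) ?M) N"
    using infsum_Sigma_banach[OF S] by simp
  also have "\<dots> \<le> infsum K N" by (rule infsum_mono[OF inner K(1)]) (use c(2) in auto)
  finally have I: "infsum ?h (N \<times> ?M) \<le> L" using K by simp
  show ?thesis
  proof (rule ps_collect[where J = "N \<times> ?M" and a = "\<lambda>(n, \<alpha>). c n \<alpha>" and d = snd])
    show "r > 0" by fact
    show "snd j \<in> ?M" if "j \<in> N \<times> ?M" for j using that by auto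
    show "(\<lambda>j. \<bar>case j of (n, \<alpha>) \<Rightarrow> c n \<alpha>\<bar> * r ^ sum (snd j) I) summable_on N \<times> ?M"
      using S by (simp add: case_prod_unfold)
    show "infsum (\<lambda>j. \<bar>case j of (n, \<alpha>) \<Rightarrow> c n \<alpha>\<bar> * r ^ sum (snd j) I) (N \<times> ?M) \<le> L"
      using I by (simp add: case_prod_unfold)
    fix w :: "'i \<Rightarrow> real" assume w: "\<forall>i\<in>I. \<bar>w i\<bar> \<le> r"
    have Sw: "(\<lambda>(n, \<alpha>). c n \<alpha> * monom_at I w \<alpha>) summable_on (N \<times> ?M)"
      by (rule summable_abs_le[OF S]) (auto simp: abs_mult intro!: mult_left_mono monom_at_le[OF w])
    have "F w = infsum (\<lambda>n. infsum (\<lambda>\<alpha>. c n \<alpha> * monom_at I w \<alpha>) ?M) N"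
      unfolding F[OF w] by (rule infsum_cong) (use c(3) w in auto)
    also have "\<dots> = infsum (\<lambda>(n, \<alpha>). c n \<alpha> * monom_at I w \<alpha>) (N \<times> ?M)"
      using infsum_Sigma_banach[OF Sw] by simp
    finally show "F w = infsum (\<lambda>j. (case j of (n, \<alpha>) \<Rightarrow> c n \<alpha>) * monom_at I w (snd j)) (N \<times> ?M)"
      by (simp add: case_prod_unfold)
  qed
qed

lemma ps_add:
  assumes "r > 0" "ps I r K f" "ps I r L g"
  shows "ps I r (K + L) (\<lambda>w. f w + g w)"
  \<comment> \<open>A sum of two functions is a series over \<open>bool\<close>.\<close>
  by (rule ps_infsum[where N = "UNIV :: bool set" and f = "\<lambda>b. if b then f else g" and K = "\<lambda>b. if b then K else L"])
    (use assms in \<open>auto simp: UNIV_bool\<close>)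

text \<open>A single monomial of \<open>f\<close> shifts the exponents of \<open>g\<close>, which
  multiplies the norm of \<open>g\<close> by that of the monomial. Summing over the monomials of
  \<open>f\<close> gives the product of the norms.\<close>

lemma ps_mult:
  assumes r: "r > 0" and fin: "finite I" and f: "ps I r K f" and g: "ps I r L g"
  shows "ps I r (K * L) (\<lambda>w. f w * g w)"
proof -
  let ?M = "multi_index I"
  from f obtain a where a: "(\<lambda>\<alpha>. \<bar>a \<alpha>\<bar> * r ^ sum \<alpha> I) summable_on ?M"
     "infsum (\<lambda>\<alpha>. \<bar>a \<alpha>\<bar> * r ^ sum \<alpha> I) ?M \<le> K"
     "\<And>w. (\<forall>i\<in>I. \<bar>w i\<bar> \<le> r) \<Longrightarrow> f w = infsum (\<lambda>\<alpha>. a \<alpha> * monom_at I w \<alpha>) ?M"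
    unfolding ps_def by blast
  have T: "ps I r (\<bar>a \<alpha>\<bar> * r ^ sum \<alpha> I * L) (\<lambda>w. a \<alpha> * monom_at I w \<alpha> * g w)" if \<alpha>: "\<alpha> \<in> ?M" for \<alpha>
  proof -
    from g obtain b where b: "(\<lambda>\<alpha>. \<bar>b \<alpha>\<bar> * r ^ sum \<alpha> I) summable_on ?M"
     "infsum (\<lambda>\<alpha>. \<bar>b \<alpha>\<bar> * r ^ sum \<alpha> I) ?M \<le> L"
     "\<And>w. (\<forall>i\<in>I. \<bar>w i\<bar> \<le> r) \<Longrightarrow> g w = infsum (\<lambda>\<alpha>. b \<alpha> * monom_at I w \<alpha>) ?M"
      unfolding ps_def by blast
    let ?d = "\<lambda>\<beta>. (\<lambda>i\<in>I. \<alpha> i + \<beta> i)"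
    have sd: "sum (?d \<beta>) I = sum \<alpha> I + sum \<beta> I" for \<beta>
      by (simp add: sum.distrib)
    have e: "\<bar>a \<alpha> * b \<beta>\<bar> * r ^ sum (?d \<beta>) I = (\<bar>a \<alpha>\<bar> * r ^ sum \<alpha> I) * (\<bar>b \<beta>\<bar> * r ^ sum \<beta> I)" for \<beta>
      unfolding sd by (simp add: abs_mult power_add)
    show ?thesis
    proof (rule ps_collect[where J = ?M and a = "\<lambda>\<beta>. a \<alpha> * b \<beta>" and d = ?d])
      show "r > 0" by fact
      show "?d j \<in> ?M" for j by (auto simp: multi_index_def)
      show "(\<lambda>j. \<bar>a \<alpha> * b j\<bar> * r ^ sum (?d j) I) summable_on ?M"
        unfolding e using b(1) by (rule summable_on_cmult_right)
      show "infsum (\<lambda>j. \<bar>a \<alpha> * b j\<bar> * r ^ sum (?d j) I) ?M \<le> \<bar>a \<alpha>\<bar> * r ^ sum \<alpha> I * L"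
        unfolding e using b(2) r by (simp add: infsum_cmult_right' mult_left_mono)
      fix w :: "'a \<Rightarrow> real" assume w: "\<forall>i\<in>I. \<bar>w i\<bar> \<le> r"
      have m: "monom_at I w (?d \<beta>) = monom_at I w \<alpha> * monom_at I w \<beta>" for \<beta>
        by (simp add: monom_at_def power_add prod.distrib)
      have "infsum (\<lambda>j. a \<alpha> * b j * monom_at I w (?d j)) ?M
        = infsum (\<lambda>j. (a \<alpha> * monom_at I w \<alpha>) * (b j * monom_at I w j)) ?M"
        unfolding m by (simp add: mult_ac)
      also have "\<dots> = a \<alpha> * monom_at I w \<alpha> * g w" using b(3)[OF w] by (simp add: infsum_cmult_right')
      finally show "a \<alpha> * monom_at I w \<alpha> * g w = infsum (\<lambda>j. a \<alpha> * b j * monom_at I w (?d j)) ?M" by simp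
    qed
  qed
  have L0: "L \<ge> 0" using ps_nonneg[OF g r] .
  show ?thesis
  proof (rule ps_infsum[OF r T])
    show "(\<lambda>\<alpha>. \<bar>a \<alpha>\<bar> * r ^ sum \<alpha> I * L) summable_on ?M"
      using a(1) by (rule summable_on_cmult_left)
    show "infsum (\<lambda>\<alpha>. \<bar>a \<alpha>\<bar> * r ^ sum \<alpha> I * L) ?M \<le> K * L"
      using a(2) L0 by (simp add: infsum_cmult_left' mult_right_mono)
    show "f w * g w = infsum (\<lambda>\<alpha>. a \<alpha> * monom_at I w \<alpha> * g w) ?M" if w: "\<forall>i\<in>I. \<bar>w i\<bar> \<le> r" for w
      using a(3)[OF w] by (simp add: infsum_cmult_left')
  qed auto
qed

lemma ps_cmult:
  assumes "r > 0" "finite I" "ps I r K f"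
  shows "ps I r (\<bar>k\<bar> * K) (\<lambda>w. k * f w)"
  using ps_mult[OF assms(1,2) ps_const[OF assms(1)] assms(3)] .

lemma ps_power:
  assumes "r > 0" "finite I" "ps I r K f"
  shows "ps I r (K ^ n) (\<lambda>w. f w ^ n)"
proof (induction n)
  case 0
  then show ?case using ps_const[OF assms(1), of I 1] by simp
next
  case (Suc n)
  from ps_mult[OF assms(1,2,3) this] show ?case by simp
qed

lemma ps_prod:
  assumes "r > 0" "finite I" "\<And>a. a \<in> A \<Longrightarrow> ps I r (K a) (f a)"
  shows "ps I r (prod K A) (\<lambda>w. \<Prod>a\<in>A. f a w)"
proof (cases "finite A")
  case True
  then show ?thesis using assms(3)
  proof (induction A)
    case empty
    then show ?case using ps_const[OF assms(1), of I 1] by simp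
  next
    case (insert a A)
    have "ps I r (K a) (f a)" "ps I r (prod K A) (\<lambda>w. \<Prod>a\<in>A. f a w)"
      using insert by simp_all
    from ps_mult[OF assms(1,2) this] show ?case using insert by simp
  qed
next
  case False
  then show ?thesis using ps_const[OF assms(1), of I 1] by simp
qed

text \<open>Functions of norm at most \<open>r\<close>, substituted into the monomial with exponent
  \<open>\<alpha>\<close>, give norm at most \<open>r ^ sum \<alpha> I\<close>. This is the weight
  of that monomial in the norm of \<open>f\<close>, so the bound \<open>K\<close> is inherited
  unchanged.\<close>

lemma ps_compose:
  assumes s: "s > 0" "finite J" and f: "ps I r K f"
    and \<sigma>: "\<And>i. i \<in> I \<Longrightarrow> ps J s r (\<sigma> i)" and F: "\<And>w. \<forall>j\<in>J. \<bar>w j\<bar> \<le> s \<Longrightarrow> F w = f (\<lambda>i. \<sigma> i w)"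
  shows "ps J s K F"
proof -
  let ?M = "multi_index I"
  from f obtain c where c: "(\<lambda>\<alpha>. \<bar>c \<alpha>\<bar> * r ^ sum \<alpha> I) summable_on ?M"
     "infsum (\<lambda>\<alpha>. \<bar>c \<alpha>\<bar> * r ^ sum \<alpha> I) ?M \<le> K"
     "\<And>w. (\<forall>i\<in>I. \<bar>w i\<bar> \<le> r) \<Longrightarrow> f w = infsum (\<lambda>\<alpha>. c \<alpha> * monom_at I w \<alpha>) ?M"
    unfolding ps_def by blast
  show ?thesis
  proof (rule ps_infsum[OF s(1) _ c(1) c(2)])
    fix \<alpha>
    have "ps J s (\<bar>c \<alpha>\<bar> * (\<Prod>i\<in>I. r ^ \<alpha> i)) (\<lambda>w. c \<alpha> * (\<Prod>i\<in>I. \<sigma> i w ^ \<alpha> i))"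
      by (intro ps_cmult ps_prod ps_power s \<sigma>)
    then show "ps J s (\<bar>c \<alpha>\<bar> * r ^ sum \<alpha> I) (\<lambda>w. c \<alpha> * monom_at I (\<lambda>i. \<sigma> i w) \<alpha>)"
      by (simp add: power_sum monom_at_def)
  next
    fix w :: "'a \<Rightarrow> real" assume w: "\<forall>i\<in>J. \<bar>w i\<bar> \<le> s"
    have "\<forall>i\<in>I. \<bar>\<sigma> i w\<bar> \<le> r" using ps_bound[OF \<sigma> w] by auto
    then show "F w = infsum (\<lambda>\<alpha>. c \<alpha> * monom_at I (\<lambda>i. \<sigma> i w) \<alpha>) ?M"
      using F[OF w] c(3) by simp
  qed
qed

text \<open>A bound of Schwarz type: without a constant term, every monomial gains at least one
  factor \<open>s / r\<close> when the radius shrinks from \<open>r\<close> to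
  \<open>s\<close>.\<close>

lemma ps_small:
  assumes f: "ps I r K f" and f0: "f (\<lambda>_. 0) = 0" and s: "0 < s" "s \<le> r" and fin: "finite I"
  shows "ps I s (s / r * K) f"
proof -
  let ?M = "multi_index I"
  from f obtain c where c: "(\<lambda>\<alpha>. \<bar>c \<alpha>\<bar> * r ^ sum \<alpha> I) summable_on ?M"
     "infsum (\<lambda>\<alpha>. \<bar>c \<alpha>\<bar> * r ^ sum \<alpha> I) ?M \<le> K"
     "\<And>w. (\<forall>i\<in>I. \<bar>w i\<bar> \<le> r) \<Longrightarrow> f w = infsum (\<lambda>\<alpha>. c \<alpha> * monom_at I w \<alpha>) ?M"
    unfolding ps_def by blast
  let ?z = "\<lambda>i\<in>I. (0::nat)"
  have z: "?z \<in> ?M" by (auto simp: multi_index_def)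
  have nz: "\<exists>i\<in>I. \<alpha> i \<noteq> 0" if "\<alpha> \<in> ?M" "\<alpha> \<noteq> ?z" for \<alpha>
    using that by (metis (mono_tags, lifting) PiE_ext UNIV_I multi_index_def restrict_apply' z)
  have "f (\<lambda>_. 0) = infsum (\<lambda>\<alpha>. c \<alpha> * monom_at I (\<lambda>_. 0) \<alpha>) ?M"
    using s by (intro c(3)) auto
  also have "\<dots> = infsum (\<lambda>\<alpha>. c \<alpha> * monom_at I (\<lambda>_. 0) \<alpha>) {?z}"
  proof (rule infsum_cong_neutral)
    fix \<alpha> assume \<alpha>: "\<alpha> \<in> ?M - {?z}"
    then obtain i where "i \<in> I" "\<alpha> i \<noteq> 0" using nz by blast
    then have "monom_at I (\<lambda>_. 0) \<alpha> = 0" using fin by (auto simp: monom_at_def)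
    then show "c \<alpha> * monom_at I (\<lambda>_. 0) \<alpha> = 0" by simp
  qed (use z in auto)
  also have "\<dots> = c ?z" by (simp add: monom_at_def)
  finally have c0: "c ?z = 0" using f0 by simp
  have le: "\<bar>c \<alpha>\<bar> * s ^ sum \<alpha> I \<le> s / r * (\<bar>c \<alpha>\<bar> * r ^ sum \<alpha> I)" if "\<alpha> \<in> ?M" for \<alpha>
  proof (cases "\<alpha> = ?z")
    case False
    then have "sum \<alpha> I \<noteq> 0" using nz[OF that] fin by auto
    then obtain n where n: "sum \<alpha> I = Suc n" by (cases "sum \<alpha> I") auto
    have "s ^ Suc n \<le> s * r ^ n" using s by (auto intro!: mult_left_mono power_mono)
    also have "\<dots> = s / r * r ^ Suc n" using s by simp
    finally have "\<bar>c \<alpha>\<bar> * s ^ Suc n \<le> \<bar>c \<alpha>\<bar> * (s / r * r ^ Suc n)" by (rule mult_left_mono) simp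
    then show ?thesis unfolding n mult.left_commute[of "s / r"] .
  qed (simp add: c0)
  have Sr: "(\<lambda>\<alpha>. s / r * (\<bar>c \<alpha>\<bar> * r ^ sum \<alpha> I)) summable_on ?M"
    using c(1) by (rule summable_on_cmult_right)
  have S: "(\<lambda>\<alpha>. \<bar>c \<alpha>\<bar> * s ^ sum \<alpha> I) summable_on ?M"
    by (rule summable_abs_le[OF Sr]) (use le s in \<open>auto simp: abs_mult\<close>)
  have "infsum (\<lambda>\<alpha>. \<bar>c \<alpha>\<bar> * s ^ sum \<alpha> I) ?M \<le> s / r * infsum (\<lambda>\<alpha>. \<bar>c \<alpha>\<bar> * r ^ sum \<alpha> I) ?M"
    unfolding infsum_cmult_right'[symmetric] by (rule infsum_mono[OF S Sr]) (rule le)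
  also have "\<dots> \<le> s / r * K" using c(2) s by (intro mult_left_mono) auto
  finally have "infsum (\<lambda>\<alpha>. \<bar>c \<alpha>\<bar> * s ^ sum \<alpha> I) ?M \<le> s / r * K" .
  moreover have "\<forall>w. (\<forall>i\<in>I. \<bar>w i\<bar> \<le> s) \<longrightarrow> f w = infsum (\<lambda>\<alpha>. c \<alpha> * monom_at I w \<alpha>) ?M"
    using c(3) s(2) by (meson order_trans)
  ultimately show ?thesis unfolding ps_def using S by blast
qed

lemma ps_translate:
  assumes f: "ps I r K f" and fin: "finite I" and s: "s > 0" and z: "\<forall>i\<in>I. \<bar>z i\<bar> + s \<le> r"
  shows "ps I s K (\<lambda>w. f (\<lambda>i. z i + w i))"
proof (rule ps_compose[OF s fin f, where \<sigma> = "\<lambda>i w. z i + w i"])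
  fix i assume i: "i \<in> I"
  show "ps I s r (\<lambda>w. z i + w i)"
    by (rule ps_mono[OF ps_add[OF s ps_const[OF s] ps_var[OF s fin i]]]) (use z i in auto)
qed auto

section \<open>Germs of analytic functions\<close>

text \<open>Germs are always taken at the origin; analyticity at another point is \<open>an\<close>
  applied to the translated function.\<close>

definition an :: "'i set \<Rightarrow> (('i \<Rightarrow> real) \<Rightarrow> real) \<Rightarrow> bool" where
  "an I f \<longleftrightarrow> (\<exists>r>0. \<exists>K. ps I r K f)"

lemma anI: "r > 0 \<Longrightarrow> ps I r K f \<Longrightarrow> an I f" by (auto simp: an_def)

lemma an_obtain:
  assumes "an I f" "\<delta> > 0"
  obtains r K where "r > 0" "r < \<delta>" "ps I r K f"
proof -
  from assms obtain r K where rK: "r > 0" "ps I r K f" by (auto simp: an_def)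
  have "ps I (min r (\<delta>/2)) K f" by (rule ps_shrink[OF rK(2)]) (use rK assms in auto)
  then show ?thesis using that[of "min r (\<delta>/2)" K] rK assms by auto
qed

lemma an_const [intro]: "an I (\<lambda>w. k)"
  by (rule anI[OF _ ps_const]) (auto intro: zero_less_one)

lemma an_var [intro]: "finite I \<Longrightarrow> i \<in> I \<Longrightarrow> an I (\<lambda>w. w i)"
  by (rule anI[OF _ ps_var]) (auto intro: zero_less_one)

lemma an_common:
  assumes "an I f" "an I g"
  obtains r K L where "r > 0" "ps I r K f" "ps I r L g"
proof -
  obtain r K where 1: "r > 0" "ps I r K f" using assms by (auto simp: an_def)
  obtain s L where 2: "s > 0" "s < r" "ps I s L g" using an_obtain[OF assms(2) 1(1)] by metis
  show ?thesis using that[of s K L] ps_shrink[OF 1(2), of s] 2 by auto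
qed

lemma an_add [intro]: "an I f \<Longrightarrow> an I g \<Longrightarrow> an I (\<lambda>w. f w + g w)"
  by (metis an_common anI ps_add)

lemma an_mult [intro]:
  assumes "finite I" "an I f" "an I g" shows "an I (\<lambda>w. f w * g w)"
proof -
  obtain r K L where "r > 0" "ps I r K f" "ps I r L g" by (rule an_common[OF assms(2,3)])
  from anI[OF this(1) ps_mult[OF this(1) assms(1) this(2,3)]] show ?thesis .
qed

lemma an_cmult: "finite I \<Longrightarrow> an I f \<Longrightarrow> an I (\<lambda>w. k * f w)"
  by (rule an_mult) auto

lemma an_uminus [intro]: "finite I \<Longrightarrow> an I f \<Longrightarrow> an I (\<lambda>w. - f w)"
  using an_cmult[of I f "-1"] by simp

lemma an_diff [intro]: "finite I \<Longrightarrow> an I f \<Longrightarrow> an I g \<Longrightarrow> an I (\<lambda>w. f w - g w)"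
  using an_add[of I f "\<lambda>w. - g w"] by auto

lemma an_power [intro]: "finite I \<Longrightarrow> an I f \<Longrightarrow> an I (\<lambda>w. f w ^ n)"
proof (induction n)
  case (Suc n)
  from an_mult[OF Suc.prems(1,2) Suc.IH[OF Suc.prems]] show ?case by simp
qed auto

lemma an_cong:
  assumes f: "an I f" and "\<delta> > 0" and eq: "\<And>w. \<forall>i\<in>I. \<bar>w i\<bar> < \<delta> \<Longrightarrow> f w = g w"
  shows "an I g"
proof -
  obtain r K where r: "r > 0" "r < \<delta>" "ps I r K f" by (rule an_obtain[OF assms(1,2)])
  have "ps I r K g" by (rule ps_cong[OF r(3)]) (use r(2) in \<open>auto intro!: eq\<close>)
  then show ?thesis using r(1) by (rule anI[rotated])
qed

lemma ps_small_exists: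
  assumes "an I f" "f (\<lambda>_. 0) = 0" "finite I" "\<epsilon> > 0" "\<delta> > 0"
  shows "\<exists>s0>0. s0 < \<delta> \<and> (\<forall>s. 0 < s \<and> s \<le> s0 \<longrightarrow> ps I s \<epsilon> f)"
proof -
  obtain r K where r: "r > 0" "r < \<delta>" "ps I r K f" by (rule an_obtain[OF assms(1,5)])
  have K: "K \<ge> 0" using ps_nonneg[OF r(3,1)] .
  define s0 where "s0 = min r (\<epsilon> * r / (K + 1))"
  have s0: "s0 > 0" "s0 \<le> r" using r assms K by (auto simp: s0_def)
  have "ps I s \<epsilon> f" if s: "0 < s" "s \<le> s0" for s
  proof (rule ps_mono[OF ps_small[OF r(3) assms(2) s(1) _ assms(3)]])
    show "s \<le> r" using s s0 by simp
    have "s \<le> \<epsilon> * r / (K + 1)" using s by (simp add: s0_def)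
    then have "s * (K + 1) \<le> \<epsilon> * r" using K by (simp add: field_simps)
    then have "s * K \<le> \<epsilon> * r" using s by (simp add: algebra_simps)
    then show "s / r * K \<le> \<epsilon>" using r by (simp add: field_simps)
  qed
  then show ?thesis using s0 r by (intro exI[of _ s0]) auto
qed

lemma ps_small_exists_fin:
  assumes "finite A" "\<And>a. a \<in> A \<Longrightarrow> an I (f a)" "\<And>a. a \<in> A \<Longrightarrow> f a (\<lambda>_. 0) = 0" "finite I" "\<epsilon> > 0" "\<delta> > 0"
  shows "\<exists>s0>0. s0 < \<delta> \<and> (\<forall>a\<in>A. \<forall>s. 0 < s \<and> s \<le> s0 \<longrightarrow> ps I s \<epsilon> (f a))"
  using assms(1-3)
proof (induction A)
  case empty
  then show ?case using assms by (auto intro!: exI[of _ "\<delta>/2"])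
next
  case (insert a A)
  from insert obtain s0 where s0: "s0 > 0" "s0 < \<delta>" "\<forall>a\<in>A. \<forall>s. 0 < s \<and> s \<le> s0 \<longrightarrow> ps I s \<epsilon> (f a)" by auto
  obtain s1 where s1: "s1 > 0" "s1 < \<delta>" "\<forall>s. 0 < s \<and> s \<le> s1 \<longrightarrow> ps I s \<epsilon> (f a)"
    using ps_small_exists[of I "f a" \<epsilon> \<delta>] insert assms by auto
  show ?case by (rule exI[of _ "min s0 s1"]) (use s0 s1 in auto)
qed

lemma an_compose:
  assumes f: "an I f" and fin: "finite I" "finite J"
    and \<sigma>: "\<And>i. i \<in> I \<Longrightarrow> an J (\<sigma> i)" "\<And>i. i \<in> I \<Longrightarrow> \<sigma> i (\<lambda>_. 0) = 0"
  shows "an J (\<lambda>w. f (\<lambda>i. \<sigma> i w))"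
proof -
  obtain r K where r: "r > 0" "ps I r K f" using f by (auto simp: an_def)
  obtain s where s: "s > 0" "\<forall>i\<in>I. \<forall>t. 0 < t \<and> t \<le> s \<longrightarrow> ps J t r (\<sigma> i)"
    using ps_small_exists_fin[of I J \<sigma> r 1] fin \<sigma> r by auto
  have "ps J s K (\<lambda>w. f (\<lambda>i. \<sigma> i w))"
    by (rule ps_compose[OF s(1) fin(2) r(2)]) (use s in auto)
  then show ?thesis using s(1) by (rule anI[rotated])
qed

lemma an_series:
  assumes f: "an I f" and f0: "f (\<lambda>_. 0) = 0" and fin: "finite I" and R: "R > 0"
    and \<phi>: "\<And>x. \<bar>x\<bar> < R \<Longrightarrow> (\<lambda>n. a n * x ^ n) sums \<phi> x"
  shows "an I (\<lambda>w. \<phi> (f w))"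
proof -
  define \<rho> where "\<rho> = R / 2"
  have \<rho>: "0 < \<rho>" "\<rho> < R" using R by (auto simp: \<rho>_def)
  obtain s where s: "s > 0" "ps I s \<rho> f"
    using ps_small_exists[OF f f0 fin \<rho>(1), of 1] by auto
  \<comment> \<open>Convergence at a point strictly beyond \<open>\<rho>\<close> gives absolute
    convergence at \<open>\<rho>\<close>, which is the norm available for \<open>f\<close>.\<close>
  have "summable (\<lambda>n. a n * ((\<rho> + R)/2) ^ n)"
    using \<phi>[of "(\<rho> + R)/2"] \<rho> by (auto simp: sums_iff)
  then have sm: "summable (\<lambda>n. norm (a n * \<rho> ^ n))"
    by (rule powser_insidea) (use \<rho> in auto)
  have K: "(\<lambda>n. \<bar>a n\<bar> * \<rho> ^ n) summable_on UNIV"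
    by (subst summable_on_UNIV_nonneg_real_iff) (use sm \<rho> in \<open>auto simp: abs_mult\<close>)
  have "ps I s (infsum (\<lambda>n. \<bar>a n\<bar> * \<rho> ^ n) UNIV) (\<lambda>w. \<phi> (f w))"
  proof (rule ps_infsum[where f = "\<lambda>n w. a n * f w ^ n", OF s(1) _ K])
    show "ps I s (\<bar>a n\<bar> * \<rho> ^ n) (\<lambda>w. a n * f w ^ n)" for n
      by (intro ps_cmult ps_power s fin)
    fix w :: "'a \<Rightarrow> real" assume "\<forall>i\<in>I. \<bar>w i\<bar> \<le> s"
    then have b: "\<bar>f w\<bar> \<le> \<rho>" by (rule ps_bound[OF s(2)])
    have "(\<lambda>n. a n * f w ^ n) summable_on UNIV"
      by (rule summable_abs_le[OF K]) (use b in \<open>auto simp: abs_mult power_abs intro!: mult_left_mono power_mono\<close>)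
    then have "((\<lambda>n. a n * f w ^ n) has_sum infsum (\<lambda>n. a n * f w ^ n) UNIV) UNIV" by simp
    from has_sum_imp_sums[OF this] \<phi>[of "f w"] b \<rho>
    show "\<phi> (f w) = (\<Sum>\<^sub>\<infinity>n. a n * f w ^ n)" by (auto simp: sums_iff)
  qed auto
  then show ?thesis using s(1) by (rule anI[rotated])
qed

lemma an_translate:
  assumes f: "an I f" and fin: "finite I"
  shows "\<exists>\<delta>>0. \<forall>z. (\<forall>i\<in>I. \<bar>z i\<bar> < \<delta>) \<longrightarrow> an I (\<lambda>w. f (\<lambda>i. z i + w i))"
proof -
  obtain r K where r: "r > 0" "ps I r K f" using f by (auto simp: an_def)
  have "an I (\<lambda>w. f (\<lambda>i. z i + w i))" if "\<forall>i\<in>I. \<bar>z i\<bar> < r/2" for z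
    by (rule anI[OF _ ps_translate[OF r(2) fin, of "r/2"]]) (use r that in fastforce)+
  then show ?thesis using r by (intro exI[of _ "r/2"]) auto
qed

lemma an_inverse:
  assumes f: "an I f" and f0: "f (\<lambda>_. 0) \<noteq> 0" and fin: "finite I"
  shows "an I (\<lambda>w. inverse (f w))"
proof -
  let ?k = "f (\<lambda>_. 0)"
  let ?g = "\<lambda>w. f w - ?k"
  have "an I (\<lambda>w. inverse (?k + ?g w))"
  proof (rule an_series[of I ?g "\<bar>?k\<bar>" "\<lambda>n. inverse ?k * (- inverse ?k) ^ n" "\<lambda>x. inverse (?k + x)"])
    show "an I ?g" using f fin by auto
    fix x assume x: "\<bar>x\<bar> < \<bar>?k\<bar>"
    have "(\<lambda>n. (- inverse ?k * x) ^ n) sums (1 / (1 - (- inverse ?k * x)))"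
      by (rule geometric_sums) (use x f0 in \<open>auto simp: abs_mult field_simps\<close>)
    then have "(\<lambda>n. inverse ?k * (- inverse ?k * x) ^ n) sums (inverse ?k * (1 / (1 - (- inverse ?k * x))))"
      by (rule sums_mult)
    moreover have "inverse ?k * (1 / (1 - (- inverse ?k * x))) = inverse (?k + x)"
      using f0 x by (auto simp: field_simps)
    ultimately show "(\<lambda>n. inverse ?k * (- inverse ?k) ^ n * x ^ n) sums inverse (?k + x)"
      by (simp only: power_mult_distrib mult.assoc)
  qed (use f0 fin in auto)
  then show ?thesis by simp
qed

lemma an_divide [intro]:
  assumes "finite I" "an I f" "an I g" "g (\<lambda>_. 0) \<noteq> 0"
  shows "an I (\<lambda>w. f w / g w)"
  unfolding divide_inverse using assms by (auto intro: an_inverse)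

text \<open>Dividing by the nonzero value at the origin moves the problem to the binomial series
  with exponent 1/3 around 1. The factor \<open>root 3 ?k\<close> taken out in front also covers
  negative values.\<close>

lemma an_root3 [intro]:
  assumes fin: "finite I" and f: "an I f" and f0: "f (\<lambda>_. 0) \<noteq> 0"
  shows "an I (\<lambda>w. root 3 (f w))"
proof -
  let ?k = "f (\<lambda>_. 0)"
  let ?g = "\<lambda>w. f w / ?k - 1"
  have ag: "an I ?g" by (intro an_diff an_divide an_const f fin f0)
  have "an I (\<lambda>w. (1 + ?g w) powr (1/3))"
  proof (rule an_series[of I ?g 1 "\<lambda>n. (1/3) gchoose n" "\<lambda>x. (1 + x) powr (1/3)"])
    show "an I ?g" by (intro an_diff an_divide an_const f fin f0)
    fix x :: real assume x: "\<bar>x\<bar> < 1"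
    show "(\<lambda>n. ((1/3) gchoose n) * x ^ n) sums (1 + x) powr (1/3)"
      using gen_binomial_real[OF x, of "1/3"] by simp
  qed (use f0 fin in auto)
  then have a: "an I (\<lambda>w. root 3 ?k * (1 + ?g w) powr (1/3))" using fin by auto
  \<comment> \<open>On this smaller polydisc \<open>1 + ?g w\<close> is positive, and there
    \<open>powr\<close> agrees with the real cube root.\<close>
  obtain s where s: "s > 0" "ps I s (1/2) ?g"
    using ps_small_exists[OF ag _ fin, of "1/2" 1] f0 by auto
  show ?thesis
  proof (rule an_cong[OF a s(1)])
    fix w :: "'a \<Rightarrow> real" assume "\<forall>i\<in>I. \<bar>w i\<bar> < s"
    then have "\<bar>?g w\<bar> \<le> 1/2" by (intro ps_bound[OF s(2)]) auto
    then have p: "1 + ?g w > 0" unfolding abs_le_iff by linarith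
    have "(1 + ?g w) powr (1/3) = root 3 (1 + ?g w)" using p by (simp add: root_powr_inverse)
    then have "root 3 ?k * (1 + ?g w) powr (1/3) = root 3 (?k * (1 + ?g w))" by (simp only: real_root_mult)
    also have "?k * (1 + ?g w) = f w" using f0 by simp
    finally show "root 3 ?k * (1 + ?g w) powr (1/3) = root 3 (f w)" .
  qed
qed

section \<open>Passage between analyticity at a point and germs at the origin\<close>

lemma analytic_vars_at_iff:
  assumes fin: "finite I"
  shows "analytic_vars_at I f z \<longleftrightarrow> an I (\<lambda>h. f (\<lambda>i. z i + h i))"
proof
  assume "analytic_vars_at I f z"
  then obtain c r where r: "r > 0" and c: "\<And>w. (\<forall>i\<in>I. \<bar>w i - z i\<bar> < r) \<Longrightarrow>
        ((\<lambda>\<alpha>. c \<alpha> * (\<Prod>i\<in>I. (w i - z i) ^ \<alpha> i)) has_sum f w) (I \<rightarrow>\<^sub>E UNIV)"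
    unfolding analytic_vars_at_def by blast
  define s where "s = r / 2"
  have s: "0 < s" "s < r" using r by (auto simp: s_def)
  \<comment> \<open>At a point displaced by \<open>s\<close> in every coordinate the series has the
    weighted coefficients as its terms; since \<open>has_sum\<close> is unconditional, they are
    absolutely summable.\<close>
  have "((\<lambda>\<alpha>. c \<alpha> * (\<Prod>i\<in>I. s ^ \<alpha> i)) has_sum f (\<lambda>i. z i + s)) (I \<rightarrow>\<^sub>E UNIV)"
    using c[of "\<lambda>i. z i + s"] s by simp
  then have "(\<lambda>\<alpha>. c \<alpha> * s ^ sum \<alpha> I) summable_on multi_index I"
    by (auto simp: summable_on_def multi_index_def power_sum)
  then have "(\<lambda>\<alpha>. norm (c \<alpha> * s ^ sum \<alpha> I)) summable_on multi_index I"
    by (rule iffD1[OF summable_on_iff_abs_summable_on_real])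
  then have S: "(\<lambda>\<alpha>. \<bar>c \<alpha>\<bar> * s ^ sum \<alpha> I) summable_on multi_index I"
    using s by (simp add: abs_mult)
  have "ps I s (infsum (\<lambda>\<alpha>. \<bar>c \<alpha>\<bar> * s ^ sum \<alpha> I) (multi_index I)) (\<lambda>h. f (\<lambda>i. z i + h i))"
    unfolding ps_def
  proof (intro exI[of _ c] conjI S order_refl allI impI)
    fix w assume w: "\<forall>i\<in>I. \<bar>w i\<bar> \<le> s"
    have "((\<lambda>\<alpha>. c \<alpha> * (\<Prod>i\<in>I. w i ^ \<alpha> i)) has_sum f (\<lambda>i. z i + w i)) (I \<rightarrow>\<^sub>E UNIV)"
      using c[of "\<lambda>i. z i + w i"] w s by fastforce
    then show "f (\<lambda>i. z i + w i) = infsum (\<lambda>\<alpha>. c \<alpha> * monom_at I w \<alpha>) (multi_index I)"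
      unfolding monom_at_def multi_index_def by (rule infsumI[symmetric])
  qed
  then show "an I (\<lambda>h. f (\<lambda>i. z i + h i))" using s(1) by (rule anI[rotated])
next
  assume "an I (\<lambda>h. f (\<lambda>i. z i + h i))"
  then obtain r K where r: "r > 0" "ps I r K (\<lambda>h. f (\<lambda>i. z i + h i))" by (auto simp: an_def)
  from r(2) obtain c where c: "(\<lambda>\<alpha>. \<bar>c \<alpha>\<bar> * r ^ sum \<alpha> I) summable_on multi_index I"
     "\<And>w. (\<forall>i\<in>I. \<bar>w i\<bar> \<le> r) \<Longrightarrow> f (\<lambda>i. z i + w i) = infsum (\<lambda>\<alpha>. c \<alpha> * monom_at I w \<alpha>) (multi_index I)"
    unfolding ps_def by blast
  show "analytic_vars_at I f z" unfolding analytic_vars_at_def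
  proof (intro exI[of _ c] exI[of _ r] conjI r(1) allI impI)
    fix w assume "\<forall>i\<in>I. \<bar>w i - z i\<bar> < r"
    then have w: "\<forall>i\<in>I. \<bar>w i - z i\<bar> \<le> r" by auto
    let ?g = "\<lambda>\<alpha>. c \<alpha> * monom_at I (\<lambda>i. w i - z i) \<alpha>"
    have "?g summable_on multi_index I"
      by (rule summable_abs_le[OF c(1)]) (auto simp: abs_mult intro!: mult_left_mono monom_at_le[OF w])
    then have "(?g has_sum f w) (multi_index I)" using c(2)[OF w] by simp
    then show "((\<lambda>\<alpha>. c \<alpha> * (\<Prod>i\<in>I. (w i - z i) ^ \<alpha> i)) has_sum f w) (I \<rightarrow>\<^sub>E UNIV)"
      by (simp add: monom_at_def multi_index_def)
  qed
qed

lemma multi_index2_bij: "bij_betw (\<lambda>(i, j). \<lambda>k\<in>{..<2::nat}. if k = 0 then i else j) UNIV (multi_index {..<2})"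
proof (rule bij_betwI[of _ _ _ "\<lambda>\<alpha>. (\<alpha> 0, \<alpha> 1)"])
  show "(case (\<alpha> 0, \<alpha> 1) of (i, j) \<Rightarrow> \<lambda>k\<in>{..<2}. if k = 0 then i else j) = \<alpha>" if "\<alpha> \<in> multi_index {..<2}" for \<alpha> :: "nat \<Rightarrow> nat"
  proof
    fix k :: nat
    consider "k = 0" | "k = 1" | "k \<ge> 2" by linarith
    then show "(case (\<alpha> 0, \<alpha> 1) of (i, j) \<Rightarrow> \<lambda>k\<in>{..<2}. if k = 0 then i else j) k = \<alpha> k"
      using that by cases (auto simp: multi_index_def PiE_def extensional_def)
  qed
qed (auto simp: multi_index_def split: if_splits)

lemma analytic2_at_vars: "analytic2_at f p \<longleftrightarrow> analytic_vars_at {..<2::nat} (\<lambda>w. f (w 0, w 1)) (\<lambda>k. if k = 0 then fst p else snd p)"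
proof -
  let ?\<iota> = "\<lambda>(i, j). \<lambda>k\<in>{..<2::nat}. if k = 0 then i else (j::nat)"
  have two: "{..<2::nat} = {0, 1}" by auto
  have key: "((\<lambda>\<alpha>. c \<alpha> * (\<Prod>i\<in>{..<2::nat}. u i ^ \<alpha> i)) has_sum s) ({..<2} \<rightarrow>\<^sub>E UNIV) \<longleftrightarrow>
      ((\<lambda>(i, j). c (?\<iota> (i, j)) * u 0 ^ i * u 1 ^ j) has_sum s) UNIV" for c :: "(nat \<Rightarrow> nat) \<Rightarrow> real" and u s
    by (subst has_sum_reindex_bij_betw[OF multi_index2_bij, symmetric, unfolded multi_index_def])
      (simp add: two case_prod_unfold mult.assoc cong: if_cong)
  show ?thesis
  proof
    assume "analytic2_at f p"
    then obtain c r where r: "r > 0" and c: "\<And>h k. \<bar>h\<bar> < r \<Longrightarrow> \<bar>k\<bar> < r \<Longrightarrow>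
        ((\<lambda>(i, j). c i j * h ^ i * k ^ j) has_sum f (fst p + h, snd p + k)) UNIV"
      unfolding analytic2_at_def by blast
    show "analytic_vars_at {..<2::nat} (\<lambda>w. f (w 0, w 1)) (\<lambda>k. if k = 0 then fst p else snd p)"
      unfolding analytic_vars_at_def
    proof (intro exI[of _ "\<lambda>\<alpha>. c (\<alpha> 0) (\<alpha> 1)"] exI[of _ r] conjI r allI impI)
      fix w assume "\<forall>i\<in>{..<2::nat}. \<bar>w i - (if i = 0 then fst p else snd p)\<bar> < r"
      then have "\<bar>w 0 - fst p\<bar> < r" "\<bar>w 1 - snd p\<bar> < r" unfolding two by auto
      from c[OF this]
      show "((\<lambda>\<alpha>. c (\<alpha> 0) (\<alpha> 1) * (\<Prod>i<2. (w i - (if i = 0 then fst p else snd p)) ^ \<alpha> i)) has_sum f (w 0, w 1)) ({..<2} \<rightarrow>\<^sub>E UNIV)"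
        unfolding key by (simp add: case_prod_unfold)
    qed
  next
    assume "analytic_vars_at {..<2::nat} (\<lambda>w. f (w 0, w 1)) (\<lambda>k. if k = 0 then fst p else snd p)"
    then obtain c r where r: "r > 0" and c: "\<And>w. \<forall>i\<in>{..<2::nat}. \<bar>w i - (if i = 0 then fst p else snd p)\<bar> < r \<Longrightarrow>
      ((\<lambda>\<alpha>. c \<alpha> * (\<Prod>i<2. (w i - (if i = 0 then fst p else snd p)) ^ \<alpha> i)) has_sum f (w 0, w 1)) ({..<2} \<rightarrow>\<^sub>E UNIV)"
      unfolding analytic_vars_at_def by blast
    show "analytic2_at f p" unfolding analytic2_at_def
    proof (intro exI[of _ "\<lambda>i j. c (?\<iota> (i, j))"] exI[of _ r] conjI r allI impI)
      fix h k :: real assume hk: "\<bar>h\<bar> < r \<and> \<bar>k\<bar> < r"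
      have "((\<lambda>\<alpha>. c \<alpha> * (\<Prod>i<2. ((if i = 0 then fst p + h else snd p + k) - (if i = 0 then fst p else snd p)) ^ \<alpha> i)) has_sum f (fst p + h, snd p + k)) ({..<2} \<rightarrow>\<^sub>E UNIV)"
        using c[of "\<lambda>i. if i = 0 then fst p + h else snd p + k"] hk unfolding two by auto
      then show "((\<lambda>(i, j). c (?\<iota> (i, j)) * h ^ i * k ^ j) has_sum f (fst p + h, snd p + k)) UNIV"
        unfolding key by (simp add: case_prod_unfold)
    qed
  qed
qed

lemma analytic2_at_iff: "analytic2_at f p \<longleftrightarrow> an {..<2::nat} (\<lambda>h. f (fst p + h 0, snd p + h 1))"
  unfolding analytic2_at_vars by (simp add: analytic_vars_at_iff)

section \<open>An implicit function theorem\<close>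

text \<open>Absorbs the factor \<open>k\<close> that appears in the difference of two k-th powers
  into a change of radius by the factor 4.\<close>

lemma of_nat_le_4_power: "real n \<le> 4 ^ (n - 1)"
proof (induction n)
  case (Suc n)
  then show ?case by (cases n) auto
qed auto

text \<open>The norm of \<open>ps\<close> turns the equation \<open>u = H(w, u)\<close> into a contraction.\<close>

lemma ps_contraction:
  fixes H :: "(nat \<Rightarrow> real) \<Rightarrow> real"
  assumes H: "ps {..<Suc n} R K H" and R: "R > 0"
    and dH: "((\<lambda>u. H ((\<lambda>_. 0)(n := u))) has_real_derivative 0) (at 0)"
  obtains \<theta> where "\<theta> > 0"
    "\<And>r \<rho> d V1 V2. 0 < r \<Longrightarrow> r \<le> \<rho> \<Longrightarrow> \<rho> \<le> \<theta> \<Longrightarrow> ps {..<n} r \<rho> V1 \<Longrightarrow> ps {..<n} r \<rho> V2 \<Longrightarrow>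
      ps {..<n} r d (\<lambda>w. V1 w - V2 w) \<Longrightarrow>
      ps {..<n} r (d / 2) (\<lambda>w. H (w(n := V1 w)) - H (w(n := V2 w)))"
proof -
  let ?M = "multi_index {..<Suc n}"
  from H obtain c where c: "(\<lambda>\<alpha>. \<bar>c \<alpha>\<bar> * R ^ sum \<alpha> {..<Suc n}) summable_on ?M"
     "infsum (\<lambda>\<alpha>. \<bar>c \<alpha>\<bar> * R ^ sum \<alpha> {..<Suc n}) ?M \<le> K"
     "\<And>w. (\<forall>i\<in>{..<Suc n}. \<bar>w i\<bar> \<le> R) \<Longrightarrow> H w = infsum (\<lambda>\<alpha>. c \<alpha> * monom_at {..<Suc n} w \<alpha>) ?M"
    unfolding ps_def by blast
  have K: "K \<ge> 0" using ps_nonneg[OF H R] .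
  define e where "e k = (\<lambda>i\<in>{..<Suc n}. if i = n then k else (0::nat))" for k
  have e: "e k \<in> ?M" for k by (auto simp: e_def multi_index_def)
  have e_eq: "\<alpha> = e (\<alpha> n)" if "\<alpha> \<in> ?M" "\<forall>i<n. \<alpha> i = 0" for \<alpha>
  proof
    fix i show "\<alpha> i = e (\<alpha> n) i"
      using that by (cases "i < n"; cases "i = n") (auto simp: e_def multi_index_def PiE_def extensional_def)
  qed
  have inj_e: "inj e" by (rule injI) (auto simp: e_def fun_eq_iff split: if_splits)
  \<comment> \<open>The derivative hypothesis removes the monomial that is linear in the last
    variable alone; its coefficient is read off from the restriction of the series to that
    axis.\<close>
  have c1: "c (e 1) = 0"
  proof -
    have ser: "(\<lambda>k. c (e k) * u ^ k) sums H ((\<lambda>_. 0)(n := u))" if u: "\<bar>u\<bar> \<le> R" for u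
    proof -
      let ?w = "(\<lambda>_. 0)(n := u)"
      have w: "\<forall>i\<in>{..<Suc n}. \<bar>?w i\<bar> \<le> R" using u R by auto
      let ?g = "\<lambda>\<alpha>. c \<alpha> * monom_at {..<Suc n} ?w \<alpha>"
      have "?g summable_on ?M"
        by (rule summable_abs_le[OF c(1)]) (auto simp: abs_mult simp del: sum.lessThan_Suc intro!: mult_left_mono monom_at_le[OF w])
      then have "(?g has_sum H ?w) ?M" unfolding c(3)[OF w] by (rule has_sum_infsum)
      moreover have "(?g has_sum H ?w) ?M \<longleftrightarrow> (?g has_sum H ?w) (range e)"
      proof (rule has_sum_cong_neutral)
        fix \<alpha> assume \<alpha>: "\<alpha> \<in> ?M - range e"
        then obtain i where "i < n" "\<alpha> i \<noteq> 0" using e_eq by blast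
        then have "monom_at {..<Suc n} ?w \<alpha> = 0" by (auto simp: monom_at_def intro!: prod_zero)
        then show "?g \<alpha> = 0" by simp
      qed (use e in auto)
      ultimately have "(?g \<circ> e has_sum H ?w) UNIV" using has_sum_reindex[OF inj_e] by blast
      moreover have "monom_at {..<Suc n} ?w (e k) = u ^ k" for k
        by (simp add: monom_at_def e_def)
      ultimately show ?thesis using has_sum_imp_sums by (force simp: o_def)
    qed
    have "((\<lambda>u. suminf (\<lambda>k. c (e k) * u ^ k)) has_field_derivative suminf (\<lambda>k. diffs (\<lambda>k. c (e k)) k * 0 ^ k)) (at 0)"
    proof (rule termdiffs_strong)
      show "summable (\<lambda>k. c (e k) * R ^ k)" using ser[of R] R by (auto simp: sums_iff)
    qed (use R in auto)
    moreover have "suminf (\<lambda>k. diffs (\<lambda>k. c (e k)) k * 0 ^ k) = c (e 1)"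
      by (simp add: diffs_def)
    ultimately have d: "((\<lambda>u. suminf (\<lambda>k. c (e k) * u ^ k)) has_field_derivative c (e 1)) (at 0)" by simp
    have "((\<lambda>u. H ((\<lambda>_. 0)(n := u))) has_real_derivative c (e 1)) (at 0)"
    proof (rule DERIV_cong_ev[THEN iffD1, OF refl _ refl d])
      show "\<forall>\<^sub>F u in nhds 0. (\<Sum>k. c (e k) * u ^ k) = H ((\<lambda>_. 0)(n := u))"
        unfolding eventually_nhds_metric
        by (intro exI[of _ R]) (use R ser in \<open>auto simp: sums_iff dist_real_def\<close>)
    qed
    then show ?thesis using dH DERIV_unique by blast
  qed
  \<comment> \<open>With \<open>\<rho> \<le> R / 4\<close> the powers of \<open>4 * \<rho>\<close>
    are dominated by powers of \<open>R\<close>. The second bound gives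
    \<open>4 * \<theta> \<le> R^2 / (2 * (K + 1))\<close>, which is where the contraction factor 1/2
    comes from.\<close>
  define \<theta> where "\<theta> = min (R / 4) (R * R / (8 * (K + 1)))"
  have \<theta>: "\<theta> > 0" "\<theta> \<le> R / 4"
    using R K by (simp add: \<theta>_def) (unfold \<theta>_def, rule min.cobounded1)
  show ?thesis
  proof (rule that[OF \<theta>(1)])
    fix r \<rho> d V1 V2
    assume r: "0 < r" "r \<le> \<rho>" and \<rho>: "\<rho> \<le> \<theta>" and V1: "ps {..<n} r \<rho> V1" and V2: "ps {..<n} r \<rho> V2"
      and d: "ps {..<n} r d (\<lambda>w. V1 w - V2 w)"
    \<comment> \<open>The cofactor of \<open>V1 - V2\<close> in the difference of the k-th
      powers.\<close>
    let ?V = "\<lambda>k w. \<Sum>i<k. V2 w ^ (k - Suc i) * V1 w ^ i"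
    have d0: "d \<ge> 0" using ps_nonneg[OF d r(1)] .
    have \<rho>0: "\<rho> > 0" "\<rho> \<le> R" using r \<rho> \<theta> R by auto
    have Vk: "ps {..<n} r (real k * \<rho> ^ (k - 1)) (?V k)" for k
    proof (rule ps_infsum[where N = "{..<k}" and f = "\<lambda>i w. V2 w ^ (k - Suc i) * V1 w ^ i" and K = "\<lambda>_. \<rho> ^ (k - 1)", OF r(1)])
      fix i assume i: "i \<in> {..<k}"
      have "ps {..<n} r (\<rho> ^ (k - Suc i) * \<rho> ^ i) (\<lambda>w. V2 w ^ (k - Suc i) * V1 w ^ i)"
        by (intro ps_mult ps_power r V1 V2) auto
      moreover have "\<rho> ^ (k - Suc i) * \<rho> ^ i = \<rho> ^ (k - 1)" using i by (simp flip: power_add)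
      ultimately show "ps {..<n} r (\<rho> ^ (k - 1)) (\<lambda>w. V2 w ^ (k - Suc i) * V1 w ^ i)" by simp
    qed auto
    let ?T = "\<lambda>\<alpha> w. c \<alpha> * (monom_at {..<n} w \<alpha> * ((V1 w - V2 w) * ?V (\<alpha> n) w))"
    let ?K = "\<lambda>\<alpha>. \<bar>c \<alpha>\<bar> * (r ^ sum \<alpha> {..<n} * (d * (real (\<alpha> n) * \<rho> ^ (\<alpha> n - 1))))"
    have T: "ps {..<n} r (?K \<alpha>) (?T \<alpha>)" for \<alpha>
    proof (intro ps_cmult ps_mult r d Vk)
      have "ps {..<n} r (\<Prod>i<n. r ^ \<alpha> i) (\<lambda>w. \<Prod>i<n. w i ^ \<alpha> i)"
        by (intro ps_prod ps_power ps_var r) auto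
      then show "ps {..<n} r (r ^ sum \<alpha> {..<n}) (\<lambda>w. monom_at {..<n} w \<alpha>)"
        by (simp add: monom_at_def power_sum)
    qed auto
    let ?q = "d / (2 * (K + 1))"
    have Kle: "?K \<alpha> \<le> ?q * (\<bar>c \<alpha>\<bar> * R ^ sum \<alpha> {..<Suc n})" if \<alpha>: "\<alpha> \<in> ?M" for \<alpha>
    proof (cases "\<alpha> n = 0 \<or> c \<alpha> = 0")
      case True
      then show ?thesis using d0 K R by auto
    next
      case False
      define k where "k = \<alpha> n"
      define a where "a = sum \<alpha> {..<n}"
      define m where "m = a + k"
      have m: "sum \<alpha> {..<Suc n} = m" by (simp add: m_def a_def k_def)
      have k0: "k \<noteq> 0" using False by (simp add: k_def)
      \<comment> \<open>Every monomial that contains the last variable and survives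
        \<open>c1\<close> has degree at least 2. Hence a factor \<open>\<rho>\<close> remains after
        \<open>V1 - V2\<close> has been split off, and this factor makes the term small.\<close>
      have "m \<ge> 2"
      proof (rule ccontr)
        assume "\<not> m \<ge> 2"
        then have "a = 0" "k = 1" using k0 by (auto simp: m_def)
        then have "\<alpha> = e 1" using e_eq[OF \<alpha>] by (auto simp: a_def k_def)
        then show False using c1 False by simp
      qed
      then obtain m' where m': "m = m' + 2" by (metis add.commute le_Suc_ex)
      have "r ^ a * (real k * \<rho> ^ (k - 1)) \<le> \<rho> ^ a * (real m * \<rho> ^ (k - 1))"
        using r \<rho>0 by (intro mult_mono power_mono) (auto simp: m_def)
      also have "\<dots> = real m * \<rho> ^ (a + (k - 1))" by (simp add: power_add)
      also have "a + (k - 1) = m' + 1" using k0 m' by (auto simp: m_def)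
      also have "real m * \<rho> ^ (m' + 1) \<le> 4 ^ (m - 1) * \<rho> ^ (m' + 1)"
        using of_nat_le_4_power[of m] \<rho>0 by (intro mult_right_mono) auto
      also have "\<dots> = 4 * \<rho> * (4 * \<rho>) ^ m'" using m' by (simp add: power_mult_distrib)
      also have "\<dots> \<le> 4 * \<theta> * R ^ m'"
        using \<rho> \<rho>0 \<theta> by (intro mult_mono power_mono) auto
      also have "\<dots> \<le> 4 * (R * R / (8 * (K + 1))) * R ^ m'"
        using R by (intro mult_right_mono) (auto simp: \<theta>_def)
      also have "\<dots> = R ^ m / (2 * (K + 1))" unfolding m' using K by (simp add: field_simps)
      finally have "\<bar>c \<alpha>\<bar> * d * (r ^ a * (real k * \<rho> ^ (k - 1))) \<le> \<bar>c \<alpha>\<bar> * d * (R ^ m / (2 * (K + 1)))"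
        using d0 by (intro mult_left_mono) auto
      then show ?thesis unfolding m by (simp add: k_def a_def mult_ac)
    qed
    have S: "(\<lambda>\<alpha>. ?q * (\<bar>c \<alpha>\<bar> * R ^ sum \<alpha> {..<Suc n})) summable_on ?M"
      using c(1) by (rule summable_on_cmult_right)
    have SK: "?K summable_on ?M"
      by (rule summable_abs_le[OF S]) (use Kle r d0 \<rho>0 in \<open>auto simp: abs_mult\<close>)
    have "infsum ?K ?M \<le> infsum (\<lambda>\<alpha>. ?q * (\<bar>c \<alpha>\<bar> * R ^ sum \<alpha> {..<Suc n})) ?M"
      by (rule infsum_mono[OF SK S Kle])
    also have "\<dots> \<le> ?q * K" unfolding infsum_cmult_right' using c(2) d0 K by (intro mult_left_mono) auto
    also have "\<dots> \<le> d / 2" using K d0 by (simp add: field_simps)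
    finally have K2: "infsum ?K ?M \<le> d / 2" .
    show "ps {..<n} r (d / 2) (\<lambda>w. H (w(n := V1 w)) - H (w(n := V2 w)))"
    proof (rule ps_infsum[OF r(1) T SK K2])
      fix w :: "nat \<Rightarrow> real" assume w: "\<forall>i\<in>{..<n}. \<bar>w i\<bar> \<le> r"
      have Hs: "((\<lambda>\<alpha>. c \<alpha> * (monom_at {..<n} w \<alpha> * V w ^ \<alpha> n)) has_sum H (w(n := V w))) ?M"
        if V: "ps {..<n} r \<rho> V" for V
      proof -
        have "\<bar>V w\<bar> \<le> \<rho>" by (rule ps_bound[OF V w])
        then have w': "\<forall>i\<in>{..<Suc n}. \<bar>(w(n := V w)) i\<bar> \<le> R"
        proof (intro ballI)
          fix i assume i: "i \<in> {..<Suc n}"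
          show "\<bar>(w(n := V w)) i\<bar> \<le> R"
          proof (cases "i = n")
            case False
            then have "\<bar>w i\<bar> \<le> r" using w i by auto
            then show ?thesis using False r \<rho>0 by simp
          qed (use \<open>\<bar>V w\<bar> \<le> \<rho>\<close> \<rho>0 in simp)
        qed
        let ?g = "\<lambda>\<alpha>. c \<alpha> * monom_at {..<Suc n} (w(n := V w)) \<alpha>"
        have "?g summable_on ?M"
          by (rule summable_abs_le[OF c(1)]) (auto simp: abs_mult simp del: sum.lessThan_Suc intro!: mult_left_mono monom_at_le[OF w'])
        then have "(?g has_sum H (w(n := V w))) ?M" unfolding c(3)[OF w'] by (rule has_sum_infsum)
        moreover have "monom_at {..<Suc n} (w(n := V w)) \<alpha> = monom_at {..<n} w \<alpha> * V w ^ \<alpha> n" for \<alpha>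
          by (simp add: monom_at_def)
        ultimately show ?thesis by simp
      qed
      have "((\<lambda>\<alpha>. c \<alpha> * (monom_at {..<n} w \<alpha> * V1 w ^ \<alpha> n) - c \<alpha> * (monom_at {..<n} w \<alpha> * V2 w ^ \<alpha> n)) has_sum
         H (w(n := V1 w)) - H (w(n := V2 w))) ?M"
        using has_sum_add[OF Hs[OF V1] has_sum_uminusI[OF Hs[OF V2]]] by simp
      moreover have "c \<alpha> * (monom_at {..<n} w \<alpha> * V1 w ^ \<alpha> n) - c \<alpha> * (monom_at {..<n} w \<alpha> * V2 w ^ \<alpha> n) = ?T \<alpha> w" for \<alpha>
        by (simp add: power_diff_sumr2 flip: right_diff_distrib)
      ultimately have "(((\<lambda>\<alpha>. ?T \<alpha> w)) has_sum H (w(n := V1 w)) - H (w(n := V2 w))) ?M" by (simp only:)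
      then show "H (w(n := V1 w)) - H (w(n := V2 w)) = infsum (\<lambda>\<alpha>. ?T \<alpha> w) ?M" by (rule infsumI[symmetric])
    qed
  qed
qed

text \<open>Picard iteration from the zero function: the increments halve in norm, so their sum
  \<open>U\<close> is again a power series. Uniqueness is pointwise and holds for all
  \<open>u\<close> with \<open>\<bar>u\<bar> \<le> \<rho>\<close>, so that the solution set can be
  identified in a whole box.\<close>

lemma analytic_fixed_point:
  fixes H :: "(nat \<Rightarrow> real) \<Rightarrow> real"
  assumes H: "an {..<Suc n} H" and H0: "H (\<lambda>_. 0) = 0"
    and dH: "((\<lambda>u. H ((\<lambda>_. 0)(n := u))) has_real_derivative 0) (at 0)" and \<delta>: "\<delta> > 0"
  obtains r \<rho> U where "0 < r" "r < \<delta>" "0 < \<rho>" "\<rho> < \<delta>" "an {..<n} U" "U (\<lambda>_. 0) = 0"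
    "\<And>w. \<forall>i<n. \<bar>w i\<bar> \<le> r \<Longrightarrow> \<bar>U w\<bar> < \<rho> \<and> H (w(n := U w)) = U w"
    "\<And>w u. \<forall>i<n. \<bar>w i\<bar> \<le> r \<Longrightarrow> \<bar>u\<bar> \<le> \<rho> \<Longrightarrow> H (w(n := u)) = u \<Longrightarrow> u = U w"
proof -
  obtain R K where R: "R > 0" "ps {..<Suc n} R K H" using H by (auto simp: an_def)
  obtain \<theta> where \<theta>: "\<theta> > 0" and ctr: "\<And>r \<rho> d V1 V2. 0 < r \<Longrightarrow> r \<le> \<rho> \<Longrightarrow> \<rho> \<le> \<theta> \<Longrightarrow> ps {..<n} r \<rho> V1 \<Longrightarrow> ps {..<n} r \<rho> V2 \<Longrightarrow>
      ps {..<n} r d (\<lambda>w. V1 w - V2 w) \<Longrightarrow>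
      ps {..<n} r (d / 2) (\<lambda>w. H (w(n := V1 w)) - H (w(n := V2 w)))"
    by (rule ps_contraction[OF R(2,1) dH]) blast
  define \<rho> where "\<rho> = min \<theta> (\<delta> / 2)"
  have \<rho>: "\<rho> > 0" "\<rho> < \<delta>" "\<rho> \<le> \<theta>" using \<theta> \<delta> by (auto simp: \<rho>_def)
  have an0: "an {..<n} (\<lambda>w. H (w(n := 0)))"
  proof -
    have "an {..<n} (\<lambda>w. (w(n := 0)) i)" if "i \<in> {..<Suc n}" for i
      using that by (cases "i = n") auto
    from an_compose[where \<sigma> = "\<lambda>i w. (w(n := 0)) i", OF H _ _ this] show ?thesis by (simp add: fun_upd_def)
  qed
  \<comment> \<open>A first increment of norm at most \<open>\<rho> / 5\<close>, halved at each
    later step, keeps all iterates and the limit within \<open>2 * \<rho> / 5\<close>, strictly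
    inside the ball of radius \<open>\<rho>\<close>.\<close>
  obtain s0 where s0: "s0 > 0" "\<forall>s. 0 < s \<and> s \<le> s0 \<longrightarrow> ps {..<n} s (\<rho> / 5) (\<lambda>w. H (w(n := 0)))"
    using ps_small_exists[OF an0, of "\<rho> / 5" 1] \<rho> H0 by (auto simp: fun_upd_idem)
  define r where "r = min s0 \<rho>"
  have r: "0 < r" "r \<le> \<rho>" "r < \<delta>" using s0 \<rho> by (auto simp: r_def)
  have H0r: "ps {..<n} r (\<rho> / 5) (\<lambda>w. H (w(n := 0)))" using s0 r by (auto simp: r_def)
  define V where "V k = ((\<lambda>V w. H (w(n := V w))) ^^ k) (\<lambda>_. 0)" for k
  have V0: "V 0 = (\<lambda>_. 0)" and VS: "V (Suc k) = (\<lambda>w. H (w(n := V k w)))" for k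
    by (auto simp: V_def)
  let ?b = "\<lambda>k. 2 * \<rho> / 5 * (1 - (1/2) ^ k)"
  have b: "?b k \<le> \<rho>" for k
  proof -
    have "2 * \<rho> / 5 * (1 - (1/2) ^ k) \<le> 2 * \<rho> / 5 * 1" using \<rho> by (intro mult_left_mono) auto
    then show ?thesis using \<rho> by linarith
  qed
  have V: "ps {..<n} r (?b k) (V k) \<and> ps {..<n} r (\<rho> / 5 * (1/2) ^ k) (\<lambda>w. V (Suc k) w - V k w)" for k
  proof (induction k)
    case 0
    show ?case using H0r ps_const[OF r(1), of "{..<n}" 0] by (simp add: V0 VS)
  next
    case (Suc k)
    have "ps {..<n} r (?b k + \<rho> / 5 * (1/2) ^ k) (\<lambda>w. V k w + (V (Suc k) w - V k w))"
      by (rule ps_add[OF r(1)]) (use Suc in auto)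
    moreover have e: "?b k + \<rho> / 5 * (1/2) ^ k = ?b (Suc k)" by (simp add: field_simps)
    ultimately have 1: "ps {..<n} r (?b (Suc k)) (V (Suc k))" unfolding e by simp
    have "ps {..<n} r (\<rho> / 5 * (1/2) ^ k / 2) (\<lambda>w. H (w(n := V (Suc k) w)) - H (w(n := V k w)))"
      by (rule ctr[OF r(1,2) \<rho>(3)]) (use 1 Suc ps_mono b in blast)+
    then show ?case using 1 by (simp add: VS)
  qed
  define U where "U w = infsum (\<lambda>k. V (Suc k) w - V k w) UNIV" for w
  have S: "(\<lambda>k. \<rho> / 5 * (1/2::real) ^ k) sums (\<rho> / 5 * (1 / (1 - 1/2)))"
    by (rule sums_mult, rule geometric_sums) auto
  have S': "(\<lambda>k. \<rho> / 5 * (1/2::real) ^ k) summable_on UNIV"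
    by (subst summable_on_UNIV_nonneg_real_iff) (use S \<rho> in \<open>auto simp: sums_iff\<close>)
  have "((\<lambda>k. \<rho> / 5 * (1/2::real) ^ k) has_sum infsum (\<lambda>k. \<rho> / 5 * (1/2::real) ^ k) UNIV) UNIV"
    using S' by simp
  from has_sum_imp_sums[OF this] S have I: "infsum (\<lambda>k. \<rho> / 5 * (1/2::real) ^ k) UNIV = \<rho> / 5 * (1 / (1 - 1/2))"
    by (rule sums_unique2)
  have U: "ps {..<n} r (2 * \<rho> / 5) U"
    by (rule ps_infsum[where N = UNIV and f = "\<lambda>k w. V (Suc k) w - V k w", OF r(1) _ S'])
      (use V I in \<open>auto simp: U_def\<close>)
  have Ub: "\<bar>U w\<bar> \<le> 2 * \<rho> / 5" if "\<forall>i<n. \<bar>w i\<bar> \<le> r" for w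
    by (rule ps_bound[OF U]) (use that in auto)
  have Vb: "\<bar>V k w\<bar> \<le> \<rho>" if "\<forall>i<n. \<bar>w i\<bar> \<le> r" for w k
    using ps_bound[of "{..<n}" r "?b k" "V k" w] V b[of k] that by force
  \<comment> \<open>The contraction estimate for constant functions \<open>V1\<close> and
    \<open>V2\<close> is a pointwise Lipschitz bound in the last variable.\<close>
  have lip: "\<bar>H (w(n := u)) - H (w(n := v))\<bar> \<le> \<bar>u - v\<bar> / 2"
    if w: "\<forall>i<n. \<bar>w i\<bar> \<le> r" and u: "\<bar>u\<bar> \<le> \<rho>" and v: "\<bar>v\<bar> \<le> \<rho>" for w u v
  proof -
    have cst: "ps {..<n} r \<rho> (\<lambda>_. t)" if "\<bar>t\<bar> \<le> \<rho>" for t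
      by (rule ps_mono[OF ps_const[OF r(1)] that])
    have "ps {..<n} r (\<bar>u - v\<bar> / 2) (\<lambda>w. H (w(n := u)) - H (w(n := v)))"
      by (rule ctr[OF r(1,2) \<rho>(3) cst[OF u] cst[OF v] ps_const[OF r(1)]])
    from ps_bound[OF this] w show ?thesis by auto
  qed
  have lim: "(\<lambda>k. V k w) \<longlonglongrightarrow> U w" if w: "\<forall>i<n. \<bar>w i\<bar> \<le> r" for w
  proof -
    have "(\<lambda>k. V (Suc k) w - V k w) summable_on UNIV"
      by (rule summable_abs_le[OF S']) (use V ps_bound w in blast)
    then have "((\<lambda>k. V (Suc k) w - V k w) has_sum U w) UNIV" unfolding U_def by simp
    from has_sum_imp_sums[OF this] have "(\<lambda>m. \<Sum>k<m. V (Suc k) w - V k w) \<longlonglongrightarrow> U w"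
      by (simp add: sums_def)
    moreover have "(\<Sum>k<m. V (Suc k) w - V k w) = V m w" for m
      by (induction m) (auto simp: V0)
    ultimately show ?thesis by simp
  qed
  have fixp: "H (w(n := U w)) = U w" if w: "\<forall>i<n. \<bar>w i\<bar> \<le> r" for w
  proof -
    have "(\<lambda>k. \<bar>U w - V k w\<bar> / 2) \<longlonglongrightarrow> \<bar>U w - U w\<bar> / 2"
      by (intro tendsto_intros lim w) auto
    then have z: "(\<lambda>k. \<bar>U w - V k w\<bar> / 2) \<longlonglongrightarrow> 0" by simp
    have "(\<lambda>k. H (w(n := U w)) - V (Suc k) w) \<longlonglongrightarrow> 0"
    proof (rule Lim_null_comparison[OF _ z], rule always_eventually, rule allI)
      fix k show "norm (H (w(n := U w)) - V (Suc k) w) \<le> \<bar>U w - V k w\<bar> / 2"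
        using lip[OF w _ Vb[OF w], of "U w" k] Ub[OF w] \<rho> by (simp add: VS)
    qed
    then have "(\<lambda>k. H (w(n := U w)) - (H (w(n := U w)) - V (Suc k) w)) \<longlonglongrightarrow> H (w(n := U w)) - 0"
      by (intro tendsto_intros)
    then have "(\<lambda>k. V (Suc k) w) \<longlonglongrightarrow> H (w(n := U w))" by simp
    moreover have "(\<lambda>k. V (Suc k) w) \<longlonglongrightarrow> U w" using lim[OF w] by (rule LIMSEQ_Suc)
    ultimately show ?thesis by (rule LIMSEQ_unique)
  qed
  have uniq: "u = U w" if w: "\<forall>i<n. \<bar>w i\<bar> \<le> r" and u: "\<bar>u\<bar> \<le> \<rho>" "H (w(n := u)) = u" for w u
  proof -
    have "\<bar>u - U w\<bar> \<le> \<bar>u - U w\<bar> / 2"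
      using lip[OF w u(1), of "U w"] Ub[OF w] \<rho> u(2) fixp[OF w] by simp
    then have "\<bar>u - U w\<bar> \<le> 0" by simp
    then show ?thesis by simp
  qed
  have U0: "U (\<lambda>_. 0) = 0"
    using uniq[of "\<lambda>_. 0" 0] r \<rho> H0 by (auto simp: fun_upd_idem)
  show ?thesis
    by (rule that[OF r(1,3) \<rho>(1,2) anI[OF r(1) U] U0])
      (use fixp uniq Ub \<rho> in \<open>fastforce+\<close>)
qed

section \<open>Taylor coefficients and partial derivatives\<close>

definition expansion :: "(nat \<Rightarrow> nat \<Rightarrow> real) \<Rightarrow> real \<Rightarrow> (real \<times> real \<Rightarrow> real) \<Rightarrow> real \<times> real \<Rightarrow> bool" where
  "expansion c r F p \<longleftrightarrow> r > 0 \<and> (\<forall>h k. \<bar>h\<bar> < r \<and> \<bar>k\<bar> < r \<longrightarrow>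
        ((\<lambda>(i, j). c i j * h ^ i * k ^ j) has_sum F (fst p + h, snd p + k)) UNIV)"

lemma analytic2_expansion: "analytic2_at F p \<longleftrightarrow> (\<exists>c r. expansion c r F p)"
  by (auto simp: analytic2_at_def expansion_def)

lemma expansion_summable:
  assumes "expansion c r F p" "0 \<le> s" "s < r"
  shows "(\<lambda>(i, j). \<bar>c i j\<bar> * s ^ i * s ^ j) summable_on UNIV"
proof -
  have "((\<lambda>(i, j). c i j * s ^ i * s ^ j) has_sum F (fst p + s, snd p + s)) UNIV"
    using assms by (auto simp: expansion_def)
  then have "(\<lambda>z. norm (case z of (i, j) \<Rightarrow> c i j * s ^ i * s ^ j)) summable_on UNIV"
    by (intro iffD1[OF summable_on_iff_abs_summable_on_real]) (auto simp: summable_on_def)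
  then show ?thesis using assms(2) by (simp add: case_prod_unfold abs_mult)
qed

lemma expansion_center: 
  assumes "expansion c r F p" shows "F p = c 0 0"
proof -
  have "((\<lambda>(i, j). c i j * 0 ^ i * 0 ^ j) has_sum F (fst p + 0, snd p + 0)) UNIV"
    using assms[unfolded expansion_def, THEN conjunct2, rule_format, of 0 0] assms[unfolded expansion_def, THEN conjunct1] by simp
  moreover have "((\<lambda>(i, j). c i j * 0 ^ i * 0 ^ j) has_sum c 0 0) UNIV"
  proof -
    have "((\<lambda>(i, j). c i j * 0 ^ i * 0 ^ j) has_sum c 0 0) {(0,0)}"
      using has_sum_finite[of "{(0::nat,0::nat)}" "\<lambda>(i, j). c i j * 0 ^ i * 0 ^ j"] by simp
    then show ?thesis by (rule has_sum_cong_neutral[THEN iffD1, rotated -1]) (auto simp: power_0_left split: if_splits)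
  qed
  ultimately show ?thesis using has_sum_unique by fastforce
qed

lemma expansion_cong:
  assumes "expansion c r F p" "s > 0" "\<And>h k. \<bar>h\<bar> < s \<Longrightarrow> \<bar>k\<bar> < s \<Longrightarrow> F (fst p + h, snd p + k) = G (fst p + h, snd p + k)"
  shows "expansion c (min r s) G p"
  using assms(1,2) by (auto simp: expansion_def assms(3)[symmetric])

lemma expansion_swap:
  assumes "expansion c r F p"
  shows "expansion (\<lambda>i j. c j i) r (\<lambda>q. F (snd q, fst q)) (snd p, fst p)"
  unfolding expansion_def
proof (intro conjI allI impI)
  show "r > 0" using assms by (simp add: expansion_def)
  fix h k assume hk: "\<bar>h\<bar> < r \<and> \<bar>k\<bar> < r"
  then have "((\<lambda>(i, j). c i j * k ^ i * h ^ j) has_sum F (fst p + k, snd p + h)) (UNIV \<times> UNIV)"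
    using assms by (simp add: expansion_def)
  from this[THEN iffD1[OF has_sum_swap]]
  show "((\<lambda>(i, j). c j i * h ^ i * k ^ j) has_sum
      F (snd (fst (snd p, fst p) + h, snd (snd p, fst p) + k), fst (fst (snd p, fst p) + h, snd (snd p, fst p) + k))) UNIV"
    by (simp add: case_prod_unfold mult_ac)
qed

text \<open>Summing over \<open>j\<close> first leaves a power series in one variable, which may be
  differentiated termwise; absolute summability then turns the result back into a double
  series.\<close>

lemma expansion_partial_x_aux:
  assumes E: "expansion c r F p" and h: "\<bar>h\<bar> < r" and k: "\<bar>k\<bar> < r"
  shows "\<exists>D. ((\<lambda>t. F (t, snd p + k)) has_real_derivative D) (at (fst p + h)) \<and>
    ((\<lambda>(i, j). (real (Suc i) * c (Suc i) j) * h ^ i * k ^ j) has_sum D) UNIV"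
proof -
  define s where "s = (max \<bar>h\<bar> \<bar>k\<bar> + r) / 2"
  have s: "\<bar>h\<bar> < s" "\<bar>k\<bar> < s" "s < r" "s > 0" using h k by (auto simp: s_def max_def)
  define a where "a i = infsum (\<lambda>j. c i j * k ^ j) UNIV" for i
  have sm: "(\<lambda>(i, j). c i j * t ^ i * k ^ j) summable_on (UNIV \<times> UNIV)" if "\<bar>t\<bar> < r" for t
    using E that k unfolding expansion_def summable_on_def UNIV_Times_UNIV by blast
  have smk: "(\<lambda>j. c i j * k ^ j) summable_on UNIV" for i
  proof -
    have "(\<lambda>j. c i j * s ^ i * k ^ j) summable_on UNIV"
      using summable_on_SigmaD1[OF sm[of s], of i] s by simp
    then have "(\<lambda>j. inverse (s ^ i) * (c i j * s ^ i * k ^ j)) summable_on UNIV"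
      by (rule summable_on_cmult_right)
    moreover have "inverse (s ^ i) * (c i j * s ^ i * k ^ j) = c i j * k ^ j" for j using s by simp
    ultimately show ?thesis by simp
  qed
  have ser: "(\<lambda>i. a i * t ^ i) sums F (fst p + t, snd p + k)" if t: "\<bar>t\<bar> < r" for t
  proof -
    have "((\<lambda>(i, j). c i j * t ^ i * k ^ j) has_sum F (fst p + t, snd p + k)) (UNIV \<times> UNIV)"
      using E t k by (auto simp: expansion_def)
    then have "((\<lambda>i. a i * t ^ i) has_sum F (fst p + t, snd p + k)) UNIV"
    proof (rule has_sum_SigmaD)
      fix i
      have "((\<lambda>j. t ^ i * (c i j * k ^ j)) has_sum (t ^ i * a i)) UNIV"
        unfolding a_def by (intro has_sum_cmult_right has_sum_infsum smk)
      then show "((\<lambda>j. case (i, j) of (i, j) \<Rightarrow> c i j * t ^ i * k ^ j) has_sum a i * t ^ i) UNIV"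
        by (simp add: mult_ac)
    qed
    then show ?thesis by (rule has_sum_imp_sums)
  qed
  have "((\<lambda>t. suminf (\<lambda>i. a i * t ^ i)) has_field_derivative suminf (\<lambda>i. diffs a i * h ^ i)) (at h)"
    by (rule termdiffs_strong[of a s]) (use ser[of s] s in \<open>auto simp: sums_iff\<close>)
  then have "((\<lambda>t. F (fst p + t, snd p + k)) has_field_derivative suminf (\<lambda>i. diffs a i * h ^ i)) (at h)"
  proof (rule DERIV_cong_ev[THEN iffD1, OF refl _ refl, rotated])
    show "\<forall>\<^sub>F t in nhds h. (\<Sum>i. a i * t ^ i) = F (fst p + t, snd p + k)"
      unfolding eventually_nhds_metric
    proof (intro exI[of _ "r - \<bar>h\<bar>"] conjI allI impI)
      fix t assume "dist t h < r - \<bar>h\<bar>"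
      then have "\<bar>t\<bar> < r" by (auto simp: dist_real_def)
      then show "(\<Sum>i. a i * t ^ i) = F (fst p + t, snd p + k)" using ser by (simp add: sums_iff)
    qed (use h in auto)
  qed
  then have D: "((\<lambda>t. F (t, snd p + k)) has_field_derivative suminf (\<lambda>i. diffs a i * h ^ i)) (at (fst p + h))"
    using DERIV_shift[of "\<lambda>t. F (t, snd p + k)" _ h "fst p"] by (simp add: add.commute)
  define q where "q = \<bar>h\<bar> / s"
  have q: "0 \<le> q" "q < 1" using s by (auto simp: q_def)
  \<comment> \<open>The factor \<open>Suc i\<close> produced by differentiation is absorbed by the
    gap between \<open>\<bar>h\<bar>\<close> and the intermediate radius \<open>s\<close>.\<close>
  obtain B where B: "\<And>i. \<bar>real (Suc i) * q ^ i\<bar> \<le> B"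
  proof -
    have "summable (\<lambda>i. diffs (\<lambda>_. 1) i * q ^ i)"
    proof (rule termdiff_converges[where K = 1])
      fix x :: real assume "norm x < 1"
      then show "summable (\<lambda>n. 1 * x ^ n)" using summable_geometric[of x] by simp
    qed (use q in auto)
    then have "(\<lambda>i. real (Suc i) * q ^ i) \<longlonglongrightarrow> 0"
      using summable_LIMSEQ_zero by (auto simp: diffs_def)
    then have "Bseq (\<lambda>i. real (Suc i) * q ^ i)" using convergent_imp_Bseq convergentI by blast
    then show ?thesis using that unfolding Bseq_def by (metis real_norm_def)
  qed
  have B0: "B \<ge> 0" using B[of 0] by simp
  have S: "(\<lambda>(i, j). \<bar>c i j\<bar> * s ^ i * s ^ j) summable_on UNIV"
    using expansion_summable[OF E] s by auto
  have inj: "inj (\<lambda>(i::nat, j::nat). (Suc i, j))" by (auto simp: inj_def)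
  have "(\<lambda>(i, j). \<bar>c i j\<bar> * s ^ i * s ^ j) summable_on range (\<lambda>(i, j). (Suc i, j))"
    by (rule summable_on_subset_banach[OF S]) auto
  then have "(\<lambda>(i, j). \<bar>c (Suc i) j\<bar> * s ^ Suc i * s ^ j) summable_on UNIV"
    unfolding summable_on_reindex[OF inj] by (simp add: o_def case_prod_unfold)
  then have "(\<lambda>z. (B / s) * (case z of (i, j) \<Rightarrow> \<bar>c (Suc i) j\<bar> * s ^ Suc i * s ^ j)) summable_on UNIV"
    by (rule summable_on_cmult_right)
  then have S2: "(\<lambda>(i, j). (real (Suc i) * c (Suc i) j) * h ^ i * k ^ j) summable_on (UNIV \<times> UNIV)"
    unfolding UNIV_Times_UNIV
  proof (rule summable_abs_le, clarify)
    fix i j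
    have "\<bar>(real (Suc i) * c (Suc i) j) * h ^ i * k ^ j\<bar> = \<bar>real (Suc i) * q ^ i\<bar> * (\<bar>c (Suc i) j\<bar> * s ^ i * \<bar>k\<bar> ^ j)"
      using s by (simp add: abs_mult power_abs q_def power_divide)
    also have "\<dots> \<le> B * (\<bar>c (Suc i) j\<bar> * s ^ i * s ^ j)"
      using B0 s by (intro mult_mono B mult_left_mono power_mono) auto
    also have "\<dots> = (B / s) * (\<bar>c (Suc i) j\<bar> * s ^ Suc i * s ^ j)" using s by simp
    finally show "\<bar>(real (Suc i) * c (Suc i) j) * h ^ i * k ^ j\<bar> \<le> (B / s) * (\<bar>c (Suc i) j\<bar> * s ^ Suc i * s ^ j)" .
  qed
  have "((\<lambda>(i, j). (real (Suc i) * c (Suc i) j) * h ^ i * k ^ j) has_sum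
     infsum (\<lambda>(i, j). (real (Suc i) * c (Suc i) j) * h ^ i * k ^ j) (UNIV \<times> UNIV)) (UNIV \<times> UNIV)"
    using S2 by simp
  then have "((\<lambda>i. diffs a i * h ^ i) has_sum infsum (\<lambda>(i, j). (real (Suc i) * c (Suc i) j) * h ^ i * k ^ j) (UNIV \<times> UNIV)) UNIV"
  proof (rule has_sum_SigmaD)
    fix i
    have "((\<lambda>j. (real (Suc i) * h ^ i) * (c (Suc i) j * k ^ j)) has_sum ((real (Suc i) * h ^ i) * a (Suc i))) UNIV"
      unfolding a_def by (intro has_sum_cmult_right has_sum_infsum smk)
    then show "((\<lambda>j. case (i, j) of (i, j) \<Rightarrow> (real (Suc i) * c (Suc i) j) * h ^ i * k ^ j) has_sum diffs a i * h ^ i) UNIV"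
      by (simp add: mult_ac diffs_def)
  qed
  from has_sum_imp_sums[OF this]
  have "suminf (\<lambda>i. diffs a i * h ^ i) = infsum (\<lambda>(i, j). (real (Suc i) * c (Suc i) j) * h ^ i * k ^ j) (UNIV \<times> UNIV)"
    by (simp add: sums_iff)
  then show ?thesis using D S2 by (intro exI[of _ "suminf (\<lambda>i. diffs a i * h ^ i)"]) auto
qed

lemma expansion_partial_x:
  assumes E: "expansion c r F p"
  shows "expansion (\<lambda>i j. real (Suc i) * c (Suc i) j) r (partial_x F) p"
    and "\<bar>h\<bar> < r \<Longrightarrow> \<bar>k\<bar> < r \<Longrightarrow> ((\<lambda>t. F (t, snd p + k)) has_real_derivative partial_x F (fst p + h, snd p + k)) (at (fst p + h))"
proof -
  have *: "((\<lambda>t. F (t, snd p + k)) has_real_derivative partial_x F (fst p + h, snd p + k)) (at (fst p + h)) \<and>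
     ((\<lambda>(i, j). (real (Suc i) * c (Suc i) j) * h ^ i * k ^ j) has_sum partial_x F (fst p + h, snd p + k)) UNIV"
    if hk: "\<bar>h\<bar> < r" "\<bar>k\<bar> < r" for h k
  proof -
    obtain D where D: "((\<lambda>t. F (t, snd p + k)) has_real_derivative D) (at (fst p + h))"
      "((\<lambda>(i, j). (real (Suc i) * c (Suc i) j) * h ^ i * k ^ j) has_sum D) UNIV"
      using expansion_partial_x_aux[OF E hk] by blast
    have "partial_x F (fst p + h, snd p + k) = D"
      by (simp add: partial_x_def DERIV_imp_deriv[OF D(1)])
    then show ?thesis using D by simp
  qed
  show "expansion (\<lambda>i j. real (Suc i) * c (Suc i) j) r (partial_x F) p"
    using * E by (auto simp: expansion_def)
  show "\<bar>h\<bar> < r \<Longrightarrow> \<bar>k\<bar> < r \<Longrightarrow> ((\<lambda>t. F (t, snd p + k)) has_real_derivative partial_x F (fst p + h, snd p + k)) (at (fst p + h))"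
    using * by blast
qed

lemma partial_y_swap: "partial_y F = (\<lambda>q. partial_x (\<lambda>q. F (snd q, fst q)) (snd q, fst q))"
  by (auto simp: partial_y_def partial_x_def)

lemma expansion_partial_y:
  assumes E: "expansion c r F p"
  shows "expansion (\<lambda>i j. real (Suc j) * c i (Suc j)) r (partial_y F) p"
    and "\<bar>h\<bar> < r \<Longrightarrow> \<bar>k\<bar> < r \<Longrightarrow> ((\<lambda>t. F (fst p + h, t)) has_real_derivative partial_y F (fst p + h, snd p + k)) (at (snd p + k))"
proof -
  note E' = expansion_swap[OF E]
  show "expansion (\<lambda>i j. real (Suc j) * c i (Suc j)) r (partial_y F) p"
    using expansion_swap[OF expansion_partial_x(1)[OF E']] by (simp add: partial_y_swap)
  show "((\<lambda>t. F (fst p + h, t)) has_real_derivative partial_y F (fst p + h, snd p + k)) (at (snd p + k))"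
    if "\<bar>h\<bar> < r" "\<bar>k\<bar> < r"
    using expansion_partial_x(2)[OF E' that(2,1)] by (simp add: partial_y_swap)
qed

lemma expansion_partial:
  assumes E: "expansion c r F p"
  shows "expansion (\<lambda>i l. fact (i + j) / fact i * (fact (l + k) / fact l) * c (i + j) (l + k)) r (partial j k F) p"
proof -
  have y: "expansion (\<lambda>i l. fact (l + k) / fact l * c i (l + k)) r ((partial_y ^^ k) F) p"
  proof (induction k)
    case (Suc k)
    from expansion_partial_y(1)[OF Suc]
    show ?case by (simp add: field_simps del: of_nat_Suc)
  qed (use E in auto)
  show ?thesis unfolding partial_def
  proof (induction j)
    case 0
    then show ?case using y by simp
  next
    case (Suc j)
    from expansion_partial_x(1)[OF Suc]
    show ?case by (simp add: field_simps del: of_nat_Suc)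
  qed
qed

lemma partial_eq_coeff:
  assumes "expansion c r F p"
  shows "partial j k F p = fact j * fact k * c j k"
  using expansion_center[OF expansion_partial[OF assms, of j k]] by simp

lemma expansion_unique:
  assumes "expansion c r F p" "expansion d s F p" shows "c j k = d j k"
  using partial_eq_coeff[OF assms(1), of j k] partial_eq_coeff[OF assms(2), of j k] by simp

lemma analytic2_partial:
  assumes "analytic2_at F p" shows "analytic2_at (partial j k F) p"
  using assms expansion_partial unfolding analytic2_expansion by blast

lemma partial_x_partial: "partial_x (partial j k F) = partial (Suc j) k F"
  by (simp add: partial_def)

lemma partial_y_partial:
  assumes "analytic2_at F p" shows "partial_y (partial j k F) p = partial j (Suc k) F p"
proof -
  from assms obtain c r where E: "expansion c r F p" unfolding analytic2_expansion by blast
  show ?thesis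
    using expansion_center[OF expansion_partial_y(1)[OF expansion_partial[OF E, of j k]]]
      partial_eq_coeff[OF E, of j "Suc k"] by simp
qed

lemma analytic2_DERIV_x:
  assumes "analytic2_at F (x, y)"
  shows "((\<lambda>t. F (t, y)) has_real_derivative partial_x F (x, y)) (at x)"
  using assms expansion_partial_x(2)[of _ _ F "(x, y)" 0 0] unfolding analytic2_expansion
  by (auto simp: expansion_def)

lemma analytic2_DERIV_y:
  assumes "analytic2_at F (x, y)"
  shows "((\<lambda>t. F (x, t)) has_real_derivative partial_y F (x, y)) (at y)"
  using assms expansion_partial_y(2)[of _ _ F "(x, y)" 0 0] unfolding analytic2_expansion
  by (auto simp: expansion_def)

lemma analytic2_isCont:
  assumes "analytic2_at F p" shows "isCont F p"
proof -
  let ?f = "\<lambda>h :: nat \<Rightarrow> real. F (fst p + h 0, snd p + h 1) - F p"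
  have a: "an {..<2} ?f" using assms by (auto simp: analytic2_at_iff)
  show ?thesis unfolding continuous_at_eps_delta
  proof (intro allI impI)
    fix e :: real assume e: "e > 0"
    obtain s where s: "s > 0" "ps {..<2} s (e/2) ?f"
      using ps_small_exists[OF a, of "e/2" 1] e by auto
    show "\<exists>d>0. \<forall>q. dist q p < d \<longrightarrow> dist (F q) (F p) < e"
    proof (intro exI[of _ s] conjI allI impI s(1))
      fix q assume q: "dist q p < s"
      have "\<bar>fst q - fst p\<bar> \<le> s" "\<bar>snd q - snd p\<bar> \<le> s"
        using q dist_fst_le[of q p] dist_snd_le[of q p] by (auto simp: dist_real_def)
      then have "\<bar>?f (\<lambda>i. if i = 0 then fst q - fst p else snd q - snd p)\<bar> \<le> e / 2"
        by (intro ps_bound[OF s(2)]) auto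
      then show "dist (F q) (F p) < e" using e by (simp add: dist_real_def)
    qed
  qed
qed

section \<open>Boxes as neighbourhoods, and persistence of analyticity nearby\<close>

lemma box_in_ball:
  assumes "\<bar>fst q - fst p\<bar> < e / 2" "\<bar>snd q - snd p\<bar> < e / 2"
  shows "dist q p < (e::real)"
proof -
  have "dist q p \<le> \<bar>fst q - fst p\<bar> + \<bar>snd q - snd p\<bar>"
    by (cases q; cases p) (auto simp: dist_Pair_Pair dist_real_def intro: sqrt_sum_squares_le_sum_abs)
  then show ?thesis using assms by simp
qed

lemma eventually_nhds_box:
  "(\<forall>\<^sub>F q in nhds p. P q) \<longleftrightarrow> (\<exists>r>0. \<forall>h k. \<bar>h\<bar> < r \<longrightarrow> \<bar>k\<bar> < r \<longrightarrow> P (fst p + h, snd p + (k::real) :: real))"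
proof
  assume "\<forall>\<^sub>F q in nhds p. P q"
  then obtain e where e: "e > 0" "\<And>q. dist q p < e \<Longrightarrow> P q" unfolding eventually_nhds_metric by blast
  show "\<exists>r>0. \<forall>h k. \<bar>h\<bar> < r \<longrightarrow> \<bar>k\<bar> < r \<longrightarrow> P (fst p + h, snd p + k)"
    by (intro exI[of _ "e/2"]) (use e box_in_ball in auto)
next
  assume "\<exists>r>0. \<forall>h k. \<bar>h\<bar> < r \<longrightarrow> \<bar>k\<bar> < r \<longrightarrow> P (fst p + h, snd p + (k::real))"
  then obtain r where r: "r > 0" "\<And>h k. \<bar>h\<bar> < r \<Longrightarrow> \<bar>k\<bar> < r \<Longrightarrow> P (fst p + h, snd p + k)" by blast
  show "\<forall>\<^sub>F q in nhds p. P q" unfolding eventually_nhds_metric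
  proof (intro exI[of _ r] conjI allI impI r(1))
    fix q assume q: "dist q p < r"
    have "\<bar>fst q - fst p\<bar> < r" "\<bar>snd q - snd p\<bar> < r"
      using q dist_fst_le[of q p] dist_snd_le[of q p] by (auto simp: dist_real_def)
    from r(2)[OF this] show "P q" by simp
  qed
qed

lemma analytic2_nearby:
  assumes "analytic2_at F p" shows "\<forall>\<^sub>F q in nhds p. analytic2_at F q"
proof -
  have "an {..<2::nat} (\<lambda>h. F (fst p + h 0, snd p + h 1))" using assms by (simp add: analytic2_at_iff)
  from an_translate[OF this] obtain d where d: "d > 0"
    "\<And>z :: nat \<Rightarrow> real. \<forall>i\<in>{..<2}. \<bar>z i\<bar> < d \<Longrightarrow> an {..<2::nat} (\<lambda>w. F (fst p + (z 0 + w 0), snd p + (z 1 + w 1)))"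
    by auto
  show ?thesis unfolding eventually_nhds_box
  proof (intro exI[of _ d] conjI allI impI d(1))
    fix h k :: real assume "\<bar>h\<bar> < d" "\<bar>k\<bar> < d"
    then show "analytic2_at F (fst p + h, snd p + k)"
      using d(2)[of "\<lambda>i. if i = 0 then h else k"] by (simp add: analytic2_at_iff add.assoc)
  qed
qed

lemma analytic2_cong:
  assumes "analytic2_at F p" "\<forall>\<^sub>F q in nhds p. F q = G q"
  shows "analytic2_at G p"
  using assms expansion_cong[of _ _ F p _ G] unfolding analytic2_expansion eventually_nhds_box by blast

lemma partial_cong:
  assumes "\<forall>\<^sub>F q in nhds p. F q = G q" "analytic2_at F p"
  shows "partial j k F p = partial j k G p"
proof -
  obtain c r where E: "expansion c r F p" using assms(2) unfolding analytic2_expansion by blast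
  obtain s where "expansion c s G p"
    using expansion_cong[OF E] assms(1) unfolding eventually_nhds_box by blast
  then show ?thesis using E by (simp add: partial_eq_coeff)
qed

text \<open>With \<open>m = \<bar>h\<bar> + \<bar>k\<bar> \<le> s\<close>, each monomial of degree
  at least \<open>N\<close> is at most \<open>(m / s)^N\<close> times its value at
  \<open>(s, s)\<close>, and those values are absolutely summable.\<close>

lemma expansion_remainder:
  assumes E: "expansion c r F p"
  obtains C s where "s > 0" "\<And>h k. \<bar>h\<bar> < s \<Longrightarrow> \<bar>k\<bar> < s \<Longrightarrow>
    \<bar>F (fst p + h, snd p + k) - (\<Sum>(i, j) | i + j < N. c i j * h ^ i * k ^ j)\<bar> \<le> C * (\<bar>h\<bar> + \<bar>k\<bar>) ^ N"
proof -
  define s where "s = r / 2"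
  have s: "s > 0" "s < r" using E by (auto simp: s_def expansion_def)
  have fin: "finite {(i::nat, j). i + j < N}"
    by (rule finite_subset[of _ "{..<N} \<times> {..<N}"]) auto
  have S: "(\<lambda>(i, j). \<bar>c i j\<bar> * s ^ i * s ^ j) summable_on UNIV"
    using expansion_summable[OF E] s by auto
  define K where "K = infsum (\<lambda>(i, j). \<bar>c i j\<bar> * s ^ i * s ^ j) (UNIV - {(i, j). i + j < N})"
  have S': "(\<lambda>(i, j). \<bar>c i j\<bar> * s ^ i * s ^ j) summable_on (UNIV - {(i, j). i + j < N})"
    by (rule summable_on_subset_banach[OF S]) auto
  show ?thesis
  proof (rule that[of "s / 2" "K / s ^ N"])
    show "s / 2 > 0" using s by simp
    fix h k assume hk: "\<bar>h\<bar> < s / 2" "\<bar>k\<bar> < s / 2"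
    define m where "m = \<bar>h\<bar> + \<bar>k\<bar>"
    have m: "0 \<le> m" "m \<le> s" using hk by (auto simp: m_def)
    have "((\<lambda>(i, j). c i j * h ^ i * k ^ j) has_sum F (fst p + h, snd p + k)) UNIV"
      using E hk s by (auto simp: expansion_def)
    from has_sum_Diff[OF this has_sum_finite[OF fin], of ]
    have R: "((\<lambda>(i, j). c i j * h ^ i * k ^ j) has_sum F (fst p + h, snd p + k) - (\<Sum>(i, j) | i + j < N. c i j * h ^ i * k ^ j))
       (UNIV - {(i, j). i + j < N})" by simp
    have S2: "((\<lambda>z. (m / s) ^ N * (case z of (i, j) \<Rightarrow> \<bar>c i j\<bar> * s ^ i * s ^ j)) has_sum (m / s) ^ N * K) (UNIV - {(i, j). i + j < N})"
      unfolding K_def by (intro has_sum_cmult_right has_sum_infsum S')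
    have "norm (F (fst p + h, snd p + k) - (\<Sum>(i, j) | i + j < N. c i j * h ^ i * k ^ j)) \<le> (m / s) ^ N * K"
    proof (rule norm_infsum_le[OF R S2])
      fix z assume "z \<in> UNIV - {(i::nat, j). i + j < N}"
      then obtain i j where z: "z = (i, j)" and ij: "N \<le> i + j" by (cases z) auto
      have "\<bar>h\<bar> ^ i * \<bar>k\<bar> ^ j \<le> m ^ i * m ^ j"
        by (intro mult_mono power_mono) (auto simp: m_def)
      also have "\<dots> = m ^ (i + j)" by (simp add: power_add)
      also have "\<dots> = (m / s) ^ (i + j) * (s ^ i * s ^ j)" using s by (simp add: power_divide power_add)
      also have "\<dots> \<le> (m / s) ^ N * (s ^ i * s ^ j)"
        using m s ij by (intro mult_right_mono power_decreasing) auto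
      finally have "\<bar>c i j\<bar> * (\<bar>h\<bar> ^ i * \<bar>k\<bar> ^ j) \<le> \<bar>c i j\<bar> * ((m / s) ^ N * (s ^ i * s ^ j))"
        by (rule mult_left_mono) simp
      then show "norm (case z of (i, j) \<Rightarrow> c i j * h ^ i * k ^ j) \<le> (m / s) ^ N * (case z of (i, j) \<Rightarrow> \<bar>c i j\<bar> * s ^ i * s ^ j)"
        by (simp add: z abs_mult power_abs mult_ac)
    qed
    then show "\<bar>F (fst p + h, snd p + k) - (\<Sum>(i, j) | i + j < N. c i j * h ^ i * k ^ j)\<bar> \<le> K / s ^ N * (\<bar>h\<bar> + \<bar>k\<bar>) ^ N"
      by (simp add: m_def power_divide mult_ac)
  qed
qed

section \<open>Taylor expansion along a line\<close>

notation fps_nth (infixl "$$" 90)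

text \<open>Taylor expansion modulo \<open>O(e^N)\<close>. The arithmetic takes place in formal
  power series, of which only the coefficients below \<open>N\<close> are constrained.\<close>

definition expands :: "nat \<Rightarrow> (real \<Rightarrow> real) \<Rightarrow> real fps \<Rightarrow> bool" where
  "expands N f A \<longleftrightarrow> (\<lambda>e. f e - (\<Sum>i<N. A $$ i * e ^ i)) \<in> O[at 0](\<lambda>e. e ^ N)"

lemma bigo_power_mono: "m \<ge> N \<Longrightarrow> (\<lambda>e::real. a * e ^ m) \<in> O[at 0](\<lambda>e. e ^ N)"
proof -
  assume m: "m \<ge> N"
  have "\<forall>\<^sub>F e::real in at 0. \<bar>e\<bar> < 1"
    unfolding eventually_at by (intro exI[of _ 1]) (auto simp: dist_real_def)
  then have "\<forall>\<^sub>F e::real in at 0. norm (a * e ^ m) \<le> \<bar>a\<bar> * norm (e ^ N)"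
    by eventually_elim (use m in \<open>auto simp: abs_mult power_abs intro!: mult_left_mono power_decreasing\<close>)
  then show ?thesis by (rule bigoI)
qed

lemma expands_poly_bound: "(\<lambda>e. \<Sum>i<N. A $$ i * e ^ i) \<in> O[at 0](\<lambda>_. 1 :: real)" for A :: "real fps"
  by (intro big_sum_in_bigo) (use bigo_power_mono[of 0] in auto)

lemma expands_bounded: "expands N f A \<Longrightarrow> f \<in> O[at 0](\<lambda>_. 1)"
proof -
  assume "expands N f A"
  then have "(\<lambda>e. f e - (\<Sum>i<N. A $$ i * e ^ i)) \<in> O[at 0](\<lambda>_. 1)"
    unfolding expands_def using bigo_power_mono[of 0 N 1] by (simp add: landau_o.big_trans)
  from sum_in_bigo(1)[OF this expands_poly_bound[of A N]] show ?thesis by simp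
qed

lemma expands_add: "expands N f A \<Longrightarrow> expands N g B \<Longrightarrow> expands N (\<lambda>e. f e + g e) (A + B)"
  unfolding expands_def using sum_in_bigo(1)[of _ "at 0" "\<lambda>e. e ^ N"]
  by (fastforce simp: algebra_simps sum.distrib)

lemma expands_mult:
  assumes f: "expands N f A" and g: "expands N g B"
  shows "expands N (\<lambda>e. f e * g e) (A * B)"
proof -
  let ?P = "\<lambda>A e. \<Sum>i<N. (A::real fps) $$ i * e ^ i"
  have 1: "(\<lambda>e. (f e - ?P A e) * g e) \<in> O[at 0](\<lambda>e. e ^ N * 1)"
    by (rule landau_o.big.mult[OF f[unfolded expands_def] expands_bounded[OF g]])
  have 2: "(\<lambda>e. ?P A e * (g e - ?P B e)) \<in> O[at 0](\<lambda>e. 1 * e ^ N)"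
    by (rule landau_o.big.mult[OF expands_poly_bound g[unfolded expands_def]])
  \<comment> \<open>The product of the truncations and the truncation of the product differ only by
    monomials of degree at least \<open>N\<close>.\<close>
  have eq: "?P A e * ?P B e - ?P (A * B) e = (\<Sum>(i, j) \<in> {..<N} \<times> {..<N} - {(i, j). i + j < N}. A $$ i * B $$ j * e ^ (i + j))" for e
  proof -
    have "?P A e * ?P B e = (\<Sum>(i, j) \<in> {..<N} \<times> {..<N}. A $$ i * B $$ j * e ^ (i + j))"
      by (simp add: sum_product sum.cartesian_product power_add mult_ac)
    moreover have "?P (A * B) e = (\<Sum>(i, j) | i + j < N. A $$ i * B $$ j * e ^ (i + j))"
    proof -
      have "(\<Sum>(i, j) | i + j < N. A $$ i * B $$ j * e ^ (i + j)) = (\<Sum>k<N. \<Sum>i\<le>k. A $$ i * B $$ (k - i) * e ^ (i + (k - i)))"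
        by (rule sum.triangle_reindex)
      also have "\<dots> = (\<Sum>k<N. \<Sum>i\<le>k. A $$ i * B $$ (k - i) * e ^ k)" by (intro sum.cong) auto
      finally show ?thesis by (simp add: fps_mult_nth sum_distrib_right atLeast0AtMost)
    qed
    moreover have "{(i, j). i + j < N} \<subseteq> {..<N} \<times> {..<N}" by auto
    ultimately show ?thesis by (simp add: sum_diff)
  qed
  have 3: "(\<lambda>e. ?P A e * ?P B e - ?P (A * B) e) \<in> O[at 0](\<lambda>e. e ^ N)"
    unfolding eq by (rule big_sum_in_bigo) (auto intro!: bigo_power_mono)
  have "(\<lambda>e. (f e - ?P A e) * g e + ?P A e * (g e - ?P B e) + (?P A e * ?P B e - ?P (A * B) e)) \<in> O[at 0](\<lambda>e. e ^ N)"
    using sum_in_bigo(1)[OF sum_in_bigo(1)[OF 1[simplified] 2[simplified]] 3] .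
  then show ?thesis unfolding expands_def by (simp add: algebra_simps)
qed

lemma expands_const: "expands N (\<lambda>_. a) (fps_const a)"
proof (cases N)
  case (Suc n)
  have "(\<Sum>i<N. fps_const a $$ i * e ^ i) = a" for e
    unfolding Suc sum.lessThan_Suc_shift by simp
  then show ?thesis by (simp add: expands_def)
qed (simp add: expands_def)

lemma expands_id: "expands N (\<lambda>e. e) fps_X"
proof -
  consider "N = 0" | "N = 1" | n where "N = Suc (Suc n)" by (metis One_nat_def old.nat.exhaust)
  then show ?thesis
  proof cases
    case 3
    have "(\<Sum>i<N. fps_X $$ i * e ^ i) = e" for e :: real
      unfolding 3 sum.lessThan_Suc_shift by (simp add: fps_X_def)
    then show ?thesis by (simp add: expands_def)
  qed (use bigo_power_mono[of 0 1 1] in \<open>auto simp: expands_def\<close>)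
qed

lemma expands_cmult: "expands N f A \<Longrightarrow> expands N (\<lambda>e. a * f e) (fps_const a * A)"
  by (rule expands_mult[OF expands_const])

lemma expands_power: "expands N f A \<Longrightarrow> expands N (\<lambda>e. f e ^ n) (A ^ n)"
  by (induction n) (use expands_const[of N 1] expands_mult in auto)

lemma expands_sum:
  "finite S \<Longrightarrow> (\<And>s. s \<in> S \<Longrightarrow> expands N (f s) (A s)) \<Longrightarrow> expands N (\<lambda>e. \<Sum>s\<in>S. f s e) (\<Sum>s\<in>S. A s)"
  by (induction S rule: finite_induct) (use expands_const[of N 0] expands_add in auto)

lemma bigo_imp_tendsto_0_aux:
  fixes f g :: "real \<Rightarrow> real"
  assumes "f \<in> O[at 0](g)" "(g \<longlongrightarrow> 0) (at 0)" shows "(f \<longlongrightarrow> 0) (at 0)"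
proof -
  obtain C where "\<forall>\<^sub>F e in at 0. norm (f e) \<le> C * norm (g e)" using assms(1) by (auto elim: landau_o.bigE)
  moreover have "((\<lambda>e. C * norm (g e)) \<longlongrightarrow> C * norm (0::real)) (at 0)" by (intro tendsto_intros assms)
  ultimately show ?thesis by (intro Lim_null_comparison[of f "\<lambda>e. C * norm (g e)"]) auto
qed

text \<open>If all coefficients below \<open>n\<close> agree, the difference of the truncations is
  \<open>e^n\<close> times a polynomial whose value at 0 is the next difference of coefficients. The
  factor \<open>e^n\<close> cancels against \<open>O(e^N)\<close>, and the limit at 0 gives
  zero.\<close>

lemma expands_unique:
  assumes A: "expands N f A" and B: "expands N g B" and fg: "\<forall>\<^sub>F e in at 0. f e = g e" and n: "n < N"
  shows "A $$ n = B $$ n"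
proof -
  have "(\<lambda>e. f e - (\<Sum>i<N. B $$ i * e ^ i)) \<in> O[at 0](\<lambda>e. e ^ N)"
    using B unfolding expands_def
    by (rule landau_o.big.in_cong[THEN iffD1, rotated]) (use fg in eventually_elim, simp)
  from sum_in_bigo(2)[OF this A[unfolded expands_def]]
  have d: "(\<lambda>e. \<Sum>i<N. (A $$ i - B $$ i) * e ^ i) \<in> O[at 0](\<lambda>e. e ^ N)"
    by (simp add: sum_subtractf left_diff_distrib)
  have "\<forall>m<N. n \<le> m \<longrightarrow> A $$ n - B $$ n = 0" for n
  proof (induction n rule: less_induct)
    case (less n)
    show ?case
    proof (cases "n < N")
      case True
      have z: "A $$ i - B $$ i = 0" if "i < n" for i using less[of i] that True by auto
      have "(\<Sum>i<N. (A $$ i - B $$ i) * e ^ i) = e ^ n * (\<Sum>i<N-n. (A $$ (i + n) - B $$ (i + n)) * e ^ i)" for e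
      proof -
        have "(\<Sum>i<N. (A $$ i - B $$ i) * e ^ i) = (\<Sum>i=n..<N. (A $$ i - B $$ i) * e ^ i)"
          by (rule sum.mono_neutral_right) (use z True in auto)
        also have "\<dots> = (\<Sum>i=0..<N-n. (A $$ (i + n) - B $$ (i + n)) * e ^ (i + n))"
          using sum.shift_bounds_nat_ivl[of "\<lambda>i. (A $$ i - B $$ i) * e ^ i" 0 n "N - n"] True by simp
        finally show ?thesis by (simp add: power_add sum_distrib_left atLeast0LessThan mult_ac)
      qed
      with d have "(\<lambda>e. e ^ n * (\<Sum>i<N-n. (A $$ (i + n) - B $$ (i + n)) * e ^ i)) \<in> O[at 0](\<lambda>e. e ^ N)" by simp
      also have "(\<lambda>e::real. e ^ N) = (\<lambda>e. e ^ n * e ^ (N - n))" using True by (simp flip: power_add)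
      finally have "(\<lambda>e. (\<Sum>i<N-n. (A $$ (i + n) - B $$ (i + n)) * e ^ i)) \<in> O[at 0](\<lambda>e. e ^ (N - n))"
        by (subst (asm) landau_o.big.mult_cancel_left) (simp_all add: frequently_def eventually_at_filter)
      moreover have "((\<lambda>e::real. e ^ (N - n)) \<longlongrightarrow> 0 ^ (N - n)) (at 0)" by (intro tendsto_intros)
      then have "((\<lambda>e::real. e ^ (N - n)) \<longlongrightarrow> 0) (at 0)" using True by (simp add: power_0_left)
      ultimately have "((\<lambda>e. (\<Sum>i<N-n. (A $$ (i + n) - B $$ (i + n)) * e ^ i)) \<longlongrightarrow> 0) (at 0)"
        by (rule bigo_imp_tendsto_0_aux)
      moreover have "((\<lambda>e. (\<Sum>i<N-n. (A $$ (i + n) - B $$ (i + n)) * e ^ i)) \<longlongrightarrow> (\<Sum>i<N-n. (A $$ (i + n) - B $$ (i + n)) * 0 ^ i)) (at 0)"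
        by (intro tendsto_intros)
      moreover have "(\<Sum>i<N-n. (A $$ (i + n) - B $$ (i + n)) * 0 ^ i) = A $$ n - B $$ n"
      proof -
        obtain k where k: "N - n = Suc k" using True by (metis Suc_diff_Suc)
        show ?thesis unfolding k sum.lessThan_Suc_shift by simp
      qed
      ultimately show ?thesis using tendsto_unique[OF trivial_limit_at] by fastforce
    qed auto
  qed
  then show ?thesis using n by auto
qed

lemma expands_bigo_id:
  assumes A: "expands N f A" "A $$ 0 = 0" "N \<ge> 1"
  shows "f \<in> O[at 0](\<lambda>e. e)"
proof -
  have "(\<lambda>e::real. e ^ N) \<in> O[at 0](\<lambda>e. e)" using bigo_power_mono[of 1 N 1] assms(3) by simp
  with A(1) have 1: "(\<lambda>e. f e - (\<Sum>i<N. A $$ i * e ^ i)) \<in> O[at 0](\<lambda>e. e)"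
    unfolding expands_def by (rule landau_o.big_trans)
  have 2: "(\<lambda>e. \<Sum>i<N. A $$ i * e ^ i) \<in> O[at 0](\<lambda>e. e)"
  proof (rule big_sum_in_bigo)
    fix i show "(\<lambda>e. A $$ i * e ^ i) \<in> O[at 0](\<lambda>e. e)"
      using bigo_power_mono[of 1 i "A $$ i"] A(2) by (cases "i = 0") auto
  qed
  from sum_in_bigo(1)[OF 1 2] show ?thesis by simp
qed

text \<open>Both inner functions are \<open>O(e)\<close>, so the terms of \<open>F\<close> of degree
  at least \<open>N\<close> contribute only \<open>O(e^N)\<close>, and the finite sum of the others
  is formal arithmetic.\<close>

lemma expands_compose:
  assumes E: "expansion c r F p" and A: "expands N \<xi> A" "A $$ 0 = 0" and B: "expands N \<eta> B" "B $$ 0 = 0" and N: "N \<ge> 1"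
  shows "expands N (\<lambda>e. F (fst p + \<xi> e, snd p + \<eta> e)) (\<Sum>(i, j) | i + j < N. fps_const (c i j) * (A ^ i * B ^ j))"
proof -
  have fin: "finite {(i::nat, j). i + j < N}"
    by (rule finite_subset[of _ "{..<N} \<times> {..<N}"]) auto
  let ?S = "\<Sum>(i, j) | i + j < N. fps_const (c i j) * (A ^ i * B ^ j)"
  let ?P = "\<lambda>e. \<Sum>(i, j) | i + j < N. c i j * \<xi> e ^ i * \<eta> e ^ j"
  have "expands N (\<lambda>e. \<Sum>z | fst z + snd z < N. c (fst z) (snd z) * (\<xi> e ^ fst z * \<eta> e ^ snd z))
      (\<Sum>z | fst z + snd z < N. fps_const (c (fst z) (snd z)) * (A ^ fst z * B ^ snd z))"
    by (rule expands_sum) (use fin in \<open>auto simp: case_prod_unfold intro!: expands_cmult expands_mult expands_power A B\<close>)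
  then have 1: "(\<lambda>e. ?P e - (\<Sum>i<N. ?S $$ i * e ^ i)) \<in> O[at 0](\<lambda>e. e ^ N)"
    by (simp add: expands_def case_prod_unfold mult.assoc)
  obtain C s where s: "s > 0" and C: "\<And>h k. \<bar>h\<bar> < s \<Longrightarrow> \<bar>k\<bar> < s \<Longrightarrow>
    \<bar>F (fst p + h, snd p + k) - (\<Sum>(i, j) | i + j < N. c i j * h ^ i * k ^ j)\<bar> \<le> C * (\<bar>h\<bar> + \<bar>k\<bar>) ^ N"
    by (rule expansion_remainder[OF E, of N]) blast
  have b: "\<xi> \<in> O[at 0](\<lambda>e. e)" "\<eta> \<in> O[at 0](\<lambda>e. e)" using expands_bigo_id A B N by auto
  then have t: "(\<xi> \<longlongrightarrow> 0) (at 0)" "(\<eta> \<longlongrightarrow> 0) (at 0)"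
    using bigo_imp_tendsto_0_aux[OF _ tendsto_ident_at] by auto
  have ev: "\<forall>\<^sub>F e in at 0. \<bar>\<xi> e\<bar> < s" "\<forall>\<^sub>F e in at 0. \<bar>\<eta> e\<bar> < s"
    using t[THEN tendstoD, OF s] by (auto simp: dist_real_def)
  have "(\<lambda>e. F (fst p + \<xi> e, snd p + \<eta> e) - ?P e) \<in> O[at 0](\<lambda>e. (\<bar>\<xi> e\<bar> + \<bar>\<eta> e\<bar>) ^ N)"
  proof (rule bigoI)
    show "\<forall>\<^sub>F e in at 0. norm (F (fst p + \<xi> e, snd p + \<eta> e) - ?P e) \<le> C * norm ((\<bar>\<xi> e\<bar> + \<bar>\<eta> e\<bar>) ^ N)"
      using ev by eventually_elim (use C in auto)
  qed
  moreover have "(\<lambda>e. (\<bar>\<xi> e\<bar> + \<bar>\<eta> e\<bar>) ^ N) \<in> O[at 0](\<lambda>e. e ^ N)"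
    by (intro landau_o.big_power sum_in_bigo) (use b in auto)
  ultimately have 2: "(\<lambda>e. F (fst p + \<xi> e, snd p + \<eta> e) - ?P e) \<in> O[at 0](\<lambda>e. e ^ N)"
    by (rule landau_o.big_trans)
  show ?thesis unfolding expands_def using sum_in_bigo(1)[OF 1 2] by simp
qed

section \<open>Coefficients of products and substitutions up to order five\<close>

lemma fps_mult_nths:
  fixes f g :: "real fps"
  shows "(f * g) $$ 0 = f $$ 0 * g $$ 0" "(f * g) $$ 1 = f $$ 0 * g $$ 1 + f $$ 1 * g $$ 0"
    "(f * g) $$ 2 = f $$ 0 * g $$ 2 + f $$ 1 * g $$ 1 + f $$ 2 * g $$ 0"
    "(f * g) $$ 3 = f $$ 0 * g $$ 3 + f $$ 1 * g $$ 2 + f $$ 2 * g $$ 1 + f $$ 3 * g $$ 0"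
    "(f * g) $$ 4 = f $$ 0 * g $$ 4 + f $$ 1 * g $$ 3 + f $$ 2 * g $$ 2 + f $$ 3 * g $$ 1 + f $$ 4 * g $$ 0"
    "(f * g) $$ 5 = f $$ 0 * g $$ 5 + f $$ 1 * g $$ 4 + f $$ 2 * g $$ 3 + f $$ 3 * g $$ 2 + f $$ 4 * g $$ 1 + f $$ 5 * g $$ 0"
  by (simp_all add: fps_mult_nth eval_nat_numeral)

text \<open>The list stops at order 5, the order of \<open>M_inv\<close>. Coefficient comparisons up
  to this order are read off from these formulas.\<close>

lemma fps_compose_nths:
  fixes x y :: "real fps" and c :: "nat \<Rightarrow> nat \<Rightarrow> real"
  assumes z: "x $$ 0 = 0" "y $$ 0 = 0"
  defines "S \<equiv> \<Sum>(i, j) | i + j < 6. fps_const (c i j) * (x ^ i * y ^ j)"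
  shows
  "S $$ 0 = c 0 0 * (1)"
  "S $$ 1 = c 0 1 * ((y $$ 1)) + c 1 0 * ((x $$ 1))"
  "S $$ 2 = c 0 1 * ((y $$ 2)) + c 1 0 * ((x $$ 2)) + c 0 2 * ((y $$ 1)^2) + c 1 1 * ((x $$ 1) * (y $$ 1)) + c 2 0 * ((x $$ 1)^2)"
  "S $$ 3 = c 0 1 * ((y $$ 3)) + c 1 0 * ((x $$ 3)) + c 0 2 * (2 * (y $$ 1) * (y $$ 2)) + c 1 1 * ((x $$ 1) * (y $$ 2) + (x $$ 2) * (y $$ 1)) + c 2 0 * (2 * (x $$ 1) * (x $$ 2)) + c 0 3 * ((y $$ 1)^3) + c 1 2 * ((x $$ 1) * (y $$ 1)^2) + c 2 1 * ((x $$ 1)^2 * (y $$ 1)) + c 3 0 * ((x $$ 1)^3)"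
  "S $$ 4 = c 0 1 * ((y $$ 4)) + c 1 0 * ((x $$ 4)) + c 0 2 * (2 * (y $$ 1) * (y $$ 3) + (y $$ 2)^2) + c 1 1 * ((x $$ 1) * (y $$ 3) + (x $$ 2) * (y $$ 2) + (x $$ 3) * (y $$ 1)) + c 2 0 * (2 * (x $$ 1) * (x $$ 3) + (x $$ 2)^2) + c 0 3 * (3 * (y $$ 1)^2 * (y $$ 2)) + c 1 2 * (2 * (x $$ 1) * (y $$ 1) * (y $$ 2) + (x $$ 2) * (y $$ 1)^2) + c 2 1 * (2 * (x $$ 1) * (x $$ 2) * (y $$ 1) + (x $$ 1)^2 * (y $$ 2)) + c 3 0 * (3 * (x $$ 1)^2 * (x $$ 2)) + c 0 4 * ((y $$ 1)^4) + c 1 3 * ((x $$ 1) * (y $$ 1)^3) + c 2 2 * ((x $$ 1)^2 * (y $$ 1)^2) + c 3 1 * ((x $$ 1)^3 * (y $$ 1)) + c 4 0 * ((x $$ 1)^4)"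
  "S $$ 5 = c 0 1 * ((y $$ 5)) + c 1 0 * ((x $$ 5)) + c 0 2 * (2 * (y $$ 1) * (y $$ 4) + 2 * (y $$ 2) * (y $$ 3)) + c 1 1 * ((x $$ 1) * (y $$ 4) + (x $$ 2) * (y $$ 3) + (x $$ 3) * (y $$ 2) + (x $$ 4) * (y $$ 1)) + c 2 0 * (2 * (x $$ 1) * (x $$ 4) + 2 * (x $$ 2) * (x $$ 3)) + c 0 3 * (3 * (y $$ 1) * (y $$ 2)^2 + 3 * (y $$ 1)^2 * (y $$ 3)) + c 1 2 * (2 * (x $$ 1) * (y $$ 1) * (y $$ 3) + (x $$ 1) * (y $$ 2)^2 + 2 * (x $$ 2) * (y $$ 1) * (y $$ 2) + (x $$ 3) * (y $$ 1)^2) + c 2 1 * (2 * (x $$ 1) * (x $$ 2) * (y $$ 2) + 2 * (x $$ 1) * (x $$ 3) * (y $$ 1) + (x $$ 1)^2 * (y $$ 3) + (x $$ 2)^2 * (y $$ 1)) + c 3 0 * (3 * (x $$ 1) * (x $$ 2)^2 + 3 * (x $$ 1)^2 * (x $$ 3)) + c 0 4 * (4 * (y $$ 1)^3 * (y $$ 2)) + c 1 3 * (3 * (x $$ 1) * (y $$ 1)^2 * (y $$ 2) + (x $$ 2) * (y $$ 1)^3) + c 2 2 * (2 * (x $$ 1) * (x $$ 2) * (y $$ 1)^2 + 2 * (x $$ 1)^2 * (y $$ 1) * (y $$ 2)) + c 3 1 * (3 * (x $$ 1)^2 * (x $$ 2) * (y $$ 1) + (x $$ 1)^3 * (y $$ 2))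 + c 4 0 * (4 * (x $$ 1)^3 * (x $$ 2)) + c 0 5 * ((y $$ 1)^5) + c 1 4 * ((x $$ 1) * (y $$ 1)^4) + c 2 3 * ((x $$ 1)^2 * (y $$ 1)^3) + c 3 2 * ((x $$ 1)^3 * (y $$ 1)^2) + c 4 1 * ((x $$ 1)^4 * (y $$ 1)) + c 5 0 * ((x $$ 1)^5)"
proof -
  have S: "S = (\<Sum>k<6. \<Sum>i\<le>k. fps_const (c i (k - i)) * (x ^ i * y ^ (k - i)))"
    unfolding S_def by (rule sum.triangle_reindex)
  have e6: "{..<6} = {0,1,2,3,4,5::nat}" and a: "{..1} = {0,1::nat}" "{..2} = {0,1,2::nat}" "{..3} = {0,1,2,3::nat}"
    "{..4} = {0,1,2,3,4::nat}" "{..5} = {0,1,2,3,4,5::nat}" by auto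
  have p5: "z ^ 5 = z * z * z * z * z" for z :: "real fps" by (simp add: eval_nat_numeral mult_ac)
  have p5r: "z ^ 5 = z * z * z * z * z" for z :: real by (simp add: eval_nat_numeral mult_ac)
  note S = S[unfolded e6, simplified, unfolded a, simplified]
  note pw = power2_eq_square power3_eq_cube power4_eq_xxxx p5 p5r
  show "S $$ 0 = c 0 0 * (1)"
    unfolding S by (simp add: pw fps_mult_nths z algebra_simps)
  show "S $$ 1 = c 0 1 * ((y $$ 1)) + c 1 0 * ((x $$ 1))"
    unfolding S by (simp add: pw fps_mult_nths z algebra_simps)
  show "S $$ 2 = c 0 1 * ((y $$ 2)) + c 1 0 * ((x $$ 2)) + c 0 2 * ((y $$ 1)^2) + c 1 1 * ((x $$ 1) * (y $$ 1)) + c 2 0 * ((x $$ 1)^2)"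
    unfolding S by (simp add: pw fps_mult_nths z algebra_simps)
  show "S $$ 3 = c 0 1 * ((y $$ 3)) + c 1 0 * ((x $$ 3)) + c 0 2 * (2 * (y $$ 1) * (y $$ 2)) + c 1 1 * ((x $$ 1) * (y $$ 2) + (x $$ 2) * (y $$ 1)) + c 2 0 * (2 * (x $$ 1) * (x $$ 2)) + c 0 3 * ((y $$ 1)^3) + c 1 2 * ((x $$ 1) * (y $$ 1)^2) + c 2 1 * ((x $$ 1)^2 * (y $$ 1)) + c 3 0 * ((x $$ 1)^3)"
    unfolding S by (simp add: pw fps_mult_nths z algebra_simps)
  show "S $$ 4 = c 0 1 * ((y $$ 4)) + c 1 0 * ((x $$ 4)) + c 0 2 * (2 * (y $$ 1) * (y $$ 3) + (y $$ 2)^2) + c 1 1 * ((x $$ 1) * (y $$ 3) + (x $$ 2) * (y $$ 2) + (x $$ 3) * (y $$ 1)) + c 2 0 * (2 * (x $$ 1) * (x $$ 3) + (x $$ 2)^2) + c 0 3 * (3 * (y $$ 1)^2 * (y $$ 2)) + c 1 2 * (2 * (x $$ 1) * (y $$ 1) * (y $$ 2) + (x $$ 2) * (y $$ 1)^2) + c 2 1 * (2 * (x $$ 1) * (x $$ 2) * (y $$ 1) + (x $$ 1)^2 * (y $$ 2)) + c 3 0 * (3 * (x $$ 1)^2 * (x $$ 2)) + c 0 4 * ((y $$ 1)^4) + c 1 3 * ((x $$ 1) * (y $$ 1)^3) + c 2 2 * ((x $$ 1)^2 * (y $$ 1)^2) + c 3 1 * ((x $$ 1)^3 * (y $$ 1))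 + c 4 0 * ((x $$ 1)^4)"
    unfolding S by (simp add: pw fps_mult_nths z algebra_simps)
  show "S $$ 5 = c 0 1 * ((y $$ 5)) + c 1 0 * ((x $$ 5)) + c 0 2 * (2 * (y $$ 1) * (y $$ 4) + 2 * (y $$ 2) * (y $$ 3)) + c 1 1 * ((x $$ 1) * (y $$ 4) + (x $$ 2) * (y $$ 3) + (x $$ 3) * (y $$ 2) + (x $$ 4) * (y $$ 1)) + c 2 0 * (2 * (x $$ 1) * (x $$ 4) + 2 * (x $$ 2) * (x $$ 3)) + c 0 3 * (3 * (y $$ 1) * (y $$ 2)^2 + 3 * (y $$ 1)^2 * (y $$ 3)) + c 1 2 * (2 * (x $$ 1) * (y $$ 1) * (y $$ 3) + (x $$ 1) * (y $$ 2)^2 + 2 * (x $$ 2) * (y $$ 1) * (y $$ 2) + (x $$ 3) * (y $$ 1)^2) + c 2 1 * (2 * (x $$ 1) * (x $$ 2) * (y $$ 2) + 2 * (x $$ 1) * (x $$ 3) * (y $$ 1) + (x $$ 1)^2 * (y $$ 3) + (x $$ 2)^2 * (y $$ 1)) + c 3 0 * (3 * (x $$ 1) * (x $$ 2)^2 + 3 * (x $$ 1)^2 * (x $$ 3)) + c 0 4 * (4 * (y $$ 1)^3 * (y $$ 2)) + c 1 3 * (3 * (x $$ 1) * (y $$ 1)^2 * (y $$ 2) + (x $$ 2) * (y $$ 1)^3) + c 2 2 * (2 * (x $$ 1) * (x $$ 2) * (y $$ 1)^2 + 2 * (x $$ 1)^2 * (y $$ 1) * (y $$ 2)) + c 3 1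 * (3 * (x $$ 1)^2 * (x $$ 2) * (y $$ 1) + (x $$ 1)^3 * (y $$ 2)) + c 4 0 * (4 * (x $$ 1)^3 * (x $$ 2)) + c 0 5 * ((y $$ 1)^5) + c 1 4 * ((x $$ 1) * (y $$ 1)^4) + c 2 3 * ((x $$ 1)^2 * (y $$ 1)^3) + c 3 2 * ((x $$ 1)^3 * (y $$ 1)^2) + c 4 1 * ((x $$ 1)^4 * (y $$ 1)) + c 5 0 * ((x $$ 1)^5)"
    unfolding S by (simp add: pw fps_mult_nths z algebra_simps)
qed

section \<open>Linear images of graphs and adapted jets\<close>

text \<open>Only the inclusion of the image of the graph of \<open>F\<close> in the graph of
  \<open>G\<close> is recorded, and only near the origin. As an equation between germs it can be
  expanded in power series.\<close>

definition linear_image :: "real ^ 3 ^ 3 \<Rightarrow> (real \<times> real \<Rightarrow> real) \<Rightarrow> (real \<times> real \<Rightarrow> real) \<Rightarrow> bool" where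
  "linear_image A F G \<longleftrightarrow> (\<forall>\<^sub>F q in nhds (0, 0).
     A $ 3 $ 1 * fst q + A $ 3 $ 2 * snd q + A $ 3 $ 3 * F q =
     G (A $ 1 $ 1 * fst q + A $ 1 $ 2 * snd q + A $ 1 $ 3 * F q,
        A $ 2 $ 1 * fst q + A $ 2 $ 2 * snd q + A $ 2 $ 3 * F q))"

definition line_fps :: "(nat \<Rightarrow> nat \<Rightarrow> real) \<Rightarrow> real \<Rightarrow> real \<Rightarrow> real fps" where
  "line_fps c a b = (\<Sum>(i, j) | i + j < 6. fps_const (c i j) * ((fps_const a * fps_X) ^ i * (fps_const b * fps_X) ^ j))"

lemma fps_const_X_nths:
  "(fps_const a * fps_X :: real fps) $$ 0 = 0" "(fps_const a * fps_X :: real fps) $$ 1 = a"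
  "(fps_const a * fps_X :: real fps) $$ 2 = 0" "(fps_const a * fps_X :: real fps) $$ 3 = 0"
  "(fps_const a * fps_X :: real fps) $$ 4 = 0" "(fps_const a * fps_X :: real fps) $$ 5 = 0"
  by (simp_all add: fps_X_def)

lemma line_fps_nths:
  "line_fps c a b $$ 0 = c 0 0"
  "line_fps c a b $$ 1 = c 1 0 * a + c 0 1 * b"
  "line_fps c a b $$ 2 = c 2 0 * a^2 + c 1 1 * a * b + c 0 2 * b^2"
  "line_fps c a b $$ 3 = c 3 0 * a^3 + c 2 1 * a^2 * b + c 1 2 * a * b^2 + c 0 3 * b^3"
  "line_fps c a b $$ 4 = c 4 0 * a^4 + c 3 1 * a^3 * b + c 2 2 * a^2 * b^2 + c 1 3 * a * b^3 + c 0 4 * b^4"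
  "line_fps c a b $$ 5 = c 5 0 * a^5 + c 4 1 * a^4 * b + c 3 2 * a^3 * b^2 + c 2 3 * a^2 * b^3 + c 1 4 * a * b^4 + c 0 5 * b^5"
  unfolding line_fps_def
  unfolding fps_compose_nths[OF fps_const_X_nths(1) fps_const_X_nths(1)] fps_const_X_nths
  by simp_all

lemma expands_line_id: "expands N (\<lambda>e. e * a) (fps_const a * fps_X)"
  using expands_cmult[OF expands_id, of N a] by (simp add: mult.commute)

lemma expands_line:
  assumes "expansion c r F (0, 0)"
  shows "expands 6 (\<lambda>e. F (e * a, e * b)) (line_fps c a b)"
  unfolding line_fps_def
  using expands_compose[OF assms expands_line_id[of 6 a] _ expands_line_id[of 6 b]] by simp

lemma eventually_line:
  assumes "\<forall>\<^sub>F q in nhds (0, 0). P q"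
  shows "\<forall>\<^sub>F e in at 0. P (e * a, e * b :: real)"
proof -
  have "((\<lambda>e. (e * a, e * b)) \<longlongrightarrow> (0 * a, 0 * b)) (at 0)" by (intro tendsto_intros)
  then have "filterlim (\<lambda>e. (e * a, e * b)) (nhds (0, 0)) (at 0)" by simp
  then show ?thesis using assms by (auto simp: filterlim_iff)
qed

text \<open>Along the line with direction \<open>(a, b)\<close> the three coordinates of the image
  point have the expansions \<open>z 1\<close>, \<open>z 2\<close>, \<open>z 3\<close>, and the
  graph equation becomes one identity of formal series. Varying the direction separates the
  coefficients of equal degree.\<close>

lemma linear_image_line:
  fixes a b :: real
  assumes F: "expansion c r F (0, 0)" and c0: "c 0 0 = 0" and G: "expansion d s G (0, 0)"
    and rel: "linear_image A F G"
  defines "u \<equiv> line_fps c a b"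
  defines "z \<equiv> \<lambda>i. fps_const (A $ i $ 1 * a + A $ i $ 2 * b) * fps_X + fps_const (A $ i $ 3) * u"
  assumes n: "n < 6"
  shows "z 3 $$ n = (\<Sum>(i, j) | i + j < 6. fps_const (d i j) * (z 1 ^ i * z 2 ^ j)) $$ n"
proof -
  define \<zeta> where "\<zeta> i e = e * (A $ i $ 1 * a + A $ i $ 2 * b) + A $ i $ 3 * F (e * a, e * b)" for i :: 3 and e
  have z: "expands 6 (\<zeta> i) (z i)" for i
    unfolding \<zeta>_def z_def u_def by (intro expands_add expands_line_id expands_cmult expands_line[OF F])
  have z0: "z i $$ 0 = 0" for i by (simp add: z_def u_def line_fps_nths c0)
  have six: "1 \<le> (6::nat)" by simp
  note g0 = expands_compose[where \<xi> = "\<zeta> 1" and \<eta> = "\<zeta> 2", OF G z[of 1] z0[of 1] z[of 2] z0[of 2] six]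
  have g: "expands 6 (\<lambda>e. G (\<zeta> 1 e, \<zeta> 2 e)) (\<Sum>(i, j) | i + j < 6. fps_const (d i j) * (z 1 ^ i * z 2 ^ j))"
    using g0 by simp
  have "\<forall>\<^sub>F e in at 0. \<zeta> 3 e = G (\<zeta> 1 e, \<zeta> 2 e)"
    using eventually_line[OF rel[unfolded linear_image_def], of a b]
    by eventually_elim (simp add: \<zeta>_def algebra_simps)
  from expands_unique[OF z g this n] show ?thesis .
qed

lemma linear_image_nths:
  fixes a b :: real
  assumes F: "expansion c r F (0, 0)" and c0: "c 0 0 = 0" and G: "expansion d s G (0, 0)"
    and rel: "linear_image A F G"
  defines "u \<equiv> line_fps c a b"
  obtains x y z :: "real fps" where
    "x $$ 0 = 0" "x $$ 1 = A $ 1 $ 1 * a + A $ 1 $ 2 * b + A $ 1 $ 3 * u $$ 1"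
    "x $$ 2 = A $ 1 $ 3 * u $$ 2" "x $$ 3 = A $ 1 $ 3 * u $$ 3" "x $$ 4 = A $ 1 $ 3 * u $$ 4" "x $$ 5 = A $ 1 $ 3 * u $$ 5"
    "y $$ 0 = 0" "y $$ 1 = A $ 2 $ 1 * a + A $ 2 $ 2 * b + A $ 2 $ 3 * u $$ 1"
    "y $$ 2 = A $ 2 $ 3 * u $$ 2" "y $$ 3 = A $ 2 $ 3 * u $$ 3" "y $$ 4 = A $ 2 $ 3 * u $$ 4" "y $$ 5 = A $ 2 $ 3 * u $$ 5"
    "z $$ 0 = 0" "z $$ 1 = A $ 3 $ 1 * a + A $ 3 $ 2 * b + A $ 3 $ 3 * u $$ 1"
    "z $$ 2 = A $ 3 $ 3 * u $$ 2" "z $$ 3 = A $ 3 $ 3 * u $$ 3" "z $$ 4 = A $ 3 $ 3 * u $$ 4" "z $$ 5 = A $ 3 $ 3 * u $$ 5"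
    "\<And>n. n < 6 \<Longrightarrow> z $$ n = (\<Sum>(i, j) | i + j < 6. fps_const (d i j) * (x ^ i * y ^ j)) $$ n"
proof -
  define z where "z i = fps_const (A $ i $ 1 * a + A $ i $ 2 * b) * fps_X + fps_const (A $ i $ 3) * u" for i :: 3
  have u0: "u $$ 0 = 0" by (simp add: u_def line_fps_nths c0)
  have n: "z i $$ 0 = 0" "z i $$ 1 = A $ i $ 1 * a + A $ i $ 2 * b + A $ i $ 3 * u $$ 1"
    "z i $$ 2 = A $ i $ 3 * u $$ 2" "z i $$ 3 = A $ i $ 3 * u $$ 3" "z i $$ 4 = A $ i $ 3 * u $$ 4" "z i $$ 5 = A $ i $ 3 * u $$ 5" for i
    unfolding z_def fps_add_nth fps_const_X_nths by (simp_all add: u0)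
  show ?thesis
    by (rule that[of "z 1" "z 2" "z 3", OF n n n])
      (use linear_image_line[OF F c0 G rel, of _ a b] in \<open>simp add: z_def u_def\<close>)
qed

text \<open>Six values determine a polynomial of degree 5; the points 0, 1, -1, 2, -2, 3 give a
  linear system with small integer entries.\<close>

lemma poly_coeffs_eq:
  fixes a0 a1 a2 a3 a4 a5 :: real
  assumes "\<And>t. a0 + a1 * t + a2 * t^2 + a3 * t^3 + a4 * t^4 + a5 * t^5 = b0 + b1 * t + b2 * t^2 + b3 * t^3 + b4 * t^4 + b5 * t^5"
  shows "a0 = b0" "a1 = b1" "a2 = b2" "a3 = b3" "a4 = b4" "a5 = b5"
  using assms[of 0] assms[of 1] assms[of "-1"] assms[of 2] assms[of "-2"] assms[of 3] by simp_all

section \<open>Consequences of parabolicity, degree by degree\<close>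

lemma expansion_abs_coeffs:
  fixes a b :: real
  assumes F: "expansion c r F (0, 0)"
    and par: "\<forall>\<^sub>F q in nhds (0, 0). partial 2 0 F q * partial 0 2 F q - partial 1 1 F q ^ 2 = 0"
  defines "l \<equiv> \<lambda>j k. line_fps (\<lambda>i m. fact (i + j) / fact i * (fact (m + k) / fact m) * c (i + j) (m + k)) a b"
  assumes n: "n < 6"
  shows "(l 2 0 * l 0 2) $$ n = (l 1 1 * l 1 1) $$ n"
proof -
  have l: "expands 6 (\<lambda>e. partial j k F (e * a, e * b)) (l j k)" for j k
    unfolding l_def by (rule expands_line[OF expansion_partial[OF F]])
  have "\<forall>\<^sub>F e in at 0. partial 2 0 F (e * a, e * b) * partial 0 2 F (e * a, e * b) = partial 1 1 F (e * a, e * b) * partial 1 1 F (e * a, e * b)"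
    using eventually_line[OF par, of a b] by eventually_elim (simp add: power2_eq_square)
  from expands_unique[OF expands_mult[OF l l] expands_mult[OF l l] this n] show ?thesis .
qed

lemma hessian_line_nths:
  fixes a b :: real and c :: "nat \<Rightarrow> nat \<Rightarrow> real"
  defines "l \<equiv> \<lambda>j k. line_fps (\<lambda>i m. fact (i + j) / fact i * (fact (m + k) / fact m) * c (i + j) (m + k)) a b"
  shows "l 2 0 $$ 0 = 2 * c 2 0" "l 2 0 $$ 1 = 6 * c 3 0 * a + 2 * c 2 1 * b"
    "l 2 0 $$ 2 = 12 * c 4 0 * a^2 + 6 * c 3 1 * a * b + 2 * c 2 2 * b^2"
    "l 2 0 $$ 3 = 20 * c 5 0 * a^3 + 12 * c 4 1 * a^2 * b + 6 * c 3 2 * a * b^2 + 2 * c 2 3 * b^3"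
    "l 0 2 $$ 0 = 2 * c 0 2" "l 0 2 $$ 1 = 2 * c 1 2 * a + 6 * c 0 3 * b"
    "l 0 2 $$ 2 = 2 * c 2 2 * a^2 + 6 * c 1 3 * a * b + 12 * c 0 4 * b^2"
    "l 0 2 $$ 3 = 2 * c 3 2 * a^3 + 6 * c 2 3 * a^2 * b + 12 * c 1 4 * a * b^2 + 20 * c 0 5 * b^3"
    "l 1 1 $$ 0 = c 1 1" "l 1 1 $$ 1 = 2 * c 2 1 * a + 2 * c 1 2 * b"
    "l 1 1 $$ 2 = 3 * c 3 1 * a^2 + 4 * c 2 2 * a * b + 3 * c 1 3 * b^2"
    "l 1 1 $$ 3 = 4 * c 4 1 * a^3 + 6 * c 3 2 * a^2 * b + 6 * c 2 3 * a * b^2 + 4 * c 1 4 * b^3"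
  unfolding l_def line_fps_nths by (simp_all add: fact_numeral eval_nat_numeral)

text \<open>At the origin the second x-derivative is 1 and the mixed one is 0. Degree
  \<open>n\<close> of the equation therefore expresses the degree \<open>n\<close> part of the
  second y-derivative through Taylor coefficients of order below \<open>n + 2\<close>.\<close>

lemma parabolic_coeffs:
  assumes F: "expansion c r F (0, 0)"
    and par: "\<forall>\<^sub>F q in nhds (0, 0). partial 2 0 F q * partial 0 2 F q - partial 1 1 F q ^ 2 = 0"
    and c: "c 2 0 = 1/2" "c 1 1 = 0"
  shows "c 0 2 = 0" "c 1 2 = 0" "c 0 3 = 0" "c 2 2 = 2 * c 2 1 ^ 2" "c 1 3 = 0" "c 0 4 = 0"
    "c 3 2 = 6 * c 2 1 * c 3 1 - 12 * c 3 0 * c 2 1 ^ 2" "c 2 3 = 4 * c 2 1 ^ 3" "c 1 4 = 0" "c 0 5 = 0"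
proof -
  note I = expansion_abs_coeffs[OF F par, of _ 1, unfolded fps_mult_nths hessian_line_nths c]
  note I = expansion_abs_coeffs[OF F par, where a = 1 and n = 0, unfolded fps_mult_nths hessian_line_nths c]
    expansion_abs_coeffs[OF F par, where a = 1 and n = 1, unfolded fps_mult_nths hessian_line_nths c]
    expansion_abs_coeffs[OF F par, where a = 1 and n = 2, unfolded fps_mult_nths hessian_line_nths c]
    expansion_abs_coeffs[OF F par, where a = 1 and n = 3, unfolded fps_mult_nths hessian_line_nths c]
  show c02: "c 0 2 = 0" using I(1) by simp
  have "c 1 2 + 3 * c 0 3 * t = 0" for t
    using I(2)[of t] c02 by simp
  from this[of 0] this[of 1] show c3: "c 1 2 = 0" "c 0 3 = 0" by simp_all
  have "c 2 2 + 3 * c 1 3 * t + 6 * c 0 4 * t ^ 2 = 2 * c 2 1 ^ 2" for t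
    using I(3)[of t] c02 c3 by (simp add: power2_eq_square)
  then have *: "\<And>t. c 2 2 + 3 * c 1 3 * t + 6 * c 0 4 * t ^ 2 + 0 * t ^ 3 + 0 * t ^ 4 + 0 * t ^ 5 = 
     2 * c 2 1 ^ 2 + 0 * t + 0 * t ^ 2 + 0 * t ^ 3 + 0 * t ^ 4 + 0 * t ^ 5" by simp
  show c4: "c 2 2 = 2 * c 2 1 ^ 2" "c 1 3 = 0" "c 0 4 = 0" using poly_coeffs_eq[OF *] by simp_all
  have *: "2 * c 3 2 + 6 * c 2 3 * t + 12 * c 1 4 * t ^ 2 + 20 * c 0 5 * t ^ 3 + 0 * t ^ 4 + 0 * t ^ 5 = 
     (12 * c 2 1 * c 3 1 - 24 * c 3 0 * c 2 1 ^ 2) + 24 * c 2 1 ^ 3 * t + 0 * t ^ 2 + 0 * t ^ 3 + 0 * t ^ 4 + 0 * t ^ 5" for t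
    using I(4)[of t] unfolding c02 c3 c4 by (simp add: power2_eq_square power3_eq_cube algebra_simps)
  show "c 3 2 = 6 * c 2 1 * c 3 1 - 12 * c 3 0 * c 2 1 ^ 2" "c 2 3 = 4 * c 2 1 ^ 3" "c 1 4 = 0" "c 0 5 = 0"
    using poly_coeffs_eq[OF *] by simp_all
qed

lemma det_linear_image:
  fixes A :: "real ^ 3 ^ 3"
  shows "det A = A $ 1 $ 1 * A $ 2 $ 2 * A $ 3 $ 3 + A $ 1 $ 2 * A $ 2 $ 3 * A $ 3 $ 1 + A $ 1 $ 3 * A $ 2 $ 1 * A $ 3 $ 2
    - A $ 1 $ 1 * A $ 2 $ 3 * A $ 3 $ 2 - A $ 1 $ 2 * A $ 2 $ 1 * A $ 3 $ 3 - A $ 1 $ 3 * A $ 2 $ 2 * A $ 3 $ 1"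
  by (simp add: det_3)

text \<open>\<open>l\<close> is the differential of the induced map of base points and
  \<open>k\<close> the factor in the transverse direction. Thus \<open>k\<close> times the quadratic
  part of \<open>F\<close> is the pullback under \<open>l\<close> of the quadratic part of
  \<open>G\<close>, and unit determinant says that \<open>det l\<close> times \<open>k\<close> is
  1.\<close>

lemma linear_image_hessian:
  assumes F: "expansion c r F (0, 0)" and c0: "c 0 0 = 0" and G: "expansion d s G (0, 0)"
    and rel: "linear_image A F G" and det: "det A = 1"
  defines "l \<equiv> \<lambda>i j. A $ i $ j + A $ i $ 3 * (if j = 1 then c 1 0 else c 0 1)"
  defines "k \<equiv> A $ 3 $ 3 - d 1 0 * A $ 1 $ 3 - d 0 1 * A $ 2 $ 3"
  shows "(l 1 1 * l 2 2 - l 1 2 * l 2 1) * k = 1"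
    and "k * c 2 0 = d 2 0 * l 1 1 ^ 2 + d 1 1 * l 1 1 * l 2 1 + d 0 2 * l 2 1 ^ 2"
    and "k * c 0 2 = d 2 0 * l 1 2 ^ 2 + d 1 1 * l 1 2 * l 2 2 + d 0 2 * l 2 2 ^ 2"
    and "k * c 1 1 = 2 * d 2 0 * l 1 1 * l 1 2 + d 1 1 * (l 1 1 * l 2 2 + l 1 2 * l 2 1) + 2 * d 0 2 * l 2 1 * l 2 2"
    and "A $ 3 $ 1 + A $ 3 $ 3 * c 1 0 = d 1 0 * l 1 1 + d 0 1 * l 2 1"
    and "A $ 3 $ 2 + A $ 3 $ 3 * c 0 1 = d 1 0 * l 1 2 + d 0 1 * l 2 2"
proof -
  have *: "A $ 3 $ 1 * a + A $ 3 $ 2 * b + A $ 3 $ 3 * (c 1 0 * a + c 0 1 * b) =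
      d 1 0 * (l 1 1 * a + l 1 2 * b) + d 0 1 * (l 2 1 * a + l 2 2 * b)"
    "k * (c 2 0 * a^2 + c 1 1 * a * b + c 0 2 * b^2) = d 2 0 * (l 1 1 * a + l 1 2 * b)^2 +
      d 1 1 * (l 1 1 * a + l 1 2 * b) * (l 2 1 * a + l 2 2 * b) + d 0 2 * (l 2 1 * a + l 2 2 * b)^2" for a b
  proof -
    obtain x y z :: "real fps" where x: "x $$ 0 = 0" "x $$ 1 = l 1 1 * a + l 1 2 * b" "x $$ 2 = A $ 1 $ 3 * (c 2 0 * a^2 + c 1 1 * a * b + c 0 2 * b^2)"
      and y: "y $$ 0 = 0" "y $$ 1 = l 2 1 * a + l 2 2 * b" "y $$ 2 = A $ 2 $ 3 * (c 2 0 * a^2 + c 1 1 * a * b + c 0 2 * b^2)"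
      and z: "z $$ 1 = A $ 3 $ 1 * a + A $ 3 $ 2 * b + A $ 3 $ 3 * (c 1 0 * a + c 0 1 * b)" "z $$ 2 = A $ 3 $ 3 * (c 2 0 * a^2 + c 1 1 * a * b + c 0 2 * b^2)"
      and eq: "\<And>n. n < 6 \<Longrightarrow> z $$ n = (\<Sum>(i, j) | i + j < 6. fps_const (d i j) * (x ^ i * y ^ j)) $$ n"
      by (rule linear_image_nths[OF F c0 G rel, of a b]) (simp add: line_fps_nths line_fps_nths[unfolded One_nat_def] l_def algebra_simps)
    note nths = fps_compose_nths[OF x(1) y(1), of d]
    show "A $ 3 $ 1 * a + A $ 3 $ 2 * b + A $ 3 $ 3 * (c 1 0 * a + c 0 1 * b) =
      d 1 0 * (l 1 1 * a + l 1 2 * b) + d 0 1 * (l 2 1 * a + l 2 2 * b)"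
      using eq[of 1] unfolding nths x y z by simp
    show "k * (c 2 0 * a^2 + c 1 1 * a * b + c 0 2 * b^2) = d 2 0 * (l 1 1 * a + l 1 2 * b)^2 +
      d 1 1 * (l 1 1 * a + l 1 2 * b) * (l 2 1 * a + l 2 2 * b) + d 0 2 * (l 2 1 * a + l 2 2 * b)^2"
      using eq[of 2] unfolding nths x y z k_def by (simp add: algebra_simps)
  qed
  show r3: "A $ 3 $ 1 + A $ 3 $ 3 * c 1 0 = d 1 0 * l 1 1 + d 0 1 * l 2 1"
    "A $ 3 $ 2 + A $ 3 $ 3 * c 0 1 = d 1 0 * l 1 2 + d 0 1 * l 2 2"
    using *(1)[of 1 0] *(1)[of 0 1] by simp_all
  \<comment> \<open>Adding multiples of the third column to the others and subtracting multiples of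
    the first two rows from the third turns \<open>A\<close> into a matrix with last row
    \<open>(0, 0, k)\<close>, by the tangency relations \<open>r3\<close>.\<close>
  have "(l 1 1 * l 2 2 - l 1 2 * l 2 1) * k = det A" unfolding det_linear_image l_def k_def
    using r3 unfolding l_def by (simp) algebra
  then show "(l 1 1 * l 2 2 - l 1 2 * l 2 1) * k = 1" using det by simp
  show e1: "k * c 2 0 = d 2 0 * l 1 1 ^ 2 + d 1 1 * l 1 1 * l 2 1 + d 0 2 * l 2 1 ^ 2"
    and e2: "k * c 0 2 = d 2 0 * l 1 2 ^ 2 + d 1 1 * l 1 2 * l 2 2 + d 0 2 * l 2 2 ^ 2"
    using *(2)[of 1 0] *(2)[of 0 1] by simp_all
  \<comment> \<open>Polarisation: the value at \<open>(1, 1)\<close> minus the values at the two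
    basis vectors.\<close>
  show "k * c 1 1 = 2 * d 2 0 * l 1 1 * l 1 2 + d 1 1 * (l 1 1 * l 2 2 + l 1 2 * l 2 1) + 2 * d 0 2 * l 2 1 * l 2 2"
    using *(2)[of 1 1] e1 e2 by (simp add: power2_eq_square algebra_simps)
qed

text \<open>The discriminant of a binary quadratic form is a relative invariant: pullback multiplies
  it by the square of the determinant.\<close>

lemma linear_image_disc:
  assumes F: "expansion c r F (0, 0)" and c0: "c 0 0 = 0" and G: "expansion d s G (0, 0)"
    and rel: "linear_image A F G" and det: "det A = 1" and par: "4 * c 2 0 * c 0 2 = c 1 1 ^ 2"
  shows "4 * d 2 0 * d 0 2 = d 1 1 ^ 2"
proof -
  define l where "l i j = A $ i $ j + A $ i $ 3 * (if j = 1 then c 1 0 else c 0 1)" for i j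
  define k where "k = A $ 3 $ 3 - d 1 0 * A $ 1 $ 3 - d 0 1 * A $ 2 $ 3"
  note h = linear_image_hessian[OF F c0 G rel det, folded l_def k_def]
  have "(4 * d 2 0 * d 0 2 - d 1 1 ^ 2) * (l 1 1 * l 2 2 - l 1 2 * l 2 1) ^ 2 = k ^ 2 * (4 * c 2 0 * c 0 2 - c 1 1 ^ 2)"
    using h(2,3,4) by algebra
  moreover have "l 1 1 * l 2 2 - l 1 2 * l 2 1 \<noteq> 0" using h(1) by auto
  ultimately show ?thesis using par by simp
qed

text \<open>The numbers \<open>e, e4, b, k, e5\<close> are the derivatives \<open>F\<^sub>3\<^sub>0, F\<^sub>4\<^sub>0, F\<^sub>3\<^sub>1, F\<^sub>4\<^sub>1, F\<^sub>5\<^sub>0\<close> in an adapted frame;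
  the coefficients of \<open>x\<^sup>j y\<^sup>k\<close> with \<open>k \<ge> 2\<close> are forced by parabolicity.\<close>

definition adapted5 :: "(nat \<Rightarrow> nat \<Rightarrow> real) \<Rightarrow> real \<Rightarrow> real \<Rightarrow> real \<Rightarrow> real \<Rightarrow> real \<Rightarrow> bool" where
  "adapted5 c e e4 b k e5 \<longleftrightarrow> c 0 0 = 0 \<and> c 1 0 = 0 \<and> c 0 1 = 0 \<and>
     c 2 0 = 1/2 \<and> c 1 1 = 0 \<and> c 0 2 = 0 \<and>
     c 3 0 = e / 6 \<and> c 2 1 = 1/2 \<and> c 1 2 = 0 \<and> c 0 3 = 0 \<and>
     c 4 0 = e4 / 24 \<and> c 3 1 = b / 6 \<and> c 2 2 = 1/2 \<and> c 1 3 = 0 \<and> c 0 4 = 0 \<and>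
     c 5 0 = e5 / 120 \<and> c 4 1 = k / 24 \<and> c 3 2 = (b - e) / 2 \<and> c 2 3 = 1/2 \<and> c 1 4 = 0 \<and> c 0 5 = 0"

text \<open>\<open>r\<close> and \<open>w\<close> tilt the transverse axis, \<open>s\<close> tilts
  the x-axis towards the ruling. These matrices are what remains of the group between two adapted
  frames, see \<open>linear_image_adapted_shear\<close>.\<close>

definition shear :: "real \<Rightarrow> real \<Rightarrow> real \<Rightarrow> real ^ 3 ^ 3" where
  "shear r s w = vector [vector [1, 0, r], vector [s, 1, w], vector [0, 0, 1]]"

lemma shear_nth:
  "shear r s w $ 1 $ 1 = 1" "shear r s w $ 1 $ 2 = 0" "shear r s w $ 1 $ 3 = r"
  "shear r s w $ 2 $ 1 = s" "shear r s w $ 2 $ 2 = 1" "shear r s w $ 2 $ 3 = w"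
  "shear r s w $ 3 $ 1 = 0" "shear r s w $ 3 $ 2 = 0" "shear r s w $ 3 $ 3 = 1"
  by (simp_all add: shear_def vector_3)

lemma eq_by_difference: "(a::real) = b \<Longrightarrow> c - d = b - a \<Longrightarrow> c = d"
  by simp

text \<open>The system is triangular: in degree \<open>n\<close> the coefficients of
  \<open>G\<close> of order \<open>n\<close> enter linearly, and everything else is known from lower
  orders. Comparing powers of the slope \<open>t\<close> then yields them one by one.\<close>

lemma adapted5_shear:
  assumes F: "expansion c \<rho> F (0, 0)" and c: "adapted5 c e e4 b k e5"
    and G: "expansion d \<rho>' G (0, 0)" and rel: "linear_image (shear r s w) F G"
  shows "adapted5 d (e - 3 * r - 3 * s)
    (e4 - 4 * b * s - 10 * e * r + 30 * r * s + 15 * r^2 + 12 * s^2 - 6 * w)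
    (b - 6 * r - 6 * s)
    (k - 10 * b * r - 24 * b * s - 10 * e * r + 24 * e * s + 90 * r * s + 45 * r^2 + 36 * s^2 - 18 * w)
    (60 * b * r * s + 60 * b * s^2 - 10 * b * w - 5 * k * s + 60 * e * r * s + 105 * e * r^2 - 60 * e * s^2
      - 10 * e * w - 10 * e^2 * r - 15 * e4 * r + e5 - 270 * r * s^2 + 90 * r * w - 315 * r^2 * s - 105 * r^3
      + 90 * s * w - 60 * s^3)"
proof -
  have cs: "c 0 0 = 0" "c 1 0 = 0" "c 0 1 = 0" "c 2 0 = 1/2" "c 1 1 = 0" "c 0 2 = 0"
     "c 3 0 = e / 6" "c 2 1 = 1/2" "c 1 2 = 0" "c 0 3 = 0"
     "c 4 0 = e4 / 24" "c 3 1 = b / 6" "c 2 2 = 1/2" "c 1 3 = 0" "c 0 4 = 0"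
     "c 5 0 = e5 / 120" "c 4 1 = k / 24" "c 3 2 = (b - e) / 2" "c 2 3 = 1/2" "c 1 4 = 0" "c 0 5 = 0"
    using c[unfolded adapted5_def] by blast+
  define u3 where "u3 t = e / 6 + (t - s) / 2" for t
  define u4 where "u4 t = e4 / 24 + b / 6 * (t - s) + (t - s)^2 / 2" for t
  define u5 where "u5 t = e5 / 120 + k / 24 * (t - s) + (b - e) / 2 * (t - s)^2 + (t - s)^3 / 2" for t
  \<comment> \<open>The direction \<open>(1, t - s)\<close> is chosen so that the sheared curve has
    first order part \<open>(1, t)\<close>. The unknown part of degree \<open>n\<close> is then
    exactly the sum of \<open>d (n - k) k * t^k\<close>.\<close>
  define U where "U t = line_fps c 1 (t - s)" for t
  define x where "x t = fps_const 1 * fps_X + fps_const r * U t" for t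
  define y where "y t = fps_const t * fps_X + fps_const w * U t" for t
  have U: "U t $$ 0 = 0" "U t $$ 1 = 0" "U t $$ 2 = 1/2" "U t $$ 3 = u3 t" "U t $$ 4 = u4 t" "U t $$ 5 = u5 t" for t
    unfolding U_def line_fps_nths u3_def u4_def u5_def cs by simp_all
  have nx: "x t $$ 0 = 0" "x t $$ 1 = 1" "x t $$ 2 = r * (1/2)" "x t $$ 3 = r * u3 t" "x t $$ 4 = r * u4 t" "x t $$ 5 = r * u5 t"
    and ny: "y t $$ 0 = 0" "y t $$ 1 = t" "y t $$ 2 = w * (1/2)" "y t $$ 3 = w * u3 t" "y t $$ 4 = w * u4 t" "y t $$ 5 = w * u5 t" for t
    unfolding x_def y_def fps_add_nth fps_const_X_nths fps_mult_left_const_nth U by simp_all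
  have eqn: "U t $$ n = (\<Sum>(i, j) | i + j < 6. fps_const (d i j) * (x t ^ i * y t ^ j)) $$ n" if "n < 6" for t n
    using linear_image_line[OF F cs(1) G rel that, of 1 "t - s"] by (simp add: shear_nth x_def y_def U_def)
  note cn = fps_compose_nths[OF nx(1) ny(1), of d]
  note nths = cn nx ny U
  note u = u3_def u4_def u5_def
  have D0: "d 0 0 = 0" using eqn[where n = 0] unfolding nths by simp
  have "d 1 0 + d 0 1 * t = 0" for t using eqn[where t = t and n = 1] unfolding nths by simp
  from this[of 0] this[of 1] have D1: "d 1 0 = 0" "d 0 1 = 0" by simp_all
  have *: "d 2 0 + d 1 1 * t + d 0 2 * t ^ 2 + 0 * t ^ 3 + 0 * t ^ 4 + 0 * t ^ 5 = 1/2 + 0 * t + 0 * t ^ 2 + 0 * t ^ 3 + 0 * t ^ 4 + 0 * t ^ 5" for t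
    using eqn[where t = t and n = 2] unfolding nths D1 by simp
  have D2: "d 2 0 = 1/2" "d 1 1 = 0" "d 0 2 = 0" using poly_coeffs_eq[OF *] by simp_all
  have *: "d 3 0 + d 2 1 * t + d 1 2 * t ^ 2 + d 0 3 * t ^ 3 + 0 * t ^ 4 + 0 * t ^ 5 =
    (1 / 6 * e - 1 / 2 * r - 1 / 2 * s) + (1 / 2) * t + (0) * t ^ 2 + (0) * t ^ 3 + 0 * t ^ 4 + 0 * t ^ 5" for t
    using eqn[where t = t and n = 3] unfolding nths u D1 D2
    by (rule eq_by_difference) (simp_all add: field_simps power2_eq_square power3_eq_cube eval_nat_numeral)
  have D3: "d 3 0 = 1 / 6 * e - 1 / 2 * r - 1 / 2 * s"
    "d 2 1 = 1 / 2"
    "d 1 2 = 0"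
    "d 0 3 = 0"
    using poly_coeffs_eq[OF *] by simp_all
  have *: "d 4 0 + d 3 1 * t + d 2 2 * t ^ 2 + d 1 3 * t ^ 3 + d 0 4 * t ^ 4 + 0 * t ^ 5 =
    (- 1 / 6 * b * s - 5 / 12 * e * r + 1 / 24 * e4 + 5 / 4 * r * s + 5 / 8 * r^2 + 1 / 2 * s^2 - 1 / 4 * w) + (1 / 6 * b - r - s) * t + (1 / 2) * t ^ 2 + (0) * t ^ 3 + (0) * t ^ 4 + 0 * t ^ 5" for t
    using eqn[where t = t and n = 4] unfolding nths u D1 D2 D3
    by (rule eq_by_difference) (simp_all add: field_simps power2_eq_square power3_eq_cube eval_nat_numeral)
  have D4: "d 4 0 = - 1 / 6 * b * s - 5 / 12 * e * r + 1 / 24 * e4 + 5 / 4 * r * s + 5 / 8 * r^2 + 1 / 2 * s^2 - 1 / 4 * w"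
    "d 3 1 = 1 / 6 * b - r - s"
    "d 2 2 = 1 / 2"
    "d 1 3 = 0"
    "d 0 4 = 0"
    using poly_coeffs_eq[OF *] by simp_all
  have *: "d 5 0 + d 4 1 * t + d 3 2 * t ^ 2 + d 2 3 * t ^ 3 + d 1 4 * t ^ 4 + d 0 5 * t ^ 5 =
    (1 / 2 * b * r * s + 1 / 2 * b * s^2 - 1 / 12 * b * w + 1 / 2 * e * r * s + 7 / 8 * e * r^2 - 1 / 2 * e * s^2 - 1 / 12 * e * w - 1 / 12 * e^2 * r - 1 / 8 * e4 * r + 1 / 120 * e5 - 1 / 24 * k * s - 9 / 4 * r * s^2 + 3 / 4 * r * w - 21 / 8 * r^2 * s - 7 / 8 * r^3 + 3 / 4 * s * w - 1 / 2 * s^3) + (- 5 / 12 * b * r - b * s - 5 / 12 * e * r + e * s + 1 / 24 * k + 15 / 4 * r * s + 15 / 8 * r^2 + 3 / 2 * s^2 - 3 / 4 * w) * t + (1 / 2 * b - 1 / 2 * e - 3 / 2 * r - 3 / 2 * s) * t ^ 2 + (1 / 2) * t ^ 3 + (0) * t ^ 4 + (0) * t ^ 5" for t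
    using eqn[where t = t and n = 5] unfolding nths u D1 D2 D3 D4
    by (rule eq_by_difference) (simp_all add: field_simps power2_eq_square power3_eq_cube eval_nat_numeral)
  have D5: "d 5 0 = 1 / 2 * b * r * s + 1 / 2 * b * s^2 - 1 / 12 * b * w + 1 / 2 * e * r * s + 7 / 8 * e * r^2 - 1 / 2 * e * s^2 - 1 / 12 * e * w - 1 / 12 * e^2 * r - 1 / 8 * e4 * r + 1 / 120 * e5 - 1 / 24 * k * s - 9 / 4 * r * s^2 + 3 / 4 * r * w - 21 / 8 * r^2 * s - 7 / 8 * r^3 + 3 / 4 * s * w - 1 / 2 * s^3"
    "d 4 1 = - 5 / 12 * b * r - b * s - 5 / 12 * e * r + e * s + 1 / 24 * k + 15 / 4 * r * s + 15 / 8 * r^2 + 3 / 2 * s^2 - 3 / 4 * w"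
    "d 3 2 = 1 / 2 * b - 1 / 2 * e - 3 / 2 * r - 3 / 2 * s"
    "d 2 3 = 1 / 2"
    "d 1 4 = 0"
    "d 0 5 = 0"
    using poly_coeffs_eq[OF *] by simp_all
  show ?thesis unfolding adapted5_def using D0 D1 D2 D3 D4 D5 by (simp add: field_simps)
qed

section \<open>The affine group and its action on germs\<close>

definition compose_affine :: "(real ^ 3 ^ 3) \<times> (real ^ 3) \<Rightarrow> (real ^ 3 ^ 3) \<times> (real ^ 3) \<Rightarrow> (real ^ 3 ^ 3) \<times> (real ^ 3)" where
  "compose_affine h g = (fst h ** fst g, fst h *v snd g + snd h)"

definition inverse_affine :: "(real ^ 3 ^ 3) \<times> (real ^ 3) \<Rightarrow> (real ^ 3 ^ 3) \<times> (real ^ 3)" where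
  "inverse_affine g = (matrix_inv (fst g), - (matrix_inv (fst g) *v snd g))"

lemma act_compose: "act (compose_affine h g) v = act h (act g v)"
  by (simp add: act_def compose_affine_def matrix_vector_mul_assoc matrix_vector_right_distrib)

lemma SA3_compose: "g \<in> SA3 \<Longrightarrow> h \<in> SA3 \<Longrightarrow> compose_affine h g \<in> SA3"
  by (auto simp: SA3_def compose_affine_def det_mul)

lemma SA3_inv_mult:
  assumes "g \<in> SA3"
  shows "matrix_inv (fst g) ** fst g = mat 1" "fst g ** matrix_inv (fst g) = mat 1"
proof -
  have "invertible (fst g)" using assms by (auto simp: SA3_def invertible_det_nz)
  then obtain B where "fst g ** B = mat 1 \<and> B ** fst g = mat 1" unfolding invertible_def by blast
  from someI[where P = "\<lambda>B. fst g ** B = mat 1 \<and> B ** fst g = mat 1", OF this]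
  show "matrix_inv (fst g) ** fst g = mat 1" "fst g ** matrix_inv (fst g) = mat 1"
    unfolding matrix_inv_def by auto
qed

lemma SA3_inverse: "g \<in> SA3 \<Longrightarrow> inverse_affine g \<in> SA3"
proof -
  assume g: "g \<in> SA3"
  have "det (matrix_inv (fst g)) * det (fst g) = 1"
    using SA3_inv_mult(1)[OF g] by (metis det_I det_mul)
  then show ?thesis using g by (auto simp: SA3_def inverse_affine_def)
qed

lemma act_inverse:
  assumes "g \<in> SA3"
  shows "act (inverse_affine g) (act g v) = v" "act g (act (inverse_affine g) v) = v"
  using SA3_inv_mult[OF assms]
  by (simp_all add: act_def inverse_affine_def matrix_vector_right_distrib matrix_vector_mul_assoc
      matrix_vector_mult_diff_distrib)

lemma continuous_act: "continuous_on UNIV (act g)"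
  unfolding act_def by (intro continuous_intros matrix_vector_mult_linear_continuous_on)

lemma open_vimage_act: "open V \<Longrightarrow> open (act g -` V)"
  by (rule open_vimage[OF _ continuous_act])

lemma maps_germ_compose:
  assumes g: "g \<in> SA3" and h: "h \<in> SA3" and 1: "maps_germ g S p S' p'" and 2: "maps_germ h S' p' S'' p''"
  shows "maps_germ (compose_affine h g) S p S'' p''"
proof -
  from 1 obtain V1 V1' where V1: "act g p = p'" "open V1" "p \<in> V1" "open V1'" "p' \<in> V1'" "act g ` (S \<inter> V1) = S' \<inter> V1'"
    unfolding maps_germ_def by blast
  from 2 obtain V2 V2' where V2: "act h p' = p''" "open V2" "p' \<in> V2" "open V2'" "p'' \<in> V2'" "act h ` (S' \<inter> V2) = S'' \<inter> V2'"
    unfolding maps_germ_def by blast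
  define W where "W = V1 \<inter> act g -` V2"
  define W' where "W' = V2' \<inter> act (inverse_affine h) -` V1'"
  have "act g ` (S \<inter> W) = S' \<inter> V1' \<inter> V2"
  proof -
    have "act g ` (S \<inter> W) = act g ` (S \<inter> V1) \<inter> V2" unfolding W_def by auto
    then show ?thesis by (simp only: V1(6))
  qed
  moreover have "act (compose_affine h g) ` (S \<inter> W) = act h ` (act g ` (S \<inter> W))"
    by (simp add: image_image act_compose)
  ultimately have "act (compose_affine h g) ` (S \<inter> W) = act h ` (S' \<inter> V1' \<inter> V2)" by simp
  also have "\<dots> = S'' \<inter> W'"
  proof (intro set_eqI iffI)
    fix v assume "v \<in> act h ` (S' \<inter> V1' \<inter> V2)"
    then show "v \<in> S'' \<inter> W'" using V2(6) act_inverse[OF h] unfolding W'_def by auto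
  next
    fix v assume v: "v \<in> S'' \<inter> W'"
    then have "v \<in> act h ` (S' \<inter> V2)" using V2(6) by (auto simp: W'_def)
    then obtain u where "u \<in> S' \<inter> V2" "v = act h u" by blast
    then show "v \<in> act h ` (S' \<inter> V1' \<inter> V2)" using v act_inverse[OF h] by (auto simp: W'_def)
  qed
  finally show ?thesis unfolding maps_germ_def
    using V1 V2 by (intro conjI exI[of _ W] exI[of _ W'])
      (auto simp: act_compose W_def W'_def act_inverse[OF h] open_vimage_act intro!: open_Int)
qed

lemma maps_germ_inverse:
  assumes g: "g \<in> SA3" and 1: "maps_germ g S p S' p'"
  shows "maps_germ (inverse_affine g) S' p' S p"
proof -
  from 1 obtain V V' where V: "act g p = p'" "open V" "p \<in> V" "open V'" "p' \<in> V'" "act g ` (S \<inter> V) = S' \<inter> V'"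
    unfolding maps_germ_def by blast
  have "act (inverse_affine g) ` (S' \<inter> V') = S \<inter> V"
    unfolding V(6)[symmetric] image_image act_inverse[OF g] by simp
  then show ?thesis using V act_inverse[OF g] unfolding maps_germ_def by blast
qed

lemma point_nth [simp]: "point F q $ 1 = fst q" "point F q $ 2 = snd q" "point F q $ 3 = F q"
  by (simp_all add: point_def vector_3)

lemma act_nth: "act g v $ i = fst g $ i $ 1 * v $ 1 + fst g $ i $ 2 * v $ 2 + fst g $ i $ 3 * v $ 3 + snd g $ i"
  by (simp add: act_def matrix_vector_mult_def sum_3)

lemma in_surface: "v \<in> surface D F \<longleftrightarrow> (v $ 1, v $ 2) \<in> D \<and> v $ 3 = F (v $ 1, v $ 2)"
proof
  assume v: "(v $ 1, v $ 2) \<in> D \<and> v $ 3 = F (v $ 1, v $ 2)"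
  have "v = point F (v $ 1, v $ 2)" using v by (simp add: vec_eq_iff forall_3)
  then show "v \<in> surface D F" using v unfolding surface_def by blast
qed (auto simp: surface_def)

definition centered :: "(real \<times> real \<Rightarrow> real) \<Rightarrow> real \<times> real \<Rightarrow> real \<times> real \<Rightarrow> real" where
  "centered F p = (\<lambda>h. F (fst p + fst h, snd p + snd h) - F p)"

lemma continuous_point:
  assumes "isCont F p" shows "isCont (point F) p"
proof -
  have "((\<lambda>q. point F q) \<longlongrightarrow> point F p) (at p)"
  proof (rule vec_tendstoI)
    fix i :: 3
    have "((\<lambda>q. point F q $ 1) \<longlongrightarrow> point F p $ 1) (at p)" "((\<lambda>q. point F q $ 2) \<longlongrightarrow> point F p $ 2) (at p)"
      "((\<lambda>q. point F q $ 3) \<longlongrightarrow> point F p $ 3) (at p)"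
      using assms by (auto simp: continuous_at intro!: tendsto_intros)
    then show "((\<lambda>q. point F q $ i) \<longlongrightarrow> point F p $ i) (at p)" using exhaust_3[of i] by metis
  qed
  then show ?thesis by (simp add: continuous_at)
qed

text \<open>Moving both base points to the origin cancels the translation part of \<open>g\<close>,
  so only its linear part acts on the centred graphs.\<close>

lemma maps_germ_linear_image:
  assumes m: "maps_germ g (surface D F) (point F p) (surface E G) (point G p')"
    and D: "open D" "p \<in> D" and F: "isCont F p"
  shows "linear_image (fst g) (centered F p) (centered G p')"
proof -
  from m obtain V V' where V: "act g (point F p) = point G p'" "open V" "point F p \<in> V" 
    "act g ` (surface D F \<inter> V) = surface E G \<inter> V'"
    unfolding maps_germ_def by blast
  have "\<forall>\<^sub>F q in nhds p. point F q \<in> V"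
    using topological_tendstoD[OF tendsto_at_iff_tendsto_nhds[THEN iffD1, OF continuous_point[OF F, unfolded continuous_at]]] V(2,3) by blast
  moreover have "\<forall>\<^sub>F q in nhds p. q \<in> D" using D by (rule eventually_nhds_in_open)
  ultimately have ev: "\<forall>\<^sub>F q in nhds p. act g (point F q) \<in> surface E G"
    by eventually_elim (use V(4) in \<open>auto simp: surface_def\<close>)
  have p': "fst p' = act g (point F p) $ 1" "snd p' = act g (point F p) $ 2" "G p' = act g (point F p) $ 3"
    unfolding V(1) by simp_all
  have "\<forall>\<^sub>F q in nhds (0, 0). act g (point F (fst p + fst q, snd p + snd q)) \<in> surface E G"
    using ev unfolding eventually_nhds_box by simp
  then show ?thesis unfolding linear_image_def
  proof eventually_elim
    case (elim q)
    let ?v = "act g (point F (fst p + fst q, snd p + snd q))"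
    have e: "?v $ 3 = G (?v $ 1, ?v $ 2)" using elim by (simp add: in_surface)
    have d: "?v $ i = act g (point F p) $ i + (fst g $ i $ 1 * fst q + fst g $ i $ 2 * snd q + fst g $ i $ 3 * centered F p q)" for i
      by (simp add: act_nth centered_def algebra_simps)
    show ?case using e unfolding d[of 1] d[of 2] d[of 3] centered_def[of G] p'[symmetric] by simp
  qed
qed

lemma expansion_shift: "expansion c r F p \<longleftrightarrow> expansion c r (\<lambda>h. F (fst p + fst h, snd p + snd h)) (0, 0)"
  by (simp add: expansion_def)

section \<open>Triangular substitutions and the adapted frame\<close>

lemma analytic2_subst:
  assumes F: "analytic2_at F p"
    and H: "\<And>h l. H (fst q + h, snd q + l) = k * F (fst p + (\<alpha> * h + \<beta> * l), snd p + \<delta> * l) + a0 + a1 * h + a2 * l"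
  shows "analytic2_at H q"
proof -
  have f: "an {..<2::nat} (\<lambda>h. F (fst p + h 0, snd p + h 1))" using F by (simp add: analytic2_at_iff)
  let ?\<sigma> = "\<lambda>i h. if i = (0::nat) then \<alpha> * h 0 + \<beta> * h 1 else \<delta> * h (1::nat)"
  have v: "an {..<2::nat} (\<lambda>h. h 0)" "an {..<2::nat} (\<lambda>h. h 1)" by (auto intro!: an_var)
  have s: "an {..<2::nat} (\<lambda>h. \<alpha> * h 0 + \<beta> * h 1)" "an {..<2::nat} (\<lambda>h. \<delta> * h 1)"
    by (intro an_add an_cmult v finite_lessThan)+
  have "an {..<2::nat} (\<lambda>h. F (fst p + (\<lambda>i. ?\<sigma> i h) 0, snd p + (\<lambda>i. ?\<sigma> i h) 1))"
  proof (rule an_compose[OF f, of "{..<2}" ?\<sigma>])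
    show "an {..<2} (?\<sigma> i)" for i using s by (cases "i = 0") simp_all
  qed auto
  then have "an {..<2::nat} (\<lambda>h. F (fst p + (\<alpha> * h 0 + \<beta> * h 1), snd p + \<delta> * h 1))" by simp
  then show ?thesis unfolding analytic2_at_iff H
    by (intro an_add an_cmult v finite_lessThan an_const)
qed

text \<open>The substitution is triangular because an adapted frame keeps the x-direction and turns
  only the y-axis into the ruling. Therefore the coefficients of \<open>x^j\<close> and
  \<open>x^j y\<close> of the new graph depend only on those of \<open>F\<close>, and the affine
  terms \<open>a0\<close>, \<open>a1\<close>, \<open>a2\<close> are confined to orders 0 and
  1.\<close>

lemma subst_coeffs:
  assumes F: "expansion c r F p"
    and H: "\<And>h l. H (fst q + h, snd q + l) = k * F (fst p + (\<alpha> * h + \<beta> * l), snd p + \<delta> * l) + a0 + a1 * h + a2 * l"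
  obtains d s where "expansion d s H q"
    "d 0 0 = k * c 0 0 + a0" "d 1 0 = k * \<alpha> * c 1 0 + a1" "d 0 1 = k * (\<beta> * c 1 0 + \<delta> * c 0 1) + a2"
    "d 2 0 = k * \<alpha>^2 * c 2 0" "d 1 1 = k * (2 * \<alpha> * \<beta> * c 2 0 + \<alpha> * \<delta> * c 1 1)"
    "d 0 2 = k * (\<beta>^2 * c 2 0 + \<beta> * \<delta> * c 1 1 + \<delta>^2 * c 0 2)"
    "d 3 0 = k * \<alpha>^3 * c 3 0" "d 2 1 = k * \<alpha>^2 * (3 * \<beta> * c 3 0 + \<delta> * c 2 1)"
    "d 4 0 = k * \<alpha>^4 * c 4 0" "d 3 1 = k * \<alpha>^3 * (4 * \<beta> * c 4 0 + \<delta> * c 3 1)"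
    "d 5 0 = k * \<alpha>^5 * c 5 0" "d 4 1 = k * \<alpha>^4 * (5 * \<beta> * c 5 0 + \<delta> * c 4 1)"
proof -
  obtain d s where E: "expansion d s H q"
    using analytic2_subst[OF _ H] F unfolding analytic2_expansion by blast
  note E' = iffD1[OF expansion_shift E] and F' = iffD1[OF expansion_shift F]
  have eq: "line_fps d 1 t $$ n = (fps_const k * line_fps c (\<alpha> + \<beta> * t) (\<delta> * t) + fps_const a0 + fps_const (a1 + a2 * t) * fps_X) $$ n"
    if "n < 6" for n t
  proof (rule expands_unique[OF expands_line[OF E'] _ _ that])
    show "expands 6 (\<lambda>e. k * (\<lambda>h. F (fst p + fst h, snd p + snd h)) (e * (\<alpha> + \<beta> * t), e * (\<delta> * t)) + a0 + e * (a1 + a2 * t))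
      (fps_const k * line_fps c (\<alpha> + \<beta> * t) (\<delta> * t) + fps_const a0 + fps_const (a1 + a2 * t) * fps_X)"
      by (intro expands_add expands_cmult expands_line[OF F'] expands_const expands_line_id)
    show "\<forall>\<^sub>F e in at 0. H (fst q + fst (e * 1, e * t), snd q + snd (e * 1, e * t)) =
      k * F (fst p + fst (e * (\<alpha> + \<beta> * t), e * (\<delta> * t)), snd p + snd (e * (\<alpha> + \<beta> * t), e * (\<delta> * t))) + a0 + e * (a1 + a2 * t)"
    proof (rule always_eventually, rule allI)
      fix e
      have "e * (\<alpha> + \<beta> * t) = \<alpha> * e + \<beta> * (e * t)" "e * (\<delta> * t) = \<delta> * (e * t)" "e * (a1 + a2 * t) = a1 * e + a2 * (e * t)"
        by (simp_all add: algebra_simps)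
      then show "H (fst q + fst (e * 1, e * t), snd q + snd (e * 1, e * t)) =
      k * F (fst p + fst (e * (\<alpha> + \<beta> * t), e * (\<delta> * t)), snd p + snd (e * (\<alpha> + \<beta> * t), e * (\<delta> * t))) + a0 + e * (a1 + a2 * t)"
        using H[of e "e * t"] by (simp only: fst_conv snd_conv mult_1_right add.assoc)
    qed
  qed
  have kn: "fps_const a0 $$ 0 = a0" "fps_const a0 $$ 1 = 0" "fps_const a0 $$ 2 = 0" "fps_const a0 $$ 3 = 0"
    "fps_const a0 $$ 4 = 0" "fps_const a0 $$ 5 = 0" by simp_all
  note nths = line_fps_nths fps_add_nth fps_mult_left_const_nth kn
  have eq: "line_fps d 1 t $$ n = k * line_fps c (\<alpha> + \<beta> * t) (\<delta> * t) $$ n + fps_const a0 $$ n + (fps_const (a1 + a2 * t) * fps_X) $$ n"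
    if "n < 6" for n t using eq[OF that] by (simp only: fps_add_nth fps_mult_left_const_nth)
  note nths = line_fps_nths kn fps_const_X_nths
  have D0: "d 0 0 = k * c 0 0 + a0" using eq[of 0 0] unfolding nths by simp
  have "d 1 0 + d 0 1 * t = k * (c 1 0 * (\<alpha> + \<beta> * t) + c 0 1 * (\<delta> * t)) + a1 + a2 * t" for t
    using eq[of 1 t] unfolding nths by (simp add: algebra_simps)
  from this[of 0] this[of 1] have D1: "d 1 0 = k * \<alpha> * c 1 0 + a1" "d 0 1 = k * (\<beta> * c 1 0 + \<delta> * c 0 1) + a2"
    by (simp_all add: algebra_simps)
  have *: "d 2 0 + d 1 1 * t + d 0 2 * t ^ 2 + 0 * t ^ 3 + 0 * t ^ 4 + 0 * t ^ 5 =
    (\<alpha>^2 * c 2 0 * k) + (2 * \<alpha> * \<beta> * c 2 0 * k + \<alpha> * c 1 1 * \<delta> * k) * t + (\<beta> * c 1 1 * \<delta> * k + \<beta>^2 * c 2 0 * k + c 0 2 * \<delta>^2 * k) * t ^ 2 + 0 * t ^ 3 + 0 * t ^ 4 + 0 * t ^ 5" for t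
    using eq[of 2 t, symmetric] unfolding nths
    by (rule eq_by_difference) (simp_all add: field_simps power2_eq_square power3_eq_cube eval_nat_numeral)
  have D2: "d 2 0 = \<alpha>^2 * c 2 0 * k" "d 1 1 = 2 * \<alpha> * \<beta> * c 2 0 * k + \<alpha> * c 1 1 * \<delta> * k" "d 0 2 = \<beta> * c 1 1 * \<delta> * k + \<beta>^2 * c 2 0 * k + c 0 2 * \<delta>^2 * k"
    using poly_coeffs_eq[OF *] by simp_all
  have *: "d 3 0 + d 2 1 * t + d 1 2 * t ^ 2 + d 0 3 * t ^ 3 + 0 * t ^ 4 + 0 * t ^ 5 =
    (\<alpha>^3 * c 3 0 * k) + (3 * \<alpha>^2 * \<beta> * c 3 0 * k + \<alpha>^2 * c 2 1 * \<delta> * k) * t + (2 * \<alpha> * \<beta> * c 2 1 * \<delta> * k + 3 * \<alpha> * \<beta>^2 * c 3 0 * k + \<alpha> * c 1 2 * \<delta>^2 * k) * t ^ 2 + (\<beta> * c 1 2 * \<delta>^2 * k + \<beta>^2 * c 2 1 * \<delta> * k + \<beta>^3 * c 3 0 * k + c 0 3 * \<delta>^3 * k) * t ^ 3 + 0 * t ^ 4 + 0 * t ^ 5" for t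
    using eq[of 3 t, symmetric] unfolding nths
    by (rule eq_by_difference) (simp_all add: field_simps power2_eq_square power3_eq_cube eval_nat_numeral)
  have D3: "d 3 0 = \<alpha>^3 * c 3 0 * k" "d 2 1 = 3 * \<alpha>^2 * \<beta> * c 3 0 * k + \<alpha>^2 * c 2 1 * \<delta> * k"
    using poly_coeffs_eq[OF *] by simp_all
  have *: "d 4 0 + d 3 1 * t + d 2 2 * t ^ 2 + d 1 3 * t ^ 3 + d 0 4 * t ^ 4 + 0 * t ^ 5 =
    (\<alpha>^4 * c 4 0 * k) + (4 * \<alpha>^3 * \<beta> * c 4 0 * k + \<alpha>^3 * c 3 1 * \<delta> * k) * t + (3 * \<alpha>^2 * \<beta> * c 3 1 * \<delta> * k + 6 * \<alpha>^2 * \<beta>^2 * c 4 0 * k + \<alpha>^2 * c 2 2 * \<delta>^2 * k) * t ^ 2 + (2 * \<alpha> * \<beta> * c 2 2 * \<delta>^2 * k + 3 * \<alpha> * \<beta>^2 * c 3 1 * \<delta> * k + 4 * \<alpha> * \<beta>^3 * c 4 0 * k + \<alpha> * c 1 3 * \<delta>^3 * k) * t ^ 3 + (\<beta> * c 1 3 * \<delta>^3 * k + \<beta>^2 * c 2 2 * \<delta>^2 * k + \<beta>^3 * c 3 1 * \<delta> * k + \<beta>^4 * c 4 0 * k + c 0 4 * \<delta>^4 * k) * t ^ 4 + 0 * t ^ 5" for t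
    using eq[of 4 t, symmetric] unfolding nths
    by (rule eq_by_difference) (simp_all add: field_simps power2_eq_square power3_eq_cube eval_nat_numeral)
  have D4: "d 4 0 = \<alpha>^4 * c 4 0 * k" "d 3 1 = 4 * \<alpha>^3 * \<beta> * c 4 0 * k + \<alpha>^3 * c 3 1 * \<delta> * k"
    using poly_coeffs_eq[OF *] by simp_all
  have *: "d 5 0 + d 4 1 * t + d 3 2 * t ^ 2 + d 2 3 * t ^ 3 + d 1 4 * t ^ 4 + d 0 5 * t ^ 5 =
    (\<alpha>^5 * c 5 0 * k) + (5 * \<alpha>^4 * \<beta> * c 5 0 * k + \<alpha>^4 * c 4 1 * \<delta> * k) * t + (4 * \<alpha>^3 * \<beta> * c 4 1 * \<delta> * k + 10 * \<alpha>^3 * \<beta>^2 * c 5 0 * k + \<alpha>^3 * c 3 2 * \<delta>^2 * k) * t ^ 2 + (3 * \<alpha>^2 * \<beta> * c 3 2 * \<delta>^2 * k + 6 * \<alpha>^2 * \<beta>^2 * c 4 1 * \<delta> * k + 10 * \<alpha>^2 * \<beta>^3 * c 5 0 * k + \<alpha>^2 * c 2 3 * \<delta>^3 * k) * t ^ 3 + (2 * \<alpha> * \<beta> * c 2 3 * \<delta>^3 * k + 3 * \<alpha> * \<beta>^2 * c 3 2 * \<delta>^2 * k + 4 * \<alpha> * \<beta>^3 * c 4 1 * \<delta> * k + 5 * \<alpha> * \<beta>^4 * c 5 0 * k + \<alpha> * c 1 4 * \<delta>^4 * k) * t ^ 4 + (\<beta> * c 1 4 * \<delta>^4 * k + \<beta>^2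 * c 2 3 * \<delta>^3 * k + \<beta>^3 * c 3 2 * \<delta>^2 * k + \<beta>^4 * c 4 1 * \<delta> * k + \<beta>^5 * c 5 0 * k + c 0 5 * \<delta>^5 * k) * t ^ 5" for t
    using eq[of 5 t, symmetric] unfolding nths
    by (rule eq_by_difference) (simp_all add: field_simps power2_eq_square power3_eq_cube eval_nat_numeral)
  have D5: "d 5 0 = \<alpha>^5 * c 5 0 * k" "d 4 1 = 5 * \<alpha>^4 * \<beta> * c 5 0 * k + \<alpha>^4 * c 4 1 * \<delta> * k"
    using poly_coeffs_eq[OF *] by simp_all
  show ?thesis
    by (rule that[OF E D0 D1]; unfold D2 D3 D4 D5) (simp_all add: algebra_simps)
qed

text \<open>The vector \<open>(adapt_xy z \<alpha>, adapt_y z \<alpha>)\<close> is a multiple of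
  \<open>(- z (Fxy 1) / z (Fx 2), 1)\<close>, the null direction of the Hessian. The factor
  \<open>adapt_u\<close> makes the second x-derivative 1, and the length of the null vector is fixed
  by determinant 1.\<close>

definition adapt_y :: "jet \<Rightarrow> real \<Rightarrow> real" where "adapt_y z \<alpha> = 1 / (\<alpha>^3 * z (Fx 2))"

definition adapt_u :: "jet \<Rightarrow> real \<Rightarrow> real" where "adapt_u z \<alpha> = 1 / (\<alpha>^2 * z (Fx 2))"

definition adapt_xy :: "jet \<Rightarrow> real \<Rightarrow> real" where "adapt_xy z \<alpha> = - z (Fxy 1) / (\<alpha>^3 * z (Fx 2)^2)"

definition adapt :: "jet \<Rightarrow> real \<Rightarrow> (real \<times> real \<Rightarrow> real) \<Rightarrow> real \<times> real \<Rightarrow> real \<times> real \<Rightarrow> real" where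
  "adapt z \<alpha> F p = (\<lambda>h. adapt_u z \<alpha> * (centered F p (\<alpha> * fst h + adapt_xy z \<alpha> * snd h, adapt_y z \<alpha> * snd h)
     - z (Fx 1) * (\<alpha> * fst h + adapt_xy z \<alpha> * snd h) - z (Fxy 0) * (adapt_y z \<alpha> * snd h)))"

definition adapt_mat :: "jet \<Rightarrow> real \<Rightarrow> real ^ 3 ^ 3" where
  "adapt_mat z \<alpha> = vector [vector [\<alpha>, adapt_xy z \<alpha>, 0], vector [0, adapt_y z \<alpha>, 0],
     vector [z (Fx 1) * \<alpha>, z (Fx 1) * adapt_xy z \<alpha> + z (Fxy 0) * adapt_y z \<alpha>, \<alpha>^2 * z (Fx 2)]]"

definition adapt_inv :: "jet \<Rightarrow> real \<Rightarrow> real ^ 3 ^ 3" where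
  "adapt_inv z \<alpha> = vector [vector [1 / \<alpha>, z (Fxy 1) / (\<alpha> * z (Fx 2)), 0], vector [0, \<alpha>^3 * z (Fx 2), 0],
     vector [- adapt_u z \<alpha> * z (Fx 1), - adapt_u z \<alpha> * z (Fxy 0), adapt_u z \<alpha>]]"

lemma adapt_mat_nth:
  "adapt_mat z \<alpha> $ 1 $ 1 = \<alpha>" "adapt_mat z \<alpha> $ 1 $ 2 = adapt_xy z \<alpha>" "adapt_mat z \<alpha> $ 1 $ 3 = 0"
  "adapt_mat z \<alpha> $ 2 $ 1 = 0" "adapt_mat z \<alpha> $ 2 $ 2 = adapt_y z \<alpha>" "adapt_mat z \<alpha> $ 2 $ 3 = 0"
  "adapt_mat z \<alpha> $ 3 $ 1 = z (Fx 1) * \<alpha>" "adapt_mat z \<alpha> $ 3 $ 2 = z (Fx 1) * adapt_xy z \<alpha> + z (Fxy 0) * adapt_y z \<alpha>"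
  "adapt_mat z \<alpha> $ 3 $ 3 = \<alpha>^2 * z (Fx 2)"
  by (simp_all add: adapt_mat_def vector_3)

lemma adapt_inv_nth:
  "adapt_inv z \<alpha> $ 1 $ 1 = 1 / \<alpha>" "adapt_inv z \<alpha> $ 1 $ 2 = z (Fxy 1) / (\<alpha> * z (Fx 2))" "adapt_inv z \<alpha> $ 1 $ 3 = 0"
  "adapt_inv z \<alpha> $ 2 $ 1 = 0" "adapt_inv z \<alpha> $ 2 $ 2 = \<alpha>^3 * z (Fx 2)" "adapt_inv z \<alpha> $ 2 $ 3 = 0"
  "adapt_inv z \<alpha> $ 3 $ 1 = - adapt_u z \<alpha> * z (Fx 1)" "adapt_inv z \<alpha> $ 3 $ 2 = - adapt_u z \<alpha> * z (Fxy 0)"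
  "adapt_inv z \<alpha> $ 3 $ 3 = adapt_u z \<alpha>"
  by (simp_all add: adapt_inv_def vector_3)

lemma adapt_det:
  assumes "\<alpha> \<noteq> 0" "z (Fx 2) \<noteq> 0"
  shows "det (adapt_mat z \<alpha>) = 1" "det (adapt_inv z \<alpha>) = 1"
  unfolding det_linear_image adapt_mat_nth adapt_inv_nth adapt_y_def adapt_u_def
  using assms by (simp_all add: field_simps power2_eq_square power3_eq_cube)

lemma adapt_mat_inv:
  assumes "\<alpha> \<noteq> 0" "z (Fx 2) \<noteq> 0"
  shows "adapt_mat z \<alpha> ** adapt_inv z \<alpha> = mat 1" "adapt_inv z \<alpha> ** adapt_mat z \<alpha> = mat 1"
  by (simp_all add: vec_eq_iff forall_3 matrix_matrix_mult_def sum_3 mat_def adapt_mat_nth adapt_inv_nth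
      adapt_y_def adapt_u_def adapt_xy_def)
    (use assms in \<open>simp_all add: field_simps power2_eq_square power3_eq_cube\<close>)

lemma linear_image_adapt_target:
  assumes rel: "linear_image A F (centered G p)" and nz: "\<alpha> \<noteq> 0" "z (Fx 2) \<noteq> 0"
  shows "linear_image (adapt_inv z \<alpha> ** A) F (adapt z \<alpha> G p)"
  using rel unfolding linear_image_def
proof eventually_elim
  case (elim q)
  define Z where "Z i = A $ i $ 1 * fst q + A $ i $ 2 * snd q + A $ i $ 3 * F q" for i
  have Z3: "Z 3 = centered G p (Z 1, Z 2)" using elim by (simp add: Z_def)
  have m: "(adapt_inv z \<alpha> ** A) $ i $ 1 * fst q + (adapt_inv z \<alpha> ** A) $ i $ 2 * snd q + (adapt_inv z \<alpha> ** A) $ i $ 3 * F q =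
     adapt_inv z \<alpha> $ i $ 1 * Z 1 + adapt_inv z \<alpha> $ i $ 2 * Z 2 + adapt_inv z \<alpha> $ i $ 3 * Z 3" for i
    by (simp add: matrix_matrix_mult_def sum_3 Z_def algebra_simps)
  define X1 X2 where "X1 = 1 / \<alpha> * Z 1 + z (Fxy 1) / (\<alpha> * z (Fx 2)) * Z 2" and "X2 = \<alpha>^3 * z (Fx 2) * Z 2"
  have x: "\<alpha> * X1 + adapt_xy z \<alpha> * X2 = Z 1" and y: "adapt_y z \<alpha> * X2 = Z 2"
    using nz by (simp_all add: X1_def X2_def adapt_xy_def adapt_y_def field_simps power2_eq_square power3_eq_cube)
  have X: "1 / \<alpha> * Z 1 + z (Fxy 1) / (\<alpha> * z (Fx 2)) * Z 2 + 0 * Z 3 = X1"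
    "0 * Z 1 + \<alpha>^3 * z (Fx 2) * Z 2 + 0 * Z 3 = X2" by (simp_all add: X1_def X2_def)
  show ?case unfolding m adapt_inv_nth X adapt_def fst_conv snd_conv x y
    by (simp add: Z3 algebra_simps)
qed

lemma linear_image_adapt_source:
  assumes rel: "linear_image A (centered F p) G" and nz: "\<alpha> \<noteq> 0" "z (Fx 2) \<noteq> 0"
  shows "linear_image (A ** adapt_mat z \<alpha>) (adapt z \<alpha> F p) G"
proof -
  let ?L = "\<lambda>h. (\<alpha> * fst h + adapt_xy z \<alpha> * snd h, adapt_y z \<alpha> * snd h)"
  have "(?L \<longlongrightarrow> ?L (0, 0)) (at (0, 0))" by (intro tendsto_intros)
  then have "(?L \<longlongrightarrow> ?L (0, 0)) (nhds (0, 0))" by (rule iffD1[OF tendsto_at_iff_tendsto_nhds[of ?L]])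
  then have "filterlim ?L (nhds (0, 0)) (nhds (0, 0))" by simp
  then have "\<forall>\<^sub>F h in nhds (0, 0). A $ 3 $ 1 * fst (?L h) + A $ 3 $ 2 * snd (?L h) + A $ 3 $ 3 * centered F p (?L h) =
     G (A $ 1 $ 1 * fst (?L h) + A $ 1 $ 2 * snd (?L h) + A $ 1 $ 3 * centered F p (?L h),
        A $ 2 $ 1 * fst (?L h) + A $ 2 $ 2 * snd (?L h) + A $ 2 $ 3 * centered F p (?L h))"
    using rel unfolding linear_image_def filterlim_iff by blast
  then show ?thesis unfolding linear_image_def
  proof eventually_elim
    case (elim h)
    have u: "\<alpha>^2 * z (Fx 2) * adapt z \<alpha> F p h = centered F p (?L h) - z (Fx 1) * fst (?L h) - z (Fxy 0) * snd (?L h)"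
      using nz by (simp add: adapt_def adapt_u_def)
    have "(A ** adapt_mat z \<alpha>) $ i $ 1 * fst h + (A ** adapt_mat z \<alpha>) $ i $ 2 * snd h + (A ** adapt_mat z \<alpha>) $ i $ 3 * adapt z \<alpha> F p h
       = A $ i $ 1 * fst (?L h) + A $ i $ 2 * snd (?L h) + A $ i $ 3 * (z (Fx 1) * fst (?L h) + z (Fxy 0) * snd (?L h) + \<alpha>^2 * z (Fx 2) * adapt z \<alpha> F p h)" for i
      by (simp add: matrix_matrix_mult_def sum_3 adapt_mat_nth algebra_simps)
    then have "(A ** adapt_mat z \<alpha>) $ i $ 1 * fst h + (A ** adapt_mat z \<alpha>) $ i $ 2 * snd h + (A ** adapt_mat z \<alpha>) $ i $ 3 * adapt z \<alpha> F p h
       = A $ i $ 1 * fst (?L h) + A $ i $ 2 * snd (?L h) + A $ i $ 3 * centered F p (?L h)" for i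
      unfolding u by simp
    then show ?case using elim by simp
  qed
qed

section \<open>Invariance of W and M\<close>

text \<open>\<open>W_of\<close>, \<open>Phi41_of\<close> and \<open>Phi50_of\<close> are the
  invariant expressions at an adapted jet, where \<open>z (Fx 2) = 1\<close>,
  \<open>z (Fxy 1) = 0\<close>, \<open>A_jet z = 1\<close>, \<open>B_jet z = b\<close> and
  \<open>C_jet z = k\<close>.\<close>

definition W_of :: "real \<Rightarrow> real \<Rightarrow> real" where "W_of e b = b - 2 * e"

definition Phi41_of :: "real \<Rightarrow> real \<Rightarrow> real \<Rightarrow> real \<Rightarrow> real" where
  "Phi41_of e e4 b k = 8 * e^2 - 4 * e * b + k - 3 * e4"

definition Phi50_of :: "real \<Rightarrow> real \<Rightarrow> real \<Rightarrow> real \<Rightarrow> real \<Rightarrow> real" where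
  "Phi50_of e e4 b k e5 = (20 * e * b^2 - 40 * e^3 - 15 * e4 * b + 30 * e * e4 + 9 * e5 - 15 * e * k) / 9"

definition M_of :: "real \<Rightarrow> real \<Rightarrow> real \<Rightarrow> real \<Rightarrow> real \<Rightarrow> real" where
  "M_of e e4 b k e5 = Phi50_of e e4 b k e5 + 10 / 3 * W_of e b * Phi41_of e e4 b k - 5 / 4 * (Phi41_of e e4 b k ^ 2 / W_of e b)"

text \<open>The primed values are those after a shear with parameters \<open>r, s, w\<close>.\<close>

lemma Phi41_shear:
  fixes e e4 b k r s w :: real
  defines "e' \<equiv> e - 3 * r - 3 * s"
    and "e4' \<equiv> e4 - 4 * b * s - 10 * e * r + 30 * r * s + 15 * r^2 + 12 * s^2 - 6 * w"
    and "b' \<equiv> b - 6 * r - 6 * s"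
    and "k' \<equiv> k - 10 * b * r - 24 * b * s - 10 * e * r + 24 * e * s + 90 * r * s + 45 * r^2 + 36 * s^2 - 18 * w"
  shows "W_of e' b' = W_of e b" "Phi41_of e' e4' b' k' = Phi41_of e e4 b k + 2 * W_of e b * r"
  unfolding W_of_def Phi41_of_def e'_def e4'_def b'_def k'_def
  by (simp_all add: power2_eq_square algebra_simps)

text \<open>This explains the numbers 10/3 and 5/4. With \<open>\<Phi>\<close> for
  \<open>Phi41\<close>, the shear changes \<open>Phi50\<close> by
  \<open>- 20/3 * W^2 * r + 5 * r * \<Phi> + 5 * W * r^2\<close>. Since \<open>\<Phi>\<close> grows
  by \<open>2 * W * r\<close>, the first term is cancelled by \<open>10/3 * W * \<Phi>\<close> and
  the other two by \<open>5/4 * \<Phi>^2 / W\<close>.\<close>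

lemma M_shear:
  fixes e e4 b k e5 r s w :: real
  defines "e' \<equiv> e - 3 * r - 3 * s"
    and "e4' \<equiv> e4 - 4 * b * s - 10 * e * r + 30 * r * s + 15 * r^2 + 12 * s^2 - 6 * w"
    and "b' \<equiv> b - 6 * r - 6 * s"
    and "k' \<equiv> k - 10 * b * r - 24 * b * s - 10 * e * r + 24 * e * s + 90 * r * s + 45 * r^2 + 36 * s^2 - 18 * w"
    and "e5' \<equiv> 60 * b * r * s + 60 * b * s^2 - 10 * b * w - 5 * k * s + 60 * e * r * s + 105 * e * r^2 - 60 * e * s^2
      - 10 * e * w - 10 * e^2 * r - 15 * e4 * r + e5 - 270 * r * s^2 + 90 * r * w - 315 * r^2 * s - 105 * r^3
      + 90 * s * w - 60 * s^3"
  assumes nz: "W_of e b \<noteq> 0"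
  shows "M_of e' e4' b' k' e5' = M_of e e4 b k e5"
proof -
  define W where "W = W_of e b"
  define \<Phi> where "\<Phi> = Phi41_of e e4 b k"
  have W: "W_of e' b' = W" and \<Phi>: "Phi41_of e' e4' b' k' = \<Phi> + 2 * W * r"
    unfolding W_def \<Phi>_def e'_def e4'_def b'_def k'_def by (rule Phi41_shear)+
  have 5: "Phi50_of e' e4' b' k' e5' = Phi50_of e e4 b k e5 - 10 / 3 * W * (2 * W * r) + 5 * r * \<Phi> + 5 * W * r^2"
    unfolding Phi50_of_def W_def \<Phi>_def W_of_def Phi41_of_def e'_def e4'_def b'_def k'_def e5'_def
    by (simp add: power2_eq_square power3_eq_cube field_simps)
  have "(\<Phi> + 2 * W * r)^2 / W = \<Phi>^2 / W + 4 * r * \<Phi> + 4 * W * r^2"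
    using nz by (simp add: W_def power2_eq_square field_simps)
  then show ?thesis unfolding M_of_def W \<Phi> 5 W_def[symmetric] \<Phi>_def[symmetric]
    by (simp add: algebra_simps)
qed

lemma A_root: "root 3 (A_jet z) ^ 3 = A_jet z"
  by (rule odd_real_root_pow) simp

definition ad :: "jet \<Rightarrow> real" where "ad z = root 3 (A_jet z) / z (Fx 2)"

lemma ad_nz: "A_jet z \<noteq> 0 \<Longrightarrow> z (Fx 2) \<noteq> 0 \<Longrightarrow> ad z \<noteq> 0"
  by (simp add: ad_def)

lemma ad_cube: "z (Fx 2) \<noteq> 0 \<Longrightarrow> A_jet z = ad z ^ 3 * z (Fx 2) ^ 3"
  by (simp add: ad_def power_divide A_root)

text \<open>\<open>ad_e\<close>, \<open>ad_e4\<close>, \<open>ad_e5\<close>, \<open>ad_b\<close> and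
  \<open>ad_k\<close> are the derivatives of orders (3,0), (4,0), (5,0), (3,1) and (4,1) of the
  adapted graph, written in the original jet coordinates; see \<open>adapt_adapted5\<close>.\<close>

definition ad_e :: "jet \<Rightarrow> real" where "ad_e z = ad z * z (Fx 3) / z (Fx 2)"
definition ad_e4 :: "jet \<Rightarrow> real" where "ad_e4 z = ad z ^ 2 * z (Fx 4) / z (Fx 2)"
definition ad_e5 :: "jet \<Rightarrow> real" where "ad_e5 z = ad z ^ 3 * z (Fx 5) / z (Fx 2)"
definition ad_b :: "jet \<Rightarrow> real" where "ad_b z = B_jet z / (ad z ^ 2 * z (Fx 2) ^ 3)"
definition ad_k :: "jet \<Rightarrow> real" where "ad_k z = C_jet z / (ad z * z (Fx 2) ^ 3)"

lemma invariants_adapted: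
  assumes f: "z (Fx 2) \<noteq> 0" and A: "A_jet z \<noteq> 0"
  shows "W_inv z = W_of (ad_e z) (ad_b z)"
    "Phi41 z = Phi41_of (ad_e z) (ad_e4 z) (ad_b z) (ad_k z)"
    "Phi50 z = Phi50_of (ad_e z) (ad_e4 z) (ad_b z) (ad_k z) (ad_e5 z)"
    "M_inv z = M_of (ad_e z) (ad_e4 z) (ad_b z) (ad_k z) (ad_e5 z)"
proof -
  define \<alpha> f2 where "\<alpha> = ad z" and "f2 = z (Fx 2)"
  have nz: "\<alpha> \<noteq> 0" "f2 \<noteq> 0" using assms ad_nz by (auto simp: \<alpha>_def f2_def)
  have r: "root 3 (A_jet z) = \<alpha> * f2" using nz by (simp add: \<alpha>_def ad_def f2_def)
  have a: "A_jet z = \<alpha> ^ 3 * f2 ^ 3" using ad_cube[of z, OF f] by (simp add: \<alpha>_def f2_def)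
  show 1: "W_inv z = W_of (ad_e z) (ad_b z)"
    unfolding W_inv_def W_of_def ad_e_def ad_b_def r unfolding a \<alpha>_def[symmetric] f2_def[symmetric]
    using nz by (simp add: field_simps power2_eq_square power3_eq_cube)
  show 2: "Phi41 z = Phi41_of (ad_e z) (ad_e4 z) (ad_b z) (ad_k z)"
    unfolding Phi41_def Phi41_of_def ad_e_def ad_b_def ad_e4_def ad_k_def r unfolding a \<alpha>_def[symmetric] f2_def[symmetric]
    using nz by (simp add: field_simps eval_nat_numeral)
  show 3: "Phi50 z = Phi50_of (ad_e z) (ad_e4 z) (ad_b z) (ad_k z) (ad_e5 z)"
    unfolding Phi50_def Phi50_of_def ad_e_def ad_b_def ad_e4_def ad_k_def ad_e5_def a \<alpha>_def[symmetric] f2_def[symmetric]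
    using nz by (simp add: field_simps eval_nat_numeral)
  show "M_inv z = M_of (ad_e z) (ad_e4 z) (ad_b z) (ad_k z) (ad_e5 z)"
    unfolding M_inv_def M_of_def 1 2 3 ..
qed

text \<open>First order terms preserve the tangent plane, the quadratic part \<open>x^2/2\<close>
  preserves the null direction and fixes the vertical scale \<open>p^2\<close>, and the determinant
  then fixes the scale along the ruling. The coefficient of \<open>x^2 y\<close> is the first one
  that sees \<open>p\<close>, through its cube.\<close>

lemma linear_image_isotropy:
  assumes F: "expansion c \<rho> F (0, 0)" and c: "adapted5 c e e4 b k e5"
    and G: "expansion d \<rho>' G (0, 0)" and d: "d 1 0 = 0" "d 0 1 = 0" "d 2 0 = 1/2" "d 1 1 = 0" "d 0 2 = 0"
      "d 1 2 = 0" "d 0 3 = 0"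
    and rel: "linear_image A F G" and det: "det A = 1"
  defines "p \<equiv> A $ 1 $ 1"
  shows "A $ 3 $ 1 = 0" "A $ 3 $ 2 = 0" "A $ 1 $ 2 = 0" "A $ 3 $ 3 = p^2" "p^3 * A $ 2 $ 2 = 1" "2 * d 2 1 = p^3"
proof -
  have cs: "c 0 0 = 0" "c 1 0 = 0" "c 0 1 = 0" "c 2 0 = 1/2" "c 1 1 = 0" "c 0 2 = 0"
     "c 3 0 = e / 6" "c 2 1 = 1/2" "c 1 2 = 0" "c 0 3 = 0"
    using c[unfolded adapted5_def] by blast+
  note h = linear_image_hessian[OF F cs(1) G rel det]
  show 1: "A $ 3 $ 1 = 0" "A $ 3 $ 2 = 0" using h(5,6) by (simp_all add: cs d cs[unfolded One_nat_def] d[unfolded One_nat_def])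
  have "(A $ 1 $ 2)^2 = 0" using h(3) by (simp add: cs d cs[unfolded One_nat_def] d[unfolded One_nat_def])
  then show 2: "A $ 1 $ 2 = 0" by simp
  show 3: "A $ 3 $ 3 = p^2" using h(2) by (simp add: cs d cs[unfolded One_nat_def] d[unfolded One_nat_def] p_def)
  have "A $ 1 $ 1 * A $ 2 $ 2 * A $ 3 $ 3 = 1" using det unfolding det_linear_image by (simp add: 1 2)
  then show 4: "p^3 * A $ 2 $ 2 = 1" by (simp add: 3 p_def power2_eq_square power3_eq_cube algebra_simps)
  have p0: "p \<noteq> 0" using 4 by auto
  have *: "p^2 * (e / 6 + t / 2) = p * A $ 1 $ 3 / 2 + d 3 0 * p^3 + d 2 1 * p^2 * (A $ 2 $ 1 + A $ 2 $ 2 * t)" for t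
  proof -
    define U where "U = line_fps c 1 t"
    define Z where "Z i = fps_const (A $ i $ 1 * 1 + A $ i $ 2 * t) * fps_X + fps_const (A $ i $ 3) * U" for i
    have U: "U $$ 0 = 0" "U $$ 1 = 0" "U $$ 2 = 1/2" "U $$ 3 = e / 6 + t / 2"
      unfolding U_def line_fps_nths cs by simp_all
    have Z: "Z i $$ 0 = 0" "Z i $$ 1 = A $ i $ 1 + A $ i $ 2 * t" "Z i $$ 2 = A $ i $ 3 / 2" "Z i $$ 3 = A $ i $ 3 * (e / 6 + t / 2)" for i
      unfolding Z_def fps_add_nth fps_const_X_nths fps_mult_left_const_nth U by simp_all
    have "Z 3 $$ 3 = (\<Sum>(i, j) | i + j < 6. fps_const (d i j) * (Z 1 ^ i * Z 2 ^ j)) $$ 3"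
      using linear_image_line[OF F cs(1) G rel, of 3 1 t] by (simp add: Z_def U_def)
    then show ?thesis unfolding fps_compose_nths[OF Z(1) Z(1), of d] Z d 1 2 3 p_def[symmetric]
      by (simp add: algebra_simps)
  qed
  \<comment> \<open>\<open>R\<close> is affine in the slope and vanishes identically; its increment
    from 0 to 1 isolates the equation for \<open>d 2 1\<close>.\<close>
  define R where "R t = p^2 * (e / 6 + t / 2) - (p * A $ 1 $ 3 / 2 + d 3 0 * p^3 + d 2 1 * p^2 * (A $ 2 $ 1 + A $ 2 $ 2 * t))" for t
  have "R t = 0" for t using *[of t] by (simp add: R_def)
  moreover have "p^2 / 2 - d 2 1 * p^2 * A $ 2 $ 2 = R 1 - R 0" by (simp add: R_def field_simps)
  ultimately have "p^2 / 2 = d 2 1 * p^2 * A $ 2 $ 2" by simp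
  then have H: "d 2 1 * A $ 2 $ 2 = 1 / 2" using p0 by simp
  have "d 2 1 = d 2 1 * (p^3 * A $ 2 $ 2)" unfolding 4 by simp
  also have "\<dots> = p^3 * (d 2 1 * A $ 2 $ 2)" by (simp only: mult_ac)
  also have "\<dots> = p^3 * (1 / 2)" unfolding H ..
  finally show "2 * d 2 1 = p^3" by simp
qed

section \<open>Taylor coefficients in the adapted frame\<close>

definition parabolic_near :: "(real \<times> real \<Rightarrow> real) \<Rightarrow> real \<times> real \<Rightarrow> bool" where
  "parabolic_near F p \<longleftrightarrow> (\<forall>\<^sub>F q in nhds p. partial 2 0 F q * partial 0 2 F q - partial 1 1 F q ^ 2 = 0)"

lemma disc_coeffs:
  assumes "expansion c r F p"
  shows "partial 2 0 F p * partial 0 2 F p - partial 1 1 F p ^ 2 = 0 \<longleftrightarrow> 4 * c 2 0 * c 0 2 = c 1 1 ^ 2"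
  unfolding partial_eq_coeff[OF assms] by (simp add: fact_numeral mult.assoc)

lemma tendsto_nhds_affine:
  fixes f :: "real \<times> real \<Rightarrow> real \<times> real"
  assumes "isCont f p" shows "filterlim f (nhds (f p)) (nhds p)"
  using assms by (simp only: isCont_def tendsto_at_iff_tendsto_nhds)

lemma adapt_eq:
  "adapt z \<alpha> F p (h, l) = adapt_u z \<alpha> * F (fst p + (\<alpha> * h + adapt_xy z \<alpha> * l), snd p + adapt_y z \<alpha> * l)
    + (- adapt_u z \<alpha> * F p) + (- adapt_u z \<alpha> * z (Fx 1) * \<alpha>) * h
    + (- adapt_u z \<alpha> * (z (Fx 1) * adapt_xy z \<alpha> + z (Fxy 0) * adapt_y z \<alpha>)) * l"
  by (simp add: adapt_def centered_def algebra_simps)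

text \<open>Around each nearby point the adapted graph is a triangular substitution of
  \<open>F\<close> plus an affine function, which does not touch the second order. So the
  discriminant vanishes point by point.\<close>

lemma adapt_parabolic:
  assumes F: "analytic2_at F p" and par: "parabolic_near F p"
  shows "parabolic_near (adapt z \<alpha> F p) (0, 0)"
proof -
  let ?L = "\<lambda>q. (fst p + (\<alpha> * fst q + adapt_xy z \<alpha> * snd q), snd p + adapt_y z \<alpha> * snd q)"
  have "isCont ?L (0, 0)" by (intro continuous_intros)
  from tendsto_nhds_affine[OF this] have L: "filterlim ?L (nhds p) (nhds (0, 0))" by simp
  have "\<forall>\<^sub>F q in nhds p. analytic2_at F q \<and> partial 2 0 F q * partial 0 2 F q - partial 1 1 F q ^ 2 = 0"
    using analytic2_nearby[OF F] par unfolding parabolic_near_def by (rule eventually_conj)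
  with L have "\<forall>\<^sub>F q in nhds (0, 0). analytic2_at F (?L q) \<and> partial 2 0 F (?L q) * partial 0 2 F (?L q) - partial 1 1 F (?L q) ^ 2 = 0"
    unfolding filterlim_iff by blast
  then show ?thesis unfolding parabolic_near_def
  proof eventually_elim
    case (elim q)
    then obtain c r where c: "expansion c r F (?L q)" unfolding analytic2_expansion by blast
    let ?k = "adapt_u z \<alpha>"
    have H: "adapt z \<alpha> F p (fst q + h, snd q + l) = ?k * F (fst (?L q) + (\<alpha> * h + adapt_xy z \<alpha> * l), snd (?L q) + adapt_y z \<alpha> * l)
       + (- ?k * F p + (- ?k * z (Fx 1) * \<alpha>) * fst q + (- ?k * (z (Fx 1) * adapt_xy z \<alpha> + z (Fxy 0) * adapt_y z \<alpha>)) * snd q)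
       + (- ?k * z (Fx 1) * \<alpha>) * h + (- ?k * (z (Fx 1) * adapt_xy z \<alpha> + z (Fxy 0) * adapt_y z \<alpha>)) * l" for h l
      unfolding adapt_eq by (simp add: algebra_simps)
    obtain d s where d: "expansion d s (adapt z \<alpha> F p) q" "d 2 0 = ?k * \<alpha>^2 * c 2 0"
      "d 1 1 = ?k * (2 * \<alpha> * adapt_xy z \<alpha> * c 2 0 + \<alpha> * adapt_y z \<alpha> * c 1 1)"
      "d 0 2 = ?k * (adapt_xy z \<alpha>^2 * c 2 0 + adapt_xy z \<alpha> * adapt_y z \<alpha> * c 1 1 + adapt_y z \<alpha>^2 * c 0 2)"
      by (rule subst_coeffs[OF c H]) blast
    have "4 * c 2 0 * c 0 2 = c 1 1 ^ 2" using elim disc_coeffs[OF c] by simp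
    then have "4 * d 2 0 * d 0 2 = d 1 1 ^ 2" unfolding d(2-4) by algebra
    then show ?case using disc_coeffs[OF d(1)] by simp
  qed
qed

lemma adapt_expansion:
  fixes F p defines "z \<equiv> jet_of F p"
  assumes F: "analytic2_at F p" and par: "parabolic_near F p" and nz: "z (Fx 2) \<noteq> 0" "\<alpha> \<noteq> 0"
  obtains d s where "expansion d s (adapt z \<alpha> F p) (0, 0)" "d 0 0 = 0" "d 1 0 = 0" "d 0 1 = 0" "d 2 0 = 1/2" "d 1 1 = 0" "d 0 2 = 0"
    "d 3 0 = \<alpha> * z (Fx 3) / z (Fx 2) / 6" "d 2 1 = A_jet z / (\<alpha>^3 * z (Fx 2)^3) / 2" "d 1 2 = 0" "d 0 3 = 0"
    "d 4 0 = \<alpha>^2 * z (Fx 4) / z (Fx 2) / 24" "d 3 1 = B_jet z / (\<alpha>^2 * z (Fx 2)^3) / 6" "d 2 2 = 2 * d 2 1 ^ 2" "d 1 3 = 0" "d 0 4 = 0"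
    "d 5 0 = \<alpha>^3 * z (Fx 5) / z (Fx 2) / 120" "d 4 1 = C_jet z / (\<alpha> * z (Fx 2)^3) / 24"
    "d 3 2 = 6 * d 2 1 * d 3 1 - 12 * d 3 0 * d 2 1 ^ 2" "d 2 3 = 4 * d 2 1 ^ 3" "d 1 4 = 0" "d 0 5 = 0"
proof -
  obtain c r where c: "expansion c r F p" using F unfolding analytic2_expansion by blast
  have cz: "c 0 0 = F p" "c 1 0 = z (Fx 1)" "c 0 1 = z (Fxy 0)" "c 2 0 = z (Fx 2) / 2" "c 1 1 = z (Fxy 1)"
    "c 3 0 = z (Fx 3) / 6" "c 2 1 = z (Fxy 2) / 2" "c 4 0 = z (Fx 4) / 24" "c 3 1 = z (Fxy 3) / 6"
    "c 5 0 = z (Fx 5) / 120" "c 4 1 = z (Fxy 4) / 24"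
    unfolding z_def jet_of.simps partial_eq_coeff[OF c] using expansion_center[OF c] by (simp_all add: fact_numeral)
  let ?k = "adapt_u z \<alpha>"
  have H: "adapt z \<alpha> F p (fst (0, 0) + h, snd (0, 0) + l) = ?k * F (fst p + (\<alpha> * h + adapt_xy z \<alpha> * l), snd p + adapt_y z \<alpha> * l)
       + (- ?k * F p) + (- ?k * z (Fx 1) * \<alpha>) * h + (- ?k * (z (Fx 1) * adapt_xy z \<alpha> + z (Fxy 0) * adapt_y z \<alpha>)) * l" for h l
    unfolding fst_conv snd_conv add_0 adapt_eq by simp
  obtain d s where E: "expansion d s (adapt z \<alpha> F p) (0, 0)"
    and d: "d 0 0 = ?k * c 0 0 + (- ?k * F p)" "d 1 0 = ?k * \<alpha> * c 1 0 + (- ?k * z (Fx 1) * \<alpha>)"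
    "d 0 1 = ?k * (adapt_xy z \<alpha> * c 1 0 + adapt_y z \<alpha> * c 0 1) + (- ?k * (z (Fx 1) * adapt_xy z \<alpha> + z (Fxy 0) * adapt_y z \<alpha>))"
    "d 2 0 = ?k * \<alpha>^2 * c 2 0" "d 1 1 = ?k * (2 * \<alpha> * adapt_xy z \<alpha> * c 2 0 + \<alpha> * adapt_y z \<alpha> * c 1 1)"
    "d 3 0 = ?k * \<alpha>^3 * c 3 0" "d 2 1 = ?k * \<alpha>^2 * (3 * adapt_xy z \<alpha> * c 3 0 + adapt_y z \<alpha> * c 2 1)"
    "d 4 0 = ?k * \<alpha>^4 * c 4 0" "d 3 1 = ?k * \<alpha>^3 * (4 * adapt_xy z \<alpha> * c 4 0 + adapt_y z \<alpha> * c 3 1)"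
    "d 5 0 = ?k * \<alpha>^5 * c 5 0" "d 4 1 = ?k * \<alpha>^4 * (5 * adapt_xy z \<alpha> * c 5 0 + adapt_y z \<alpha> * c 4 1)"
    by (rule subst_coeffs[OF c H]) blast
  note defs = adapt_u_def adapt_xy_def adapt_y_def cz A_jet_def B_jet_def C_jet_def
  have d2: "d 2 0 = 1/2" "d 1 1 = 0" using nz unfolding d defs by (simp_all add: field_simps power2_eq_square power3_eq_cube)
  note P = parabolic_coeffs[OF E adapt_parabolic[OF F par, unfolded parabolic_near_def] d2]
  show ?thesis
  proof (rule that[OF E _ _ _ d2 P(1) _ _ P(2,3) _ _ P(4,5,6) _ _ P(7,8,9,10)])
    show "d 0 0 = 0" "d 1 0 = 0" "d 0 1 = 0" unfolding d cz by (simp_all add: algebra_simps)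
    show "d 3 0 = \<alpha> * z (Fx 3) / z (Fx 2) / 6" "d 2 1 = A_jet z / (\<alpha>^3 * z (Fx 2)^3) / 2"
      "d 4 0 = \<alpha>^2 * z (Fx 4) / z (Fx 2) / 24" "d 3 1 = B_jet z / (\<alpha>^2 * z (Fx 2)^3) / 6"
      "d 5 0 = \<alpha>^3 * z (Fx 5) / z (Fx 2) / 120" "d 4 1 = C_jet z / (\<alpha> * z (Fx 2)^3) / 24"
      using nz unfolding d defs by (simp_all add: field_simps eval_nat_numeral)
  qed
qed

lemma adapt_adapted5:
  fixes F p defines "z \<equiv> jet_of F p"
  assumes F: "analytic2_at F p" and par: "parabolic_near F p" and nz: "z (Fx 2) \<noteq> 0" "A_jet z \<noteq> 0"
  obtains d s where "expansion d s (adapt z (ad z) F p) (0, 0)" "adapted5 d (ad_e z) (ad_e4 z) (ad_b z) (ad_k z) (ad_e5 z)"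
proof (rule adapt_expansion[OF F par nz(1)[unfolded z_def], of "ad z", folded z_def])
  show "ad z \<noteq> 0" using ad_nz nz by simp
  fix d s
  assume d: "expansion d s (adapt z (ad z) F p) (0, 0)" "d 0 0 = 0" "d 1 0 = 0" "d 0 1 = 0" "d 2 0 = 1/2" "d 1 1 = 0" "d 0 2 = 0"
    "d 3 0 = ad z * z (Fx 3) / z (Fx 2) / 6" "d 2 1 = A_jet z / (ad z^3 * z (Fx 2)^3) / 2" "d 1 2 = 0" "d 0 3 = 0"
    "d 4 0 = ad z^2 * z (Fx 4) / z (Fx 2) / 24" "d 3 1 = B_jet z / (ad z^2 * z (Fx 2)^3) / 6" "d 2 2 = 2 * d 2 1 ^ 2" "d 1 3 = 0" "d 0 4 = 0"
    "d 5 0 = ad z^3 * z (Fx 5) / z (Fx 2) / 120" "d 4 1 = C_jet z / (ad z * z (Fx 2)^3) / 24"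
    "d 3 2 = 6 * d 2 1 * d 3 1 - 12 * d 3 0 * d 2 1 ^ 2" "d 2 3 = 4 * d 2 1 ^ 3" "d 1 4 = 0" "d 0 5 = 0"
  have s: "d 2 1 = 1/2" unfolding d(9) using ad_cube[of z] nz ad_nz[of z] by simp
  have t: "d 3 0 = ad_e z / 6" "d 4 0 = ad_e4 z / 24" "d 3 1 = ad_b z / 6" "d 5 0 = ad_e5 z / 120" "d 4 1 = ad_k z / 24"
    unfolding d ad_e_def ad_e4_def ad_b_def ad_k_def ad_e5_def by simp_all
  have u: "d 2 2 = 1/2" "d 2 3 = 1/2" "d 3 2 = (ad_b z - ad_e z) / 2"
    unfolding d(14,19,20) s t by (simp_all add: field_simps power2_eq_square power3_eq_cube)
  have "adapted5 d (ad_e z) (ad_e4 z) (ad_b z) (ad_k z) (ad_e5 z)"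
    unfolding adapted5_def using d(2-7,10,11,15,16,21,22) s t u by blast
  with d(1) show thesis by (rule that)
qed

lemma adapted5_eq:
  assumes "adapted5 d e e4 b k e5" "adapted5 d e' e4' b' k' e5'"
  shows "e' = e" "e4' = e4" "b' = b" "k' = k" "e5' = e5"
  using assms by (simp_all add: adapted5_def)

lemma mat3_eqI:
  fixes A B :: "real ^ 3 ^ 3"
  assumes "A $ 1 $ 1 = B $ 1 $ 1" "A $ 1 $ 2 = B $ 1 $ 2" "A $ 1 $ 3 = B $ 1 $ 3"
    "A $ 2 $ 1 = B $ 2 $ 1" "A $ 2 $ 2 = B $ 2 $ 2" "A $ 2 $ 3 = B $ 2 $ 3"
    "A $ 3 $ 1 = B $ 3 $ 1" "A $ 3 $ 2 = B $ 3 $ 2" "A $ 3 $ 3 = B $ 3 $ 3"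
  shows "A = B"
  using assms by (simp add: vec_eq_iff forall_3)

text \<open>Since \<open>2 * d 2 1 = 1\<close> on the target as well, the remaining scale has cube 1
  and is therefore 1 over the reals.\<close>

lemma linear_image_adapted_shear:
  assumes F: "expansion c \<rho> F (0, 0)" and c: "adapted5 c e e4 b k e5"
    and G: "expansion d \<rho>' G (0, 0)" and d: "adapted5 d e' e4' b' k' e5'"
    and rel: "linear_image A F G" and det: "det A = 1"
  obtains r s w where "A = shear r s w"
proof -
  have ds: "d 1 0 = 0" "d 0 1 = 0" "d 2 0 = 1/2" "d 1 1 = 0" "d 0 2 = 0" "d 1 2 = 0" "d 0 3 = 0" "d 2 1 = 1/2"
    using d[unfolded adapted5_def] by blast+
  note i = linear_image_isotropy[OF F c G ds(1-7) rel det]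
  have "(A $ 1 $ 1)^3 = 1" using i(6) ds(8) by simp
  then have p: "A $ 1 $ 1 = 1" using odd_real_root_power_cancel[of 3 "A $ 1 $ 1"] by simp
  have "A = shear (A $ 1 $ 3) (A $ 2 $ 1) (A $ 2 $ 3)"
    by (rule mat3_eqI) (use i p in \<open>simp_all add: shear_nth\<close>)
  then show ?thesis by (rule that)
qed

text \<open>In adapted frames on both sides the linear map becomes a shear, so its effect on the
  5-jet is explicit. No nearness to the identity enters: the values agree for every matrix of
  determinant 1.\<close>

theorem linear_image_invariants:
  fixes F G p p' defines "z \<equiv> jet_of F p" and "z' \<equiv> jet_of G p'"
  assumes F: "analytic2_at F p" "parabolic_near F p" "z (Fx 2) \<noteq> 0" "A_jet z \<noteq> 0"
    and G: "analytic2_at G p'" "parabolic_near G p'" "z' (Fx 2) \<noteq> 0"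
    and rel: "linear_image B (centered F p) (centered G p')" and det: "det B = 1"
  shows "A_jet z' \<noteq> 0" "W_inv z' = W_inv z" "W_inv z \<noteq> 0 \<Longrightarrow> M_inv z' = M_inv z"
proof -
  have a: "ad z \<noteq> 0" using ad_nz F by simp
  obtain c \<rho> where c: "expansion c \<rho> (adapt z (ad z) F p) (0, 0)" "adapted5 c (ad_e z) (ad_e4 z) (ad_b z) (ad_k z) (ad_e5 z)"
    by (rule adapt_adapted5[OF F[unfolded z_def], folded z_def])
  define B' where "B' = B ** adapt_mat z (ad z)"
  have rel': "linear_image B' (adapt z (ad z) F p) (centered G p')"
    unfolding B'_def by (rule linear_image_adapt_source[where z = z and \<alpha> = "ad z", OF rel a F(3)])
  have det': "det (adapt_inv z' \<alpha> ** B') = 1" if "\<alpha> \<noteq> 0" for \<alpha>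
    unfolding B'_def det_mul using det adapt_det a F(3) G(3) that by simp
  \<comment> \<open>The scale \<open>ad z'\<close> is usable only once it is known to be nonzero, so
    this is shown first in the frame of the target with scale 1.\<close>
  show A: "A_jet z' \<noteq> 0"
  proof -
    obtain d s where d: "expansion d s (adapt z' 1 G p') (0, 0)" "d 1 0 = 0" "d 0 1 = 0" "d 2 0 = 1/2" "d 1 1 = 0" "d 0 2 = 0"
      "d 2 1 = A_jet z' / (1^3 * z' (Fx 2)^3) / 2" "d 1 2 = 0" "d 0 3 = 0"
      by (rule adapt_expansion[OF G[unfolded z'_def], of 1, folded z'_def]) (simp, blast)
    have "linear_image (adapt_inv z' 1 ** B') (adapt z (ad z) F p) (adapt z' 1 G p')"
      by (rule linear_image_adapt_target[OF rel']) (use G in auto)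
    note i = linear_image_isotropy[OF c d(1-6,8,9) this det'[of 1]]
    have "d 2 1 \<noteq> 0" using i(5,6) by auto
    then show ?thesis unfolding d(7) by auto
  qed
  have a': "ad z' \<noteq> 0" using ad_nz A G(3) by simp
  obtain d s where d: "expansion d s (adapt z' (ad z') G p') (0, 0)" "adapted5 d (ad_e z') (ad_e4 z') (ad_b z') (ad_k z') (ad_e5 z')"
    by (rule adapt_adapted5[OF G[unfolded z'_def] A[unfolded z'_def], folded z'_def])
  have rel2: "linear_image (adapt_inv z' (ad z') ** B') (adapt z (ad z) F p) (adapt z' (ad z') G p')"
    by (rule linear_image_adapt_target[where z = z' and \<alpha> = "ad z'", OF rel' a' G(3)])
  obtain r s w where sh: "adapt_inv z' (ad z') ** B' = shear r s w"
    by (rule linear_image_adapted_shear[OF c d rel2 det'[OF a']])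
  note eqs = adapted5_eq[OF adapted5_shear[OF c d(1) rel2[unfolded sh]] d(2)]
  show W: "W_inv z' = W_inv z"
    unfolding invariants_adapted(1)[OF F(3,4)] invariants_adapted(1)[OF G(3) A] eqs by (rule Phi41_shear)
  assume "W_inv z \<noteq> 0"
  then have "W_of (ad_e z) (ad_b z) \<noteq> 0" unfolding invariants_adapted(1)[OF F(3,4)] .
  then show "M_inv z' = M_inv z"
    unfolding invariants_adapted(4)[OF F(3,4)] invariants_adapted(4)[OF G(3) A] eqs by (rule M_shear)
qed

section \<open>Images of branch surfaces\<close>

text \<open>The third column of \<open>B\<close> is the preimage of the vertical direction. If it
  were tangent to the graph, its base part would lie in the kernel of the 2 by 2 differential, hence
  vanish, and with it the whole column.\<close>

lemma transversal_inverse: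
  fixes A B :: "real ^ 3 ^ 3"
  assumes AB: "A ** B = mat 1"
    and T: "(A $ 1 $ 1 + A $ 1 $ 3 * m) * (A $ 2 $ 2 + A $ 2 $ 3 * n) - (A $ 1 $ 2 + A $ 1 $ 3 * n) * (A $ 2 $ 1 + A $ 2 $ 3 * m) \<noteq> 0"
  shows "B $ 3 $ 3 - m * B $ 1 $ 3 - n * B $ 2 $ 3 \<noteq> 0"
proof
  define v1 v2 v3 where "v1 = B $ 1 $ 3" and "v2 = B $ 2 $ 3" and "v3 = B $ 3 $ 3"
  assume "B $ 3 $ 3 - m * B $ 1 $ 3 - n * B $ 2 $ 3 = 0"
  then have v3: "v3 = m * v1 + n * v2" by (simp add: v1_def v2_def v3_def)
  have e: "A $ i $ 1 * v1 + A $ i $ 2 * v2 + A $ i $ 3 * v3 = (if i = 3 then 1 else 0)" for i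
    using arg_cong[OF AB, of "\<lambda>M. M $ i $ 3"] by (simp add: matrix_matrix_mult_def sum_3 mat_def v1_def v2_def v3_def)
  define a b c d where "a = A $ 1 $ 1 + A $ 1 $ 3 * m" and "b = A $ 1 $ 2 + A $ 1 $ 3 * n"
    and "c = A $ 2 $ 1 + A $ 2 $ 3 * m" and "d = A $ 2 $ 2 + A $ 2 $ 3 * n"
  have 1: "a * v1 + b * v2 = 0" "c * v1 + d * v2 = 0"
    using e[of 1] e[of 2] by (simp_all add: v3 a_def b_def c_def d_def algebra_simps)
  have "(a * d - b * c) * v1 = d * (a * v1 + b * v2) - b * (c * v1 + d * v2)"
    "(a * d - b * c) * v2 = a * (c * v1 + d * v2) - c * (a * v1 + b * v2)" by (simp_all add: algebra_simps)
  then have "(a * d - b * c) * v1 = 0" "(a * d - b * c) * v2 = 0" unfolding 1 by simp_all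
  then have "v1 = 0" "v2 = 0" using T unfolding a_def[symmetric] b_def[symmetric] c_def[symmetric] d_def[symmetric] by simp_all
  then show False using e[of 3] v3 by simp
qed

text \<open>A point belongs to the image exactly if its preimage satisfies the graph equation
  \<open>\<Phi> = 0\<close>. Transversality makes the vertical derivative \<open>\<kappa>\<close> of
  \<open>\<Phi>\<close> nonzero, so the equation can be solved for the height.\<close>

lemma graph_local:
  fixes F :: "real \<times> real \<Rightarrow> real" and g :: "(real ^ 3 ^ 3) \<times> (real ^ 3)"
  defines "A \<equiv> fst g"
  assumes D: "open D" "p \<in> D" and F: "analytic2_at F p" and g: "g \<in> SA3"
    and T: "(A $ 1 $ 1 + A $ 1 $ 3 * partial 1 0 F p) * (A $ 2 $ 2 + A $ 2 $ 3 * partial 0 1 F p)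
      - (A $ 1 $ 2 + A $ 1 $ 3 * partial 0 1 F p) * (A $ 2 $ 1 + A $ 2 $ 3 * partial 1 0 F p) \<noteq> 0"
  obtains E G p' V V' where "open E" "p' \<in> E" "\<And>q. q \<in> E \<Longrightarrow> analytic2_at G q" "act g (point F p) = point G p'"
    "open V" "point F p \<in> V" "open V'" "\<And>q. q \<in> E \<Longrightarrow> point G q \<in> V'" "act g ` (surface D F \<inter> V) = surface E G \<inter> V'"
proof -
  define B where "B = matrix_inv A"
  have AB: "A ** B = mat 1" "B ** A = mat 1" using SA3_inv_mult[OF g] by (auto simp: A_def B_def)
  define m n where "m = partial 1 0 F p" and "n = partial 0 1 F p"
  define \<kappa> where "\<kappa> = B $ 3 $ 3 - m * B $ 1 $ 3 - n * B $ 2 $ 3"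
  have \<kappa>: "\<kappa> \<noteq> 0" using transversal_inverse[OF AB(1) T] by (simp add: \<kappa>_def m_def n_def)
  define P' where "P' = act g (point F p)"
  define l where "l i h = B $ i $ 1 * h 0 + B $ i $ 2 * h 1 + B $ i $ 3 * h (2::nat)" for i :: 3 and h :: "nat \<Rightarrow> real"
  \<comment> \<open>The height by which the preimage of the point with displacement \<open>h\<close>
    from \<open>P'\<close> misses the graph of \<open>F\<close>.\<close>
  define \<Phi> where "\<Phi> h = F p + l 3 h - F (fst p + l 1 h, snd p + l 2 h)" for h
  have lan: "an {..<3} (l i)" for i
    unfolding l_def by (intro an_add an_cmult an_var finite_lessThan) auto
  have l0: "l i (\<lambda>_. 0) = 0" for i by (simp add: l_def)
  have Fan: "an {..<2::nat} (\<lambda>h. F (fst p + h 0, snd p + h 1))" using F by (simp add: analytic2_at_iff)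
  have "an {..<3} (\<lambda>h. F (fst p + (\<lambda>i. (if i = (0::nat) then l 1 else l 2) h) 0, snd p + (\<lambda>i. (if i = (0::nat) then l 1 else l 2) h) 1))"
    by (rule an_compose[OF Fan, of "{..<3}" "\<lambda>i. if i = 0 then l 1 else l 2"]) (use lan l0 in auto)
  then have \<Phi>an: "an {..<3} \<Phi>" unfolding \<Phi>_def by (intro an_diff an_add an_const lan finite_lessThan) simp
  \<comment> \<open>A simplified Newton step: its fixed points in the last variable are the zeros of
    \<open>\<Phi>\<close>, and its derivative in that variable vanishes at the origin.\<close>
  define H where "H h = h 2 - (1 / \<kappa>) * \<Phi> h" for h
  have "an {..<3} H" unfolding H_def by (intro an_diff an_cmult an_var \<Phi>an finite_lessThan) auto
  then have Han: "an {..<Suc 2} H" by (simp add: eval_nat_numeral)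
  have H0: "H (\<lambda>_. 0) = 0" by (simp add: H_def \<Phi>_def l_def)
  \<comment> \<open>On the last axis \<open>H\<close> is, up to the factor
    \<open>1 / \<kappa>\<close>, the difference of \<open>F\<close> and its first order part, hence
    quadratically small.\<close>
  have dH: "((\<lambda>u. H ((\<lambda>_. 0)(2 := u))) has_real_derivative 0) (at 0)"
  proof -
    obtain c r where c: "expansion c r F p" using F unfolding analytic2_expansion by blast
    have cmn: "c 1 0 = m" "c 0 1 = n" "c 0 0 = F p"
      using partial_eq_coeff[OF c] by (simp_all add: m_def n_def expansion_center[OF c])
    define a b where "a = B $ 1 $ 3" and "b = B $ 2 $ 3"
    obtain C s where s: "s > 0" and C: "\<And>h k. \<bar>h\<bar> < s \<Longrightarrow> \<bar>k\<bar> < s \<Longrightarrow>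
      \<bar>F (fst p + h, snd p + k) - (\<Sum>(i, j) | i + j < 2. c i j * h ^ i * k ^ j)\<bar> \<le> C * (\<bar>h\<bar> + \<bar>k\<bar>) ^ 2"
      by (rule expansion_remainder[OF c, of 2]) blast
    have S: "(\<Sum>(i, j) | i + j < 2. c i j * h ^ i * k ^ j) = F p + m * h + n * k" for h k
    proof -
      have "{(i::nat, j). i + j < 2} = {(0, 0), (1, 0), (0, 1)}" by auto
      then show ?thesis by (simp add: cmn cmn[unfolded One_nat_def])
    qed
    have Hu: "H ((\<lambda>_. 0)(2 := u)) = (1 / \<kappa>) * (F (fst p + a * u, snd p + b * u) - (F p + m * (a * u) + n * (b * u)))" for u
      using \<kappa> by (simp add: H_def \<Phi>_def l_def a_def b_def \<kappa>_def field_simps)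
    define K where "K = \<bar>a\<bar> + \<bar>b\<bar> + 1"
    have K: "K > 0" "\<bar>a\<bar> < K" "\<bar>b\<bar> < K" "\<bar>a\<bar> + \<bar>b\<bar> \<le> K" by (auto simp: K_def)
    have C0: "\<bar>C\<bar> \<ge> C" by simp
    have bound: "\<bar>H ((\<lambda>_. 0)(2 := u))\<bar> \<le> (\<bar>1 / \<kappa>\<bar> * \<bar>C\<bar> * K ^ 2) * u ^ 2" if u: "\<bar>u\<bar> < s / K" for u
    proof -
      have us: "\<bar>u\<bar> * K < s" using u K by (simp add: field_simps)
      have au: "\<bar>a * u\<bar> < s" "\<bar>b * u\<bar> < s"
        using us K mult_right_mono[of "\<bar>a\<bar>" K "\<bar>u\<bar>"] mult_right_mono[of "\<bar>b\<bar>" K "\<bar>u\<bar>"] by (auto simp: abs_mult mult.commute)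
      have "\<bar>F (fst p + a * u, snd p + b * u) - (F p + m * (a * u) + n * (b * u))\<bar> \<le> C * (\<bar>a * u\<bar> + \<bar>b * u\<bar>) ^ 2"
        using C[OF au] unfolding S .
      also have "\<dots> \<le> \<bar>C\<bar> * (K * \<bar>u\<bar>) ^ 2"
      proof (intro mult_mono power_mono C0)
        have "\<bar>a * u\<bar> + \<bar>b * u\<bar> = (\<bar>a\<bar> + \<bar>b\<bar>) * \<bar>u\<bar>" by (simp add: abs_mult algebra_simps)
        then show "\<bar>a * u\<bar> + \<bar>b * u\<bar> \<le> K * \<bar>u\<bar>" using K by (simp add: mult_right_mono)
      qed auto
      finally have "\<bar>1 / \<kappa>\<bar> * \<bar>F (fst p + a * u, snd p + b * u) - (F p + m * (a * u) + n * (b * u))\<bar> \<le> \<bar>1 / \<kappa>\<bar> * (\<bar>C\<bar> * (K * \<bar>u\<bar>) ^ 2)"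
        by (rule mult_left_mono) simp
      then show ?thesis unfolding Hu abs_mult by (simp add: power_mult_distrib mult_ac)
    qed
    show ?thesis
      unfolding has_field_derivative_iff
    proof (rule Lim_null_comparison[where g = "\<lambda>u. (\<bar>1 / \<kappa>\<bar> * \<bar>C\<bar> * K ^ 2) * \<bar>u\<bar>"])
      have h0: "H ((\<lambda>_. 0)(2 := 0)) = 0" using H0 by (simp add: fun_upd_idem)
      show "\<forall>\<^sub>F u in at 0. norm ((H ((\<lambda>_. 0)(2 := u)) - H ((\<lambda>_. 0)(2 := 0))) / (u - 0)) \<le> (\<bar>1 / \<kappa>\<bar> * \<bar>C\<bar> * K ^ 2) * \<bar>u\<bar>"
        unfolding eventually_at
      proof (intro exI[of _ "s / K"] conjI ballI impI)
        fix u :: real assume u: "u \<noteq> 0 \<and> dist u 0 < s / K"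
        then have "\<bar>H ((\<lambda>_. 0)(2 := u))\<bar> \<le> (\<bar>1 / \<kappa>\<bar> * \<bar>C\<bar> * K ^ 2) * \<bar>u\<bar> * \<bar>u\<bar>"
          using bound[of u] by (simp add: power2_eq_square mult.assoc)
        then show "norm ((H ((\<lambda>_. 0)(2 := u)) - H ((\<lambda>_. 0)(2 := 0))) / (u - 0)) \<le> (\<bar>1 / \<kappa>\<bar> * \<bar>C\<bar> * K ^ 2) * \<bar>u\<bar>"
          unfolding h0 using u by (simp add: divide_le_eq)
      qed (use s K in auto)
      have "((\<lambda>u. (\<bar>1 / \<kappa>\<bar> * \<bar>C\<bar> * K ^ 2) * \<bar>u\<bar>) \<longlongrightarrow> (\<bar>1 / \<kappa>\<bar> * \<bar>C\<bar> * K ^ 2) * \<bar>0\<bar>) (at (0::real))"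
        by (intro tendsto_intros)
      then show "((\<lambda>u. (\<bar>1 / \<kappa>\<bar> * \<bar>C\<bar> * K ^ 2) * \<bar>u\<bar>) \<longlongrightarrow> 0) (at (0::real))" by simp
    qed
  qed
  obtain d where d: "d > 0" "\<And>h k. \<bar>h\<bar> < d \<Longrightarrow> \<bar>k\<bar> < d \<Longrightarrow> (fst p + h, snd p + k) \<in> D"
    using eventually_nhds_in_open[OF D] unfolding eventually_nhds_box by blast
  \<comment> \<open>One more than the sum of the absolute entries of \<open>B\<close>: displacements
    below \<open>d / K\<close> are carried by \<open>B\<close> to displacements below
    \<open>d\<close>, where the base point stays in \<open>D\<close>.\<close>
  define K where "K = (\<Sum>i\<in>UNIV. \<Sum>j\<in>UNIV. \<bar>B $ i $ j\<bar>) + 1"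
  have K: "K > 0" unfolding K_def by (intro add_nonneg_pos sum_nonneg) auto
  have lb: "\<bar>l i h\<bar> < d" if "\<bar>h 0\<bar> < d / K" "\<bar>h 1\<bar> < d / K" "\<bar>h 2\<bar> < d / K" for i h
  proof -
    have dK: "0 \<le> d / K" using d K by simp
    have "\<bar>l i h\<bar> \<le> \<bar>B $ i $ 1\<bar> * \<bar>h 0\<bar> + \<bar>B $ i $ 2\<bar> * \<bar>h 1\<bar> + \<bar>B $ i $ 3\<bar> * \<bar>h 2\<bar>"
      unfolding l_def abs_mult[symmetric] by linarith
    also have "\<dots> \<le> \<bar>B $ i $ 1\<bar> * (d / K) + \<bar>B $ i $ 2\<bar> * (d / K) + \<bar>B $ i $ 3\<bar> * (d / K)"
      using that by (intro add_mono mult_left_mono) auto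
    also have "\<dots> = (\<Sum>j\<in>UNIV. \<bar>B $ i $ j\<bar>) * (d / K)" by (simp add: sum_3 algebra_simps)
    also have "\<dots> \<le> (\<Sum>i\<in>UNIV. \<Sum>j\<in>UNIV. \<bar>B $ i $ j\<bar>) * (d / K)"
      using dK by (intro mult_right_mono member_le_sum) (auto intro: sum_nonneg)
    also have "\<dots> < K * (d / K)" unfolding K_def using d K by (intro mult_strict_right_mono) (auto simp: K_def)
    finally show ?thesis using K by simp
  qed
  have dK: "d / K > 0" using d K by simp
  obtain r \<rho> U where r: "0 < r" "r < d / K" "0 < \<rho>" "\<rho> < d / K" and U: "an {..<2} U" "U (\<lambda>_. 0) = 0"
    and fixU: "\<And>w. \<forall>i<2. \<bar>w i\<bar> \<le> r \<Longrightarrow> \<bar>U w\<bar> < \<rho> \<and> H (w(2 := U w)) = U w"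
    and uniU: "\<And>w u. \<forall>i<2. \<bar>w i\<bar> \<le> r \<Longrightarrow> \<bar>u\<bar> \<le> \<rho> \<Longrightarrow> H (w(2 := u)) = u \<Longrightarrow> u = U w"
    using analytic_fixed_point[OF Han H0 dH dK] by blast
  have HF: "H (w(2 := u)) = u \<longleftrightarrow> \<Phi> (w(2 := u)) = 0" for w u
    using \<kappa> by (simp add: H_def)
  define w where "w q = (\<lambda>i::nat. if i = 0 then fst q - P' $ 1 else snd q - P' $ 2)" for q :: "real \<times> real"
  define G where "G q = P' $ 3 + U (w q)" for q
  define p' where "p' = (P' $ 1, P' $ 2)"
  have Gan: "analytic2_at G p'"
  proof -
    let ?\<sigma> = "\<lambda>i h. if i = (0::nat) then h (0::nat) else h 1"
    have \<sigma>: "an {..<2} (?\<sigma> i)" for i by (cases "i = 0") (auto intro!: an_var)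
    have "an {..<2} (\<lambda>h. U (\<lambda>i. ?\<sigma> i h))"
      by (rule an_compose[OF U(1), of "{..<2}" ?\<sigma>]) (use \<sigma> in auto)
    then have "an {..<2} (\<lambda>h. P' $ 3 + U (\<lambda>i. ?\<sigma> i h))" by (intro an_add an_const)
    then show ?thesis unfolding analytic2_at_iff G_def w_def p'_def fst_conv snd_conv add_diff_cancel_left' .
  qed
  obtain e where e: "e > 0" "\<And>h k. \<bar>h\<bar> < e \<Longrightarrow> \<bar>k\<bar> < e \<Longrightarrow> analytic2_at G (fst p' + h, snd p' + k)"
    using analytic2_nearby[OF Gan] unfolding eventually_nhds_box by blast
  define s where "s = min r e"
  have s: "s > 0" "s \<le> r" "s \<le> e" using r e by (auto simp: s_def)
  define E where "E = {q :: real \<times> real. \<bar>fst q - P' $ 1\<bar> < s \<and> \<bar>snd q - P' $ 2\<bar> < s}"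
  define V' where "V' = {v :: real ^ 3. \<bar>v $ 1 - P' $ 1\<bar> < s \<and> \<bar>v $ 2 - P' $ 2\<bar> < s \<and> \<bar>v $ 3 - P' $ 3\<bar> < \<rho>}"
  have openE: "open E" unfolding E_def by (intro open_Collect_conj open_Collect_less continuous_intros)
  have openV': "open V'" unfolding V'_def by (intro open_Collect_conj open_Collect_less continuous_intros)
  have p'E: "p' \<in> E" using s by (simp add: E_def p'_def)
  have GE: "analytic2_at G q" if "q \<in> E" for q
    using e(2)[of "fst q - P' $ 1" "snd q - P' $ 2"] that s by (simp add: E_def p'_def)
  have wE: "\<forall>i<2. \<bar>w q i\<bar> \<le> r" if "q \<in> E" for q
    using that s by (auto simp: w_def E_def)
  have GV: "point G q \<in> V'" if "q \<in> E" for q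
    using that fixU[OF wE[OF that]] by (simp add: V'_def E_def G_def)
  have w0: "w p' = (\<lambda>_. 0)" by (auto simp: w_def p'_def)
  have P'G: "P' = point G p'"
    by (simp add: vec_eq_iff forall_3) (simp add: p'_def[symmetric] G_def w0 U, simp add: p'_def)
  have key: "act g v $ 1 - P' $ 1 = h 0 \<and> act g v $ 2 - P' $ 2 = h 1 \<and> act g v $ 3 - P' $ 3 = h 2 \<longleftrightarrow>
      v $ 1 = fst p + l 1 h \<and> v $ 2 = snd p + l 2 h \<and> v $ 3 = F p + l 3 h" for v :: "real ^ 3" and h :: "nat \<Rightarrow> real"
  proof -
    define H3 :: "real ^ 3" where "H3 = vector [h 0, h 1, h 2]"
    have "act g v - P' = A *v (v - point F p)"
      by (simp add: act_def P'_def A_def matrix_vector_mult_diff_distrib)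
    moreover have "A *v (v - point F p) = H3 \<longleftrightarrow> v - point F p = B *v H3"
      by (metis AB matrix_vector_mul_assoc matrix_vector_mul_lid)
    ultimately have "act g v - P' = H3 \<longleftrightarrow> v - point F p = B *v H3" by simp
    then show ?thesis
      by (simp add: vec_eq_iff forall_3 H3_def vector_3 matrix_vector_mult_def sum_3 l_def diff_eq_eq algebra_simps)
  qed
  define V where "V = act g -` V'"
  have "act g ` (surface D F \<inter> V) = surface E G \<inter> V'"
  proof (intro set_eqI iffI)
    fix x assume "x \<in> act g ` (surface D F \<inter> V)"
    then obtain v where v: "v \<in> surface D F" "act g v \<in> V'" "x = act g v" by (auto simp: V_def)
    define h where "h = (\<lambda>i::nat. if i = 0 then x $ 1 - P' $ 1 else if i = 1 then x $ 2 - P' $ 2 else x $ 3 - P' $ 3)"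
    have k: "v $ 1 = fst p + l 1 h" "v $ 2 = snd p + l 2 h" "v $ 3 = F p + l 3 h"
      using key[of v h] v(3) by (simp_all add: h_def)
    have "v $ 3 = F (v $ 1, v $ 2)" using v(1) by (simp add: in_surface)
    then have "\<Phi> h = 0" using k by (simp add: \<Phi>_def)
    have xE: "(x $ 1, x $ 2) \<in> E" using v(2,3) by (simp add: V'_def E_def)
    have wx: "((w (x $ 1, x $ 2))(2 := h 2)) i = h i" if "i < 3" for i
      using that by (auto simp: w_def h_def)
    have "\<Phi> ((w (x $ 1, x $ 2))(2 := h 2)) = \<Phi> h"
      unfolding \<Phi>_def l_def using wx[of 0] wx[of 1] wx[of 2] by simp
    then have "\<Phi> ((w (x $ 1, x $ 2))(2 := h 2)) = 0" using \<open>\<Phi> h = 0\<close> by simp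
    then have "h 2 = U (w (x $ 1, x $ 2))"
      using uniU[OF wE[OF xE], of "h 2"] HF v(2,3) by (simp add: V'_def h_def)
    then have "x $ 3 = G (x $ 1, x $ 2)" by (simp add: G_def h_def)
    then show "x \<in> surface E G \<inter> V'" using xE v(2,3) by (simp add: in_surface)
  next
    fix x assume x: "x \<in> surface E G \<inter> V'"
    then have xE: "(x $ 1, x $ 2) \<in> E" and x3: "x $ 3 = G (x $ 1, x $ 2)" by (simp_all add: in_surface)
    define q where "q = (x $ 1, x $ 2)"
    define h where "h = (w q)(2 := U (w q))"
    have fx: "\<bar>U (w q)\<bar> < \<rho>" "\<Phi> h = 0" using fixU[OF wE[OF xE]] HF by (simp_all add: q_def h_def)
    have hb: "\<bar>h 0\<bar> < d / K" "\<bar>h 1\<bar> < d / K" "\<bar>h 2\<bar> < d / K"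
      using xE s r fx by (auto simp: h_def w_def q_def E_def)
    define v :: "real ^ 3" where "v = vector [fst p + l 1 h, snd p + l 2 h, F p + l 3 h]"
    have vn: "v $ 1 = fst p + l 1 h" "v $ 2 = snd p + l 2 h" "v $ 3 = F p + l 3 h"
      by (simp_all add: v_def vector_3)
    have a: "act g v $ 1 - P' $ 1 = h 0" "act g v $ 2 - P' $ 2 = h 1" "act g v $ 3 - P' $ 3 = h 2"
      using key[of v h] vn by simp_all
    have gv: "act g v = x" using a x3 by (simp add: vec_eq_iff forall_3 h_def w_def q_def G_def)
    have "v \<in> surface D F" unfolding in_surface vn using d(2)[OF lb lb, OF hb hb] fx(2) by (simp add: \<Phi>_def)
    then show "x \<in> act g ` (surface D F \<inter> V)" using gv x by (auto simp: V_def)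
  qed
  moreover have "point F p \<in> V" using GV[OF p'E] P'G by (simp add: V_def P'_def)
  moreover have "open V" unfolding V_def by (rule open_vimage_act[OF openV'])
  ultimately show ?thesis
    using that[OF openE p'E GE _ _ _ openV' GV, of V] P'G by (simp add: P'_def)
qed

section \<open>Transport of the branch conditions\<close>

lemma branch_surface_near:
  assumes S: "branch_surface D F" and p: "p \<in> D"
  shows "open D" "analytic2_at F p" "parabolic_near F p" "jet_of F p (Fx 2) \<noteq> 0" "A_jet (jet_of F p) \<noteq> 0" "W_inv (jet_of F p) \<noteq> 0"
proof -
  show D: "open D" and "analytic2_at F p" using assms by (auto simp: branch_surface_def)
  have "\<forall>\<^sub>F q in nhds p. q \<in> D" using D p by (rule eventually_nhds_in_open)
  then show "parabolic_near F p" unfolding parabolic_near_def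
    by eventually_elim (use S in \<open>auto simp: branch_surface_def\<close>)
  have "jet_of F p \<in> branch_jets" using assms by (auto simp: branch_surface_def)
  then show "jet_of F p (Fx 2) \<noteq> 0" "A_jet (jet_of F p) \<noteq> 0" "W_inv (jet_of F p) \<noteq> 0"
    by (auto simp: branch_jets_def S_inv_def)
qed

text \<open>Equality of whole open pieces gives a germ equivalence at each of their points, so facts
  about a single germ spread to a neighbourhood.\<close>

lemma maps_germ_move:
  assumes "open V" "open V'" "act g ` (S \<inter> V) = S' \<inter> V'" "v \<in> S" "v \<in> V"
  shows "maps_germ g S v S' (act g v)"
  using assms unfolding maps_germ_def by blast

lemma centered_expansion:
  assumes "expansion c r F p"
  shows "expansion (\<lambda>i j. if i = 0 \<and> j = 0 then 0 else c i j) r (centered F p) (0, 0)"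
proof -
  have "F p = c 0 0" by (rule expansion_center[OF assms])
  have r: "r > 0" using assms by (simp add: expansion_def)
  show ?thesis unfolding expansion_def
  proof (intro conjI r allI impI)
    fix h k assume hk: "\<bar>h\<bar> < r \<and> \<bar>k\<bar> < r"
    then have 1: "((\<lambda>(i, j). c i j * h ^ i * k ^ j) has_sum F (fst p + h, snd p + k)) UNIV"
      using assms by (simp add: expansion_def)
    have "((\<lambda>(i::nat, j::nat). if i = 0 \<and> j = 0 then - c 0 0 else 0) has_sum - c 0 0) {(0, 0)}"
      using has_sum_finite[of "{(0::nat, 0::nat)}" "\<lambda>(i, j). if i = 0 \<and> j = 0 then - c 0 0 else 0"] by simp
    then have 2: "((\<lambda>(i::nat, j::nat). if i = 0 \<and> j = 0 then - c 0 0 else 0) has_sum - c 0 0) UNIV"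
      by (rule has_sum_cong_neutral[THEN iffD1, rotated -1]) (auto split: if_splits)
    have 3: "(\<lambda>z. (case z of (i, j) \<Rightarrow> c i j * h ^ i * k ^ j) + (case z of (i, j) \<Rightarrow> if i = 0 \<and> j = 0 then - c 0 0 else 0)) =
       (\<lambda>(i, j). (if i = 0 \<and> j = 0 then 0 else c i j) * h ^ i * k ^ j)" by (auto simp: fun_eq_iff)
    from has_sum_add[OF 1 2]
    show "((\<lambda>(i, j). (if i = 0 \<and> j = 0 then 0 else c i j) * h ^ i * k ^ j) has_sum
        centered F p (fst (0, 0) + h, snd (0, 0) + k)) UNIV"
      unfolding 3 by (simp add: centered_def \<open>F p = c 0 0\<close>)
  qed
qed

text \<open>Here \<open>L\<close> is the derivative of the map that \<open>g\<close> induces on the base coordinates.\<close>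

lemma linear_image_second_order:
  assumes F: "analytic2_at F p" and G: "analytic2_at G p'"
    and rel: "linear_image A (centered F p) (centered G p')" and det: "det A = 1"
    and par: "partial 2 0 F p * partial 0 2 F p - partial 1 1 F p ^ 2 = 0"
  defines "L \<equiv> \<lambda>i j. A $ i $ j + A $ i $ 3 * (if j = 1 then partial 1 0 F p else partial 0 1 F p)"
  shows "partial 2 0 G p' * partial 0 2 G p' - partial 1 1 G p' ^ 2 = 0"
    and "partial 2 0 F p \<noteq> 0 \<Longrightarrow> L 2 2 * partial 2 0 F p - L 2 1 * partial 1 1 F p \<noteq> 0 \<Longrightarrow> partial 2 0 G p' \<noteq> 0"
proof -
  obtain c r where c: "expansion c r F p" using F unfolding analytic2_expansion by blast
  obtain d s where d: "expansion d s G p'" using G unfolding analytic2_expansion by blast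
  define c' where "c' i j = (if i = 0 \<and> j = 0 then 0 else c i j)" for i j
  define d' where "d' i j = (if i = 0 \<and> j = 0 then 0 else d i j)" for i j
  note c' = centered_expansion[OF c, folded c'_def] and d' = centered_expansion[OF d, folded d'_def]
  have c'c: "c' 2 0 = c 2 0" "c' 1 1 = c 1 1" "c' 0 2 = c 0 2" "c' 1 0 = c 1 0" "c' 0 1 = c 0 1" "c' 0 0 = 0"
    and d'd: "d' 2 0 = d 2 0" "d' 1 1 = d 1 1" "d' 0 2 = d 0 2"
    by (simp_all add: c'_def d'_def)
  have disc: "4 * c' 2 0 * c' 0 2 = c' 1 1 ^ 2" using par disc_coeffs[OF c] by (simp only: c'c)
  have "4 * d' 2 0 * d' 0 2 = d' 1 1 ^ 2"
    by (rule linear_image_disc[OF c' c'c(6) d' rel det disc])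
  then show "partial 2 0 G p' * partial 0 2 G p' - partial 1 1 G p' ^ 2 = 0"
    using disc_coeffs[OF d] by (simp only: d'd)
  have P: "partial 1 0 F p = c' 1 0" "partial 0 1 F p = c' 0 1" "partial 2 0 F p = 2 * c' 2 0" "partial 1 1 F p = c' 1 1" "partial 2 0 G p' = 2 * d' 2 0"
    unfolding c'c d'd partial_eq_coeff[OF c] partial_eq_coeff[OF d] by (simp_all add: fact_numeral)
  define k where "k = A $ 3 $ 3 - d' 1 0 * A $ 1 $ 3 - d' 0 1 * A $ 2 $ 3"
  have Lc: "L i j = A $ i $ j + A $ i $ 3 * (if j = 1 then c' 1 0 else c' 0 1)" for i j by (simp only: L_def P)
  have h: "(L 1 1 * L 2 2 - L 1 2 * L 2 1) * k = 1"
    "k * c' 2 0 = d' 2 0 * L 1 1 ^ 2 + d' 1 1 * L 1 1 * L 2 1 + d' 0 2 * L 2 1 ^ 2"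
    "k * c' 0 2 = d' 2 0 * L 1 2 ^ 2 + d' 1 1 * L 1 2 * L 2 2 + d' 0 2 * L 2 2 ^ 2"
    "k * c' 1 1 = 2 * d' 2 0 * L 1 1 * L 1 2 + d' 1 1 * (L 1 1 * L 2 2 + L 1 2 * L 2 1) + 2 * d' 0 2 * L 2 1 * L 2 2"
    unfolding Lc k_def by (rule linear_image_hessian[OF c' c'c(6) d' rel det])+
  \<comment> \<open>The vector \<open>(L 2 2, - L 2 1)\<close> is mapped to the x-axis, so the
    second x-derivative of \<open>G\<close> is governed by the quadratic part of \<open>F\<close> on
    this vector. By degeneracy that value is \<open>X^2\<close> up to the factor
    \<open>4 * c' 2 0\<close>.\<close>
  define X where "X = L 2 2 * partial 2 0 F p - L 2 1 * partial 1 1 F p"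
  have "d' 2 0 * (L 1 1 * L 2 2 - L 1 2 * L 2 1) ^ 2 = k * (c' 2 0 * L 2 2 ^ 2 - c' 1 1 * L 2 2 * L 2 1 + c' 0 2 * L 2 1 ^ 2)"
  proof -
    have "k * (c' 2 0 * L 2 2 ^ 2 - c' 1 1 * L 2 2 * L 2 1 + c' 0 2 * L 2 1 ^ 2) =
      L 2 2 ^ 2 * (k * c' 2 0) - L 2 2 * L 2 1 * (k * c' 1 1) + L 2 1 ^ 2 * (k * c' 0 2)" by (simp only: algebra_simps)
    then show ?thesis unfolding h(2,3,4) by (simp add: power2_eq_square algebra_simps)
  qed
  moreover have "4 * c' 2 0 * (c' 2 0 * L 2 2 ^ 2 - c' 1 1 * L 2 2 * L 2 1 + c' 0 2 * L 2 1 ^ 2) = X ^ 2"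
  proof -
    have "4 * c' 2 0 * (c' 2 0 * L 2 2 ^ 2 - c' 1 1 * L 2 2 * L 2 1 + c' 0 2 * L 2 1 ^ 2) =
      4 * c' 2 0 ^ 2 * L 2 2 ^ 2 - 4 * c' 2 0 * c' 1 1 * L 2 2 * L 2 1 + (4 * c' 2 0 * c' 0 2) * L 2 1 ^ 2"
      by (simp add: power2_eq_square algebra_simps)
    then show ?thesis unfolding disc X_def P by (simp add: power2_eq_square algebra_simps)
  qed
  ultimately have e: "4 * c' 2 0 * (d' 2 0 * (L 1 1 * L 2 2 - L 1 2 * L 2 1) ^ 2) = k * X ^ 2" by (simp add: mult.left_commute)
  assume "partial 2 0 F p \<noteq> 0" "L 2 2 * partial 2 0 F p - L 2 1 * partial 1 1 F p \<noteq> 0"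
  then have "X \<noteq> 0" by (simp add: X_def)
  moreover have "k \<noteq> 0" using h(1) by auto
  ultimately show "partial 2 0 G p' \<noteq> 0" using e unfolding P by auto
qed

text \<open>Parabolicity and the conditions on \<open>A_jet\<close> and \<open>W_inv\<close> are
  transported along \<open>linear_image\<close>. A nonzero second x-derivative depends on the
  position of the graph and is therefore a hypothesis.\<close>

lemma branch_surface_image:
  assumes S: "branch_surface D F" and E: "open E" and G: "\<And>q. q \<in> E \<Longrightarrow> analytic2_at G q" and g: "g \<in> SA3"
    and m: "\<And>q'. q' \<in> E \<Longrightarrow> \<exists>q\<in>D. maps_germ g (surface D F) (point F q) (surface E' G) (point G q')"
    and nz: "\<And>q'. q' \<in> E \<Longrightarrow> partial 2 0 G q' \<noteq> 0"
  shows "branch_surface E G"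
proof -
  have det: "det (fst g) = 1" using g by (auto simp: SA3_def)
  have *: "\<exists>q\<in>D. linear_image (fst g) (centered F q) (centered G q')" if q': "q' \<in> E" for q'
  proof -
    obtain q where q: "q \<in> D" "maps_germ g (surface D F) (point F q) (surface E' G) (point G q')" using m[OF q'] by blast
    note b = branch_surface_near[OF S q(1)]
    show ?thesis using maps_germ_linear_image[OF q(2) b(1) q(1) analytic2_isCont[OF b(2)]] q(1) by blast
  qed
  have par: "partial 2 0 G q' * partial 0 2 G q' - partial 1 1 G q' ^ 2 = 0" if q': "q' \<in> E" for q'
  proof -
    obtain q where q: "q \<in> D" "linear_image (fst g) (centered F q) (centered G q')" using *[OF q'] by blast
    show ?thesis
      by (rule linear_image_second_order(1)[OF branch_surface_near(2)[OF S q(1)] G[OF q'] q(2) det])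
        (use S q in \<open>auto simp: branch_surface_def\<close>)
  qed
  have near: "parabolic_near G q'" if q': "q' \<in> E" for q'
    using eventually_nhds_in_open[OF E q'] unfolding parabolic_near_def by eventually_elim (rule par)
  have "jet_of G q' \<in> branch_jets" if q': "q' \<in> E" for q'
  proof -
    obtain q where q: "q \<in> D" "linear_image (fst g) (centered F q) (centered G q')" using *[OF q'] by blast
    note b = branch_surface_near[OF S q(1)]
    have nz': "jet_of G q' (Fx 2) \<noteq> 0" using nz[OF q'] by simp
    note i = linear_image_invariants[OF b(2-5) G[OF q'] near[OF q'] nz' q(2) det]
    show ?thesis using i b(6) nz' by (simp add: branch_jets_def S_inv_def)
  qed
  then show ?thesis using E G par by (simp add: branch_surface_def)
qed

lemma branch_surface_invariants:
  assumes S: "branch_surface D F" and p: "p \<in> D" and S': "branch_surface E G" and p': "p' \<in> E" and g: "g \<in> SA3"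
    and m: "maps_germ g (surface D F) (point F p) (surface E G) (point G p')"
  shows "W_inv (jet_of G p') = W_inv (jet_of F p)" "M_inv (jet_of G p') = M_inv (jet_of F p)"
proof -
  note b = branch_surface_near[OF S p] and b' = branch_surface_near[OF S' p']
  have det: "det (fst g) = 1" using g by (auto simp: SA3_def)
  note l = maps_germ_linear_image[OF m b(1) p analytic2_isCont[OF b(2)]]
  show "W_inv (jet_of G p') = W_inv (jet_of F p)" "M_inv (jet_of G p') = M_inv (jet_of F p)"
    using linear_image_invariants[OF b(2-5) b'(2-4) l det] b(6) by simp_all
qed

text \<open>The first condition in \<open>T\<close> makes the image a graph. The second keeps the
  image of the ruling away from the x-axis, so that the second x-derivative of \<open>G\<close> is
  nonzero at \<open>p'\<close>; by continuity it stays nonzero on a smaller domain.\<close>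

lemma transform_branch:
  fixes g :: "(real ^ 3 ^ 3) \<times> (real ^ 3)"
  assumes S: "branch_surface D F" and p: "p \<in> D" and g: "g \<in> SA3"
  defines "L \<equiv> \<lambda>i j. fst g $ i $ j + fst g $ i $ 3 * (if j = 1 then partial 1 0 F p else partial 0 1 F p)"
  assumes T: "L 1 1 * L 2 2 - L 1 2 * L 2 1 \<noteq> 0" "L 2 2 * partial 2 0 F p - L 2 1 * partial 1 1 F p \<noteq> 0"
  obtains E G p' V V' where "branch_surface E G" "p' \<in> E" "act g (point F p) = point G p'"
    "open V" "point F p \<in> V" "open V'" "\<And>q. q \<in> E \<Longrightarrow> point G q \<in> V'" "act g ` (surface D F \<inter> V) = surface E G \<inter> V'"
proof -
  note b = branch_surface_near[OF S p]
  obtain E G p' V V' where E: "open E" "p' \<in> E" "\<And>q. q \<in> E \<Longrightarrow> analytic2_at G q" "act g (point F p) = point G p'"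
    and V: "open V" "point F p \<in> V" "open V'" "\<And>q. q \<in> E \<Longrightarrow> point G q \<in> V'" "act g ` (surface D F \<inter> V) = surface E G \<inter> V'"
    by (rule graph_local[OF b(1) p b(2) g]) (use T(1) in \<open>simp add: L_def\<close>, blast)
  have det: "det (fst g) = 1" using g by (auto simp: SA3_def)
  have m: "\<exists>q\<in>D. maps_germ g (surface D F) (point F q) (surface E G) (point G q')" if q': "q' \<in> E" for q'
  proof -
    have "point G q' \<in> surface E G \<inter> V'" using q' V(4) by (auto simp: surface_def)
    then obtain q where q: "q \<in> D" "point F q \<in> V" "act g (point F q) = point G q'"
      unfolding V(5)[symmetric] by (auto simp: surface_def)
    then have "maps_germ g (surface D F) (point F q) (surface E G) (act g (point F q))"
      by (intro maps_germ_move[OF V(1,3,5)]) (auto simp: surface_def)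
    then show ?thesis using q by auto
  qed
  have mp: "maps_germ g (surface D F) (point F p) (surface E G) (point G p')"
    unfolding E(4)[symmetric] by (rule maps_germ_move[OF V(1,3,5)]) (use p V in \<open>auto simp: surface_def\<close>)
  note lp = maps_germ_linear_image[OF mp b(1) p analytic2_isCont[OF b(2)]]
  have Gp: "partial 2 0 G p' \<noteq> 0"
    by (rule linear_image_second_order(2)[OF b(2) E(3)[OF E(2)] lp det])
      (use S p b(4) T in \<open>auto simp: branch_surface_def L_def\<close>)
  have "isCont (partial 2 0 G) p'" by (rule analytic2_isCont[OF analytic2_partial[OF E(3)[OF E(2)]]])
  then have "\<forall>\<^sub>F q in nhds p'. partial 2 0 G q \<noteq> 0"
    using tendsto_imp_eventually_ne[of "partial 2 0 G" _ "nhds p'"] Gp by (simp only: isCont_def tendsto_at_iff_tendsto_nhds) 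
  with eventually_nhds_in_open[OF E(1,2)] have "\<forall>\<^sub>F q in nhds p'. q \<in> E \<and> partial 2 0 G q \<noteq> 0" by (rule eventually_conj)
  then obtain E2 where E2: "open E2" "p' \<in> E2" "\<forall>q\<in>E2. q \<in> E \<and> partial 2 0 G q \<noteq> 0" unfolding eventually_nhds by blast
  have br: "branch_surface E2 G"
    by (rule branch_surface_image[OF S E2(1) _ g, of G E]) (use E2 E m in auto)
  \<comment> \<open>Shrinking the base to \<open>E2\<close> must be matched in space by the cylinder
    over \<open>E2\<close>, so that the image of a neighbourhood is exactly the smaller
    graph.\<close>
  define W' where "W' = V' \<inter> {v. (v $ 1, v $ 2) \<in> E2}"
  have "open {v :: real ^ 3. (v $ 1, v $ 2) \<in> E2}"
  proof -
    have "continuous_on UNIV (\<lambda>v :: real ^ 3. (v $ 1, v $ 2))" by (intro continuous_intros)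
    from open_vimage[OF E2(1) this] show ?thesis by (simp add: vimage_def)
  qed
  then have W': "open W'" unfolding W'_def using V by auto
  have "act g ` (surface D F \<inter> (V \<inter> act g -` W')) = surface E2 G \<inter> W'"
  proof -
    have "act g ` (surface D F \<inter> (V \<inter> act g -` W')) = act g ` (surface D F \<inter> V) \<inter> W'" by auto
    also have "\<dots> = surface E G \<inter> W'" unfolding V(5) by (auto simp: W'_def)
    also have "\<dots> = surface E2 G \<inter> W'" using E2 by (auto simp: in_surface W'_def)
    finally show ?thesis .
  qed
  moreover have "open (V \<inter> act g -` W')" using V(1) open_vimage_act[OF W'] by (rule open_Int)
  moreover have "point F p \<in> V \<inter> act g -` W'" "\<And>q. q \<in> E2 \<Longrightarrow> point G q \<in> W'"
    using V E2 E(4) by (simp_all add: W'_def)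
  ultimately show ?thesis by (intro that[OF br E2(2) E(4) _ _ W'])
qed

section \<open>The normal form\<close>

text \<open>Merges the explicit polynomial with the free coefficients into one array, so that a
  normal form becomes an ordinary \<open>expansion\<close> at the origin.\<close>

definition nf_coeff :: "real \<Rightarrow> real \<Rightarrow> (nat \<Rightarrow> nat \<Rightarrow> real) \<Rightarrow> nat \<Rightarrow> nat \<Rightarrow> real" where
  "nf_coeff a b c j k = (if j + k \<ge> 6 then c j k
     else if (j, k) \<in> {(2, 0), (2, 1), (2, 2), (2, 3)} then 1 / 2
     else if (j, k) = (3, 1) then a / 6 else if (j, k) = (5, 0) then b / 120
     else if (j, k) = (3, 2) then a / 2 else 0)"

lemma nf_coeff_adapted5: "adapted5 (nf_coeff a b c) 0 0 a 0 b"
  by (simp add: adapted5_def nf_coeff_def)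

lemma nf_coeff_sum:
  "(\<Sum>(j, k) | j + k < 6. nf_coeff a b c j k * x ^ j * y ^ k) =
    x^2 / 2 + x^2 * y / 2 + a * (x^3 * y / 6) + x^2 * y^2 / 2 + b * (x^5 / 120) + 6 * a * (x^3 * y^2 / 12) + x^2 * y^3 / 2"
proof -
  have S: "(\<Sum>(j, k) | j + k < 6. nf_coeff a b c j k * x ^ j * y ^ k) = (\<Sum>n<6. \<Sum>j\<le>n. nf_coeff a b c j (n - j) * x ^ j * y ^ (n - j))"
    by (rule sum.triangle_reindex)
  have e6: "{..<6} = {0,1,2,3,4,5::nat}" and a: "{..1} = {0,1::nat}" "{..2} = {0,1,2::nat}" "{..3} = {0,1,2,3::nat}"
    "{..4} = {0,1,2,3,4::nat}" "{..5} = {0,1,2,3,4,5::nat}" by auto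
  show ?thesis unfolding S[unfolded e6, simplified, unfolded a, simplified] by (simp add: nf_coeff_def)
qed

lemma nf_coeff_split:
  "((\<lambda>(j, k). c j k * x ^ j * y ^ k) has_sum (S - (x^2 / 2 + x^2 * y / 2 + a * (x^3 * y / 6) + x^2 * y^2 / 2
      + b * (x^5 / 120) + 6 * a * (x^3 * y^2 / 12) + x^2 * y^3 / 2))) {(j, k). j + k \<ge> 6} \<longleftrightarrow>
   ((\<lambda>(j, k). nf_coeff a b c j k * x ^ j * y ^ k) has_sum S) UNIV" (is "(_ has_sum (S - ?P)) ?H \<longleftrightarrow> _")
proof -
  have fin: "finite {(j::nat, k). j + k < 6}"
    by (rule finite_subset[of _ "{..<6} \<times> {..<6}"]) auto
  have f: "((\<lambda>(j, k). nf_coeff a b c j k * x ^ j * y ^ k) has_sum ?P) {(j, k). j + k < 6}"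
    using has_sum_finite[OF fin, of "\<lambda>(j, k). nf_coeff a b c j k * x ^ j * y ^ k"] unfolding nf_coeff_sum .
  have h: "((\<lambda>(j, k). c j k * x ^ j * y ^ k) has_sum s) ?H \<longleftrightarrow> ((\<lambda>(j, k). nf_coeff a b c j k * x ^ j * y ^ k) has_sum s) ?H" for s
    by (rule has_sum_cong) (auto simp: nf_coeff_def)
  have U: "UNIV - {(j::nat, k). j + k < 6} = ?H" "{(j::nat, k). j + k < 6} \<union> ?H = UNIV" by auto
  show ?thesis unfolding h
  proof
    assume "((\<lambda>(j, k). nf_coeff a b c j k * x ^ j * y ^ k) has_sum (S - ?P)) ?H"
    moreover have "{(j::nat, k). j + k < 6} \<inter> ?H = {}" by auto
    ultimately have "((\<lambda>(j, k). nf_coeff a b c j k * x ^ j * y ^ k) has_sum (?P + (S - ?P))) ({(j, k). j + k < 6} \<union> ?H)"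
      by (rule has_sum_Un_disjoint[OF f])
    then show "((\<lambda>(j, k). nf_coeff a b c j k * x ^ j * y ^ k) has_sum S) UNIV"
      unfolding U by simp
  next
    assume "((\<lambda>(j, k). nf_coeff a b c j k * x ^ j * y ^ k) has_sum S) UNIV"
    from has_sum_Diff[OF this f] show "((\<lambda>(j, k). nf_coeff a b c j k * x ^ j * y ^ k) has_sum (S - ?P)) ?H"
      unfolding U by simp
  qed
qed

lemma normal_form_expansion: "normal_form a b c G \<longleftrightarrow> (\<exists>r. expansion (nf_coeff a b c) r G (0, 0))"
  unfolding normal_form_def expansion_def nf_coeff_split by auto

lemma adapted5_normal_form:
  assumes d: "expansion d r G (0, 0)" and a: "adapted5 d 0 0 a 0 b"
  shows "normal_form a b d G"
proof -
  have as: "d 0 0 = 0" "d 1 0 = 0" "d 0 1 = 0" "d 2 0 = 1/2" "d 1 1 = 0" "d 0 2 = 0"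
     "d 3 0 = 0" "d 2 1 = 1/2" "d 1 2 = 0" "d 0 3 = 0"
     "d 4 0 = 0" "d 3 1 = a / 6" "d 2 2 = 1/2" "d 1 3 = 0" "d 0 4 = 0"
     "d 5 0 = b / 120" "d 4 1 = 0" "d 3 2 = a / 2" "d 2 3 = 1/2" "d 1 4 = 0" "d 0 5 = 0"
    using a[unfolded adapted5_def] by simp_all
  have "d j k = nf_coeff a b d j k" for j k
  proof (cases "j + k \<ge> 6")
    case False
    then have "j = 0 \<or> j = 1 \<or> j = 2 \<or> j = 3 \<or> j = 4 \<or> j = 5" "k = 0 \<or> k = 1 \<or> k = 2 \<or> k = 3 \<or> k = 4 \<or> k = 5" by linarith+
    then show ?thesis using False by (elim disjE) (simp_all add: nf_coeff_def as as[unfolded One_nat_def])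
  qed (simp add: nf_coeff_def)
  then have "nf_coeff a b d = d" by (auto simp: fun_eq_iff)
  then show ?thesis unfolding normal_form_expansion using d by auto
qed

lemma normal_form_jet:
  assumes "normal_form a b c G"
  shows "G (0, 0) = 0" "W_inv (jet_of G (0, 0)) = a" "M_inv (jet_of G (0, 0)) = b"
proof -
  obtain r where e: "expansion (nf_coeff a b c) r G (0, 0)" using assms unfolding normal_form_expansion by blast
  show "G (0, 0) = 0" using expansion_center[OF e] by (simp add: nf_coeff_def)
  let ?z = "jet_of G (0, 0)"
  have z: "?z (Fx 2) = 1" "?z (Fx 3) = 0" "?z (Fx 4) = 0" "?z (Fx 5) = b" "?z (Fxy 1) = 0" "?z (Fxy 2) = 1" "?z (Fxy 3) = a" "?z (Fxy 4) = 0"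
    unfolding jet_of.simps partial_eq_coeff[OF e] by (simp_all add: nf_coeff_def fact_numeral)
  have A: "A_jet ?z = 1" "B_jet ?z = a" "C_jet ?z = 0" unfolding A_jet_def B_jet_def C_jet_def z by simp_all
  have P: "Phi41 ?z = 0" unfolding Phi41_def A z by simp
  show "W_inv ?z = a" unfolding W_inv_def A z by simp
  show "M_inv ?z = b" unfolding M_inv_def P Phi50_def A z by simp
qed

text \<open>The linear part of the normalising map, in terms of the 5-jet: the first factor is the
  shear that removes \<open>F\<^sub>x\<^sub>x\<^sub>x\<close>, \<open>F\<^sub>x\<^sub>x\<^sub>x\<^sub>x\<close> and \<open>F\<^sub>x\<^sub>x\<^sub>x\<^sub>x\<^sub>y\<close>.\<close>

definition nf_r :: "jet \<Rightarrow> real" where "nf_r z = - Phi41 z / (2 * W_inv z)"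
text \<open>With \<open>nf_r\<close> fixed by the vanishing of \<open>Phi41\<close> after the shear,
  \<open>nf_s\<close> and \<open>nf_w\<close> solve the linear equations that make the sheared
  values of \<open>e\<close> and \<open>e4\<close> zero.\<close>

definition nf_s :: "jet \<Rightarrow> real" where "nf_s z = ad_e z / 3 - nf_r z"
definition nf_w :: "jet \<Rightarrow> real" where
  "nf_w z = (ad_e4 z - 4 * ad_b z * nf_s z - 10 * ad_e z * nf_r z + 30 * nf_r z * nf_s z + 15 * nf_r z^2 + 12 * nf_s z^2) / 6"

definition nf_lin :: "jet \<Rightarrow> real ^ 3 ^ 3" where
  "nf_lin z = shear (nf_r z) (nf_s z) (nf_w z) ** adapt_inv z (ad z)"

definition nf_map :: "jet \<Rightarrow> (real ^ 3 ^ 3) \<times> (real ^ 3)" where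
  "nf_map z = (nf_lin z, - (nf_lin z *v vector [z X, z Y, z (Fx 0)]))"

text \<open>When \<open>e\<close> and \<open>e4\<close> vanish, the invariant expressions collapse:
  \<open>W\<close> is \<open>b\<close>, \<open>Phi41\<close> is \<open>k\<close>, and for
  \<open>k = 0\<close> the value of \<open>M\<close> is \<open>e5\<close>. Invariance of
  \<open>W\<close> and \<open>M\<close> under shears identifies what is left.\<close>

lemma shear_adapted5_nf:
  assumes z: "z (Fx 2) \<noteq> 0" "A_jet z \<noteq> 0" "W_inv z \<noteq> 0"
    and F: "expansion c \<rho> F (0, 0)" "adapted5 c (ad_e z) (ad_e4 z) (ad_b z) (ad_k z) (ad_e5 z)"
    and G: "expansion d \<rho>' G (0, 0)" and rel: "linear_image (shear (nf_r z) (nf_s z) (nf_w z)) F G"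
  shows "adapted5 d 0 0 (W_inv z) 0 (M_inv z)"
proof -
  note inv = invariants_adapted[OF z(1,2)]
  define e e4 b k e5 where d: "e = ad_e z" "e4 = ad_e4 z" "b = ad_b z" "k = ad_k z" "e5 = ad_e5 z"
  define r s w where rsw: "r = nf_r z" "s = nf_s z" "w = nf_w z"
  note T = adapted5_shear[OF F G rel, folded d rsw]
  define e' where "e' = e - 3 * r - 3 * s"
  define e4' where "e4' = e4 - 4 * b * s - 10 * e * r + 30 * r * s + 15 * r^2 + 12 * s^2 - 6 * w"
  define b' where "b' = b - 6 * r - 6 * s"
  define k' where "k' = k - 10 * b * r - 24 * b * s - 10 * e * r + 24 * e * s + 90 * r * s + 45 * r^2 + 36 * s^2 - 18 * w"
  define e5' where "e5' = 60 * b * r * s + 60 * b * s^2 - 10 * b * w - 5 * k * s + 60 * e * r * s + 105 * e * r^2 - 60 * e * s^2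
      - 10 * e * w - 10 * e^2 * r - 15 * e4 * r + e5 - 270 * r * s^2 + 90 * r * w - 315 * r^2 * s - 105 * r^3
      + 90 * s * w - 60 * s^3"
  have A: "adapted5 d e' e4' b' k' e5'" using T unfolding e'_def e4'_def b'_def k'_def e5'_def .
  have e0: "e' = 0" unfolding e'_def rsw nf_s_def d by simp
  have e40: "e4' = 0" unfolding e4'_def rsw nf_w_def d by (simp add: field_simps)
  have W: "W_of e b = W_inv z" by (simp add: inv(1) d)
  have P: "W_of e' b' = W_inv z" "Phi41_of e' e4' b' k' = Phi41_of e e4 b k + 2 * W_of e b * r"
    unfolding W[symmetric] e'_def e4'_def b'_def k'_def by (rule Phi41_shear)+
  have bW: "b' = W_inv z" using P(1) e0 by (simp add: W_of_def)
  have "Phi41_of e e4 b k + 2 * W_of e b * r = 0"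
    unfolding W rsw nf_r_def using z(3) inv(2) by (simp add: d)
  then have P0: "Phi41_of e' e4' b' k' = 0" using P(2) by simp
  have k0: "k' = 0" using P0 unfolding e0 e40 by (simp add: Phi41_of_def)
  have "W_of e b \<noteq> 0" using z(3) W by simp
  from M_shear[where e = e and ?e4.0 = e4 and b = b and k = k and ?e5.0 = e5 and r = r and s = s and w = w, OF this, folded e'_def e4'_def b'_def k'_def e5'_def]
  have "M_of e' e4' b' k' e5' = M_inv z" by (simp add: inv(4) d)
  then have "e5' = M_inv z" using P0 unfolding M_of_def Phi50_of_def e0 e40 by simp
  then show ?thesis using A unfolding e0 e40 k0 bW by simp
qed

lemma nf_lin_adapt_mat:
  assumes "ad z \<noteq> 0" "z (Fx 2) \<noteq> 0"
  shows "nf_lin z ** adapt_mat z (ad z) = shear (nf_r z) (nf_s z) (nf_w z)"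
  unfolding nf_lin_def by (simp add: adapt_mat_inv(2)[where z = z and \<alpha> = "ad z", OF assms] flip: matrix_mul_assoc)

lemma det_shear: "det (shear r s w) = 1"
  unfolding det_linear_image shear_nth by simp

lemma nf_map_SA3:
  assumes "ad z \<noteq> 0" "z (Fx 2) \<noteq> 0" shows "nf_map z \<in> SA3"
  using assms by (simp add: SA3_def nf_map_def nf_lin_def det_mul det_shear adapt_det)

lemma point_jet: "point F p = vector [jet_of F p X, jet_of F p Y, jet_of F p (Fx 0)]"
  by (simp add: point_def partial_def)

lemma normal_form_exists:
  fixes F p defines "z \<equiv> jet_of F p"
  assumes S: "branch_surface D F" and p: "p \<in> D"
  obtains E G d where "branch_surface E G" "(0, 0) \<in> E" "normal_form (W_inv z) (M_inv z) d G"
    "maps_germ (nf_map z) (surface D F) (point F p) (surface E G) 0"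
proof -
  note b = branch_surface_near[OF S p, folded z_def]
  have ad: "ad z \<noteq> 0" using ad_nz b by simp
  define g where "g = nf_map z"
  have g: "g \<in> SA3" using nf_map_SA3 ad b by (simp add: g_def)
  define N where "N = nf_lin z"
  have fg: "fst g = N" by (simp add: g_def nf_map_def N_def)
  define \<alpha> f2 where "\<alpha> = ad z" and "f2 = z (Fx 2)"
  have nz: "\<alpha> \<noteq> 0" "f2 \<noteq> 0" using ad b by (simp_all add: \<alpha>_def f2_def)
  have zz: "partial 1 0 F p = z (Fx 1)" "partial 0 1 F p = z (Fxy 0)" "partial 2 0 F p = f2" "partial 1 1 F p = z (Fxy 1)"
    by (simp_all add: z_def f2_def)
  define L where "L i j = fst g $ i $ j + fst g $ i $ 3 * (if j = 1 then partial 1 0 F p else partial 0 1 F p)" for i j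
  have N: "N $ i $ j = shear (nf_r z) (nf_s z) (nf_w z) $ i $ 1 * adapt_inv z \<alpha> $ 1 $ j + shear (nf_r z) (nf_s z) (nf_w z) $ i $ 2 * adapt_inv z \<alpha> $ 2 $ j
     + shear (nf_r z) (nf_s z) (nf_w z) $ i $ 3 * adapt_inv z \<alpha> $ 3 $ j" for i j
    by (simp add: N_def nf_lin_def matrix_matrix_mult_def sum_3 \<alpha>_def)
  have L: "L 1 1 = 1 / \<alpha>" "L 1 2 = z (Fxy 1) / (\<alpha> * f2)" "L 2 1 = nf_s z / \<alpha>" "L 2 2 = nf_s z * z (Fxy 1) / (\<alpha> * f2) + \<alpha>^3 * f2"
    unfolding L_def fg N shear_nth adapt_inv_nth zz f2_def by (simp_all add: algebra_simps)
  \<comment> \<open>The two transversality quantities are \<open>\<alpha>^2 * f2\<close> and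
    \<open>\<alpha>^3 * f2^2\<close>, whatever the shear is: it acts on the base only by adding a
    multiple of the first row to the second.\<close>
  have T1: "L 1 1 * L 2 2 - L 1 2 * L 2 1 \<noteq> 0"
  proof -
    have "L 1 1 * L 2 2 - L 1 2 * L 2 1 = \<alpha>^2 * f2" unfolding L using nz by (simp add: field_simps eval_nat_numeral)
    then show ?thesis using nz by simp
  qed
  have T2: "L 2 2 * partial 2 0 F p - L 2 1 * partial 1 1 F p \<noteq> 0"
  proof -
    have "L 2 2 * partial 2 0 F p - L 2 1 * partial 1 1 F p = \<alpha>^3 * f2^2" unfolding L zz using nz by (simp add: field_simps eval_nat_numeral)
    then show ?thesis using nz by simp
  qed
  obtain E G p' V V' where E: "branch_surface E G" "p' \<in> E" "act g (point F p) = point G p'"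
    and V: "open V" "point F p \<in> V" "open V'" "\<And>q. q \<in> E \<Longrightarrow> point G q \<in> V'" "act g ` (surface D F \<inter> V) = surface E G \<inter> V'"
    by (rule transform_branch[OF S p g]) (use T1 T2 in \<open>simp add: L_def\<close>, use T2 in \<open>simp add: L_def\<close>, blast)
  have "act g (point F p) = 0"
    by (simp add: act_def g_def nf_map_def point_jet z_def)
  then have P0: "point G p' = 0" using E(3) by simp
  then have "fst p' = 0" "snd p' = 0" and G0: "G p' = 0" by (metis point_nth zero_index)+
  then have p': "p' = (0, 0)" by (simp add: prod_eq_iff)
  have m: "maps_germ g (surface D F) (point F p) (surface E G) (point G p')"
    unfolding E(3)[symmetric] by (rule maps_germ_move[OF V(1,3,5)]) (use p V in \<open>auto simp: surface_def\<close>)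
  have cG: "centered G p' = G" using G0 by (simp add: centered_def p' fun_eq_iff)
  have "linear_image N (centered F p) G"
    using maps_germ_linear_image[OF m b(1) p analytic2_isCont[OF b(2)]] unfolding cG fg .
  from linear_image_adapt_source[where z = z and \<alpha> = "ad z", OF this ad b(4)]
  have rel: "linear_image (shear (nf_r z) (nf_s z) (nf_w z)) (adapt z (ad z) F p) G"
    unfolding N_def nf_lin_adapt_mat[OF ad b(4)] .
  obtain c \<rho> where c: "expansion c \<rho> (adapt z (ad z) F p) (0, 0)" "adapted5 c (ad_e z) (ad_e4 z) (ad_b z) (ad_k z) (ad_e5 z)"
    by (rule adapt_adapted5[OF b(2-5)[unfolded z_def], folded z_def])
  obtain d s where d: "expansion d s G (0, 0)"
    using branch_surface_near(2)[OF E(1,2)] unfolding p' analytic2_expansion by blast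
  have "normal_form (W_inv z) (M_inv z) d G"
    by (rule adapted5_normal_form[OF d shear_adapted5_nf[OF b(4-6) c d rel]])
  then show ?thesis using that[OF E(1) E(2)[unfolded p']] m P0 by (simp add: g_def)
qed

text \<open>The vanishing of \<open>e\<close>, \<open>e4\<close> and \<open>k\<close> after the
  shear gives \<open>s = - r\<close> and two expressions for \<open>w\<close>; eliminating
  \<open>w\<close> leaves a multiple of \<open>a * r = 0\<close>. This is where
  \<open>W \<noteq> 0\<close> makes the isotropy trivial.\<close>

lemma nf_rigid:
  assumes F: "expansion c \<rho> F (0, 0)" "adapted5 c 0 0 a 0 b" and G: "expansion d \<rho>' G (0, 0)" "adapted5 d 0 0 a' 0 b'"
    and a: "a \<noteq> 0" and rel: "linear_image A F G" and det: "det A = 1"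
  shows "A = mat 1"
proof -
  obtain r s w where A: "A = shear r s w" by (rule linear_image_adapted_shear[OF F G rel det])
  note eqs = adapted5_eq[OF adapted5_shear[OF F G(1) rel[unfolded A]] G(2)]
  have "r + s = 0" using eqs(1) by simp
  then have s: "s = - r" by simp
  have w: "6 * w = 4 * (a * r) - 3 * r^2" using eqs(2) unfolding s by (simp add: power2_eq_square algebra_simps)
  have "18 * w = 14 * (a * r) - 9 * r^2" using eqs(4) unfolding s by (simp add: power2_eq_square algebra_simps)
  with w have "a * r = 0" by linarith
  then have "r = 0" using a by simp
  then have "r = 0" "s = 0" "w = 0" using s w by simp_all
  then show ?thesis unfolding A by (intro mat3_eqI) (simp_all add: shear_nth mat_def)
qed

text \<open>Rigidity of the linear part together with the fixed origin leaves only the identity, so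
  equivalent normal forms are equal as germs.\<close>

lemma maps_germ_normal_forms:
  assumes S: "branch_surface D F" "(0, 0) \<in> D" "normal_form a b c F"
    and S': "branch_surface E G" "(0, 0) \<in> E" "normal_form a' b' c' G"
    and g: "g \<in> SA3" and m: "maps_germ g (surface D F) 0 (surface E G) 0"
  shows "g = (mat 1, 0)" "\<forall>\<^sub>F q in nhds (0, 0). F q = G q"
proof -
  note n = normal_form_jet[OF S(3)] and n' = normal_form_jet[OF S'(3)]
  have p0: "point F (0, 0) = 0" "point G (0, 0) = 0" using n(1) n'(1) by (simp_all add: vec_eq_iff forall_3)
  have cF: "centered F (0, 0) = F" "centered G (0, 0) = G" using n(1) n'(1) by (simp_all add: centered_def fun_eq_iff)
  note b = branch_surface_near[OF S(1,2)]
  have rel: "linear_image (fst g) F G"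
    using maps_germ_linear_image[of g D F "(0, 0)" E G "(0, 0)"] m b(1) S(2) analytic2_isCont[OF b(2)] unfolding p0 cF by blast
  obtain r where c: "expansion (nf_coeff a b c) r F (0, 0)" using S(3) unfolding normal_form_expansion by blast
  obtain r' where c': "expansion (nf_coeff a' b' c') r' G (0, 0)" using S'(3) unfolding normal_form_expansion by blast
  have a: "a \<noteq> 0" using b(6) n(2) by simp
  have A: "fst g = mat 1"
    by (rule nf_rigid[OF c nf_coeff_adapted5 c' nf_coeff_adapted5 a rel]) (use g in \<open>auto simp: SA3_def\<close>)
  have "act g 0 = 0" using m by (simp add: maps_germ_def)
  then have "snd g = 0" by (simp add: act_def)
  then show "g = (mat 1, 0)" using A by (simp add: prod_eq_iff)
  show "\<forall>\<^sub>F q in nhds (0, 0). F q = G q"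
    using rel unfolding linear_image_def A by (simp add: mat_def)
qed

section \<open>Germs determined by the coefficients of \<open>x^j\<close> and
  \<open>x^j y\<close>\<close>

lemma expands_vertical:
  assumes "expansion c r F p"
  shows "expands (Suc N) (\<lambda>e. F (fst p, snd p + e)) (Abs_fps (\<lambda>n. c 0 n))"
proof -
  have "expands (Suc N) (\<lambda>e. F (fst p + 0, snd p + e)) (\<Sum>(i, j) | i + j < Suc N. fps_const (c i j) * (fps_const 0 ^ i * fps_X ^ j))"
    by (rule expands_compose[OF assms, of "Suc N" "\<lambda>e. 0" "fps_const 0" "\<lambda>e. e" fps_X])
      (use expands_const[of "Suc N" 0] expands_id[of "Suc N"] in auto)
  then have 1: "expands (Suc N) (\<lambda>e. F (fst p, snd p + e)) (\<Sum>(i, j) | i + j < Suc N. fps_const (c i j) * (fps_const 0 ^ i * fps_X ^ j))" by simp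
  have "(\<Sum>(i, j) | i + j < Suc N. fps_const (c i j) * (fps_const 0 ^ i * fps_X ^ j)) $$ n = c 0 n" if n: "n < Suc N" for n
  proof -
    have fin: "finite {(i::nat, j). i + j < Suc N}"
      by (rule finite_subset[of _ "{..<Suc N} \<times> {..<Suc N}"]) auto
    have "(\<Sum>(i, j) | i + j < Suc N. fps_const (c i j) * (fps_const 0 ^ i * fps_X ^ j)) $$ n =
       (\<Sum>z | fst z + snd z < Suc N. if z = (0, n) then c 0 n else 0)"
      unfolding fps_sum_nth case_prod_unfold
      by (rule sum.cong) (auto simp: power_0_left fps_X_power_nth prod_eq_iff)
    also have "\<dots> = c 0 n" using fin n by (simp add: case_prod_unfold)
    finally show ?thesis .
  qed
  then have "(\<Sum>i<Suc N. (\<Sum>(i, j) | i + j < Suc N. fps_const (c i j) * (fps_const 0 ^ i * fps_X ^ j)) $$ i * e ^ i) = (\<Sum>i<Suc N. c 0 i * e ^ i)" for e :: real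
    by (intro sum.cong) auto
  then show ?thesis using 1 unfolding expands_def by simp
qed

text \<open>Solving \<open>F\<^sub>x\<^sub>x F\<^sub>y\<^sub>y = F\<^sub>x\<^sub>y\<^sup>2\<close> for the highest \<open>y\<close>-derivative.\<close>

lemma parabolic_recursion:
  assumes F: "analytic2_at F p" and par: "parabolic_near F p"
  shows "(\<Sum>i\<le>n. partial 2 i F p / fact i * (partial 0 (n - i + 2) F p / fact (n - i))) =
    (\<Sum>i\<le>n. partial 1 (i + 1) F p / fact i * (partial 1 (n - i + 1) F p / fact (n - i)))"
proof -
  obtain c r where c: "expansion c r F p" using F unfolding analytic2_expansion by blast
  define l where "l j k = Abs_fps (\<lambda>n. partial j (n + k) F p / fact n)" for j k
  have l: "expands (Suc n) (\<lambda>e. partial j k F (fst p, snd p + e)) (l j k)" for j k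
    using expands_vertical[OF expansion_partial[OF c, of j k], of n] unfolding l_def partial_eq_coeff[OF c] by simp
  have "((\<lambda>e. (fst p, snd p + e)) \<longlongrightarrow> (fst p, snd p + 0)) (at (0::real))" by (intro tendsto_intros)
  then have "filterlim (\<lambda>e. (fst p, snd p + e)) (nhds p) (at (0::real))" by simp
  then have "\<forall>\<^sub>F e in at 0. partial 2 0 F (fst p, snd p + e) * partial 0 2 F (fst p, snd p + e) - partial 1 1 F (fst p, snd p + e) ^ 2 = 0"
    using par unfolding parabolic_near_def filterlim_iff by blast
  then have "\<forall>\<^sub>F e in at 0. partial 2 0 F (fst p, snd p + e) * partial 0 2 F (fst p, snd p + e) = partial 1 1 F (fst p, snd p + e) * partial 1 1 F (fst p, snd p + e)"
    by eventually_elim (simp add: power2_eq_square)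
  from expands_unique[OF expands_mult[OF l l] expands_mult[OF l l] this, of n]
  have "(l 2 0 * l 0 2) $$ n = (l 1 1 * l 1 1) $$ n" by simp
  then show ?thesis by (simp add: fps_mult_nth l_def atLeast0AtMost)
qed

text \<open>The recursion is run at all points of a segment of the x-axis and not only at the
  origin. Equality of the k-th y-derivatives along the segment can then be differentiated in x,
  which supplies all mixed derivatives for the next step of the induction on
  \<open>k\<close>.\<close>

lemma parabolic_determined:
  assumes F: "expansion c r F (0, 0)" "parabolic_near F (0, 0)" and G: "expansion d s G (0, 0)" "parabolic_near G (0, 0)"
    and nz: "c 2 0 \<noteq> 0" and eq: "\<And>j. c j 0 = d j 0" "\<And>j. c j 1 = d j 1"
  shows "\<forall>\<^sub>F q in nhds (0, 0). F q = G q"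
proof -
  have Fa: "analytic2_at F (0, 0)" and Ga: "analytic2_at G (0, 0)" using F G analytic2_expansion by blast+
  have "isCont (partial 2 0 F) (0, 0)" by (rule analytic2_isCont[OF analytic2_partial[OF Fa]])
  moreover have "partial 2 0 F (0, 0) \<noteq> 0" unfolding partial_eq_coeff[OF F(1)] using nz by simp
  ultimately have "\<forall>\<^sub>F q in nhds (0, 0). partial 2 0 F q \<noteq> 0"
    using tendsto_imp_eventually_ne[of "partial 2 0 F" _ "nhds (0, 0)"] by (simp only: isCont_def tendsto_at_iff_tendsto_nhds)
  moreover have "\<forall>\<^sub>F q in nhds (0, 0). parabolic_near H q" if "parabolic_near H (0, 0)" for H
    using that unfolding parabolic_near_def eventually_eventually by simp
  ultimately have "\<forall>\<^sub>F q in nhds (0, 0). partial 2 0 F q \<noteq> 0 \<and> parabolic_near F q \<and> parabolic_near G q \<and> analytic2_at F q \<and> analytic2_at G q"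
    using F(2) G(2) analytic2_nearby[OF Fa] analytic2_nearby[OF Ga] by (intro eventually_conj) auto
  then obtain t where t: "t > 0" "\<And>h k. \<bar>h\<bar> < t \<Longrightarrow> \<bar>k\<bar> < t \<Longrightarrow> partial 2 0 F (h, k) \<noteq> 0 \<and> parabolic_near F (h, k) \<and>
      parabolic_near G (h, k) \<and> analytic2_at F (h, k) \<and> analytic2_at G (h, k)"
    unfolding eventually_nhds_box by auto
  define \<delta> where "\<delta> = min t (min r s)"
  have \<delta>: "\<delta> > 0" using t F G by (auto simp: \<delta>_def expansion_def)
  have good: "partial 2 0 F (x, 0) \<noteq> 0" "parabolic_near F (x, 0)" "parabolic_near G (x, 0)" "analytic2_at F (x, 0)" "analytic2_at G (x, 0)"
    if "\<bar>x\<bar> < \<delta>" for x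
    using t(2)[of x 0] that t(1) by (auto simp: \<delta>_def)
  \<comment> \<open>On the axis \<open>F\<close> and its first y-derivative are the power series in
    \<open>x\<close> with coefficients \<open>c j 0\<close> and \<open>c j 1\<close>.\<close>
  have base: "partial 0 k F (x, 0) = partial 0 k G (x, 0)" if "k = 0 \<or> k = 1" "\<bar>x\<bar> < \<delta>" for k x
  proof -
    have ser: "((\<lambda>(i, j). fact (i + 0) / fact i * (fact (j + k) / fact j) * c i (j + k) * x ^ i * 0 ^ j) has_sum partial 0 k F (x, 0)) UNIV"
      if "expansion c r F (0, 0)" "\<bar>x\<bar> < r" for c r F
      using expansion_partial[OF that(1), of 0 k] that(2) unfolding expansion_def by auto
    have "(\<lambda>(i, j). fact (i + 0) / fact i * (fact (j + k) / fact j) * c i (j + k) * x ^ i * 0 ^ j) =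
      (\<lambda>(i, j). fact (i + 0) / fact i * (fact (j + k) / fact j) * d i (j + k) * x ^ i * 0 ^ j)"
      using that(1) eq by (auto simp: fun_eq_iff power_0_left)
    with ser[OF F(1)] ser[OF G(1)] that(2) show ?thesis
      by (intro has_sum_unique[OF ser[OF F(1)]]) (auto simp: \<delta>_def)
  qed
  have dx: "\<forall>x. \<bar>x\<bar> < \<delta> \<longrightarrow> partial j k F (x, 0) = partial j k G (x, 0)"
    if "\<forall>x. \<bar>x\<bar> < \<delta> \<longrightarrow> partial 0 k F (x, 0) = partial 0 k G (x, 0)" for j k
  proof (induction j)
    case (Suc j)
    show ?case
    proof (intro allI impI)
      fix x assume x: "\<bar>x\<bar> < \<delta>"
      have "\<forall>\<^sub>F u in nhds x. partial j k F (u, 0) = partial j k G (u, 0)"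
        unfolding eventually_nhds_metric
        by (intro exI[of _ "\<delta> - \<bar>x\<bar>"]) (use x Suc in \<open>auto simp: dist_real_def\<close>)
      then have "deriv (\<lambda>u. partial j k F (u, 0)) x = deriv (\<lambda>u. partial j k G (u, 0)) x" by (rule deriv_cong_ev) simp
      then show "partial (Suc j) k F (x, 0) = partial (Suc j) k G (x, 0)"
        unfolding partial_x_partial[symmetric] by (simp add: partial_x_def)
    qed
  qed (use that in simp)
  have all: "\<forall>x. \<bar>x\<bar> < \<delta> \<longrightarrow> partial 0 k F (x, 0) = partial 0 k G (x, 0)" for k
  proof (induction k rule: less_induct)
    case (less k)
    show ?case
    proof (cases "k < 2")
      case True
      then show ?thesis using base by (auto simp: less_2_cases_iff)
    next
      case False
      then obtain n where n: "k = n + 2" by (metis add.commute le_Suc_ex not_less)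
      show ?thesis
      proof (intro allI impI)
        fix x assume x: "\<bar>x\<bar> < \<delta>"
        \<comment> \<open>Apart from the one term with factor \<open>partial 2 0\<close>, the
          recursion involves y-derivatives of order at most \<open>n + 1\<close>.\<close>
        have e: "partial j i F (x, 0) = partial j i G (x, 0)" if "i < n + 2" for i j
          using dx[OF less.IH] that x n by blast
        have split: "(\<Sum>i\<le>n. partial 2 i H (x, 0) / fact i * (partial 0 (n - i + 2) H (x, 0) / fact (n - i))) =
          partial 2 0 H (x, 0) * (partial 0 (n + 2) H (x, 0) / fact n) +
          (\<Sum>i\<in>{1..n}. partial 2 i H (x, 0) / fact i * (partial 0 (n - i + 2) H (x, 0) / fact (n - i)))" for H
        proof -
          have "{..n} = insert 0 {1..n}" by auto
          then show ?thesis by simp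
        qed
        have "partial 2 0 F (x, 0) * (partial 0 (n + 2) F (x, 0) / fact n) +
          (\<Sum>i\<in>{1..n}. partial 2 i F (x, 0) / fact i * (partial 0 (n - i + 2) F (x, 0) / fact (n - i))) =
          (\<Sum>i\<le>n. partial 1 (i + 1) F (x, 0) / fact i * (partial 1 (n - i + 1) F (x, 0) / fact (n - i)))"
          using parabolic_recursion[OF good(4,2)[OF x], of n] unfolding split .
        also have "\<dots> = (\<Sum>i\<le>n. partial 1 (i + 1) G (x, 0) / fact i * (partial 1 (n - i + 1) G (x, 0) / fact (n - i)))"
          by (rule sum.cong) (auto simp: e)
        also have "\<dots> = partial 2 0 G (x, 0) * (partial 0 (n + 2) G (x, 0) / fact n) +
          (\<Sum>i\<in>{1..n}. partial 2 i G (x, 0) / fact i * (partial 0 (n - i + 2) G (x, 0) / fact (n - i)))"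
          using parabolic_recursion[OF good(5,3)[OF x], of n] unfolding split by simp
        also have "(\<Sum>i\<in>{1..n}. partial 2 i G (x, 0) / fact i * (partial 0 (n - i + 2) G (x, 0) / fact (n - i))) =
          (\<Sum>i\<in>{1..n}. partial 2 i F (x, 0) / fact i * (partial 0 (n - i + 2) F (x, 0) / fact (n - i)))"
          by (rule sum.cong) (auto simp: e)
        also have "partial 2 0 G (x, 0) = partial 2 0 F (x, 0)" by (simp add: e)
        finally show "partial 0 k F (x, 0) = partial 0 k G (x, 0)" using good(1)[OF x] by (simp add: n)
      qed
    qed
  qed
  have cd: "c j k = d j k" for j k
  proof -
    have "partial j k F (0, 0) = partial j k G (0, 0)" using dx[OF all, of j k] \<delta> by simp
    then show ?thesis unfolding partial_eq_coeff[OF F(1)] partial_eq_coeff[OF G(1)] by simp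
  qed
  show ?thesis unfolding eventually_nhds_box
  proof (intro exI[of _ "min r s"] conjI allI impI)
    show "min r s > 0" using F G by (auto simp: expansion_def)
    fix h k assume "\<bar>h\<bar> < min r s" "\<bar>k\<bar> < min r s"
    then have "((\<lambda>(i, j). c i j * h ^ i * k ^ j) has_sum F (h, k)) UNIV" "((\<lambda>(i, j). d i j * h ^ i * k ^ j) has_sum G (h, k)) UNIV"
      using F G by (auto simp: expansion_def)
    then show "F (fst (0, 0) + h, snd (0, 0) + k) = G (fst (0, 0) + h, snd (0, 0) + k)"
      unfolding cd using has_sum_unique by fastforce
  qed
qed

text \<open>Equivalence means equality of germs, hence of all coefficients. Conversely
  \<open>a\<close>, \<open>b\<close> and the listed coefficients fill the columns
  \<open>k = 0\<close> and \<open>k = 1\<close> of the array; in column 1 the free coefficients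
  begin at \<open>l = 5\<close>, where the order \<open>l + 1\<close> reaches 6.\<close>

lemma normal_form_equivalence:
  assumes S: "branch_surface D F" "(0, 0) \<in> D" "normal_form a b c F"
    and S': "branch_surface E G" "(0, 0) \<in> E" "normal_form a' b' c' G"
  shows "equivalent_germs (surface E G) 0 (surface D F) 0 \<longleftrightarrow>
     a' = a \<and> b' = b \<and> (\<forall>l\<ge>6. c' l 0 = c l 0) \<and> (\<forall>l\<ge>5. c' l 1 = c l 1)"
proof -
  obtain r where e: "expansion (nf_coeff a b c) r F (0, 0)" using S(3) unfolding normal_form_expansion by blast
  obtain r' where e': "expansion (nf_coeff a' b' c') r' G (0, 0)" using S'(3) unfolding normal_form_expansion by blast
  show ?thesis
  proof
    assume "equivalent_germs (surface E G) 0 (surface D F) 0"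
    then obtain g where g: "g \<in> SA3" "maps_germ g (surface E G) 0 (surface D F) 0" unfolding equivalent_germs_def by blast
    have "\<forall>\<^sub>F q in nhds (0, 0). G q = F q" by (rule maps_germ_normal_forms(2)[OF S' S g])
    then obtain s where "expansion (nf_coeff a' b' c') s F (0, 0)"
      using expansion_cong[OF e', of _ F] unfolding eventually_nhds_box by blast
    from expansion_unique[OF this e] have eq: "nf_coeff a' b' c' j k = nf_coeff a b c j k" for j k .
    have "a' = a" using eq[of 3 1] by (simp add: nf_coeff_def)
    moreover have "b' = b" using eq[of 5 0] by (simp add: nf_coeff_def)
    moreover have "c' l 0 = c l 0" if "l \<ge> 6" for l using eq[of l 0] that by (simp add: nf_coeff_def)
    moreover have "c' l 1 = c l 1" if "l \<ge> 5" for l using eq[of l 1] that by (simp add: nf_coeff_def)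
    ultimately show "a' = a \<and> b' = b \<and> (\<forall>l\<ge>6. c' l 0 = c l 0) \<and> (\<forall>l\<ge>5. c' l 1 = c l 1)" by blast
  next
    assume eq: "a' = a \<and> b' = b \<and> (\<forall>l\<ge>6. c' l 0 = c l 0) \<and> (\<forall>l\<ge>5. c' l 1 = c l 1)"
    have "\<forall>\<^sub>F q in nhds (0, 0). F q = G q"
    proof (rule parabolic_determined[OF e branch_surface_near(3)[OF S(1,2)] e' branch_surface_near(3)[OF S'(1,2)]])
      show "nf_coeff a b c 2 0 \<noteq> 0" by (simp add: nf_coeff_def)
      show "nf_coeff a b c j 0 = nf_coeff a' b' c' j 0" for j using eq by (simp add: nf_coeff_def)
      show "nf_coeff a b c j 1 = nf_coeff a' b' c' j 1" for j using eq by (auto simp: nf_coeff_def)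
    qed
    moreover have "\<forall>\<^sub>F q in nhds (0, 0). q \<in> D" "\<forall>\<^sub>F q in nhds (0, 0). q \<in> E"
      using eventually_nhds_in_open branch_surface_near(1) S S' by blast+
    ultimately have "\<forall>\<^sub>F q in nhds (0, 0). F q = G q \<and> q \<in> D \<and> q \<in> E" by (intro eventually_conj)
    then obtain N where N: "open N" "(0, 0) \<in> N" "\<And>q. q \<in> N \<Longrightarrow> F q = G q \<and> q \<in> D \<and> q \<in> E"
      unfolding eventually_nhds by blast
    define V where "V = {v :: real ^ 3. (v $ 1, v $ 2) \<in> N}"
    have "continuous_on UNIV (\<lambda>v :: real ^ 3. (v $ 1, v $ 2))" by (intro continuous_intros)
    from open_vimage[OF N(1) this] have V: "open V" by (simp add: V_def vimage_def)
    have act1: "act (mat 1, 0) v = v" for v by (simp add: act_def)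
    have "act (mat 1, 0) ` (surface E G \<inter> V) = surface D F \<inter> V"
      unfolding act1 using N(3) by (auto simp: in_surface V_def)
    then have "maps_germ (mat 1, 0) (surface E G) 0 (surface D F) 0"
      unfolding maps_germ_def using V N(2) by (intro conjI exI[of _ V]) (auto simp: act1 V_def)
    moreover have "(mat 1, 0) \<in> SA3" by (simp add: SA3_def)
    ultimately show "equivalent_germs (surface E G) 0 (surface D F) 0" unfolding equivalent_germs_def by blast
  qed
qed

section \<open>Uniqueness of the normalising map\<close>

lemma compose_inverse_affine_eq:
  assumes h: "h \<in> SA3" and "compose_affine g (inverse_affine h) = (mat 1, 0)"
  shows "g = h"
proof -
  have 1: "fst g ** matrix_inv (fst h) = mat 1" and 2: "fst g *v (- (matrix_inv (fst h) *v snd h)) + snd g = 0"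
    using assms(2) by (simp_all add: compose_affine_def inverse_affine_def)
  have "fst g = fst g ** (matrix_inv (fst h) ** fst h)" using SA3_inv_mult(1)[OF h] by simp
  also have "\<dots> = fst h" by (simp add: matrix_mul_assoc 1)
  finally have f: "fst g = fst h" .
  have "fst g *v (- (matrix_inv (fst h) *v snd h)) = - ((fst g ** matrix_inv (fst h)) *v snd h)"
    using linear_neg[OF matrix_vector_mul_linear, of "fst g"] by (simp add: matrix_vector_mul_assoc)
  then have "snd g = snd h" using 2 unfolding 1 by simp
  then show ?thesis using f by (simp add: prod_eq_iff)
qed

text \<open>Two normalising maps differ by an equivalence between normal forms, which is the
  identity.\<close>

lemma nf_map_unique:
  assumes S: "branch_surface D F" and p: "p \<in> D" and g: "g \<in> SA3"
    and E': "branch_surface E' G'" "(0, 0) \<in> E'" "normal_form a' b' c' G'" "maps_germ g (surface D F) (point F p) (surface E' G') 0"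
  shows "g = nf_map (jet_of F p)"
proof -
  let ?z = "jet_of F p"
  note b = branch_surface_near[OF S p]
  have n: "nf_map ?z \<in> SA3" by (rule nf_map_SA3[OF ad_nz[OF b(5,4)] b(4)])
  obtain E G d where E: "branch_surface E G" "(0, 0) \<in> E" "normal_form (W_inv ?z) (M_inv ?z) d G"
    "maps_germ (nf_map ?z) (surface D F) (point F p) (surface E G) 0"
    by (rule normal_form_exists[OF S p])
  have "maps_germ (compose_affine g (inverse_affine (nf_map ?z))) (surface E G) 0 (surface E' G') 0"
    by (rule maps_germ_compose[OF SA3_inverse[OF n] g maps_germ_inverse[OF n E(4)] E'(4)])
  from maps_germ_normal_forms(1)[OF E(1-3) E'(1-3) SA3_compose[OF SA3_inverse[OF n] g] this]
  show ?thesis by (rule compose_inverse_affine_eq[OF n])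
qed

lemma normalizing_map_eq:
  assumes S: "branch_surface D F" and p: "p \<in> D"
  shows "normalizing_map D F p = nf_map (jet_of F p)"
  unfolding normalizing_map_def
proof (rule the_equality)
  note b = branch_surface_near[OF S p]
  have "nf_map (jet_of F p) \<in> SA3" by (rule nf_map_SA3[OF ad_nz[OF b(5,4)] b(4)])
  then show "nf_map (jet_of F p) \<in> SA3 \<and> (\<exists>E G a b c. branch_surface E G \<and> (0, 0) \<in> E \<and> normal_form a b c G \<and>
           maps_germ (nf_map (jet_of F p)) (surface D F) (point F p) (surface E G) 0)"
    using normal_form_exists[OF S p] by metis
qed (use nf_map_unique[OF S p] in blast)

section \<open>Invariant derivatives of W\<close>

lemma W_inv_derivative:
  fixes z :: "real \<Rightarrow> jet"
  assumes d: "\<And>i. ((\<lambda>s. z s i) has_real_derivative z' i) (at 0)"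
    and z: "z 0 (Fx 2) = 1" "z 0 (Fx 3) = 0" "z 0 (Fx 4) = 0" "z 0 (Fxy 1) = 0" "z 0 (Fxy 2) = 1" "z 0 (Fxy 3) = a"
  shows "((\<lambda>s. W_inv (z s)) has_real_derivative
    2 * a * z' (Fx 2) + z' (Fxy 3) - 2 * z' (Fx 3) - a * (2 * z' (Fx 2) + 2 / 3 * (z' (Fx 2) + z' (Fxy 2)))) (at 0)"
proof -
  have A: "((\<lambda>s. A_jet (z s)) has_real_derivative z' (Fx 2) + z' (Fxy 2)) (at 0)"
    unfolding A_jet_def by (rule derivative_eq_intros d refl)+ (simp add: z z[unfolded One_nat_def])
  have B: "((\<lambda>s. B_jet (z s)) has_real_derivative z' (Fx 2) * a + z' (Fxy 3)) (at 0)"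
    unfolding B_jet_def by (rule derivative_eq_intros d refl)+ (simp add: z z[unfolded One_nat_def])
  have A0: "A_jet (z 0) = 1" "B_jet (z 0) = a" by (simp_all add: A_jet_def B_jet_def z z[unfolded One_nat_def])
  \<comment> \<open>At a normalised jet \<open>A_jet\<close> is 1, so the cube root contributes the
    factor 1/3 to the derivative.\<close>
  have "DERIV (root 3) (A_jet (z 0)) :> inverse (real 3 * root 3 (A_jet (z 0)) ^ (3 - Suc 0))"
    by (rule DERIV_odd_real_root) (simp_all add: A0)
  from DERIV_chain2[OF this A]
  have R: "((\<lambda>s. root 3 (A_jet (z s))) has_real_derivative (z' (Fx 2) + z' (Fxy 2)) / 3) (at 0)"
    by (simp add: A0)
  show ?thesis unfolding W_inv_def
    by (rule derivative_eq_intros d A B R refl)+ (simp_all add: z z[unfolded One_nat_def] A0 algebra_simps)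
qed

text \<open>The graph coordinates of a normal form are the coordinates in which the invariant
  derivatives at the point are taken. The coefficient \<open>b\<close> could enter only through the
  x-derivative of \<open>Fx 4\<close>, but in \<open>B_jet\<close> this is multiplied by
  \<open>Fxy 1\<close>, which vanishes at the origin; so differentiating \<open>W\<close> does not
  produce \<open>M\<close>.\<close>

lemma normal_form_W_derivatives:
  assumes S: "branch_surface E G" "(0, 0) \<in> E" "normal_form a b c G"
  shows "((\<lambda>s. W_inv (jet_of G (s, 0))) has_real_derivative - 2 / 3 * a^2) (at 0)"
    and "((\<lambda>t. W_inv (jet_of G (0, t))) has_real_derivative 2 * a) (at 0)"
proof -
  obtain r where e: "expansion (nf_coeff a b c) r G (0, 0)" using S(3) unfolding normal_form_expansion by blast
  note P = partial_eq_coeff[OF e]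
  have G: "analytic2_at G (0, 0)" using S by (simp add: branch_surface_def)
  note Gp = analytic2_partial[OF G]
  have z: "jet_of G (0, 0) (Fx 2) = 1" "jet_of G (0, 0) (Fx 3) = 0" "jet_of G (0, 0) (Fx 4) = 0" "jet_of G (0, 0) (Fxy 1) = 0"
    "jet_of G (0, 0) (Fxy 2) = 1" "jet_of G (0, 0) (Fxy 3) = a"
    unfolding jet_of.simps P by (simp_all add: nf_coeff_def fact_numeral)
  define dx where "dx i = (case i of X \<Rightarrow> 1 | Y \<Rightarrow> 0 | Fx j \<Rightarrow> partial (Suc j) 0 G (0, 0) | Fxy j \<Rightarrow> partial (Suc j) 1 G (0, 0))" for i
  define dy where "dy i = (case i of X \<Rightarrow> 0 | Y \<Rightarrow> 1 | Fx j \<Rightarrow> partial j 1 G (0, 0) | Fxy j \<Rightarrow> partial j 2 G (0, 0))" for i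
  have x: "((\<lambda>s. jet_of G (s, 0) i) has_real_derivative dx i) (at 0)" for i
    using analytic2_DERIV_x[OF Gp] by (cases i) (auto simp: dx_def partial_x_partial)
  have y: "((\<lambda>t. jet_of G (0, t) i) has_real_derivative dy i) (at 0)" for i
    using analytic2_DERIV_y[OF Gp] by (cases i) (auto simp: dy_def partial_y_partial[OF G] numeral_2_eq_2)
  have dx: "dx (Fx 2) = 0" "dx (Fx 3) = 0" "dx (Fxy 2) = a" "dx (Fxy 3) = 0"
    unfolding dx_def jet_coord.case P by (simp_all add: nf_coeff_def fact_numeral)
  have dy: "dy (Fx 2) = 1" "dy (Fx 3) = a" "dy (Fxy 2) = 2" "dy (Fxy 3) = 6 * a"
    unfolding dy_def jet_coord.case P by (simp_all add: nf_coeff_def fact_numeral)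
  show "((\<lambda>s. W_inv (jet_of G (s, 0))) has_real_derivative - 2 / 3 * a^2) (at 0)"
    using W_inv_derivative[OF x z] unfolding dx by (simp add: power2_eq_square mult.left_commute)
  show "((\<lambda>t. W_inv (jet_of G (0, t))) has_real_derivative 2 * a) (at 0)"
    using W_inv_derivative[OF y z] unfolding dy by simp
qed

fun direction_factor :: "direction \<Rightarrow> real \<Rightarrow> real" where
  "direction_factor Dir1 w = - 2 / 3 * w^2" | "direction_factor Dir2 w = 2 * w"

text \<open>Invariance of \<open>W\<close> means that \<open>f\<close>, read in the chart at
  \<open>p\<close>, is the same power of \<open>W\<close> on the normal form \<open>G\<close>; the
  derivative is then taken at the origin of \<open>G\<close>. The description operator in
  \<open>inv_diff\<close> also demands that any other chart expression has the same
  derivative.\<close>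

lemma inv_diff_power:
  assumes S: "branch_surface D F" and p: "p \<in> D" and f: "\<And>q. q \<in> D \<Longrightarrow> f q = K * W_inv (jet_of F q) ^ k"
  shows "inv_diff i D F f p = K * real k * W_inv (jet_of F p) ^ (k - 1) * direction_factor i (W_inv (jet_of F p))"
proof -
  let ?z = "jet_of F p"
  define g where "g = nf_map ?z"
  note b = branch_surface_near[OF S p]
  have g: "g \<in> SA3" unfolding g_def by (rule nf_map_SA3[OF ad_nz[OF b(5,4)] b(4)])
  obtain E G d where E: "branch_surface E G" "(0, 0) \<in> E" "normal_form (W_inv ?z) (M_inv ?z) d G"
    and m: "maps_germ g (surface D F) (point F p) (surface E G) 0"
    unfolding g_def by (rule normal_form_exists[OF S p])
  define a where "a = W_inv ?z"
  have ch: "chart D F p q = (act g (point F q) $ 1, act g (point F q) $ 2)" for q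
    by (simp add: chart_def normalizing_map_eq[OF S p] g_def)
  from m obtain V V' where V: "act g (point F p) = 0" "open V" "point F p \<in> V" "open V'" "0 \<in> V'" "act g ` (surface D F \<inter> V) = surface E G \<inter> V'"
    unfolding maps_germ_def by blast
  have G0: "point G (0, 0) = 0" using normal_form_jet(1)[OF E(3)] by (simp add: vec_eq_iff forall_3)
  have good: "chart D F p q \<in> E \<and> point G (chart D F p q) = act g (point F q) \<and> W_inv (jet_of G (chart D F p q)) = W_inv (jet_of F q)"
    if q: "q \<in> D" "point F q \<in> V" for q
  proof -
    have s: "point F q \<in> surface D F" using q by (auto simp: surface_def)
    then have "act g (point F q) \<in> surface E G" using V(6) q(2) by blast
    then have c: "chart D F p q \<in> E" "point G (chart D F p q) = act g (point F q)"
      unfolding in_surface ch by (auto simp: vec_eq_iff forall_3)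
    have "maps_germ g (surface D F) (point F q) (surface E G) (point G (chart D F p q))"
      unfolding c(2) by (rule maps_germ_move[OF V(2,4,6) s q(2)])
    then show ?thesis using branch_surface_invariants(1)[OF S q(1) E(1) c(1) g] c by blast
  qed
  define h0 where "h0 q = K * W_inv (jet_of G q) ^ k" for q
  have "\<forall>\<^sub>F q in nhds p. point F q \<in> V"
    using topological_tendstoD[OF tendsto_at_iff_tendsto_nhds[THEN iffD1, OF continuous_point[OF analytic2_isCont[OF b(2)], unfolded continuous_at]]] V(2,3) by blast
  with eventually_nhds_in_open[OF b(1) p] have "\<forall>\<^sub>F q in nhds p. q \<in> D \<and> point F q \<in> V" by (rule eventually_conj)
  then have ev: "\<forall>\<^sub>F q in nhds p. f q = h0 (chart D F p q)"
    by eventually_elim (simp add: f h0_def good)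
  \<comment> \<open>The chart has a continuous local inverse \<open>Q\<close>, namely the inverse
    group element applied to the graph of \<open>G\<close>. Hence the chart covers a neighbourhood
    of the origin and the expression of \<open>f\<close> in it is unique there.\<close>
  have pull: "\<forall>\<^sub>F u in nhds (0, 0). h u = h0 u" if h: "\<forall>\<^sub>F q in nhds p. f q = h (chart D F p q)" for h
  proof -
    define Q where "Q u = (act (inverse_affine g) (point G u) $ 1, act (inverse_affine g) (point G u) $ 2)" for u
    have cG: "isCont (point G) (0, 0)"
      by (rule continuous_point[OF analytic2_isCont[OF branch_surface_near(2)[OF E(1,2)]]])
    then have Gt: "filterlim (point G) (nhds 0) (nhds (0, 0))"
      unfolding G0[symmetric] by (simp only: isCont_def tendsto_at_iff_tendsto_nhds)
    have "isCont Q (0, 0)" unfolding Q_def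
      by (intro continuous_intros isCont_o2[OF cG] continuous_on_interior[of UNIV "act (inverse_affine g)"] continuous_act) simp_all
    moreover have "Q (0, 0) = p"
      using act_inverse(1)[OF g, of "point F p"] unfolding V(1) Q_def G0 by simp
    ultimately have Qt: "filterlim Q (nhds p) (nhds (0, 0))"
      by (metis isCont_def tendsto_at_iff_tendsto_nhds)
    have "\<forall>\<^sub>F u in nhds (0, 0). u \<in> E" by (rule eventually_nhds_in_open[OF branch_surface_near(1)[OF E(1,2)] E(2)])
    moreover have "\<forall>\<^sub>F u in nhds (0, 0). point G u \<in> V'"
      using Gt eventually_nhds_in_open[OF V(4,5)] unfolding filterlim_iff by blast
    moreover have "\<forall>\<^sub>F u in nhds (0, 0). f (Q u) = h (chart D F p (Q u))"
      using Qt h unfolding filterlim_iff by blast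
    moreover have "\<forall>\<^sub>F u in nhds (0, 0). f (Q u) = h0 (chart D F p (Q u))"
      using Qt ev unfolding filterlim_iff by blast
    ultimately show ?thesis
    proof eventually_elim
      case (elim u)
      then have "point G u \<in> act g ` (surface D F \<inter> V)" unfolding V(6) by (auto simp: surface_def)
      then obtain q where q: "q \<in> D" "point F q \<in> V" "act g (point F q) = point G u" by (auto simp: surface_def)
      have "act (inverse_affine g) (point G u) = point F q" using act_inverse(1)[OF g, of "point F q"] q by simp
      then have "Q u = q" by (simp add: Q_def)
      moreover have "chart D F p q = u" using q(3) by (simp add: ch)
      ultimately show ?case using elim by simp
    qed
  qed
  note dW = normal_form_W_derivatives[OF E, folded a_def]
  have G0W: "W_inv (jet_of G (0, 0)) = a" using normal_form_jet(2)[OF E(3)] by (simp add: a_def)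
  have d1: "((\<lambda>s. h0 (s, 0)) has_real_derivative K * real k * a ^ (k - 1) * (- 2 / 3 * a^2)) (at 0)"
    unfolding h0_def by (rule derivative_eq_intros dW refl)+ (simp add: G0W)
  have d2: "((\<lambda>t. h0 (0, t)) has_real_derivative K * real k * a ^ (k - 1) * (2 * a)) (at 0)"
    unfolding h0_def by (rule derivative_eq_intros dW refl)+ (simp add: G0W)
  have axis: "filterlim (\<lambda>s. (s, 0)) (nhds (0, 0)) (nhds (0::real))" "filterlim (\<lambda>s. (0, s)) (nhds (0, 0)) (nhds (0::real))"
    by (intro tendsto_Pair tendsto_const filterlim_ident)+
  have uniq: "D' = K * real k * a ^ (k - 1) * (- 2 / 3 * a^2)"
    if "\<forall>\<^sub>F q in nhds p. f q = h (chart D F p q)" "((\<lambda>s. h (s, 0)) has_real_derivative D') (at 0)" for h D'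
  proof -
    have "\<forall>\<^sub>F s in nhds 0. h (s, 0) = h0 (s, 0)" using pull[OF that(1)] axis(1) unfolding filterlim_iff by blast
    from DERIV_cong_ev[OF refl this refl, of D'] that(2) have "((\<lambda>s. h0 (s, 0)) has_real_derivative D') (at 0)" by blast
    then show ?thesis using d1 DERIV_unique by blast
  qed
  have uniq2: "D' = K * real k * a ^ (k - 1) * (2 * a)"
    if "\<forall>\<^sub>F q in nhds p. f q = h (chart D F p q)" "((\<lambda>s. h (0, s)) has_real_derivative D') (at 0)" for h D'
  proof -
    have "\<forall>\<^sub>F s in nhds 0. h (0, s) = h0 (0, s)" using pull[OF that(1)] axis(2) unfolding filterlim_iff by blast
    from DERIV_cong_ev[OF refl this refl, of D'] that(2) have "((\<lambda>s. h0 (0, s)) has_real_derivative D') (at 0)" by blast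
    then show ?thesis using d2 DERIV_unique by blast
  qed
  show ?thesis
  proof (cases i)
    case Dir1
    show ?thesis unfolding Dir1 inv_diff.simps direction_factor.simps a_def[symmetric]
      by (rule the_equality) (use ev d1 uniq in blast)+
  next
    case Dir2
    show ?thesis unfolding Dir2 inv_diff.simps direction_factor.simps a_def[symmetric]
      by (rule the_equality) (use ev d2 uniq2 in blast)+
  qed
qed

text \<open>Both directional factors are monomials in \<open>W\<close>, so monomials in
  \<open>W\<close> are closed under the two operators. The constants depend on the word alone, not
  on the surface.\<close>

lemma inv_derivative_W:
  "\<exists>K k. \<forall>D F p. branch_surface D F \<longrightarrow> p \<in> D \<longrightarrow> inv_derivative w W_inv D F p = K * W_inv (jet_of F p) ^ k"
proof (induction w)
  case Nil
  show ?case by (intro exI[of _ 1] exI[of _ "1::nat"]) (simp add: inv_derivative_def)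
next
  case (Cons i w)
  then obtain K k where IH: "\<And>D F p. branch_surface D F \<Longrightarrow> p \<in> D \<Longrightarrow> inv_derivative w W_inv D F p = K * W_inv (jet_of F p) ^ k" by blast
  have step: "inv_derivative (i # w) W_inv D F p = K * real k * W_inv (jet_of F p) ^ (k - 1) * direction_factor i (W_inv (jet_of F p))"
    if "branch_surface D F" "p \<in> D" for D F p
    using inv_diff_power[OF that, of "inv_derivative w W_inv D F" K k i] IH[OF that(1)] by (simp add: inv_derivative_def)
  show ?case
  proof (cases i)
    case Dir1
    \<comment> \<open>For \<open>k = 0\<close> the truncated exponent \<open>k - 1\<close> does no
      harm, since the factor \<open>real k\<close> vanishes.\<close>
    show ?thesis by (intro exI[of _ "K * real k * (- 2 / 3)"] exI[of _ "k - 1 + 2"]) (auto simp: step[unfolded Dir1] Dir1 power_add power2_eq_square)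
  next
    case Dir2
    show ?thesis by (intro exI[of _ "K * real k * 2"] exI[of _ "k - 1 + 1"]) (auto simp: step[unfolded Dir2] Dir2 power_add)
  qed
qed

section \<open>Surfaces with prescribed jets\<close>

lemma an_poly:
  assumes "finite I" "an I f" shows "an I (\<lambda>w. poly p (f w))"
proof (induction p)
  case (pCons a p)
  then show ?case using assms by (auto intro!: an_add an_mult)
qed (use assms in auto)

lemma expansion_translate:
  assumes "expansion c r F p"
  shows "expansion c r (\<lambda>q. F (fst q - a, snd q - b)) (fst p + a, snd p + b)"
  using assms unfolding expansion_def by (simp add: algebra_simps)

lemma partial_translate:
  assumes "analytic2_at F (fst q - a, snd q - b)"
  shows "analytic2_at (\<lambda>q. F (fst q - a, snd q - b)) q"
    "partial j k (\<lambda>q. F (fst q - a, snd q - b)) q = partial j k F (fst q - a, snd q - b)"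
proof -
  obtain c r where c: "expansion c r F (fst q - a, snd q - b)" using assms unfolding analytic2_expansion by blast
  have e: "expansion c r (\<lambda>q. F (fst q - a, snd q - b)) q" using expansion_translate[OF c, of a b] by simp
  then show "analytic2_at (\<lambda>q. F (fst q - a, snd q - b)) q" unfolding analytic2_expansion by blast
  show "partial j k (\<lambda>q. F (fst q - a, snd q - b)) q = partial j k F (fst q - a, snd q - b)"
    unfolding partial_eq_coeff[OF c] partial_eq_coeff[OF e] ..
qed

lemma pderiv_funpow_0: "poly ((pderiv ^^ k) p) 0 = fact k * coeff p k" for p :: "real poly"
proof (induction k arbitrary: p)
  case (Suc k)
  have "poly ((pderiv ^^ Suc k) p) 0 = poly ((pderiv ^^ k) (pderiv p)) 0" by (simp add: funpow_swap1)
  then show ?case unfolding Suc by (simp add: coeff_pderiv)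
qed (simp add: poly_0_coeff_0)

text \<open>The surface swept out by the lines through \<open>(t, 0, f(t))\<close> in the planes with slopes
  \<open>f'(t)\<close> and \<open>h(t)\<close>; it has prescribed \<open>F(x,0) = f(x)\<close> and \<open>F\<^sub>y(x,0) = h(x)\<close>.\<close>

lemma developable_surface:
  fixes f h :: "real poly"
  assumes f2: "poly (pderiv (pderiv f)) 0 \<noteq> 0"
  obtains F \<delta> where "\<delta> > 0"
    "\<And>x y. \<bar>x\<bar> < \<delta> \<Longrightarrow> \<bar>y\<bar> < \<delta> \<Longrightarrow> analytic2_at F (x, y)"
    "\<And>x y. \<bar>x\<bar> < \<delta> \<Longrightarrow> \<bar>y\<bar> < \<delta> \<Longrightarrow> partial 2 0 F (x, y) * partial 0 2 F (x, y) - partial 1 1 F (x, y) ^ 2 = 0"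
    "\<And>j. partial j 0 F (0, 0) = fact j * coeff f j" "\<And>j. partial j 1 F (0, 0) = fact j * coeff h j"
proof -
  define f' f'' h' where "f' = pderiv f" and "f'' = pderiv f'" and "h' = pderiv h"
  \<comment> \<open>The parameter \<open>t\<close> of the ruling through \<open>(x, y)\<close>
    satisfies the envelope equation \<open>f''(t) * (x - t) + h'(t) * y = 0\<close>, the derivative
    in \<open>t\<close> of the plane with parameter \<open>t\<close>. Solved for the isolated
    \<open>t\<close> it is a fixed point problem for \<open>H\<close>.\<close>
  define H where "H w = w 0 + poly h' (w 2) / poly f'' (w 2) * w 1" for w :: "nat \<Rightarrow> real"
  have nz: "poly f'' 0 \<noteq> 0" using f2 by (simp add: f'_def f''_def)
  have v: "an {..<3::nat} (\<lambda>w. w 0)" "an {..<3::nat} (\<lambda>w. w 1)" "an {..<3::nat} (\<lambda>w. w 2)" by (auto intro!: an_var)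
  have "an {..<3} H" unfolding H_def
    by (intro an_add an_mult an_divide an_poly v finite_lessThan) (rule nz)
  then have Han: "an {..<Suc 2} H" by (simp add: eval_nat_numeral)
  have H0: "H (\<lambda>_. 0) = 0" by (simp add: H_def)
  have dH: "((\<lambda>u. H ((\<lambda>_. 0)(2 := u))) has_real_derivative 0) (at 0)" by (simp add: H_def)
  have "isCont (\<lambda>t. poly f'' t) 0" by (intro poly_isCont)
  then have "\<forall>\<^sub>F t in nhds 0. poly f'' t \<noteq> 0"
    using tendsto_imp_eventually_ne[of "poly f''" _ "nhds 0"] nz by (simp only: isCont_def tendsto_at_iff_tendsto_nhds)
  then obtain \<delta>0 where \<delta>0: "\<delta>0 > 0" "\<And>t. \<bar>t\<bar> < \<delta>0 \<Longrightarrow> poly f'' t \<noteq> 0"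
    unfolding eventually_nhds_metric by (auto simp: dist_real_def)
  obtain r \<rho> U where r: "0 < r" "r < \<delta>0" "0 < \<rho>" "\<rho> < \<delta>0" and U: "an {..<2} U" "U (\<lambda>_. 0) = 0"
    and fixU: "\<And>w. \<forall>i<2. \<bar>w i\<bar> \<le> r \<Longrightarrow> \<bar>U w\<bar> < \<rho> \<and> H (w(2 := U w)) = U w"
    and uniU: "\<And>w u. \<forall>i<2. \<bar>w i\<bar> \<le> r \<Longrightarrow> \<bar>u\<bar> \<le> \<rho> \<Longrightarrow> H (w(2 := u)) = u \<Longrightarrow> u = U w"
    using analytic_fixed_point[OF Han H0 dH \<delta>0(1)] by blast
  define \<tau> where "\<tau> q = U (\<lambda>i::nat. if i = 0 then fst q else snd q)" for q
  have \<tau>an0: "analytic2_at \<tau> (0, 0)"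
  proof -
    let ?\<sigma> = "\<lambda>i h. if i = (0::nat) then h (0::nat) else h 1"
    have \<sigma>: "an {..<2} (?\<sigma> i)" for i by (cases "i = 0") (auto intro!: an_var)
    have "an {..<2} (\<lambda>h. U (\<lambda>i. ?\<sigma> i h))"
      by (rule an_compose[OF U(1), of "{..<2}" ?\<sigma>]) (use \<sigma> in auto)
    then show ?thesis unfolding analytic2_at_iff \<tau>_def fst_conv snd_conv add_0 .
  qed
  have \<tau>: "\<bar>\<tau> (x, y)\<bar> < \<rho>" "\<tau> (x, y) = x + poly h' (\<tau> (x, y)) / poly f'' (\<tau> (x, y)) * y"
    if "\<bar>x\<bar> \<le> r" "\<bar>y\<bar> \<le> r" for x y
  proof -
    let ?w = "\<lambda>i::nat. if i = 0 then x else y"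
    have w: "\<forall>i<2. \<bar>?w i\<bar> \<le> r" using that by simp
    from fixU[OF w] show "\<bar>\<tau> (x, y)\<bar> < \<rho>" "\<tau> (x, y) = x + poly h' (\<tau> (x, y)) / poly f'' (\<tau> (x, y)) * y"
      by (simp_all add: \<tau>_def H_def cong: if_cong)
  qed
  have \<tau>0: "\<tau> (x, 0) = x" if "\<bar>x\<bar> \<le> r" "\<bar>x\<bar> \<le> \<rho>" for x
  proof -
    let ?w = "\<lambda>i::nat. if i = 0 then x else 0"
    have w: "\<forall>i<2. \<bar>?w i\<bar> \<le> r" using that r by simp
    have "x = U ?w" by (rule uniU[OF w that(2)]) (simp add: H_def)
    then show ?thesis by (simp add: \<tau>_def cong: if_cong)
  qed
  define F where "F q = poly f (\<tau> q) + poly f' (\<tau> q) * (fst q - \<tau> q) + poly h (\<tau> q) * snd q" for q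
  have Fan0: "analytic2_at F (0, 0)"
  proof -
    have t: "an {..<2::nat} (\<lambda>w. \<tau> (w 0, w 1))" using \<tau>an0 by (simp add: analytic2_at_iff)
    have v: "an {..<2::nat} (\<lambda>w. w 0)" "an {..<2::nat} (\<lambda>w. w 1)" by (auto intro!: an_var)
    have "an {..<2::nat} (\<lambda>w. poly f (\<tau> (w 0, w 1)) + poly f' (\<tau> (w 0, w 1)) * (w 0 - \<tau> (w 0, w 1)) + poly h (\<tau> (w 0, w 1)) * w 1)"
      by (intro an_add an_mult an_diff an_poly t v finite_lessThan)
    then show ?thesis unfolding analytic2_at_iff F_def by simp
  qed
  have "\<forall>\<^sub>F q in nhds (0, 0). analytic2_at F q \<and> analytic2_at \<tau> q"
    using analytic2_nearby[OF Fan0] analytic2_nearby[OF \<tau>an0] by (rule eventually_conj)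
  then obtain e where e: "e > 0" "\<And>x y. \<bar>x\<bar> < e \<Longrightarrow> \<bar>y\<bar> < e \<Longrightarrow> analytic2_at F (x, y) \<and> analytic2_at \<tau> (x, y)"
    unfolding eventually_nhds_box by auto
  define \<delta> where "\<delta> = min e (min r \<rho>)"
  have \<delta>: "\<delta> > 0" "\<delta> \<le> e" "\<delta> \<le> r" "\<delta> \<le> \<rho>" using e r by (auto simp: \<delta>_def)
  have Fa: "analytic2_at F (x, y)" and ta: "analytic2_at \<tau> (x, y)" if "\<bar>x\<bar> < \<delta>" "\<bar>y\<bar> < \<delta>" for x y
    using e(2) that \<delta> by auto
  \<comment> \<open>In both first derivatives the terms with a derivative of \<open>\<tau>\<close>
    carry the envelope expression as a factor and drop out.\<close>
  have P: "partial_x F (x, y) = poly f' (\<tau> (x, y))" "partial_y F (x, y) = poly h (\<tau> (x, y))"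
    if xy: "\<bar>x\<bar> < \<delta>" "\<bar>y\<bar> < \<delta>" for x y
  proof -
    define t where "t = \<tau> (x, y)"
    have "\<bar>t\<bar> < \<delta>0" using \<tau>(1)[of x y] xy \<delta> r by (simp add: t_def)
    then have "poly f'' t \<noteq> 0" by (rule \<delta>0(2))
    moreover have "t = x + poly h' t / poly f'' t * y" using \<tau>(2)[of x y] xy \<delta> by (simp add: t_def)
    ultimately have k: "poly f'' t * (x - t) + poly h' t * y = 0" by (simp add: field_simps)
    note tx = analytic2_DERIV_x[OF ta[OF xy]] and ty = analytic2_DERIV_y[OF ta[OF xy]]
    let ?tx = "partial_x \<tau> (x, y)" and ?ty = "partial_y \<tau> (x, y)"
    have cx: "((\<lambda>s. poly p (\<tau> (s, y))) has_real_derivative poly (pderiv p) t * ?tx) (at x)" for p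
      using DERIV_chain2[OF poly_DERIV tx] by (simp add: t_def)
    have cy: "((\<lambda>s. poly p (\<tau> (x, s))) has_real_derivative poly (pderiv p) t * ?ty) (at y)" for p
      using DERIV_chain2[OF poly_DERIV ty] by (simp add: t_def)
    have "((\<lambda>s. F (s, y)) has_real_derivative poly f' t + ?tx * (poly f'' t * (x - t) + poly h' t * y)) (at x)"
      unfolding F_def fst_conv snd_conv
      by (rule derivative_eq_intros cx tx refl)+ (simp add: f'_def f''_def h'_def t_def algebra_simps)
    then show "partial_x F (x, y) = poly f' (\<tau> (x, y))" unfolding k by (simp add: partial_x_def t_def DERIV_imp_deriv)
    have "((\<lambda>s. F (x, s)) has_real_derivative poly h t + ?ty * (poly f'' t * (x - t) + poly h' t * y)) (at y)"
      unfolding F_def fst_conv snd_conv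
      by (rule derivative_eq_intros cy ty refl)+ (simp add: f'_def f''_def h'_def t_def algebra_simps)
    then show "partial_y F (x, y) = poly h (\<tau> (x, y))" unfolding k by (simp add: partial_y_def t_def DERIV_imp_deriv)
  qed
  have nearx: "\<forall>\<^sub>F s in nhds x. \<bar>s\<bar> < \<delta>" if "\<bar>x\<bar> < \<delta>" for x
    unfolding eventually_nhds_metric by (intro exI[of _ "\<delta> - \<bar>x\<bar>"]) (use that in \<open>auto simp: dist_real_def\<close>)
  have par: "partial 2 0 F (x, y) * partial 0 2 F (x, y) - partial 1 1 F (x, y) ^ 2 = 0" if xy: "\<bar>x\<bar> < \<delta>" "\<bar>y\<bar> < \<delta>" for x y
  proof -
    note tx = analytic2_DERIV_x[OF ta[OF xy]] and ty = analytic2_DERIV_y[OF ta[OF xy]]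
    let ?tx = "partial_x \<tau> (x, y)" and ?ty = "partial_y \<tau> (x, y)" and ?t = "\<tau> (x, y)"
    have dx: "partial_x F' (x, y) = poly (pderiv p) ?t * ?tx" if F': "\<And>x y. \<bar>x\<bar> < \<delta> \<Longrightarrow> \<bar>y\<bar> < \<delta> \<Longrightarrow> F' (x, y) = poly p (\<tau> (x, y))" for F' p
    proof -
      have "\<forall>\<^sub>F s in nhds x. F' (s, y) = poly p (\<tau> (s, y))"
        using nearx[OF xy(1)] by eventually_elim (use F' xy in auto)
      from deriv_cong_ev[OF this refl] show ?thesis
        using DERIV_imp_deriv[OF DERIV_chain2[OF poly_DERIV tx]] by (simp add: partial_x_def)
    qed
    have dy: "partial_y F' (x, y) = poly (pderiv p) ?t * ?ty" if F': "\<And>x y. \<bar>x\<bar> < \<delta> \<Longrightarrow> \<bar>y\<bar> < \<delta> \<Longrightarrow> F' (x, y) = poly p (\<tau> (x, y))" for F' p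
    proof -
      have "\<forall>\<^sub>F s in nhds y. F' (x, s) = poly p (\<tau> (x, s))"
        using nearx[OF xy(2)] by eventually_elim (use F' xy in auto)
      from deriv_cong_ev[OF this refl] show ?thesis
        using DERIV_imp_deriv[OF DERIV_chain2[OF poly_DERIV ty]] by (simp add: partial_y_def)
    qed
    have 20: "partial 2 0 F (x, y) = poly f'' ?t * ?tx"
      using dx[of "partial_x F" f'] P by (simp add: partial_def numeral_2_eq_2 f''_def)
    have 11: "partial 1 1 F (x, y) = poly h' ?t * ?tx"
      using dx[of "partial_y F" h] P by (simp add: partial_def h'_def)
    have 02: "partial 0 2 F (x, y) = poly h' ?t * ?ty"
      using dy[of "partial_y F" h] P by (simp add: partial_def numeral_2_eq_2 h'_def)
    \<comment> \<open>The gradient of \<open>F\<close> is a function of \<open>\<tau>\<close> alone.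
      Symmetry of the mixed derivative relates the two derivatives of \<open>\<tau>\<close>, and
      this makes the Hessian degenerate.\<close>
    have "partial_y (partial 1 0 F) (x, y) = poly f'' ?t * ?ty"
      using dy[of "partial_x F" f'] P by (simp add: partial_def f''_def)
    then have "poly h' ?t * ?tx = poly f'' ?t * ?ty" using partial_y_partial[OF Fa[OF xy], of 1 0] 11 by simp
    then show ?thesis unfolding 20 11 02 by (simp add: power2_eq_square mult.commute[of ?tx])
  qed
  have jets: "\<forall>x. \<bar>x\<bar> < \<delta> \<longrightarrow> (partial_x ^^ j) F' (x, 0) = poly ((pderiv ^^ j) p) x"
    if "\<And>x. \<bar>x\<bar> < \<delta> \<Longrightarrow> F' (x, 0) = poly p x" for F' p j
  proof (induction j)
    case (Suc j)
    show ?case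
    proof (intro allI impI)
      fix x assume x: "\<bar>x\<bar> < \<delta>"
      have "\<forall>\<^sub>F s in nhds x. (partial_x ^^ j) F' (s, 0) = poly ((pderiv ^^ j) p) s"
        using nearx[OF x] by eventually_elim (use Suc in auto)
      from deriv_cong_ev[OF this refl] show "(partial_x ^^ Suc j) F' (x, 0) = poly ((pderiv ^^ Suc j) p) x"
        using DERIV_imp_deriv[OF poly_DERIV] by (simp add: partial_x_def)
    qed
  qed (use that in simp)
  have F0: "F (x, 0) = poly f x" if "\<bar>x\<bar> < \<delta>" for x
    using \<tau>0[of x] that \<delta> by (simp add: F_def)
  have h0: "partial_y F (x, 0) = poly h x" if "\<bar>x\<bar> < \<delta>" for x
    using \<tau>0[of x] that \<delta> P(2)[of x 0] by simp
  show ?thesis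
  proof (rule that[OF \<delta>(1) Fa par])
    show "partial j 0 F (0, 0) = fact j * coeff f j" for j
      using jets[of F f j, OF F0] \<delta> by (simp add: partial_def pderiv_funpow_0)
    show "partial j 1 F (0, 0) = fact j * coeff h j" for j
      using jets[of "partial_y F" h j, OF h0] \<delta> by (simp add: partial_def pderiv_funpow_0)
  qed
qed

section \<open>Realizing jets, and jets that differ only in M\<close>

lemma jet_coords_cong:
  assumes "\<And>i. i \<in> jet_coords n \<Longrightarrow> z i = z' i"
  shows "4 \<le> n \<Longrightarrow> W_inv z = W_inv z'" "4 \<le> n \<Longrightarrow> z \<in> branch_jets \<longleftrightarrow> z' \<in> branch_jets" "5 \<le> n \<Longrightarrow> M_inv z = M_inv z'"
    "4 \<le> n \<Longrightarrow> A_jet z = A_jet z'"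
proof -
  have c4: "z (Fx 2) = z' (Fx 2) \<and> z (Fx 3) = z' (Fx 3) \<and> z (Fx 4) = z' (Fx 4) \<and> z (Fxy 1) = z' (Fxy 1) \<and> z (Fxy 2) = z' (Fxy 2) \<and> z (Fxy 3) = z' (Fxy 3)"
    if "4 \<le> n" using that by (intro conjI assms) (auto simp: jet_coords_def)
  have c5: "z (Fx 5) = z' (Fx 5) \<and> z (Fxy 4) = z' (Fxy 4)"
    if "5 \<le> n" using that by (intro conjI assms) (auto simp: jet_coords_def)
  show A: "A_jet z = A_jet z'" if "4 \<le> n" using c4[OF that] by (simp add: A_jet_def)
  have B: "B_jet z = B_jet z'" if "4 \<le> n" using c4[OF that] by (simp add: B_jet_def)
  have C: "C_jet z = C_jet z'" if "5 \<le> n" using c4 c5 that by (simp add: C_jet_def)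
  show W: "W_inv z = W_inv z'" if "4 \<le> n" using c4[OF that] A[OF that] B[OF that] by (simp add: W_inv_def)
  show "z \<in> branch_jets \<longleftrightarrow> z' \<in> branch_jets" if "4 \<le> n"
    using c4[OF that] A[OF that] W[OF that] by (simp add: branch_jets_def S_inv_def)
  show "M_inv z = M_inv z'" if "5 \<le> n"
    using c4 c5 A B C W that by (simp add: M_inv_def Phi41_def Phi50_def)
qed

lemma branch_jets_near:
  assumes F: "analytic2_at F p" and z: "jet_of F p \<in> branch_jets"
  shows "\<forall>\<^sub>F q in nhds p. jet_of F q \<in> branch_jets"
proof -
  have c: "isCont (\<lambda>q. jet_of F q (Fx j)) p" "isCont (\<lambda>q. jet_of F q (Fxy j)) p" for j
    using analytic2_isCont[OF analytic2_partial[OF F]] by simp_all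
  let ?z = "jet_of F p"
  have nz: "?z (Fx 2) \<noteq> 0" "S_inv ?z \<noteq> 0" "W_inv ?z \<noteq> 0" "A_jet ?z \<noteq> 0" using z by (auto simp: branch_jets_def S_inv_def)
  have A: "isCont (\<lambda>q. A_jet (jet_of F q)) p" unfolding A_jet_def by (intro continuous_intros c)
  have S: "isCont (\<lambda>q. S_inv (jet_of F q)) p" unfolding S_inv_def by (intro continuous_intros c A) (use nz in simp)
  have W: "isCont (\<lambda>q. W_inv (jet_of F q)) p" unfolding W_inv_def B_jet_def by (intro continuous_intros c A) (use nz in simp)
  have ne: "\<forall>\<^sub>F q in nhds p. f q \<noteq> 0" if "isCont f p" "f p \<noteq> 0" for f :: "real \<times> real \<Rightarrow> real"
    using that tendsto_imp_eventually_ne[of f _ "nhds p"] by (simp only: isCont_def tendsto_at_iff_tendsto_nhds)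
  have "\<forall>\<^sub>F q in nhds p. jet_of F q (Fx 2) \<noteq> 0 \<and> S_inv (jet_of F q) \<noteq> 0 \<and> W_inv (jet_of F q) \<noteq> 0"
    by (intro eventually_conj ne c S W nz)
  then show ?thesis by eventually_elim (simp add: branch_jets_def)
qed

text \<open>Taylor polynomials of order \<open>N\<close> are prescribed for \<open>F\<close> and its
  first y-derivative on the axis. With \<open>N\<close> at least 4 the jet obtained decides
  membership in the branch, which persists on a small box.\<close>

lemma jets_realized:
  assumes z: "z \<in> branch_jets" and N: "4 \<le> N"
  obtains D F where "branch_surface D F" "(z X, z Y) \<in> D" "\<And>i. i \<in> jet_coords N \<Longrightarrow> jet_of F (z X, z Y) i = z i"
proof -
  define f where "f = Poly (map (\<lambda>j. z (Fx j) / fact j) [0..<Suc N])"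
  define h where "h = Poly (map (\<lambda>j. z (Fxy j) / fact j) [0..<Suc N])"
  have f: "coeff f j = z (Fx j) / fact j" and h: "coeff h j = z (Fxy j) / fact j" if "j \<le> N" for j
    using that by (simp_all add: f_def h_def nth_default_def del: upt_Suc)
  have "poly ((pderiv ^^ 2) f) 0 = z (Fx 2)" unfolding pderiv_funpow_0 using f[of 2] N by simp
  then have f2: "poly (pderiv (pderiv f)) 0 \<noteq> 0" using z by (simp add: numeral_2_eq_2 branch_jets_def)
  obtain F \<delta> where \<delta>: "\<delta> > 0" and F: "\<And>x y. \<bar>x\<bar> < \<delta> \<Longrightarrow> \<bar>y\<bar> < \<delta> \<Longrightarrow> analytic2_at F (x, y)"
    "\<And>x y. \<bar>x\<bar> < \<delta> \<Longrightarrow> \<bar>y\<bar> < \<delta> \<Longrightarrow> partial 2 0 F (x, y) * partial 0 2 F (x, y) - partial 1 1 F (x, y) ^ 2 = 0"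
    "\<And>j. partial j 0 F (0, 0) = fact j * coeff f j" "\<And>j. partial j 1 F (0, 0) = fact j * coeff h j"
    by (rule developable_surface[OF f2, of h]) blast
  define G where "G q = F (fst q - z X, snd q - z Y)" for q
  define p where "p = (z X, z Y)"
  have G: "analytic2_at G q" "partial j k G q = partial j k F (fst q - z X, snd q - z Y)"
    if "\<bar>fst q - z X\<bar> < \<delta>" "\<bar>snd q - z Y\<bar> < \<delta>" for q j k
    unfolding G_def using partial_translate[OF F(1)[OF that]] by auto
  have jet: "jet_of G p i = z i" if "i \<in> jet_coords N" for i
    using that G(2)[of p] \<delta> F(3,4) f h by (auto simp: jet_coords_def p_def)
  have pb: "jet_of G p \<in> branch_jets" using jet_coords_cong(2)[OF jet N] z by simp
  have Gp: "analytic2_at G p" using G(1)[of p] \<delta> by (simp add: p_def)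
  obtain e where e: "e > 0" "\<And>h k. \<bar>h\<bar> < e \<Longrightarrow> \<bar>k\<bar> < e \<Longrightarrow> jet_of G (fst p + h, snd p + k) \<in> branch_jets"
    using branch_jets_near[OF Gp pb] unfolding eventually_nhds_box by blast
  define D where "D = {q :: real \<times> real. \<bar>fst q - z X\<bar> < min \<delta> e \<and> \<bar>snd q - z Y\<bar> < min \<delta> e}"
  have "open D" unfolding D_def by (intro open_Collect_conj open_Collect_less continuous_intros)
  moreover have "jet_of G q \<in> branch_jets" if "q \<in> D" for q
    using e(2)[of "fst q - z X" "snd q - z Y"] that by (simp add: D_def p_def)
  ultimately have "branch_surface D G" unfolding branch_surface_def
    using G F(2) by (auto simp: D_def)
  moreover have "(z X, z Y) \<in> D" using \<delta> e by (simp add: D_def)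
  ultimately show ?thesis using jet by (intro that) (auto simp: p_def)
qed

text \<open>The change of \<open>Fxy 4\<close> compensates that of \<open>Fx 5\<close> so that
  \<open>C_jet\<close> is unchanged. Then only the summand with \<open>z (Fx 5)\<close> in
  \<open>Phi50\<close> moves, with slope \<open>A_jet z / z (Fx 2)^4\<close>.\<close>

lemma M_vary:
  fixes z :: jet and t :: real
  assumes z: "z (Fx 2) \<noteq> 0" "A_jet z \<noteq> 0"
  defines "z' \<equiv> z(Fx 5 := z (Fx 5) + t, Fxy 4 := z (Fxy 4) + z (Fxy 1) / z (Fx 2) * t)"
  shows "M_inv z' = M_inv z + t * (A_jet z / z (Fx 2)^4)" "W_inv z' = W_inv z" "A_jet z' = A_jet z"
proof -
  have c: "z' (Fx 2) = z (Fx 2)" "z' (Fx 3) = z (Fx 3)" "z' (Fx 4) = z (Fx 4)" "z' (Fxy 1) = z (Fxy 1)" "z' (Fxy 2) = z (Fxy 2)" "z' (Fxy 3) = z (Fxy 3)"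
    "z' (Fx 5) = z (Fx 5) + t" "z' (Fxy 4) = z (Fxy 4) + z (Fxy 1) / z (Fx 2) * t"
    by (simp_all add: z'_def)
  have A: "A_jet z' = A_jet z" "B_jet z' = B_jet z" by (simp_all only: A_jet_def B_jet_def c)
  have C: "C_jet z' = C_jet z" using z by (simp add: C_jet_def c c[unfolded One_nat_def] field_simps)
  show "A_jet z' = A_jet z" by (rule A(1))
  show W: "W_inv z' = W_inv z" by (simp only: W_inv_def A c)
  have P: "Phi41 z' = Phi41 z" by (simp only: Phi41_def A C c)
  have "Phi50 z' = Phi50 z + t * (A_jet z / z (Fx 2)^4)"
    unfolding Phi50_def A C c using z by (simp add: field_simps eval_nat_numeral)
  then show "M_inv z' = M_inv z + t * (A_jet z / z (Fx 2)^4)" by (simp add: M_inv_def W P)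
qed

lemma M_vary_open:
  assumes V: "jet_open n V" "V \<subseteq> branch_jets" and z: "z \<in> V"
  shows "\<exists>z'\<in>V. (\<forall>i\<in>jet_coords 4. z i = z' i) \<and> W_inv z' = W_inv z \<and> M_inv z' \<noteq> M_inv z"
proof -
  obtain e where e: "e > 0" "\<And>z'. (\<forall>i\<in>jet_coords n. \<bar>z' i - z i\<bar> < e) \<Longrightarrow> z' \<in> V"
    using V(1) z unfolding jet_open_def by blast
  have zb: "z (Fx 2) \<noteq> 0" "A_jet z \<noteq> 0" using V(2) z by (auto simp: branch_jets_def S_inv_def)
  define s where "s = z (Fxy 1) / z (Fx 2)"
  define m where "m = \<bar>s\<bar> + 1"
  have m: "m \<ge> 1" by (simp add: m_def)
  \<comment> \<open>Small enough for both altered coordinates, \<open>Fx 5\<close> by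
    \<open>t\<close> and \<open>Fxy 4\<close> by \<open>s * t\<close>, to stay within
    \<open>e\<close>.\<close>
  define t where "t = e / (2 * m)"
  have t: "t > 0" using e m by (simp add: t_def)
  have "t * 1 \<le> t * m" using t m by (intro mult_left_mono) auto
  moreover have tm: "m * t = e / 2" using m by (simp add: t_def)
  ultimately have "t < e" using e by (simp add: mult.commute)
  have t: "t > 0" "t < e" by fact+
  have "\<bar>s\<bar> * t \<le> m * t" using t by (intro mult_right_mono) (auto simp: m_def)
  also note tm
  finally have t2: "\<bar>s * t\<bar> < e" using t e by (simp add: abs_mult)
  define z' where "z' = z(Fx 5 := z (Fx 5) + t, Fxy 4 := z (Fxy 4) + s * t)"
  have "z' \<in> V" by (rule e(2)) (use t t2 e in \<open>auto simp: z'_def\<close>)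
  moreover have "\<forall>i\<in>jet_coords 4. z i = z' i" by (auto simp: jet_coords_def z'_def)
  moreover note M_vary[OF zb, of t, folded s_def, folded z'_def]
  ultimately show ?thesis using t zb by (intro bexI[of _ z']) auto
qed

text \<open>The whole family of derived invariants is a function of the single number
  \<open>W\<close>, while every open set of jets in the branch contains two jets with equal
  \<open>W\<close> and different \<open>M\<close>.\<close>

lemma M_not_function_of_W: "\<not> locally_function_of_derivatives M_inv W_inv"
proof
  assume "locally_function_of_derivatives M_inv W_inv"
  then obtain n V and \<phi> :: "(direction list \<Rightarrow> real) \<Rightarrow> real" where V: "jet_open n V" "V \<noteq> {}" "V \<subseteq> branch_jets"
    and \<phi>: "\<And>D F p. branch_surface D F \<Longrightarrow> p \<in> D \<Longrightarrow> jet_of F p \<in> V \<Longrightarrow> M_inv (jet_of F p) = \<phi> (\<lambda>w. inv_derivative w W_inv D F p)"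
    unfolding locally_function_of_derivatives_def by blast
  obtain K k where K: "\<And>w D F p. branch_surface D F \<Longrightarrow> p \<in> D \<Longrightarrow> inv_derivative w W_inv D F p = K w * W_inv (jet_of F p) ^ k w"
    using inv_derivative_W by metis
  \<comment> \<open>The realized jet has to agree with \<open>z\<close> both in the order
    \<open>n\<close> that decides membership in \<open>V\<close> and in the order 5 in which
    \<open>M\<close> is read.\<close>
  define N where "N = max n 5"
  have M: "M_inv z = \<phi> (\<lambda>w. K w * W_inv z ^ k w)" if z: "z \<in> V" for z
  proof -
    have N4: "4 \<le> N" by (simp add: N_def)
    obtain D F where F: "branch_surface D F" "(z X, z Y) \<in> D" "\<And>i. i \<in> jet_coords N \<Longrightarrow> jet_of F (z X, z Y) i = z i"
      by (rule jets_realized[OF subsetD[OF V(3) z] N4]) blast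
    obtain e where e: "e > 0" "\<And>z'. (\<forall>i\<in>jet_coords n. \<bar>z' i - z i\<bar> < e) \<Longrightarrow> z' \<in> V"
      using V(1) z unfolding jet_open_def by blast
    have "jet_coords n \<subseteq> jet_coords N" by (auto simp: jet_coords_def N_def)
    then have "\<forall>i\<in>jet_coords n. \<bar>jet_of F (z X, z Y) i - z i\<bar> < e" using e(1) F(3) by auto
    then have "jet_of F (z X, z Y) \<in> V" by (rule e(2))
    from \<phi>[OF F(1,2) this] have "M_inv (jet_of F (z X, z Y)) = \<phi> (\<lambda>w. K w * W_inv (jet_of F (z X, z Y)) ^ k w)"
      unfolding K[OF F(1,2)] .
    then show ?thesis using jet_coords_cong(1,3)[OF F(3)] by (simp add: N_def)
  qed
  obtain z where z: "z \<in> V" using V(2) by blast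
  obtain z' where z': "z' \<in> V" "W_inv z' = W_inv z" "M_inv z' \<noteq> M_inv z"
    using M_vary_open[OF V(1,3) z] by blast
  show False using M[OF z] M[OF z'(1)] z'(2,3) by simp
qed

section \<open>Invariants of order 5\<close>

lemma finite_jet_coords [simp]: "finite (jet_coords n)"
proof -
  have "{Fxy j |j. j + 1 \<le> n} = Fxy ` {j. j + 1 \<le> n}" "{Fx j |j. j \<le> n} = Fx ` {j. j \<le> n}" by auto
  moreover have "finite {j. j + 1 \<le> n}" by (rule finite_subset[of _ "{..n}"]) auto
  ultimately show ?thesis by (simp add: jet_coords_def)
qed

lemma av_iff: "analytic_vars_at (jet_coords n) f z \<longleftrightarrow> an (jet_coords n) (\<lambda>h. f (\<lambda>i. z i + h i))"
  by (rule analytic_vars_at_iff) simp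

lemma av_const: "analytic_vars_at (jet_coords n) (\<lambda>_. k) z"
  unfolding av_iff by (rule an_const)

lemma av_coord: "i \<in> jet_coords n \<Longrightarrow> analytic_vars_at (jet_coords n) (\<lambda>z. z i) z"
  unfolding av_iff by (intro an_add an_const an_var) auto

lemma av_add: "analytic_vars_at (jet_coords n) f z \<Longrightarrow> analytic_vars_at (jet_coords n) g z \<Longrightarrow> analytic_vars_at (jet_coords n) (\<lambda>z. f z + g z) z"
  unfolding av_iff by (rule an_add)

lemma av_diff: "analytic_vars_at (jet_coords n) f z \<Longrightarrow> analytic_vars_at (jet_coords n) g z \<Longrightarrow> analytic_vars_at (jet_coords n) (\<lambda>z. f z - g z) z"
  unfolding av_iff by (rule an_diff) simp

lemma av_uminus: "analytic_vars_at (jet_coords n) f z \<Longrightarrow> analytic_vars_at (jet_coords n) (\<lambda>z. - f z) z"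
  unfolding av_iff by (rule an_uminus) simp

lemma av_mult: "analytic_vars_at (jet_coords n) f z \<Longrightarrow> analytic_vars_at (jet_coords n) g z \<Longrightarrow> analytic_vars_at (jet_coords n) (\<lambda>z. f z * g z) z"
  unfolding av_iff by (rule an_mult) simp

lemma av_power: "analytic_vars_at (jet_coords n) f z \<Longrightarrow> analytic_vars_at (jet_coords n) (\<lambda>z. f z ^ k) z"
  unfolding av_iff by (rule an_power) simp

lemma av_divide: "analytic_vars_at (jet_coords n) f z \<Longrightarrow> analytic_vars_at (jet_coords n) g z \<Longrightarrow> g z \<noteq> 0 \<Longrightarrow> analytic_vars_at (jet_coords n) (\<lambda>z. f z / g z) z"
  unfolding av_iff by (rule an_divide) auto

lemma av_root3: "analytic_vars_at (jet_coords n) f z \<Longrightarrow> f z \<noteq> 0 \<Longrightarrow> analytic_vars_at (jet_coords n) (\<lambda>z. root 3 (f z)) z"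
  unfolding av_iff by (rule an_root3) auto

lemmas av_intros = av_const av_coord av_add av_diff av_uminus av_mult av_power av_divide av_root3

lemma av_near:
  assumes "analytic_vars_at (jet_coords n) f z" "\<epsilon> > 0"
  shows "\<exists>e>0. \<forall>y. (\<forall>i\<in>jet_coords n. \<bar>y i - z i\<bar> < e) \<longrightarrow> \<bar>f y - f z\<bar> < \<epsilon>"
proof -
  have "an (jet_coords n) (\<lambda>h. f (\<lambda>i. z i + h i) - f z)" using assms(1) unfolding av_iff by (intro an_diff an_const) simp
  then obtain s where s: "s > 0" "ps (jet_coords n) s (\<epsilon> / 2) (\<lambda>h. f (\<lambda>i. z i + h i) - f z)"
    using ps_small_exists[of "jet_coords n" "\<lambda>h. f (\<lambda>i. z i + h i) - f z" "\<epsilon> / 2" 1] assms(2) by auto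
  show ?thesis
  proof (intro exI[of _ s] conjI s allI impI)
    fix y assume y: "\<forall>i\<in>jet_coords n. \<bar>y i - z i\<bar> < s"
    have "\<bar>f (\<lambda>i. z i + (y i - z i)) - f z\<bar> \<le> \<epsilon> / 2" by (rule ps_bound[OF s(2)]) (use y in auto)
    then show "\<bar>f y - f z\<bar> < \<epsilon>" using assms(2) by simp
  qed
qed

text \<open>Jets that agree in the listed coordinates have distance 0 there, so local continuity
  with an arbitrary tolerance forces equal values.\<close>

lemma av_cong_coords:
  assumes "analytic_vars_at (jet_coords n) f z" "\<And>i. i \<in> jet_coords n \<Longrightarrow> y i = z i"
  shows "f y = f z"
proof (rule ccontr)
  assume "f y \<noteq> f z"
  then have "\<bar>f y - f z\<bar> > 0" by simp
  from av_near[OF assms(1) this] obtain e where e: "e > 0"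
    "\<And>u. \<forall>i\<in>jet_coords n. \<bar>u i - z i\<bar> < e \<Longrightarrow> \<bar>f u - f z\<bar> < \<bar>f y - f z\<bar>" by blast
  have "\<forall>i\<in>jet_coords n. \<bar>y i - z i\<bar> < e" using assms(2) e(1) by simp
  from e(2)[OF this] show False by simp
qed

lemma av_nonzero:
  assumes "analytic_vars_at (jet_coords n) f z" "f z \<noteq> 0"
  shows "\<exists>e>0. \<forall>y. (\<forall>i\<in>jet_coords n. \<bar>y i - z i\<bar> < e) \<longrightarrow> f y \<noteq> 0"
  using av_near[OF assms(1), of "\<bar>f z\<bar>"] assms(2) by fastforce

lemma coords5 [simp]: "X \<in> jet_coords 5" "Y \<in> jet_coords 5" "j \<le> 5 \<Longrightarrow> Fx j \<in> jet_coords 5" "j \<le> 4 \<Longrightarrow> Fxy j \<in> jet_coords 5"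
  by (auto simp: jet_coords_def)

lemma coords5_cases:
  assumes "i \<in> jet_coords 5"
  shows "i \<in> {X, Y, Fx 0, Fx 1, Fx 2, Fx 3, Fx 4, Fx 5, Fxy 0, Fxy 1, Fxy 2, Fxy 3, Fxy 4}"
proof -
  have "j \<in> {0, 1, 2, 3, 4, 5}" if "j \<le> 5" for j :: nat using that by auto
  moreover have "j \<in> {0, 1, 2, 3, 4}" if "j + 1 \<le> 5" for j :: nat using that by auto
  ultimately show ?thesis using assms unfolding jet_coords_def by fastforce
qed

lemma av_A: "analytic_vars_at (jet_coords 5) A_jet z"
  and av_B: "analytic_vars_at (jet_coords 5) B_jet z"
  and av_C: "analytic_vars_at (jet_coords 5) C_jet z"
  unfolding A_jet_def B_jet_def C_jet_def by (intro av_intros; simp)+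

lemma branch_jetsD:
  assumes "z \<in> branch_jets"
  shows "z (Fx 2) \<noteq> 0" "A_jet z \<noteq> 0" "W_inv z \<noteq> 0" "ad z \<noteq> 0"
  using assms ad_nz by (auto simp: branch_jets_def S_inv_def)

lemma av_W:
  assumes "z (Fx 2) \<noteq> 0" "A_jet z \<noteq> 0"
  shows "analytic_vars_at (jet_coords 5) W_inv z"
  unfolding W_inv_def by (intro av_intros av_A av_B) (use assms in simp_all)

lemma av_Phi41:
  assumes "z (Fx 2) \<noteq> 0" "A_jet z \<noteq> 0"
  shows "analytic_vars_at (jet_coords 5) Phi41 z"
  unfolding Phi41_def by (intro av_intros av_A av_B av_C) (use assms in simp_all)

lemma av_M:
  assumes "z \<in> branch_jets"
  shows "analytic_vars_at (jet_coords 5) M_inv z"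
proof -
  note b = branch_jetsD[OF assms]
  have "analytic_vars_at (jet_coords 5) Phi50 z"
    unfolding Phi50_def by (intro av_intros av_A av_B av_C) (use b in simp_all)
  then show ?thesis unfolding M_inv_def by (intro av_intros av_Phi41 av_W b)
qed

lemma branch_jets_open: "jet_open 5 branch_jets"
  unfolding jet_open_def
proof
  fix z assume "z \<in> branch_jets"
  note b = branch_jetsD[OF this]
  obtain e1 where e1: "e1 > 0" "\<forall>y. (\<forall>i\<in>jet_coords 5. \<bar>y i - z i\<bar> < e1) \<longrightarrow> y (Fx 2) \<noteq> 0"
    using av_nonzero[where f = "\<lambda>y. y (Fx 2)" and z = z and n = 5, OF av_coord b(1)] by auto
  obtain e2 where e2: "e2 > 0" "\<forall>y. (\<forall>i\<in>jet_coords 5. \<bar>y i - z i\<bar> < e2) \<longrightarrow> A_jet y \<noteq> 0"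
    using av_nonzero[OF av_A b(2)] by auto
  obtain e3 where e3: "e3 > 0" "\<forall>y. (\<forall>i\<in>jet_coords 5. \<bar>y i - z i\<bar> < e3) \<longrightarrow> W_inv y \<noteq> 0"
    using av_nonzero[OF av_W[OF b(1,2)] b(3)] by auto
  show "\<exists>e>0. \<forall>z'. (\<forall>i\<in>jet_coords 5. \<bar>z' i - z i\<bar> < e) \<longrightarrow> z' \<in> branch_jets"
    by (rule exI[of _ "min e1 (min e2 e3)"]) (use e1 e2 e3 in \<open>auto simp: branch_jets_def S_inv_def\<close>)
qed

section \<open>M as a differential invariant, and images of whole graphs\<close>

lemma maps_germ_surface:
  assumes "act g ` surface D F = surface D' F'" "act g (point F p) = point F' p'"
  shows "maps_germ g (surface D F) (point F p) (surface D' F') (point F' p')"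
  using assms unfolding maps_germ_def by (intro conjI exI[of _ UNIV]) auto

lemma M_diff_invariant: "diff_invariant 5 branch_jets M_inv"
  unfolding diff_invariant_def
proof (intro conjI ballI allI impI)
  fix D F p assume a: "branch_surface D F \<and> p \<in> D \<and> jet_of F p \<in> branch_jets"
  show "\<exists>e>0. \<forall>g D' F' p'. g \<in> SA3 \<and> dist g (mat 1, 0) < e \<and> branch_surface D' F' \<and> act g ` surface D F = surface D' F' \<and>
     p' \<in> D' \<and> act g (point F p) = point F' p' \<and> jet_of F' p' \<in> branch_jets \<longrightarrow> M_inv (jet_of F' p') = M_inv (jet_of F p)"
  \<comment> \<open>The radius 1 is arbitrary: \<open>M\<close> is invariant under all of
    \<open>SA3\<close>.\<close>
  proof (intro exI[of _ 1] conjI allI impI)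
    fix g D' F' p' assume "g \<in> SA3 \<and> dist g (mat 1, 0) < 1 \<and> branch_surface D' F' \<and> act g ` surface D F = surface D' F' \<and>
     p' \<in> D' \<and> act g (point F p) = point F' p' \<and> jet_of F' p' \<in> branch_jets"
    then show "M_inv (jet_of F' p') = M_inv (jet_of F p)"
      using branch_surface_invariants(2)[of D F p D' F' p' g] maps_germ_surface a by blast
  qed simp
qed (auto simp: branch_jets_open av_M)

lemma M_order_5: "diff_invariant_of_order 5 branch_jets M_inv"
  unfolding diff_invariant_of_order_def
proof (intro conjI M_diff_invariant allI impI)
  fix V assume V: "jet_open 5 V \<and> V \<noteq> {} \<and> V \<subseteq> branch_jets"
  then obtain z where z: "z \<in> V" by blast
  from M_vary_open[OF _ _ z] V
  obtain z' where "z' \<in> V" "\<forall>i\<in>jet_coords 4. z i = z' i" "M_inv z' \<noteq> M_inv z" by blast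
  then show "\<exists>z\<in>V. \<exists>z'\<in>V. (\<forall>i\<in>jet_coords (5 - 1). z i = z' i) \<and> M_inv z \<noteq> M_inv z'"
    using z by (intro bexI[of _ z] bexI[of _ z']) auto
qed

text \<open>Injectivity of the projected map is the one global condition; being a branch surface is
  local and is supplied by \<open>transform_branch\<close> around every point.\<close>

lemma global_graph:
  fixes g :: "(real ^ 3 ^ 3) \<times> (real ^ 3)"
  assumes S: "branch_surface D F" and g: "g \<in> SA3"
    and inj: "inj_on (\<lambda>q. (act g (point F q) $ 1, act g (point F q) $ 2)) D"
  defines "L \<equiv> \<lambda>p i j. fst g $ i $ j + fst g $ i $ 3 * (if j = 1 then partial 1 0 F p else partial 0 1 F p)"
  assumes T: "\<And>p. p \<in> D \<Longrightarrow> L p 1 1 * L p 2 2 - L p 1 2 * L p 2 1 \<noteq> 0" "\<And>p. p \<in> D \<Longrightarrow> L p 2 2 * partial 2 0 F p - L p 2 1 * partial 1 1 F p \<noteq> 0"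
  obtains D' F' where "branch_surface D' F'" "act g ` surface D F = surface D' F'"
proof -
  define \<pi> where "\<pi> q = (act g (point F q) $ 1, act g (point F q) $ 2)" for q
  define D' where "D' = \<pi> ` D"
  define F' where "F' u = act g (point F (the_inv_into D \<pi> u)) $ 3" for u
  have inj': "inj_on \<pi> D" using inj by (simp add: \<pi>_def[abs_def])
  have F': "F' (\<pi> q) = act g (point F q) $ 3" if "q \<in> D" for q
    using the_inv_into_f_f[OF inj' that] by (simp add: F'_def)
  have P: "point F' (\<pi> q) = act g (point F q)" if "q \<in> D" for q
    using F'[OF that] by (simp add: vec_eq_iff forall_3 \<pi>_def)
  have img: "act g ` surface D F = surface D' F'"
    unfolding surface_def D'_def image_image by (rule image_cong) (simp_all add: P)
  \<comment> \<open>A local graph \<open>G\<close> of the image lies over \<open>D'\<close>, and by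
    injectivity no second point of the image lies above the same base point, so \<open>F'\<close>
    agrees with \<open>G\<close>.\<close>
  have loc: "\<exists>E G. branch_surface E G \<and> u \<in> E \<and> E \<subseteq> D' \<and> (\<forall>v\<in>E. F' v = G v)" if u: "u \<in> D'" for u
  proof -
    obtain p where p: "p \<in> D" "u = \<pi> p" using u by (auto simp: D'_def)
    obtain E G p' V V' where E: "branch_surface E G" "p' \<in> E" "act g (point F p) = point G p'"
      and V: "\<And>q. q \<in> E \<Longrightarrow> point G q \<in> V'" "act g ` (surface D F \<inter> V) = surface E G \<inter> V'"
      by (rule transform_branch[OF S p(1) g]) (use T[OF p(1)] in \<open>simp add: L_def\<close>, use T[OF p(1)] in \<open>simp add: L_def\<close>, blast)
    have "p' = u" using E(3) by (simp add: p \<pi>_def)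
    moreover have "v \<in> D' \<and> F' v = G v" if v: "v \<in> E" for v
    proof -
      have "point G v \<in> act g ` (surface D F \<inter> V)" unfolding V(2) using v V(1) by (auto simp: surface_def)
      then obtain q where q: "q \<in> D" "act g (point F q) = point G v" by (auto simp: surface_def)
      then have "\<pi> q = v" by (simp add: \<pi>_def)
      moreover have "F' (\<pi> q) = G v" using F'[OF q(1)] q(2) by simp
      ultimately show ?thesis using q(1) by (auto simp: D'_def)
    qed
    ultimately show ?thesis using E by blast
  qed
  have "branch_surface D' F'" unfolding branch_surface_def
  proof (intro conjI ballI)
    show "open D'"
    proof (subst open_subopen, intro ballI)
      fix u assume "u \<in> D'"
      from loc[OF this] obtain E G where E: "branch_surface E G" "u \<in> E" "E \<subseteq> D'" by blast
      then show "\<exists>T. open T \<and> u \<in> T \<and> T \<subseteq> D'" using branch_surface_near(1)[OF E(1,2)] by blast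
    qed
    fix u assume "u \<in> D'"
    from loc[OF this] obtain E G where E: "branch_surface E G" "u \<in> E" "\<forall>v\<in>E. F' v = G v" by blast
    have ev: "\<forall>\<^sub>F v in nhds u. G v = F' v"
      using eventually_nhds_in_open[OF branch_surface_near(1)[OF E(1,2)] E(2)] by eventually_elim (use E in auto)
    have G: "analytic2_at G u" using E by (simp add: branch_surface_def)
    show "analytic2_at F' u" by (rule analytic2_cong[OF G ev])
    have p: "partial j k F' u = partial j k G u" for j k using partial_cong[OF ev G] by simp
    have j: "jet_of F' u = jet_of G u"
    proof
      fix i show "jet_of F' u i = jet_of G u i" by (cases i) (simp_all add: p)
    qed
    show "partial 2 0 F' u * partial 0 2 F' u - (partial 1 1 F' u)\<^sup>2 = 0" "jet_of F' u \<in> branch_jets"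
      unfolding p j using E by (auto simp: branch_surface_def)
  qed
  then show ?thesis using img by (rule that)
qed

text \<open>The inverse of \<open>nf_map\<close>, written out so that its entries are visibly
  analytic in the jet; see \<open>act_nf_inv\<close> and \<open>av_nf_inv\<close>.\<close>

definition nf_inv :: "jet \<Rightarrow> (real ^ 3 ^ 3) \<times> (real ^ 3)" where
  "nf_inv z = (adapt_mat z (ad z) ** shear (- nf_r z) (- nf_s z) (nf_s z * nf_r z - nf_w z), vector [z X, z Y, z (Fx 0)])"

lemma shear_inverse:
  "shear r s w ** shear (- r) (- s) (s * r - w) = mat 1" "shear (- r) (- s) (s * r - w) ** shear r s w = mat 1"
  by (simp_all add: vec_eq_iff forall_3 matrix_matrix_mult_def sum_3 mat_def shear_nth)

lemma nf_inv_inverse: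
  assumes "ad z \<noteq> 0" "z (Fx 2) \<noteq> 0"
  shows "fst (nf_inv z) ** nf_lin z = mat 1" "nf_lin z ** fst (nf_inv z) = mat 1"
proof -
  let ?S = "shear (nf_r z) (nf_s z) (nf_w z)" and ?T = "shear (- nf_r z) (- nf_s z) (nf_s z * nf_r z - nf_w z)"
  let ?P = "adapt_mat z (ad z)" and ?Q = "adapt_inv z (ad z)"
  note a = adapt_mat_inv[where z = z and \<alpha> = "ad z", OF assms]
  have "(?P ** ?T) ** (?S ** ?Q) = ?P ** ((?T ** ?S) ** ?Q)" by (simp only: matrix_mul_assoc)
  then show "fst (nf_inv z) ** nf_lin z = mat 1" unfolding nf_inv_def nf_lin_def by (simp add: shear_inverse a)
  have "(?S ** ?Q) ** (?P ** ?T) = ?S ** ((?Q ** ?P) ** ?T)" by (simp only: matrix_mul_assoc)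
  then show "nf_lin z ** fst (nf_inv z) = mat 1" unfolding nf_inv_def nf_lin_def by (simp add: shear_inverse a)
qed

lemma act_nf_inv:
  assumes "ad z \<noteq> 0" "z (Fx 2) \<noteq> 0"
  shows "act (nf_map z) (act (nf_inv z) v) = v" "act (nf_inv z) (act (nf_map z) v) = v"
proof -
  let ?b = "vector [z X, z Y, z (Fx 0)] :: real ^ 3"
  have s: "snd (nf_inv z) = ?b" by (simp add: nf_inv_def)
  have m: "fst (nf_map z) = nf_lin z" "snd (nf_map z) = - (nf_lin z *v ?b)" by (simp_all add: nf_map_def)
  note i = nf_inv_inverse[OF assms]
  show "act (nf_map z) (act (nf_inv z) v) = v"
    unfolding act_def s m by (simp add: matrix_vector_right_distrib matrix_vector_mul_assoc i)
  have "nf_lin z *v v + - (nf_lin z *v ?b) = nf_lin z *v (v - ?b)" by (simp add: matrix_vector_mult_diff_distrib)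
  then show "act (nf_inv z) (act (nf_map z) v) = v"
    unfolding act_def s m by (simp add: matrix_vector_mul_assoc i)
qed

lemma nf_inv_SA3:
  assumes "ad z \<noteq> 0" "z (Fx 2) \<noteq> 0" shows "nf_inv z \<in> SA3"
  using assms by (simp add: SA3_def nf_inv_def det_mul det_shear adapt_det)

lemma affine_eqI: "(\<And>v. act g v = act h v) \<Longrightarrow> g = h"
proof -
  assume a: "\<And>v. act g v = act h v"
  from a[of 0] have s: "snd g = snd h" by (simp add: act_def)
  have "fst g *v v = fst h *v v" for v using a[of v] s by (simp add: act_def)
  then have "fst g = fst h" by (simp add: matrix_eq)
  with s show "g = h" by (simp add: prod_eq_iff)
qed

lemma nf_map_cong:
  assumes "\<And>i. i \<in> jet_coords 5 \<Longrightarrow> z i = z' i"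
  shows "nf_map z = nf_map z'"
proof -
  have c: "z (Fx j) = z' (Fx j)" if "j \<le> 5" for j using that by (intro assms) simp
  have d: "z (Fxy j) = z' (Fxy j)" if "j \<le> 4" for j using that by (intro assms) simp
  have xy: "z X = z' X" "z Y = z' Y" by (intro assms; simp)+
  have A: "A_jet z = A_jet z'" "B_jet z = B_jet z'" "C_jet z = C_jet z'"
    by (simp_all add: A_jet_def B_jet_def C_jet_def c d)
  have ad: "ad z = ad z'" by (simp add: ad_def A c)
  have e: "ad_e z = ad_e z'" "ad_e4 z = ad_e4 z'" "ad_b z = ad_b z'" by (simp_all add: ad_e_def ad_e4_def ad_b_def ad A c)
  have P: "Phi41 z = Phi41 z'" "W_inv z = W_inv z'" by (simp_all add: Phi41_def W_inv_def A c)
  have r: "nf_r z = nf_r z'" by (simp add: nf_r_def P)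
  have s: "nf_s z = nf_s z'" by (simp add: nf_s_def e r)
  have w: "nf_w z = nf_w z'" by (simp add: nf_w_def e r s)
  have "adapt_inv z (ad z) = adapt_inv z' (ad z')" by (simp add: adapt_inv_def adapt_u_def ad c d)
  then show ?thesis by (simp add: nf_map_def nf_lin_def r s w xy c)
qed

text \<open>The dimensions match: the group has dimension 11, and with \<open>W\<close> and
  \<open>M\<close> this makes 13, the number of coordinates of a 5-jet. The matrix entries and
  invariants are solved for the coordinates in triangular order, starting from the base point and
  the last row.\<close>

lemma nf_map_injective:
  assumes z: "z \<in> branch_jets" and z': "z' \<in> branch_jets"
    and eq: "nf_map z = nf_map z'" and W: "W_inv z = W_inv z'" and M: "M_inv z = M_inv z'" and i: "i \<in> jet_coords 5"
  shows "z i = z' i"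
proof -
  note b = branch_jetsD[OF z] and b' = branch_jetsD[OF z']
  have lin: "nf_lin z = nf_lin z'" using eq by (simp add: nf_map_def)
  have "nf_lin z *v vector [z X, z Y, z (Fx 0)] = nf_lin z *v vector [z' X, z' Y, z' (Fx 0)]"
    using eq unfolding nf_map_def lin by simp
  then have "fst (nf_inv z) *v (nf_lin z *v vector [z X, z Y, z (Fx 0)]) = fst (nf_inv z) *v (nf_lin z *v vector [z' X, z' Y, z' (Fx 0)])" by simp
  then have "(vector [z X, z Y, z (Fx 0)] :: real ^ 3) = vector [z' X, z' Y, z' (Fx 0)]"
    by (simp add: matrix_vector_mul_assoc nf_inv_inverse[OF b(4,1)])
  then have xy: "z X = z' X" "z Y = z' Y" "z (Fx 0) = z' (Fx 0)" by (simp_all add: vec_eq_iff forall_3 vector_3)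
  have N: "nf_lin z $ i $ j = shear (nf_r z) (nf_s z) (nf_w z) $ i $ 1 * adapt_inv z (ad z) $ 1 $ j + shear (nf_r z) (nf_s z) (nf_w z) $ i $ 2 * adapt_inv z (ad z) $ 2 $ j
     + shear (nf_r z) (nf_s z) (nf_w z) $ i $ 3 * adapt_inv z (ad z) $ 3 $ j" for z i j
    by (simp add: nf_lin_def matrix_matrix_mult_def sum_3)
  have ent: "nf_lin z $ i $ j = nf_lin z' $ i $ j" for i j using lin by simp
  have k: "adapt_u z (ad z) = adapt_u z' (ad z')"
    using ent[of 3 3] unfolding N shear_nth adapt_inv_nth by simp
  have k0: "adapt_u z (ad z) \<noteq> 0" using b by (simp add: adapt_u_def)
  have m: "z (Fx 1) = z' (Fx 1)" and n: "z (Fxy 0) = z' (Fxy 0)"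
    using ent[of 3 1] ent[of 3 2] k0 unfolding N shear_nth adapt_inv_nth k by simp_all
  have r: "nf_r z = nf_r z'" and w: "nf_w z = nf_w z'"
    using ent[of 1 3] ent[of 2 3] k0 unfolding N shear_nth adapt_inv_nth k by simp_all
  have \<alpha>: "ad z = ad z'"
    using ent[of 1 1] unfolding N shear_nth adapt_inv_nth k r m by simp
  have "ad z'^2 * z (Fx 2) = ad z'^2 * z' (Fx 2)"
    using k b b' unfolding adapt_u_def \<alpha> by (simp add: field_simps)
  then have f2: "z (Fx 2) = z' (Fx 2)" using b'(4) by simp
  have k': "adapt_u z (ad z') = adapt_u z' (ad z')" using k \<alpha> by simp
  have g1: "z (Fxy 1) = z' (Fxy 1)"
    using ent[of 1 2] b' unfolding N shear_nth adapt_inv_nth r n \<alpha> k' f2 by (simp add: field_simps)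
  have s: "nf_s z = nf_s z'"
    using ent[of 2 1] b' unfolding N shear_nth adapt_inv_nth \<alpha> k' w m by simp
  have e: "ad_e z = ad_e z'" using s r by (simp add: nf_s_def)
  have f3: "z (Fx 3) = z' (Fx 3)" using e b' unfolding ad_e_def \<alpha> f2 by simp
  have A: "A_jet z = A_jet z'" using ad_cube[of z, OF b(1)] ad_cube[of z', OF b'(1)] \<alpha> f2 by simp
  have g2: "z (Fxy 2) = z' (Fxy 2)" using A b'(1) unfolding A_jet_def f2 f3 g1 by simp
  note inv = invariants_adapted[OF b(1,2)] and inv' = invariants_adapted[OF b'(1,2)]
  have ab: "ad_b z = ad_b z'" using W unfolding inv(1) inv'(1) W_of_def e by simp
  have B: "B_jet z = B_jet z'" using ab b' unfolding ad_b_def \<alpha> f2 by simp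
  have e4: "ad_e4 z = ad_e4 z'" using w unfolding nf_w_def ab e r s by simp
  have f4: "z (Fx 4) = z' (Fx 4)" using e4 b' unfolding ad_e4_def \<alpha> f2 by simp
  have g3: "z (Fxy 3) = z' (Fxy 3)" using B b'(1) unfolding B_jet_def f2 f4 g1 by simp
  have P: "Phi41 z = Phi41 z'" using r b'(3) unfolding nf_r_def W by simp
  have ak: "ad_k z = ad_k z'" using P unfolding inv(2) inv'(2) Phi41_of_def e e4 ab by simp
  have C: "C_jet z = C_jet z'" using ak b' unfolding ad_k_def \<alpha> f2 by simp
  have "Phi50 z = Phi50 z'" using M unfolding M_inv_def W P by simp
  then have e5: "ad_e5 z = ad_e5 z'" unfolding inv(3) inv'(3) Phi50_of_def e e4 ab ak by simp
  have f5: "z (Fx 5) = z' (Fx 5)" using e5 b' unfolding ad_e5_def \<alpha> f2 by simp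
  have g4: "z (Fxy 4) = z' (Fxy 4)" using C b'(1) unfolding C_jet_def f2 f5 g1 by simp
  show ?thesis using coords5_cases[OF i] xy m n f2 g1 f3 g2 f4 g3 f5 g4 by auto
qed

text \<open>The uniform bounds on the gradient and on the slope of the ruling make all matrices in a
  fixed neighbourhood of the identity transversal at all points at once. The domain is a box so that
  the mean value inequality applies along its sides; the translation part may be arbitrary.\<close>

lemma near_identity_graph:
  assumes S: "branch_surface D F" and D: "D = {q. \<bar>fst q - fst p\<bar> < \<delta> \<and> \<bar>snd q - snd p\<bar> < \<delta>}"
    and C: "C \<ge> 1" and bd: "\<And>q. q \<in> D \<Longrightarrow> \<bar>partial 1 0 F q\<bar> \<le> C" "\<And>q. q \<in> D \<Longrightarrow> \<bar>partial 0 1 F q\<bar> \<le> C"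
      "\<And>q. q \<in> D \<Longrightarrow> \<bar>partial 1 1 F q\<bar> \<le> C * \<bar>partial 2 0 F q\<bar>"
    and g: "g \<in> SA3" and near: "\<And>i j. \<bar>fst g $ i $ j - mat 1 $ i $ j\<bar> \<le> 1 / (8 * (1 + C) * C)"
  obtains D' F' where "branch_surface D' F'" "act g ` surface D F = surface D' F'"
proof -
  define A where "A = fst g"
  \<comment> \<open>Chosen so that the base differential deviates from the identity by at most
    \<open>\<eta> * (1 + C) \<le> 1/8\<close>, and so that this deviation times the slope bound
    \<open>C\<close> is still 1/8.\<close>
  define \<eta> where "\<eta> = 1 / (8 * (1 + C) * C)"
  have \<eta>0: "\<eta> > 0" using C by (simp add: \<eta>_def)
  have \<eta>C: "\<eta> * (1 + C) * C = 1 / 8" using C by (simp add: \<eta>_def)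
  have "\<eta> * (1 + C) * 1 \<le> \<eta> * (1 + C) * C" using \<eta>0 C by (intro mult_left_mono) auto
  then have \<eta>1: "\<eta> * (1 + C) \<le> 1 / 8" using \<eta>C by simp
  have nA: "\<bar>A $ i $ j - mat 1 $ i $ j\<bar> \<le> \<eta>" for i j using near by (simp add: A_def \<eta>_def)
  have nA1: "\<bar>A $ 1 $ 1 - 1\<bar> \<le> \<eta>" "\<bar>A $ 1 $ 2\<bar> \<le> \<eta>" "\<bar>A $ 1 $ 3\<bar> \<le> \<eta>" "\<bar>A $ 2 $ 1\<bar> \<le> \<eta>" "\<bar>A $ 2 $ 2 - 1\<bar> \<le> \<eta>" "\<bar>A $ 2 $ 3\<bar> \<le> \<eta>"
    using nA[of 1 1] nA[of 1 2] nA[of 1 3] nA[of 2 1] nA[of 2 2] nA[of 2 3] by (simp_all add: mat_def)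
  have Fl: "\<bar>F q - F q'\<bar> \<le> C * (\<bar>fst q - fst q'\<bar> + \<bar>snd q - snd q'\<bar>)" if q: "q \<in> D" and q': "q' \<in> D" for q q'
  proof -
    define Ix where "Ix = {fst p - \<delta> <..< fst p + \<delta>}"
    define Iy where "Iy = {snd p - \<delta> <..< snd p + \<delta>}"
    have inD: "(x, y) \<in> D \<longleftrightarrow> x \<in> Ix \<and> y \<in> Iy" for x y unfolding D Ix_def Iy_def by (auto simp: abs_less_iff)
    have qs: "fst q \<in> Ix" "snd q \<in> Iy" "fst q' \<in> Ix" "snd q' \<in> Iy" using q q' inD by (metis prod.collapse)+
    have an: "analytic2_at F (x, y)" if "x \<in> Ix" "y \<in> Iy" for x y using S that inD by (auto simp: branch_surface_def)
    have px: "partial_x F = partial 1 0 F" "partial_y F = partial 0 1 F" by (simp_all add: partial_def)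
    have "norm (F (fst q, snd q) - F (fst q', snd q)) \<le> C * norm (fst q - fst q')"
    proof (rule field_differentiable_bound[where S = Ix and f = "\<lambda>x. F (x, snd q)" and f' = "\<lambda>x. partial 1 0 F (x, snd q)"])
      fix x assume x: "x \<in> Ix"
      show "((\<lambda>x. F (x, snd q)) has_field_derivative partial 1 0 F (x, snd q)) (at x within Ix)"
        using analytic2_DERIV_x[OF an[OF x qs(2)]] unfolding px by (rule has_field_derivative_at_within)
      show "norm (partial 1 0 F (x, snd q)) \<le> C" using bd(1) inD x qs by simp
    qed (use qs in \<open>auto simp: Ix_def\<close>)
    moreover have "norm (F (fst q', snd q) - F (fst q', snd q')) \<le> C * norm (snd q - snd q')"
    proof (rule field_differentiable_bound[where S = Iy and f = "\<lambda>y. F (fst q', y)" and f' = "\<lambda>y. partial 0 1 F (fst q', y)"])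
      fix y assume y: "y \<in> Iy"
      show "((\<lambda>y. F (fst q', y)) has_field_derivative partial 0 1 F (fst q', y)) (at y within Iy)"
        using analytic2_DERIV_y[OF an[OF qs(3) y]] unfolding px by (rule has_field_derivative_at_within)
      show "norm (partial 0 1 F (fst q', y)) \<le> C" using bd(2) inD y qs by simp
    qed (use qs in \<open>auto simp: Iy_def\<close>)
    ultimately show ?thesis by (simp add: distrib_left)
  qed
  show ?thesis
  proof (rule global_graph[OF S g])
    show "inj_on (\<lambda>q. (act g (point F q) $ 1, act g (point F q) $ 2)) D"
    proof (rule inj_onI)
      fix q q' assume q: "q \<in> D" "q' \<in> D"
        and eq: "(act g (point F q) $ 1, act g (point F q) $ 2) = (act g (point F q') $ 1, act g (point F q') $ 2)"
      define x y f where "x = fst q - fst q'" and "y = snd q - snd q'" and "f = F q - F q'"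
      define s where "s = \<bar>x\<bar> + \<bar>y\<bar>"
      have f: "\<bar>f\<bar> \<le> C * s" using Fl[OF q] by (simp add: f_def s_def x_def y_def)
      have e: "A $ 1 $ 1 * x + A $ 1 $ 2 * y + A $ 1 $ 3 * f = 0" "A $ 2 $ 1 * x + A $ 2 $ 2 * y + A $ 2 $ 3 * f = 0"
        using eq by (simp_all add: act_nth A_def x_def y_def f_def algebra_simps)
      have small: "\<bar>a * x + b * y + c * f\<bar> \<le> s / 8" if "\<bar>a\<bar> \<le> \<eta>" "\<bar>b\<bar> \<le> \<eta>" "\<bar>c\<bar> \<le> \<eta>" for a b c
      proof -
        have "\<bar>a * x + b * y + c * f\<bar> \<le> \<bar>a * x\<bar> + \<bar>b * y\<bar> + \<bar>c * f\<bar>" by linarith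
        also have "\<dots> \<le> \<eta> * \<bar>x\<bar> + \<eta> * \<bar>y\<bar> + \<eta> * (C * s)"
          unfolding abs_mult using that f \<eta>0 by (intro add_mono mult_mono) auto
        also have "\<dots> = \<eta> * (1 + C) * s" by (simp add: s_def algebra_simps)
        also have "\<dots> \<le> 1 / 8 * s" using \<eta>1 by (intro mult_right_mono) (auto simp: s_def)
        finally show ?thesis by simp
      qed
      have "x = - ((A $ 1 $ 1 - 1) * x + A $ 1 $ 2 * y + A $ 1 $ 3 * f)" "y = - (A $ 2 $ 1 * x + (A $ 2 $ 2 - 1) * y + A $ 2 $ 3 * f)"
        using e by (simp_all add: algebra_simps)
      then have "\<bar>x\<bar> \<le> s / 8" "\<bar>y\<bar> \<le> s / 8" using small nA1 by (metis abs_minus_cancel)+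
      \<comment> \<open>Both coordinates of the difference are at most an eighth of their sum
        \<open>s\<close>, which gives \<open>s \<le> s / 4\<close>.\<close>
      then have "s \<le> 0" by (simp add: s_def)
      then have "x = 0" "y = 0" by (auto simp: s_def)
      then show "q = q'" by (simp add: x_def y_def prod_eq_iff)
    qed
    fix q assume q: "q \<in> D"
    define L where "L i j = fst g $ i $ j + fst g $ i $ 3 * (if j = 1 then partial 1 0 F q else partial 0 1 F q)" for i j
    have Lb: "\<bar>a + c * d\<bar> \<le> \<eta> * (1 + C)" if "\<bar>a\<bar> \<le> \<eta>" "\<bar>c\<bar> \<le> \<eta>" "\<bar>d\<bar> \<le> C" for a c d
    proof -
      have "\<bar>a + c * d\<bar> \<le> \<bar>a\<bar> + \<bar>c\<bar> * \<bar>d\<bar>" by (simp add: abs_mult[symmetric])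
      also have "\<dots> \<le> \<eta> + \<eta> * C" using that \<eta>0 by (intro add_mono mult_mono) auto
      finally show ?thesis by (simp add: algebra_simps)
    qed
    have L: "\<bar>L 1 1 - 1\<bar> \<le> \<eta> * (1 + C)" "\<bar>L 1 2\<bar> \<le> \<eta> * (1 + C)" "\<bar>L 2 1\<bar> \<le> \<eta> * (1 + C)" "\<bar>L 2 2 - 1\<bar> \<le> \<eta> * (1 + C)"
      using Lb[OF nA1(1,3) bd(1)[OF q]] Lb[OF nA1(2,3) bd(2)[OF q]] Lb[OF nA1(4,6) bd(1)[OF q]] Lb[OF nA1(5,6) bd(2)[OF q]]
      by (simp_all add: L_def A_def algebra_simps)
    then have L8: "L 1 1 \<ge> 7/8" "\<bar>L 1 2\<bar> \<le> 1/8" "\<bar>L 2 1\<bar> \<le> 1/8" "L 2 2 \<ge> 7/8" using \<eta>1 by linarith+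
    have "L 1 1 * L 2 2 \<ge> 7/8 * (7/8)" using L8 by (intro mult_mono) auto
    moreover have "\<bar>L 1 2 * L 2 1\<bar> \<le> 1/8 * (1/8)" unfolding abs_mult using L8 by (intro mult_mono) auto
    ultimately have "L 1 1 * L 2 2 - L 1 2 * L 2 1 \<noteq> 0" by linarith
    then show "(fst g $ 1 $ 1 + fst g $ 1 $ 3 * (if (1::3) = 1 then partial 1 0 F q else partial 0 1 F q)) *
      (fst g $ 2 $ 2 + fst g $ 2 $ 3 * (if (2::3) = 1 then partial 1 0 F q else partial 0 1 F q)) -
      (fst g $ 1 $ 2 + fst g $ 1 $ 3 * (if (2::3) = 1 then partial 1 0 F q else partial 0 1 F q)) *
      (fst g $ 2 $ 1 + fst g $ 2 $ 3 * (if (1::3) = 1 then partial 1 0 F q else partial 0 1 F q)) \<noteq> 0" unfolding L_def .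
    have f0: "partial 2 0 F q \<noteq> 0" using branch_surface_near(4)[OF S q] by simp
    have "\<bar>L 2 1 * partial 1 1 F q\<bar> \<le> \<eta> * (1 + C) * (C * \<bar>partial 2 0 F q\<bar>)"
      unfolding abs_mult using L bd(3)[OF q] \<eta>0 C by (intro mult_mono) auto
    also have "\<dots> = (\<eta> * (1 + C) * C) * \<bar>partial 2 0 F q\<bar>" by (simp only: mult.assoc)
    also have "\<dots> = 1 / 8 * \<bar>partial 2 0 F q\<bar>" by (simp only: \<eta>C)
    finally have "\<bar>L 2 1 * partial 1 1 F q\<bar> \<le> 1 / 8 * \<bar>partial 2 0 F q\<bar>" .
    moreover have "\<bar>L 2 2 * partial 2 0 F q\<bar> \<ge> 7 / 8 * \<bar>partial 2 0 F q\<bar>"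
      unfolding abs_mult using L8 by (intro mult_right_mono) auto
    ultimately have "L 2 2 * partial 2 0 F q - L 2 1 * partial 1 1 F q \<noteq> 0" using f0 by linarith
    then show "(fst g $ 2 $ 2 + fst g $ 2 $ 3 * (if (2::3) = 1 then partial 1 0 F q else partial 0 1 F q)) * partial 2 0 F q -
      (fst g $ 2 $ 1 + fst g $ 2 $ 3 * (if (1::3) = 1 then partial 1 0 F q else partial 0 1 F q)) * partial 1 1 F q \<noteq> 0" unfolding L_def .
  qed (rule that)
qed

text \<open>A jet carries infinitely many coordinates, but nearness concerns only those of order 5.
  The filter makes the limit calculus available for this weaker notion.\<close>

definition jet_nhds :: "jet \<Rightarrow> jet filter" where
  "jet_nhds z = (INF e\<in>{0<..}. principal {y. \<forall>i\<in>jet_coords 5. \<bar>y i - z i\<bar> < e})"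

lemma eventually_jet_nhds:
  "eventually P (jet_nhds z) \<longleftrightarrow> (\<exists>e>0. \<forall>y. (\<forall>i\<in>jet_coords 5. \<bar>y i - z i\<bar> < e) \<longrightarrow> P y)"
  unfolding jet_nhds_def
proof (subst eventually_INF_base)
  fix a b :: real assume "a \<in> {0<..}" "b \<in> {0<..}"
  then show "\<exists>x\<in>{0<..}. principal {y. \<forall>i\<in>jet_coords 5. \<bar>y i - z i\<bar> < x} \<le>
      inf (principal {y. \<forall>i\<in>jet_coords 5. \<bar>y i - z i\<bar> < a}) (principal {y. \<forall>i\<in>jet_coords 5. \<bar>y i - z i\<bar> < b})"
    by (intro bexI[of _ "min a b"]) auto
qed (auto simp: eventually_principal)

lemma jet_open_eventually: "jet_open 5 U \<longleftrightarrow> (\<forall>z\<in>U. \<forall>\<^sub>F y in jet_nhds z. y \<in> U)"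
  by (simp add: jet_open_def eventually_jet_nhds)

lemma av_tendsto: "analytic_vars_at (jet_coords 5) f z \<Longrightarrow> (f \<longlongrightarrow> f z) (jet_nhds z)"
  unfolding tendsto_iff eventually_jet_nhds dist_real_def using av_near by blast

lemma filterlim_jet_nhds:
  assumes "\<And>i. i \<in> jet_coords 5 \<Longrightarrow> ((\<lambda>x. \<zeta> x i) \<longlongrightarrow> z i) F"
  shows "filterlim \<zeta> (jet_nhds z) F"
  unfolding filterlim_iff eventually_jet_nhds
proof (intro allI impI)
  fix P assume "\<exists>e>0. \<forall>y. (\<forall>i\<in>jet_coords 5. \<bar>y i - z i\<bar> < e) \<longrightarrow> P y"
  then obtain e where e: "e > 0" "\<And>y. \<forall>i\<in>jet_coords 5. \<bar>y i - z i\<bar> < e \<Longrightarrow> P y" by blast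
  have "\<forall>i\<in>jet_coords 5. \<forall>\<^sub>F x in F. \<bar>\<zeta> x i - z i\<bar> < e"
    using assms e(1) by (auto simp: tendsto_iff dist_real_def)
  then have "\<forall>\<^sub>F x in F. \<forall>i\<in>jet_coords 5. \<bar>\<zeta> x i - z i\<bar> < e" by (simp add: eventually_ball_finite)
  then show "\<forall>\<^sub>F x in F. P (\<zeta> x)" by eventually_elim (rule e(2))
qed

lemma tendsto_jet_coord: "i \<in> jet_coords 5 \<Longrightarrow> ((\<lambda>y. y i) \<longlongrightarrow> z i) (jet_nhds z)"
  by (rule av_tendsto) (rule av_coord)

lemma av_ad:
  assumes "z \<in> branch_jets"
  shows "analytic_vars_at (jet_coords 5) ad z" "analytic_vars_at (jet_coords 5) ad_e z"
    "analytic_vars_at (jet_coords 5) ad_e4 z" "analytic_vars_at (jet_coords 5) ad_b z"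
proof -
  note b = branch_jetsD[OF assms]
  show a: "analytic_vars_at (jet_coords 5) ad z" unfolding ad_def[abs_def] by (intro av_intros av_A) (use b in simp_all)
  show "analytic_vars_at (jet_coords 5) ad_e z" unfolding ad_e_def[abs_def] by (intro av_intros a) (use b in simp_all)
  show "analytic_vars_at (jet_coords 5) ad_e4 z" unfolding ad_e4_def[abs_def] by (intro av_intros a) (use b in simp_all)
  show "analytic_vars_at (jet_coords 5) ad_b z" unfolding ad_b_def[abs_def] by (intro av_intros a av_B) (use b in simp_all)
qed

lemma av_nf_inv:
  assumes "z \<in> branch_jets"
  shows "analytic_vars_at (jet_coords 5) (\<lambda>z. fst (nf_inv z) $ i $ j) z"
    "analytic_vars_at (jet_coords 5) (\<lambda>z. snd (nf_inv z) $ i) z"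
proof -
  note b = branch_jetsD[OF assms] and a = av_ad[OF assms]
  have r: "analytic_vars_at (jet_coords 5) nf_r z"
    unfolding nf_r_def[abs_def] by (intro av_intros av_Phi41 av_W) (use b in simp_all)
  have s: "analytic_vars_at (jet_coords 5) nf_s z"
    unfolding nf_s_def[abs_def] by (intro av_intros a r) simp
  have w: "analytic_vars_at (jet_coords 5) nf_w z"
    unfolding nf_w_def[abs_def] by (intro av_intros a r s) simp
  have xy: "analytic_vars_at (jet_coords 5) (\<lambda>z. adapt_xy z (ad z)) z" "analytic_vars_at (jet_coords 5) (\<lambda>z. adapt_y z (ad z)) z"
    unfolding adapt_xy_def adapt_y_def by (intro av_intros a; use b in simp)+
  have "\<forall>i j. analytic_vars_at (jet_coords 5) (\<lambda>z. adapt_mat z (ad z) $ i $ j) z"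
    unfolding forall_3 adapt_mat_nth by (intro conjI av_intros a xy; simp)
  then have m: "analytic_vars_at (jet_coords 5) (\<lambda>z. adapt_mat z (ad z) $ i $ j) z" for i j by blast
  have "\<forall>i j. analytic_vars_at (jet_coords 5) (\<lambda>z. shear (- nf_r z) (- nf_s z) (nf_s z * nf_r z - nf_w z) $ i $ j) z"
    unfolding forall_3 shear_nth by (intro conjI av_intros r s w)
  then have t: "analytic_vars_at (jet_coords 5) (\<lambda>z. shear (- nf_r z) (- nf_s z) (nf_s z * nf_r z - nf_w z) $ i $ j) z" for i j by blast
  show "analytic_vars_at (jet_coords 5) (\<lambda>z. fst (nf_inv z) $ i $ j) z"
    unfolding nf_inv_def fst_conv matrix_matrix_mult_def vec_lambda_beta sum_3 by (intro av_intros m t)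
  show "analytic_vars_at (jet_coords 5) (\<lambda>z. snd (nf_inv z) $ i) z"
    using exhaust_3[of i] by (elim disjE) (simp_all add: nf_inv_def av_coord)
qed

text \<open>The surface realizing \<open>z0\<close> is moved by \<open>(nf_map z1)\<^sup>-\<^sup>1 \<circ> nf_map z0\<close>, which is close to the identity;
  the moved surface has the 5-jet \<open>z1\<close> because it has the same normalising map and invariants.\<close>

lemma invariant_locally_constant:
  assumes I: "diff_invariant 5 U I" and z0: "z0 \<in> U"
  shows "\<forall>\<^sub>F z1 in jet_nhds z0. z1 \<in> U \<longrightarrow> W_inv z1 = W_inv z0 \<longrightarrow> M_inv z1 = M_inv z0 \<longrightarrow> I z1 = I z0"
proof -
  have U: "jet_open 5 U" "U \<subseteq> branch_jets" "\<And>z. z \<in> U \<Longrightarrow> analytic_vars_at (jet_coords 5) I z"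
    using I by (auto simp: diff_invariant_def)
  have zb: "z0 \<in> branch_jets" using U z0 by blast
  note b = branch_jetsD[OF zb]
  define p where "p = (z0 X, z0 Y)"
  obtain D0 F where D0: "branch_surface D0 F" "p \<in> D0" and J: "\<And>i. i \<in> jet_coords 5 \<Longrightarrow> jet_of F p i = z0 i"
    unfolding p_def by (rule jets_realized[OF zb, of 5]) (simp, blast)
  have F: "analytic2_at F p" by (rule branch_surface_near(2)[OF D0])
  have F2: "partial 2 0 F p \<noteq> 0" using branch_surface_near(4)[OF D0] by simp
  \<comment> \<open>One more than the values at \<open>p\<close> of all the quantities that
    \<open>near_identity_graph\<close> has to bound; by continuity the bounds hold on a small box
    around \<open>p\<close>.\<close>
  define C where "C = 1 + \<bar>partial 1 0 F p\<bar> + \<bar>partial 0 1 F p\<bar> + \<bar>partial 1 1 F p\<bar> / \<bar>partial 2 0 F p\<bar>"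
  have C: "C \<ge> 1" by (simp add: C_def)
  have lim: "(partial j k F \<longlongrightarrow> partial j k F p) (nhds p)" for j k
    using analytic2_isCont[OF analytic2_partial[OF F]] by (metis continuous_at tendsto_at_iff_tendsto_nhds)
  have "\<bar>partial 1 1 F p\<bar> < C * \<bar>partial 2 0 F p\<bar>"
  proof -
    have "\<bar>partial 1 1 F p\<bar> = \<bar>partial 1 1 F p\<bar> / \<bar>partial 2 0 F p\<bar> * \<bar>partial 2 0 F p\<bar>" using F2 by simp
    also have "\<dots> < C * \<bar>partial 2 0 F p\<bar>" using F2 by (intro mult_strict_right_mono) (auto simp: C_def)
    finally show ?thesis .
  qed
  then have "\<forall>\<^sub>F q in nhds p. 0 < C * \<bar>partial 2 0 F q\<bar> - \<bar>partial 1 1 F q\<bar>"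
    by (intro order_tendstoD(1)[OF tendsto_diff[OF tendsto_mult[OF tendsto_const tendsto_rabs[OF lim]] tendsto_rabs[OF lim]]]) simp
  moreover have "\<bar>partial 1 0 F p\<bar> < C" "\<bar>partial 0 1 F p\<bar> < C" by (simp_all add: C_def add_pos_nonneg add_nonneg_nonneg)
  then have "\<forall>\<^sub>F q in nhds p. \<bar>partial 1 0 F q\<bar> < C" "\<forall>\<^sub>F q in nhds p. \<bar>partial 0 1 F q\<bar> < C"
    by (auto intro: order_tendstoD(2)[OF tendsto_rabs[OF lim]])
  moreover have "\<forall>\<^sub>F q in nhds p. q \<in> D0"
    using branch_surface_near(1)[OF D0] D0(2) by (rule eventually_nhds_in_open)
  ultimately have "\<forall>\<^sub>F q in nhds p. q \<in> D0 \<and> \<bar>partial 1 0 F q\<bar> \<le> C \<and> \<bar>partial 0 1 F q\<bar> \<le> C \<and> \<bar>partial 1 1 F q\<bar> \<le> C * \<bar>partial 2 0 F q\<bar>"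
    by eventually_elim auto
  then obtain d where d: "d > 0" "\<And>q. dist q p < d \<Longrightarrow> q \<in> D0 \<and> \<bar>partial 1 0 F q\<bar> \<le> C \<and> \<bar>partial 0 1 F q\<bar> \<le> C \<and> \<bar>partial 1 1 F q\<bar> \<le> C * \<bar>partial 2 0 F q\<bar>"
    unfolding eventually_nhds_metric by blast
  define \<delta> where "\<delta> = d / 2"
  define D where "D = {q. \<bar>fst q - fst p\<bar> < \<delta> \<and> \<bar>snd q - snd p\<bar> < \<delta>}"
  have Dd: "dist q p < d" if "q \<in> D" for q
  proof -
    have "dist q p \<le> \<bar>dist (fst q) (fst p)\<bar> + \<bar>dist (snd q) (snd p)\<bar>" unfolding dist_prod_def by (rule sqrt_sum_squares_le_sum_abs)
    then show ?thesis using that by (simp add: D_def \<delta>_def dist_real_def)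
  qed
  have "open D" unfolding D_def by (intro open_Collect_conj open_Collect_less continuous_intros)
  then have D: "branch_surface D F" using D0(1) d(2) Dd by (auto simp: branch_surface_def)
  have pD: "p \<in> D" using d(1) by (simp add: D_def \<delta>_def)
  have bd: "\<bar>partial 1 0 F q\<bar> \<le> C" "\<bar>partial 0 1 F q\<bar> \<le> C" "\<bar>partial 1 1 F q\<bar> \<le> C * \<bar>partial 2 0 F q\<bar>" if "q \<in> D" for q
    using d(2)[OF Dd[OF that]] by auto
  obtain eU where eU: "eU > 0" "\<And>z'. (\<forall>i\<in>jet_coords 5. \<bar>z' i - z0 i\<bar> < eU) \<Longrightarrow> z' \<in> U"
    using U(1) z0 unfolding jet_open_def by blast
  have JU: "jet_of F p \<in> U" by (rule eU(2)) (use J eU in simp)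
  \<comment> \<open>The radius supplied by the definition belongs to the particular surface over
    \<open>D\<close>, so the box is fixed before \<open>z1\<close> varies.\<close>
  have "\<exists>e>0. \<forall>g D' F' p'. g \<in> SA3 \<and> dist g (mat 1, 0) < e \<and> branch_surface D' F' \<and>
     act g ` surface D F = surface D' F' \<and> p' \<in> D' \<and> act g (point F p) = point F' p' \<and> jet_of F' p' \<in> U \<longrightarrow>
     I (jet_of F' p') = I (jet_of F p)"
    using I[unfolded diff_invariant_def, THEN conjunct2, THEN conjunct2, THEN conjunct2] D pD JU
    by (elim allE[of _ D] allE[of _ F] allE[of _ p]) (erule mp, intro conjI)
  then obtain e1 where e1: "e1 > 0" "\<And>g D' F' p'. g \<in> SA3 \<Longrightarrow> dist g (mat 1, 0) < e1 \<Longrightarrow> branch_surface D' F' \<Longrightarrow>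
     act g ` surface D F = surface D' F' \<Longrightarrow> p' \<in> D' \<Longrightarrow> act g (point F p) = point F' p' \<Longrightarrow> jet_of F' p' \<in> U \<Longrightarrow>
     I (jet_of F' p') = I (jet_of F p)"
    by auto
  \<comment> \<open>The realized jet agrees with \<open>z0\<close> only up to order 5; analyticity
    in these coordinates makes \<open>I\<close> blind to the rest.\<close>
  have IJ: "I (jet_of F p) = I z0" by (rule av_cong_coords[OF U(3)[OF z0] J])
  define g where "g z1 = compose_affine (nf_inv z1) (nf_map z0)" for z1
  have g0: "g z0 = (mat 1, 0)"
    by (rule affine_eqI) (simp add: g_def act_compose act_nf_inv[OF b(4,1)], simp add: act_def)
  have "((\<lambda>z1. fst (nf_inv z1)) \<longlongrightarrow> fst (nf_inv z0)) (jet_nhds z0)" "((\<lambda>z1. snd (nf_inv z1)) \<longlongrightarrow> snd (nf_inv z0)) (jet_nhds z0)"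
    by (intro vec_tendstoI av_tendsto[OF av_nf_inv(1)[OF zb]] av_tendsto[OF av_nf_inv(2)[OF zb]])+
  note nl = this
  have "((\<lambda>z1. fst (g z1)) \<longlongrightarrow> fst (g z0)) (jet_nhds z0)" 
    unfolding g_def compose_affine_def fst_conv matrix_matrix_mult_def
    by (intro vec_tendstoI) (simp, intro tendsto_intros tendsto_vec_nth nl)
  moreover have "((\<lambda>z1. snd (g z1)) \<longlongrightarrow> snd (g z0)) (jet_nhds z0)" 
    unfolding g_def compose_affine_def snd_conv matrix_vector_mult_def
    by (intro vec_tendstoI) (simp, intro tendsto_intros tendsto_vec_nth nl)
  ultimately have gl: "((\<lambda>z1. fst (g z1)) \<longlongrightarrow> mat 1) (jet_nhds z0)" "((\<lambda>z1. (fst (g z1), snd (g z1))) \<longlongrightarrow> (mat 1, 0)) (jet_nhds z0)"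
    unfolding g0 by (auto simp del: prod.collapse intro!: tendsto_Pair)
  have E1: "\<forall>\<^sub>F z1 in jet_nhds z0. dist (g z1) (mat 1, 0) < e1" using tendstoD[OF gl(2) e1(1)] by (simp only: prod.collapse)
  have E2: "\<forall>\<^sub>F z1 in jet_nhds z0. \<forall>i j. \<bar>fst (g z1) $ i $ j - mat 1 $ i $ j\<bar> < 1 / (8 * (1 + C) * C)"
    by (intro eventually_all_finite)
      (use tendstoD[OF tendsto_vec_nth[OF tendsto_vec_nth[OF gl(1)]], of "1 / (8 * (1 + C) * C)"] C in \<open>simp add: dist_real_def\<close>)
  from E1 E2 show ?thesis
  proof (eventually_elim, intro impI)
    fix z1 assume gd: "dist (g z1) (mat 1, 0) < e1" and ge: "\<forall>i j. \<bar>fst (g z1) $ i $ j - mat 1 $ i $ j\<bar> < 1 / (8 * (1 + C) * C)"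
      and z1: "z1 \<in> U" and W: "W_inv z1 = W_inv z0" and M: "M_inv z1 = M_inv z0"
    have zb1: "z1 \<in> branch_jets" using z1 U by blast
    note b1 = branch_jetsD[OF zb1]
    have gS: "g z1 \<in> SA3" unfolding g_def by (intro SA3_compose nf_inv_SA3 nf_map_SA3 b b1)
    obtain D' F' where D': "branch_surface D' F'" "act (g z1) ` surface D F = surface D' F'"
      by (rule near_identity_graph[OF D D_def C bd gS]) (use ge in \<open>auto intro: less_imp_le\<close>)
    have "act (g z1) (point F p) \<in> surface D' F'" using pD unfolding D'(2)[symmetric] by (auto simp: surface_def)
    then obtain p' where p': "p' \<in> D'" "act (g z1) (point F p) = point F' p'" by (auto simp: surface_def)
    have m: "maps_germ (g z1) (surface D F) (point F p) (surface D' F') (point F' p')"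
      by (rule maps_germ_surface[OF D'(2) p'(2)])
    let ?z = "jet_of F p" and ?z' = "jet_of F' p'"
    have nm: "nf_map ?z = nf_map z0" by (rule nf_map_cong[OF J])
    obtain E G c where E: "branch_surface E G" "(0, 0) \<in> E" "normal_form (W_inv ?z) (M_inv ?z) c G"
      "maps_germ (nf_map ?z) (surface D F) (point F p) (surface E G) 0"
      by (rule normal_form_exists[OF D pD])
    have n0: "nf_map z0 \<in> SA3" by (intro nf_map_SA3 b)
    have "maps_germ (compose_affine (nf_map z0) (inverse_affine (g z1))) (surface D' F') (point F' p') (surface E G) 0"
      by (rule maps_germ_compose[OF SA3_inverse[OF gS] n0 maps_germ_inverse[OF gS m] E(4)[unfolded nm]])
    moreover have "compose_affine (nf_map z0) (inverse_affine (g z1)) = nf_map z1"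
    proof (rule affine_eqI)
      fix v
      define u where "u = act (inverse_affine (g z1)) v"
      have "act (nf_map z1) v = act (nf_map z1) (act (g z1) u)" unfolding u_def by (simp add: act_inverse[OF gS])
      also have "\<dots> = act (nf_map z0) u" by (simp add: g_def act_compose act_nf_inv[OF b1(4,1)])
      finally show "act (compose_affine (nf_map z0) (inverse_affine (g z1))) v = act (nf_map z1) v"
        by (simp add: act_compose u_def)
    qed
    ultimately have m1: "maps_germ (nf_map z1) (surface D' F') (point F' p') (surface E G) 0" by simp
    have n1: "nf_map z1 \<in> SA3" by (intro nf_map_SA3 b1)
    have nf: "nf_map z1 = nf_map ?z'" by (rule nf_map_unique[OF D'(1) p'(1) n1 E(1-3) m1])
    have z'b: "?z' \<in> branch_jets" using D'(1) p'(1) by (auto simp: branch_surface_def)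
    have WM: "W_inv ?z = W_inv z0" "M_inv ?z = M_inv z0"
      using av_cong_coords[OF av_W[OF b(1,2)] J] av_cong_coords[OF av_M[OF zb] J] by auto
    note inv = branch_surface_invariants[OF D pD D'(1) p'(1) gS m]
    have eq: "z1 i = ?z' i" if "i \<in> jet_coords 5" for i
      by (rule nf_map_injective[OF zb1 z'b nf _ _ that]) (simp_all add: inv WM W M)
    obtain e2 where e2: "e2 > 0" "\<And>z'. (\<forall>i\<in>jet_coords 5. \<bar>z' i - z1 i\<bar> < e2) \<Longrightarrow> z' \<in> U"
      using U(1) z1 unfolding jet_open_def by blast
    have "?z' \<in> U" by (rule e2(2)) (use eq e2 in simp)
    have "I ?z' = I ?z" by (rule e1(2)[OF gS gd D' p' \<open>?z' \<in> U\<close>])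
    moreover have "I ?z' = I z1" by (rule av_cong_coords[OF U(3)[OF z1]]) (simp add: eq)
    ultimately show "I z1 = I z0" using IJ by simp
  qed
qed

text \<open>\<open>adj y w m\<close> changes the jet \<open>y\<close> only in coordinates that leave \<open>A_jet\<close> fixed, so that
  \<open>W_inv\<close> becomes \<open>w\<close> and \<open>M_inv\<close> becomes \<open>m\<close>.\<close>

definition adj_W :: "jet \<Rightarrow> real \<Rightarrow> jet" where
  "adj_W y w = y(Fxy 3 := y (Fxy 3) + (w - W_inv y) * root 3 (A_jet y)^2)"

text \<open>The move of \<open>M_vary\<close>, with its parameter divided by the slope
  \<open>A_jet y / y (Fx 2)^4\<close>.\<close>

definition adj_M :: "jet \<Rightarrow> real \<Rightarrow> jet" where
  "adj_M y m = y(Fx 5 := y (Fx 5) + (m - M_inv y) * (y (Fx 2)^4 / A_jet y),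
     Fxy 4 := y (Fxy 4) + y (Fxy 1) / y (Fx 2) * ((m - M_inv y) * (y (Fx 2)^4 / A_jet y)))"

definition adj :: "jet \<Rightarrow> real \<Rightarrow> real \<Rightarrow> jet" where
  "adj y w m = adj_M (adj_W y w) m"

text \<open>\<open>A_jet\<close> does not contain \<open>Fxy 3\<close>, and \<open>W_inv\<close> is
  affine in it with slope \<open>1 / root 3 (A_jet y)^2\<close>.\<close>

lemma adj_W_simps:
  assumes "y (Fx 2) \<noteq> 0" "A_jet y \<noteq> 0"
  shows "adj_W y w (Fx 2) = y (Fx 2)" "A_jet (adj_W y w) = A_jet y" "W_inv (adj_W y w) = w"
proof -
  define \<Delta> where "\<Delta> = (w - W_inv y) * root 3 (A_jet y)^2"
  have c: "adj_W y w (Fx j) = y (Fx j)" "adj_W y w (Fxy 1) = y (Fxy 1)" "adj_W y w (Fxy 2) = y (Fxy 2)" "adj_W y w (Fxy 3) = y (Fxy 3) + \<Delta>" for j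
    by (simp_all add: adj_W_def \<Delta>_def)
  show "adj_W y w (Fx 2) = y (Fx 2)" by (rule c)
  show A: "A_jet (adj_W y w) = A_jet y" by (simp only: A_jet_def c)
  have B: "B_jet (adj_W y w) = B_jet y + y (Fx 2) * \<Delta>" unfolding B_jet_def c by (simp add: algebra_simps)
  have r: "root 3 (A_jet y) \<noteq> 0" using assms by simp
  have "W_inv (adj_W y w) = W_inv y + \<Delta> / root 3 (A_jet y)^2"
    unfolding W_inv_def A B c using assms(1) r by (simp add: field_simps power2_eq_square)
  also have "\<dots> = w" using r by (simp add: \<Delta>_def)
  finally show "W_inv (adj_W y w) = w" .
qed

lemma adj_M_simps:
  assumes "y (Fx 2) \<noteq> 0" "A_jet y \<noteq> 0"
  shows "adj_M y m (Fx 2) = y (Fx 2)" "A_jet (adj_M y m) = A_jet y" "W_inv (adj_M y m) = W_inv y" "M_inv (adj_M y m) = m"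
proof -
  let ?t = "(m - M_inv y) * (y (Fx 2)^4 / A_jet y)"
  show "adj_M y m (Fx 2) = y (Fx 2)" by (simp add: adj_M_def)
  show "A_jet (adj_M y m) = A_jet y" "W_inv (adj_M y m) = W_inv y" unfolding adj_M_def by (rule M_vary(2,3)[OF assms])+
  have "M_inv (adj_M y m) = M_inv y + ?t * (A_jet y / y (Fx 2)^4)" unfolding adj_M_def by (rule M_vary(1)[OF assms])
  then show "M_inv (adj_M y m) = m" using assms by simp
qed

lemma adj_simps:
  assumes "y (Fx 2) \<noteq> 0" "A_jet y \<noteq> 0"
  shows "W_inv (adj y w m) = w" "M_inv (adj y w m) = m" "adj y (W_inv y) (M_inv y) = y"
proof -
  note 1 = adj_W_simps[of y w, OF assms]
  have nz: "adj_W y w (Fx 2) \<noteq> 0" "A_jet (adj_W y w) \<noteq> 0" using assms 1 by simp_all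
  show "W_inv (adj y w m) = w" "M_inv (adj y w m) = m" unfolding adj_def by (simp_all add: adj_M_simps[of "adj_W y w" m, OF nz] 1)
  show "adj y (W_inv y) (M_inv y) = y" by (simp add: adj_def adj_W_def adj_M_def)
qed

text \<open>The second adjustment uses \<open>M_inv\<close> at the jet already adjusted to the value
  \<open>w0\<close> of \<open>W\<close>. There \<open>w0\<close> stands in a denominator, hence the
  hypothesis \<open>w0 \<noteq> 0\<close>.\<close>

lemma filterlim_adj:
  assumes Y: "filterlim y (jet_nhds z) F" and w: "(w \<longlongrightarrow> w0) F" and m: "(m \<longlongrightarrow> m0) F"
    and z: "z (Fx 2) \<noteq> 0" "A_jet z \<noteq> 0" "w0 \<noteq> 0"
  shows "filterlim (\<lambda>x. adj (y x) (w x) (m x)) (jet_nhds (adj z w0 m0)) F"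
proof -
  have c: "((\<lambda>x. y x i) \<longlongrightarrow> z i) F" if "i \<in> jet_coords 5" for i
    by (rule filterlim_compose[OF tendsto_jet_coord[OF that] Y])
  have A: "((\<lambda>x. A_jet (y x)) \<longlongrightarrow> A_jet z) F" "((\<lambda>x. W_inv (y x)) \<longlongrightarrow> W_inv z) F"
    by (rule filterlim_compose[OF av_tendsto Y], rule av_A av_W[OF z(1,2)])+
  have W: "filterlim (\<lambda>x. adj_W (y x) (w x)) (jet_nhds (adj_W z w0)) F"
  proof (rule filterlim_jet_nhds)
    fix i assume i: "i \<in> jet_coords 5"
    show "((\<lambda>x. adj_W (y x) (w x) i) \<longlongrightarrow> adj_W z w0 i) F"
    proof (cases "i = Fxy 3")
      case True
      then show ?thesis by (simp add: adj_W_def) (intro tendsto_intros c w A; simp)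
    qed (simp add: adj_W_def c[OF i])
  qed
  define z1 y1 where "z1 = adj_W z w0" and "y1 x = adj_W (y x) (w x)" for x
  note s = adj_W_simps[of z w0, OF z(1,2), folded z1_def]
  have b: "z1 \<in> branch_jets" using s z by (simp add: branch_jets_def S_inv_def)
  note bD = branch_jetsD[OF b]
  have Y1: "filterlim y1 (jet_nhds z1) F" using W by (simp add: z1_def y1_def[abs_def])
  have c1: "((\<lambda>x. y1 x i) \<longlongrightarrow> z1 i) F" if "i \<in> jet_coords 5" for i
    by (rule filterlim_compose[OF tendsto_jet_coord[OF that] Y1])
  have A1: "((\<lambda>x. A_jet (y1 x)) \<longlongrightarrow> A_jet z1) F" "((\<lambda>x. M_inv (y1 x)) \<longlongrightarrow> M_inv z1) F"
    by (rule filterlim_compose[OF av_tendsto Y1], rule av_A av_M[OF b])+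
  have "filterlim (\<lambda>x. adj_M (y1 x) (m x)) (jet_nhds (adj_M z1 m0)) F"
  proof (rule filterlim_jet_nhds)
    fix i assume i: "i \<in> jet_coords 5"
    have t: "((\<lambda>x. (m x - M_inv (y1 x)) * (y1 x (Fx 2)^4 / A_jet (y1 x))) \<longlongrightarrow> (m0 - M_inv z1) * (z1 (Fx 2)^4 / A_jet z1)) F"
      by (intro tendsto_intros c1 A1 m bD; simp)
    have t': "((\<lambda>x. y1 x (Fxy 1) / y1 x (Fx 2)) \<longlongrightarrow> z1 (Fxy 1) / z1 (Fx 2)) F"
      by (intro tendsto_intros c1 bD; simp)
    consider "i = Fx 5" | "i = Fxy 4" | "i \<noteq> Fx 5" "i \<noteq> Fxy 4" by blast
    then show "((\<lambda>x. adj_M (y1 x) (m x) i) \<longlongrightarrow> adj_M z1 m0 i) F"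
    proof cases
      case 1
      show ?thesis unfolding adj_M_def 1 using tendsto_add[OF c1 t, of "Fx 5"] by simp
    next
      case 2
      show ?thesis unfolding adj_M_def 2 using tendsto_add[OF c1 tendsto_mult[OF t' t], of "Fxy 4"] by simp
    qed (simp add: adj_M_def c1[OF i])
  qed
  then show ?thesis by (simp add: adj_def z1_def y1_def)
qed

lemma analytic2_av_compose:
  assumes f: "analytic_vars_at (jet_coords 5) f (\<zeta> p)" and \<zeta>: "\<And>i. i \<in> jet_coords 5 \<Longrightarrow> analytic2_at (\<lambda>q. \<zeta> q i) p"
  shows "analytic2_at (\<lambda>q. f (\<zeta> q)) p"
proof -
  have "an {..<2::nat} (\<lambda>h. f (\<lambda>i. \<zeta> p i + (\<zeta> (fst p + h 0, snd p + h 1) i - \<zeta> p i)))"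
    using f unfolding av_iff
    by (rule an_compose) (use \<zeta> in \<open>auto simp: analytic2_at_iff\<close>)
  then show ?thesis by (simp add: analytic2_at_iff)
qed

lemma analytic2_adj:
  assumes z: "z \<in> branch_jets" and f: "analytic_vars_at (jet_coords 5) f z"
  shows "analytic2_at (\<lambda>q. f (adj z (fst q) (snd q))) (W_inv z, M_inv z)"
proof -
  note b = branch_jetsD[OF z] and s = adj_W_simps[of z, OF branch_jetsD(1,2)[OF z]]
  have fs: "analytic2_at fst p" "analytic2_at snd p" for p
    unfolding analytic2_at_iff by (auto intro!: an_add)
  have cl: "analytic2_at (\<lambda>q. k) p" "analytic2_at f p \<Longrightarrow> analytic2_at g p \<Longrightarrow> analytic2_at (\<lambda>q. f q + g q) p"
    "analytic2_at f p \<Longrightarrow> analytic2_at g p \<Longrightarrow> analytic2_at (\<lambda>q. f q - g q) p"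
    "analytic2_at f p \<Longrightarrow> analytic2_at g p \<Longrightarrow> analytic2_at (\<lambda>q. f q * g q) p" for f g k p
    unfolding analytic2_at_iff by auto
  let ?p = "(W_inv z, M_inv z)"
  have z1: "adj_W z (fst ?p) = z" by (simp add: adj_W_def)
  have W: "analytic2_at (\<lambda>q. adj_W z (fst q) i) ?p" for i
    by (cases "i = Fxy 3") (simp_all add: adj_W_def cl fs)
  have M: "analytic2_at (\<lambda>q. M_inv (adj_W z (fst q))) ?p"
    by (rule analytic2_av_compose[where \<zeta> = "\<lambda>q. adj_W z (fst q)"]) (unfold z1, rule av_M[OF z], rule W)
  show ?thesis
  proof (rule analytic2_av_compose[where \<zeta> = "\<lambda>q. adj z (fst q) (snd q)"])
    show "analytic_vars_at (jet_coords 5) f (adj z (fst ?p) (snd ?p))" using f adj_simps(3)[of z, OF b(1,2)] by simp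
    fix i
    have v: "adj_W z w (Fxy 1) = z (Fxy 1)" for w by (simp add: adj_W_def)
    note v = v v[unfolded One_nat_def]
    define k1 k2 where "k1 = z (Fxy 1) / z (Fx 2)" and "k2 = z (Fx 2)^4 / A_jet z"
    have "adj z w m i = (if i = Fxy 4 then adj_W z w i + k1 * ((m - M_inv (adj_W z w)) * k2)
      else if i = Fx 5 then adj_W z w i + (m - M_inv (adj_W z w)) * k2 else adj_W z w i)" for w m
      by (simp add: adj_def adj_M_def s v k1_def k2_def)
    then show "analytic2_at (\<lambda>q. adj z (fst q) (snd q) i) ?p"
      by (cases "i = Fxy 4"; cases "i = Fx 5") (simp_all add: cl fs W M)
  qed
qed

text \<open>The jets \<open>adj z w m\<close> form a slice that meets each nearby common level set
  once. A jet \<open>z'\<close> is joined to the slice inside its own level set, along which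
  \<open>I\<close> is locally constant on a connected parameter interval, so \<open>I z'\<close> is
  the value of \<open>I\<close> on the slice.\<close>

lemma invariant_function_of_W_M:
  assumes I: "diff_invariant 5 U I"
  shows "locally_function_of_two 5 U I W_inv M_inv"
  unfolding locally_function_of_two_def
proof
  fix z assume z: "z \<in> U"
  have U: "jet_open 5 U" "U \<subseteq> branch_jets" "\<And>z. z \<in> U \<Longrightarrow> analytic_vars_at (jet_coords 5) I z"
    using I by (auto simp: diff_invariant_def)
  have zb: "z \<in> branch_jets" using U z by blast
  note b = branch_jetsD[OF zb]
  let ?N = "jet_nhds z"
  have NU: "\<forall>\<^sub>F y in jet_nhds y0. y \<in> U" if "y0 \<in> U" for y0 using U(1) that by (simp add: jet_open_eventually)
  have WM: "(W_inv \<longlongrightarrow> W_inv z) ?N" "(M_inv \<longlongrightarrow> M_inv z) ?N"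
    by (rule av_tendsto, rule av_W[OF b(1,2)] av_M[OF zb])+
  \<comment> \<open>Joint continuity at \<open>(z, z)\<close>: the jet that is adjusted and the jet
    that prescribes the values vary independently, and all results near \<open>z\<close> lie in
    \<open>U\<close>.\<close>
  have "filterlim (\<lambda>x. adj (fst x) (W_inv (snd x)) (M_inv (snd x))) (jet_nhds (adj z (W_inv z) (M_inv z))) (?N \<times>\<^sub>F ?N)"
    by (rule filterlim_adj[OF filterlim_fst filterlim_compose[OF WM(1) filterlim_snd] filterlim_compose[OF WM(2) filterlim_snd] b(1-3)])
  then have "\<forall>\<^sub>F x in ?N \<times>\<^sub>F ?N. adj (fst x) (W_inv (snd x)) (M_inv (snd x)) \<in> U"
    unfolding adj_simps(3)[of z, OF b(1,2)] filterlim_iff using NU[OF z] by blast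
  then obtain P where P: "eventually P ?N" "\<And>y z'. P y \<Longrightarrow> P z' \<Longrightarrow> adj y (W_inv z') (M_inv z') \<in> U"
    unfolding eventually_prod_same by fastforce
  from eventually_conj[OF P(1) NU[OF z]] obtain e
    where e: "e > 0" "\<And>y. \<forall>i\<in>jet_coords 5. \<bar>y i - z i\<bar> < e \<Longrightarrow> P y \<and> y \<in> U"
    unfolding eventually_jet_nhds by blast
  define V where "V = {y. \<forall>i\<in>jet_coords 5. \<bar>y i - z i\<bar> < e}"
  define \<phi> where "\<phi> q = I (adj z (fst q) (snd q))" for q
  have "jet_open 5 V" unfolding jet_open_eventually
  proof
    fix y assume "y \<in> V"
    then have "\<forall>i\<in>jet_coords 5. \<forall>\<^sub>F u in jet_nhds y. \<bar>u i - z i\<bar> < e"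
      by (auto simp: V_def intro!: order_tendstoD(2)[OF tendsto_rabs[OF tendsto_diff[OF tendsto_jet_coord tendsto_const]]])
    then show "\<forall>\<^sub>F u in jet_nhds y. u \<in> V" by (simp add: V_def eventually_ball_finite)
  qed
  moreover have "analytic2_at \<phi> (W_inv z, M_inv z)"
    unfolding \<phi>_def[abs_def] by (rule analytic2_adj[OF zb U(3)[OF z]])
  moreover have "I z' = \<phi> (W_inv z', M_inv z')" if z': "z' \<in> V" for z'
  proof -
    \<comment> \<open>The straight segment from \<open>z'\<close> to \<open>z\<close> stays in the
      box \<open>V\<close>. It need not preserve \<open>W\<close> and \<open>M\<close>, so each of
      its points is corrected by \<open>adj\<close> to the values at \<open>z'\<close>.\<close>
    define l where "l \<tau> i = (1 - \<tau>) * z' i + \<tau> * z i" for \<tau> i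
    define \<zeta> where "\<zeta> \<tau> = adj (l \<tau>) (W_inv z') (M_inv z')" for \<tau>
    have Vb: "P y" "y \<in> branch_jets" if "y \<in> V" for y using that e(2) U(2) by (auto simp: V_def)
    note b' = branch_jetsD[OF Vb(2)[OF z']]
    have lV: "l \<tau> \<in> V" if "\<tau> \<in> {0..1}" for \<tau>
      unfolding V_def
    proof (intro CollectI ballI)
      fix i assume "i \<in> jet_coords 5"
      then have "\<bar>z' i - z i\<bar> < e" using z' by (simp add: V_def)
      moreover have "l \<tau> i - z i = (1 - \<tau>) * (z' i - z i)" by (simp add: l_def algebra_simps)
      moreover have "(1 - \<tau>) * \<bar>z' i - z i\<bar> \<le> 1 * \<bar>z' i - z i\<bar>" using that by (intro mult_right_mono) auto
      ultimately show "\<bar>l \<tau> i - z i\<bar> < e" using that by (simp add: abs_mult)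
    qed
    have \<zeta>U: "\<zeta> \<tau> \<in> U" if "\<tau> \<in> {0..1}" for \<tau>
      unfolding \<zeta>_def by (rule P(2)) (use Vb lV that z' in auto)
    have \<zeta>WM: "W_inv (\<zeta> \<tau>) = W_inv z'" "M_inv (\<zeta> \<tau>) = M_inv z'" if "\<tau> \<in> {0..1}" for \<tau>
      unfolding \<zeta>_def using adj_simps branch_jetsD(1,2)[OF Vb(2)[OF lV[OF that]]] by auto
    have "I (\<zeta> 0) = I (\<zeta> 1)"
    proof (rule connected_local_const[where A = "{0..1}" and f = "\<lambda>\<tau>. I (\<zeta> \<tau>)"])
      show "\<forall>\<tau>\<in>{0..1}. \<forall>\<^sub>F \<sigma> in at \<tau> within {0..1}. I (\<zeta> \<tau>) = I (\<zeta> \<sigma>)"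
      proof
        fix \<tau> :: real assume \<tau>: "\<tau> \<in> {0..1}"
        have "filterlim l (jet_nhds (l \<tau>)) (at \<tau> within {0..1})"
          by (rule filterlim_jet_nhds) (unfold l_def, intro tendsto_intros)
        then have "filterlim \<zeta> (jet_nhds (\<zeta> \<tau>)) (at \<tau> within {0..1})"
          unfolding \<zeta>_def using b'(3) branch_jetsD(1,2)[OF Vb(2)[OF lV[OF \<tau>]]]
          by (intro filterlim_adj tendsto_const)
        from this[unfolded filterlim_iff, rule_format, OF invariant_locally_constant[OF I \<zeta>U[OF \<tau>]]]
        have "\<forall>\<^sub>F \<sigma> in at \<tau> within {0..1}. \<zeta> \<sigma> \<in> U \<longrightarrow> W_inv (\<zeta> \<sigma>) = W_inv (\<zeta> \<tau>) \<longrightarrow> M_inv (\<zeta> \<sigma>) = M_inv (\<zeta> \<tau>) \<longrightarrow> I (\<zeta> \<sigma>) = I (\<zeta> \<tau>)" .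
        moreover have "\<forall>\<^sub>F \<sigma> in at \<tau> within {0..1}. \<sigma> \<in> {0..1}" by (simp add: eventually_at_filter)
        ultimately show "\<forall>\<^sub>F \<sigma> in at \<tau> within {0..1}. I (\<zeta> \<tau>) = I (\<zeta> \<sigma>)"
          by eventually_elim (metis \<zeta>U \<zeta>WM \<tau>)
      qed
    qed auto
    \<comment> \<open>At \<open>\<tau> = 0\<close> the correction is trivial and gives
      \<open>z'\<close>; at \<open>\<tau> = 1\<close> it gives the point of the slice through
      \<open>z\<close> with the invariants of \<open>z'\<close>.\<close>
    moreover have "l 0 = z'" "l 1 = z" by (simp_all add: l_def fun_eq_iff)
    ultimately show ?thesis using adj_simps(3)[of z', OF b'(1,2)] by (simp add: \<zeta>_def \<phi>_def)
  qed
  moreover have "z \<in> V" "V \<subseteq> U" using e by (auto simp: V_def)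
  ultimately show "\<exists>V \<phi>. z \<in> V \<and> V \<subseteq> U \<and> jet_open 5 V \<and> analytic2_at \<phi> (W_inv z, M_inv z) \<and> (\<forall>z'\<in>V. I z' = \<phi> (W_inv z', M_inv z'))"
    by blast
qed

theorem theorem2p12:
  shows
    "(diff_invariant_of_order 5 branch_jets M_inv \<and>
      \<not> locally_function_of_derivatives M_inv W_inv \<and>
      (\<forall>U I. diff_invariant 5 U I \<longrightarrow> locally_function_of_two 5 U I W_inv M_inv))
     \<and>
     (\<forall>D F p. branch_surface D F \<and> p \<in> D \<longrightarrow>
        (\<exists>E G a b c. branch_surface E G \<and> (0, 0) \<in> E \<and> normal_form a b c G \<and>
           a = W_inv (jet_of G (0, 0)) \<and> b = M_inv (jet_of G (0, 0)) \<and>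
           equivalent_germs (surface D F) (point F p) (surface E G) 0))
     \<and>
     (\<forall>D F a b c E G a' b' c'.
        branch_surface D F \<and> (0, 0) \<in> D \<and> normal_form a b c F \<and>
        branch_surface E G \<and> (0, 0) \<in> E \<and> normal_form a' b' c' G \<longrightarrow>
        (equivalent_germs (surface E G) 0 (surface D F) 0 \<longleftrightarrow>
           a' = a \<and> b' = b \<and> (\<forall>l\<ge>6. c' l 0 = c l 0) \<and> (\<forall>l\<ge>5. c' l 1 = c l 1)))"
proof (intro conjI allI impI)
  show "diff_invariant_of_order 5 branch_jets M_inv" by (rule M_order_5)
  show "\<not> locally_function_of_derivatives M_inv W_inv" by (rule M_not_function_of_W)
  show "locally_function_of_two 5 U I W_inv M_inv" if "diff_invariant 5 U I" for U I
    using that by (rule invariant_function_of_W_M)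
next
  fix D F p assume a: "branch_surface D F \<and> p \<in> D"
  let ?z = "jet_of F p"
  obtain E G d where E: "branch_surface E G" "(0, 0) \<in> E" "normal_form (W_inv ?z) (M_inv ?z) d G"
    "maps_germ (nf_map ?z) (surface D F) (point F p) (surface E G) 0"
    using normal_form_exists a by blast
  have "?z \<in> branch_jets" using a by (auto simp: branch_surface_def)
  from branch_jetsD[OF this] have "nf_map ?z \<in> SA3" by (intro nf_map_SA3)
  then show "\<exists>E G a b c. branch_surface E G \<and> (0, 0) \<in> E \<and> normal_form a b c G \<and>
      a = W_inv (jet_of G (0, 0)) \<and> b = M_inv (jet_of G (0, 0)) \<and>
      equivalent_germs (surface D F) (point F p) (surface E G) 0"
    using E normal_form_jet[OF E(3)] unfolding equivalent_germs_def
    by (intro exI[of _ E] exI[of _ G] exI[of _ "W_inv ?z"] exI[of _ "M_inv ?z"] exI[of _ d]) auto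
next
  fix D F a b c E G a' b' c'
  assume "branch_surface D F \<and> (0, 0) \<in> D \<and> normal_form a b c F \<and> branch_surface E G \<and> (0, 0) \<in> E \<and> normal_form a' b' c' G"
  then show "equivalent_germs (surface E G) 0 (surface D F) 0 \<longleftrightarrow>
           a' = a \<and> b' = b \<and> (\<forall>l\<ge>6. c' l 0 = c l 0) \<and> (\<forall>l\<ge>5. c' l 1 = c l 1)"
    using normal_form_equivalence by blast
qed

end
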